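(* Let $c_0\ge0$. Let $k:\mathbb R\to\mathbb R$ satisfy $0<k_1\le k(x)\le k_2$ for all $x\in\mathbb R$ and be globally Lipschitz, let $S\in L^2(0,T;V')$, $\mathbf F\in L^2(0,T;\mathbf L^2(\Omega))\cap H^1(0,T;\mathbf V')$, $d_0\in L^2(\Omega)$, and suppose $(\mathbf u,p)\in\mathcal W_T=\mathcal W_T(\mathbf F,S,d_0,k(\cdot))$, the class of weak solutions with $p_t\in L^2(0,T;L^2(\Omega))$ defined in the context. (1) Suppose $d_0=\nabla\cdot\mathbf u_0+c_0p_0\in L^2(\Omega)$ for some $\mathbf u_0\in\mathbf V$ (and some $p_0\in L^2(\Omega)$). If additionally $p\in L^2(0,T;W^{1,\infty}(\Omega))$, then the solution $(\mathbf u,p)$ is unique in the class $\mathcal W_T$. (2) If $c_0>0$ and $p\in L^2(0,T;W^{1,\infty}(\Omega))$, then $(\mathbf u,p)$ is unique in the class $\mathcal W_T$. In each of these cases, if one solution in $\mathcal W_T$ has the stated additional spatial regularity for $p$, then all solutions in $\mathcal W_T$ are equal.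
   Context: $\Omega\subset\mathbb R^3$ is open and bounded, of class $C^2$, with boundary $\Gamma=\partial\Omega$; $T>0$. $V=H^1_0(\Omega)$, $\mathbf V=(H^1_0(\Omega))^3$, $\mathbf L^2(\Omega)=(L^2(\Omega))^3$; $V',\mathbf V'$ are the dual spaces and $\langle\cdot,\cdot\rangle$ is the duality pairing. Let $$e(\mathbf u,\mathbf w)=(\nabla\cdot\mathbf u,\nabla\cdot\mathbf w)+(\nabla\mathbf u,\nabla\mathbf w)+(\nabla\mathbf u,\nabla\mathbf w^T)$$ with $L^2(\Omega)$ and Frobenius inner products. $k(\zeta)$ denotes the composition (Nemytskii operator). The system considered is $$-\Delta\mathbf u-2\nabla(\nabla\cdot\mathbf u)+\nabla p=\mathbf F,\quad \zeta_t-\nabla\cdot[k(\zeta)\nabla p]=S,\quad \zeta=c_0p+\nabla\cdot\mathbf u\quad\text{in }\Omega\times(0,T),$$ with $\mathbf u=\mathbf 0$, $p=0$ on $\Gamma\times(0,T)$ and $\zeta(0)=d_0$. Weak solution: a pair $\mathbf u\in L^2(0,T;\mathbf V)$, $p\in L^2(0,T;V)$ with $\zeta=c_0p+\nabla\cdot\mathbf u\in L^2(0,T;L^2(\Omega))\cap H^1(0,T;V')$ such that: (a) for all $\mathbf w\in L^2(0,T;\mathbf V)$ and $q\in L^2(0,T;V)$, $$\int_0^T e(\mathbf u,\mathbf w)\,dt-\int_0^T(p,\nabla\cdot\mathbf w)_\Omega\,dt=\int_0^T(\mathbf F,\mathbf w)_\Omega\,dt,$$ $$\int_0^T\langle\zeta_t,q\rangle\,dt+\int_0^T(k(\zeta)\nabla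 p,\nabla q)_\Omega\,dt=\int_0^T\langle S,q\rangle\,dt;$$ (b) for every $q\in V$, the term $(\zeta(t),q)_{L^2(\Omega)}$ uniquely defines an absolutely continuous function on $[0,T]$, and $(\zeta(0),q)_{L^2(\Omega)}=(d_0,q)_{L^2(\Omega)}$. Class $\mathcal W_T=\mathcal W_T(\mathbf F,S,d_0,k(\cdot))$: the set of all weak solutions $(\mathbf u,p)$ on $[0,T]$ (for the fixed data $\mathbf F,S,d_0$, permeability $k$ and parameter $c_0$) such that $p_t\in L^2(0,T;L^2(\Omega))$. *)

theory Defs
  imports "HOL-Analysis.Analysis" "HOL-Probability.Essential_Supremum"
begin

section \<open>Classical differentiability\<close>

definition dir_deriv :: "'a::euclidean_space \<Rightarrow> ('a \<Rightarrow> real) \<Rightarrow> 'a \<Rightarrow> real" where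
  "dir_deriv b f x = frechet_derivative f (at x) b"

definition iter_pd :: "'a::euclidean_space list \<Rightarrow> ('a \<Rightarrow> real) \<Rightarrow> 'a \<Rightarrow> real" where
  "iter_pd bs f = foldr dir_deriv bs f"

definition C_k :: "nat \<Rightarrow> ('a::euclidean_space \<Rightarrow> real) \<Rightarrow> bool" where
  "C_k k f \<longleftrightarrow> (\<forall>bs. set bs \<subseteq> Basis \<longrightarrow> length bs \<le> k \<longrightarrow>
     continuous_on UNIV (iter_pd bs f) \<and>
     (length bs < k \<longrightarrow> (\<forall>x. iter_pd bs f differentiable (at x))))"

definition test_functions :: "'a::euclidean_space set \<Rightarrow> ('a \<Rightarrow> real) set" where
  "test_functions U = {\<phi>. (\<forall>k. C_k k \<phi>) \<and>
     compact (closure {x. \<phi> x \<noteq> 0}) \<and> closure {x. \<phi> x \<noteq> 0} \<subseteq> U}"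

text \<open>The boundary is locally, after a rigid change of coordinates, the graph of a \<open>C\<^sup>2\<close> function
  of the first two coordinates, and the set lies strictly above this graph.\<close>

definition C2_domain :: "(real^3) set \<Rightarrow> bool" where
  "C2_domain \<Omega> \<longleftrightarrow> (\<forall>x0\<in>frontier \<Omega>. \<exists>r>0. \<exists>Q::real^3 \<Rightarrow> real^3. \<exists>\<gamma>::real^2 \<Rightarrow> real.
     orthogonal_transformation Q \<and> C_k 2 \<gamma> \<and>
     \<Omega> \<inter> ball x0 r = {x \<in> ball x0 r. \<gamma> (vector [Q x $ 1, Q x $ 2]) < Q x $ 3})"

definition abs_continuous :: "real \<Rightarrow> real \<Rightarrow> (real \<Rightarrow> real) \<Rightarrow> bool" where
  "abs_continuous a b g \<longleftrightarrow> (\<forall>\<epsilon>>0. \<exists>\<delta>>0. \<forall>(n::nat) l r.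
     (\<forall>i<n. a \<le> l i \<and> l i \<le> r i \<and> r i \<le> b) \<longrightarrow>
     disjoint_family_on (\<lambda>i. {l i<..<r i}) {..<n} \<longrightarrow>
     (\<Sum>i<n. r i - l i) < \<delta> \<longrightarrow> (\<Sum>i<n. \<bar>g (r i) - g (l i)\<bar>) < \<epsilon>)"


section \<open>Lebesgue and Sobolev spaces\<close>

text \<open>Elements of \<open>L\<^sup>2\<close>, \<open>H\<^sup>1\<close> etc. are represented by functions, to be read up to equality almost
  everywhere on the domain; accordingly the norms below are seminorms on representatives.\<close>

definition L2 :: "'a::euclidean_space set \<Rightarrow> ('a \<Rightarrow> 'b::euclidean_space) set" where
  "L2 \<Omega> = {f \<in> borel_measurable (lebesgue_on \<Omega>). integrable (lebesgue_on \<Omega>) (\<lambda>x. (norm (f x))\<^sup>2)}"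

definition l2_inner :: "'a::euclidean_space set \<Rightarrow> ('a \<Rightarrow> 'b::euclidean_space) \<Rightarrow> ('a \<Rightarrow> 'b) \<Rightarrow> real" where
  "l2_inner \<Omega> f g = (LINT x|lebesgue_on \<Omega>. f x \<bullet> g x)"

definition l2_norm :: "'a::euclidean_space set \<Rightarrow> ('a \<Rightarrow> 'b::euclidean_space) \<Rightarrow> real" where
  "l2_norm \<Omega> f = sqrt (LINT x|lebesgue_on \<Omega>. (norm (f x))\<^sup>2)"

definition Linf :: "'a::euclidean_space set \<Rightarrow> ('a \<Rightarrow> 'b::euclidean_space) set" where
  "Linf \<Omega> = {f \<in> borel_measurable (lebesgue_on \<Omega>). esssup (lebesgue_on \<Omega>) (\<lambda>x. ereal (norm (f x))) < \<infinity>}"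

definition linf_norm :: "'a::euclidean_space set \<Rightarrow> ('a \<Rightarrow> 'b::euclidean_space) \<Rightarrow> real" where
  "linf_norm \<Omega> f = real_of_ereal (esssup (lebesgue_on \<Omega>) (\<lambda>x. ereal (norm (f x))))"

definition locally_integrable :: "'a::euclidean_space set \<Rightarrow> ('a \<Rightarrow> real) \<Rightarrow> bool" where
  "locally_integrable \<Omega> f \<longleftrightarrow> (\<forall>K. compact K \<longrightarrow> K \<subseteq> \<Omega> \<longrightarrow> f absolutely_integrable_on K)"

definition has_weak_partial ::
    "(real^'n) set \<Rightarrow> 'n::finite \<Rightarrow> (real^'n \<Rightarrow> real) \<Rightarrow> (real^'n \<Rightarrow> real) \<Rightarrow> bool" where
  "has_weak_partial \<Omega> i f g \<longleftrightarrow> locally_integrable \<Omega> f \<and> locally_integrable \<Omega> g \<and>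
     (\<forall>\<phi>\<in>test_functions \<Omega>.
        (LINT x|lebesgue_on \<Omega>. f x * dir_deriv (axis i 1) \<phi> x) = - (LINT x|lebesgue_on \<Omega>. g x * \<phi> x))"

text \<open>The weak derivative is unique only up to null sets; the operators below pick a representative.\<close>

definition weak_partial :: "(real^'n) set \<Rightarrow> 'n::finite \<Rightarrow> (real^'n \<Rightarrow> real) \<Rightarrow> real^'n \<Rightarrow> real" where
  "weak_partial \<Omega> i f = (SOME g. has_weak_partial \<Omega> i f g)"

definition grad :: "(real^'n) set \<Rightarrow> (real^'n::finite \<Rightarrow> real) \<Rightarrow> real^'n \<Rightarrow> real^'n" where
  "grad \<Omega> f x = (\<chi> i. weak_partial \<Omega> i f x)"

definition vgrad :: "(real^'n) set \<Rightarrow> (real^'n::finite \<Rightarrow> real^'n) \<Rightarrow> real^'n \<Rightarrow> real^'n^'n" where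
  "vgrad \<Omega> u x = (\<chi> i j. weak_partial \<Omega> j (\<lambda>y. u y $ i) x)"

definition divg :: "(real^'n) set \<Rightarrow> (real^'n::finite \<Rightarrow> real^'n) \<Rightarrow> real^'n \<Rightarrow> real" where
  "divg \<Omega> u x = (\<Sum>i\<in>UNIV. weak_partial \<Omega> i (\<lambda>y. u y $ i) x)"

definition H1 :: "(real^'n) set \<Rightarrow> (real^'n::finite \<Rightarrow> real) set" where
  "H1 \<Omega> = {f \<in> L2 \<Omega>. \<forall>i. \<exists>g\<in>L2 \<Omega>. has_weak_partial \<Omega> i f g}"

definition h1_norm :: "(real^'n) set \<Rightarrow> (real^'n::finite \<Rightarrow> real) \<Rightarrow> real" where
  "h1_norm \<Omega> f = sqrt ((l2_norm \<Omega> f)\<^sup>2 + (l2_norm \<Omega> (grad \<Omega> f))\<^sup>2)"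

definition H10 :: "(real^'n) set \<Rightarrow> (real^'n::finite \<Rightarrow> real) set" where
  "H10 \<Omega> = {f \<in> H1 \<Omega>. \<exists>\<phi>. (\<forall>n::nat. \<phi> n \<in> test_functions \<Omega>) \<and>
     (\<lambda>n. h1_norm \<Omega> (\<lambda>x. f x - \<phi> n x)) \<longlonglongrightarrow> 0}"

definition vH10 :: "(real^'n) set \<Rightarrow> (real^'n::finite \<Rightarrow> real^'n) set" where
  "vH10 \<Omega> = {u. \<forall>i. (\<lambda>x. u x $ i) \<in> H10 \<Omega>}"

definition vh1_norm :: "(real^'n) set \<Rightarrow> (real^'n::finite \<Rightarrow> real^'n) \<Rightarrow> real" where
  "vh1_norm \<Omega> u = sqrt ((l2_norm \<Omega> u)\<^sup>2 + (l2_norm \<Omega> (vgrad \<Omega> u))\<^sup>2)"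

definition W1inf :: "(real^'n) set \<Rightarrow> (real^'n::finite \<Rightarrow> real) set" where
  "W1inf \<Omega> = {f \<in> Linf \<Omega>. \<forall>i. \<exists>g\<in>Linf \<Omega>. has_weak_partial \<Omega> i f g}"

definition w1inf_norm :: "(real^'n) set \<Rightarrow> (real^'n::finite \<Rightarrow> real) \<Rightarrow> real" where
  "w1inf_norm \<Omega> f = max (linf_norm \<Omega> f) (linf_norm \<Omega> (grad \<Omega> f))"


section \<open>Dual spaces\<close>

text \<open>A space \<open>(X, N)\<close> is a set \<open>X\<close> of functions, closed under the pointwise linear operations,
  with a seminorm \<open>N\<close>. Boundedness forces a functional to respect \<open>N (f - g) = 0\<close>, so functionals on
  representatives are functionals on the space itself; their values outside \<open>X\<close> are irrelevant.\<close>

definition dual :: "('a \<Rightarrow> 'b::real_vector) set \<Rightarrow> (('a \<Rightarrow> 'b) \<Rightarrow> real) \<Rightarrow> (('a \<Rightarrow> 'b) \<Rightarrow> real) set" where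
  "dual X N = {l. (\<forall>f\<in>X. \<forall>g\<in>X. \<forall>a b. l (\<lambda>x. a *\<^sub>R f x + b *\<^sub>R g x) = a * l f + b * l g) \<and>
     (\<exists>C. \<forall>f\<in>X. \<bar>l f\<bar> \<le> C * N f)}"

definition dual_norm ::
    "('a \<Rightarrow> 'b::real_vector) set \<Rightarrow> (('a \<Rightarrow> 'b) \<Rightarrow> real) \<Rightarrow> (('a \<Rightarrow> 'b) \<Rightarrow> real) \<Rightarrow> real" where
  "dual_norm X N l = (SUP f\<in>{f\<in>X. N f \<le> 1}. \<bar>l f\<bar>)"


section \<open>Bochner spaces on \<open>(0,T)\<close>\<close>

abbreviation time :: "real \<Rightarrow> real measure" where
  "time T \<equiv> lebesgue_on {0<..<T}"

definition simple_in :: "('a \<Rightarrow> 'b) set \<Rightarrow> real \<Rightarrow> (real \<Rightarrow> 'a \<Rightarrow> 'b) \<Rightarrow> bool" where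
  "simple_in X T s \<longleftrightarrow> simple_function (time T) s \<and> s ` {0<..<T} \<subseteq> X"

definition simple_integral :: "real \<Rightarrow> (real \<Rightarrow> 'a \<Rightarrow> 'b::real_vector) \<Rightarrow> 'a \<Rightarrow> 'b" where
  "simple_integral T s x = (\<Sum>y\<in>s ` {0<..<T}. measure (time T) {t\<in>{0<..<T}. s t = y} *\<^sub>R y x)"

definition strongly_measurable ::
    "('a \<Rightarrow> 'b::real_vector) set \<Rightarrow> (('a \<Rightarrow> 'b) \<Rightarrow> real) \<Rightarrow> real \<Rightarrow> (real \<Rightarrow> 'a \<Rightarrow> 'b) \<Rightarrow> bool" where
  "strongly_measurable X N T f \<longleftrightarrow> (AE t in time T. f t \<in> X) \<and>
     (\<exists>s. (\<forall>n::nat. simple_in X T (s n)) \<and>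
       (AE t in time T. (\<lambda>n. N (\<lambda>x. s n t x - f t x)) \<longlonglongrightarrow> 0))"

definition L2_time ::
    "real \<Rightarrow> ('a \<Rightarrow> 'b::real_vector) set \<Rightarrow> (('a \<Rightarrow> 'b) \<Rightarrow> real) \<Rightarrow> (real \<Rightarrow> 'a \<Rightarrow> 'b) set" where
  "L2_time T X N = {f. strongly_measurable X N T f \<and> (\<integral>\<^sup>+t. ennreal ((N (f t))\<^sup>2) \<partial>time T) < \<infinity>}"

definition has_bochner ::
    "real \<Rightarrow> ('a \<Rightarrow> 'b::real_vector) set \<Rightarrow> (('a \<Rightarrow> 'b) \<Rightarrow> real) \<Rightarrow> (real \<Rightarrow> 'a \<Rightarrow> 'b) \<Rightarrow> ('a \<Rightarrow> 'b) \<Rightarrow> bool" where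
  "has_bochner T X N f I \<longleftrightarrow> strongly_measurable X N T f \<and> I \<in> X \<and>
     (\<exists>s. (\<forall>n::nat. simple_in X T (s n)) \<and>
       (\<lambda>n. \<integral>\<^sup>+t. ennreal (N (\<lambda>x. s n t x - f t x)) \<partial>time T) \<longlonglongrightarrow> 0 \<and>
       (\<lambda>n. N (\<lambda>x. simple_integral T (s n) x - I x)) \<longlonglongrightarrow> 0)"

definition has_weak_time_deriv ::
    "real \<Rightarrow> ('a \<Rightarrow> 'b::real_vector) set \<Rightarrow> (('a \<Rightarrow> 'b) \<Rightarrow> real) \<Rightarrow>
      (real \<Rightarrow> 'a \<Rightarrow> 'b) \<Rightarrow> (real \<Rightarrow> 'a \<Rightarrow> 'b) \<Rightarrow> bool" where
  "has_weak_time_deriv T X N f g \<longleftrightarrow> (\<forall>\<phi>\<in>test_functions {0<..<T}. \<exists>I.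
     has_bochner T X N (\<lambda>t x. deriv \<phi> t *\<^sub>R f t x) I \<and>
     has_bochner T X N (\<lambda>t x. \<phi> t *\<^sub>R g t x) (\<lambda>x. - I x))"

definition H1_time ::
    "real \<Rightarrow> ('a \<Rightarrow> 'b::real_vector) set \<Rightarrow> (('a \<Rightarrow> 'b) \<Rightarrow> real) \<Rightarrow> (real \<Rightarrow> 'a \<Rightarrow> 'b) set" where
  "H1_time T X N = {f \<in> L2_time T X N. \<exists>g\<in>L2_time T X N. has_weak_time_deriv T X N f g}"

text \<open>The embedding of \<open>L\<^sup>2\<close> into the dual spaces, \<open>f\<close> being sent to \<open>(f, \<cdot>)\<close>, applied at each time.\<close>

definition embed_dual :: "'a::euclidean_space set \<Rightarrow> (real \<Rightarrow> 'a \<Rightarrow> 'b::euclidean_space) \<Rightarrow> real \<Rightarrow> ('a \<Rightarrow> 'b) \<Rightarrow> real" where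
  "embed_dual \<Omega> f t = (\<lambda>q. l2_inner \<Omega> (f t) q)"

abbreviation L2_L2 :: "real \<Rightarrow> 'a::euclidean_space set \<Rightarrow> (real \<Rightarrow> 'a \<Rightarrow> 'b::euclidean_space) set" where
  "L2_L2 T \<Omega> \<equiv> L2_time T (L2 \<Omega>) (l2_norm \<Omega>)"

abbreviation L2_V :: "real \<Rightarrow> (real^3) set \<Rightarrow> (real \<Rightarrow> real^3 \<Rightarrow> real) set" where
  "L2_V T \<Omega> \<equiv> L2_time T (H10 \<Omega>) (h1_norm \<Omega>)"

abbreviation L2_vV :: "real \<Rightarrow> (real^3) set \<Rightarrow> (real \<Rightarrow> real^3 \<Rightarrow> real^3) set" where
  "L2_vV T \<Omega> \<equiv> L2_time T (vH10 \<Omega>) (vh1_norm \<Omega>)"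

abbreviation L2_W1inf :: "real \<Rightarrow> (real^3) set \<Rightarrow> (real \<Rightarrow> real^3 \<Rightarrow> real) set" where
  "L2_W1inf T \<Omega> \<equiv> L2_time T (W1inf \<Omega>) (w1inf_norm \<Omega>)"

abbreviation dual_V :: "(real^3) set \<Rightarrow> ((real^3 \<Rightarrow> real) \<Rightarrow> real) set" where
  "dual_V \<Omega> \<equiv> dual (H10 \<Omega>) (h1_norm \<Omega>)"

abbreviation dual_V_norm :: "(real^3) set \<Rightarrow> ((real^3 \<Rightarrow> real) \<Rightarrow> real) \<Rightarrow> real" where
  "dual_V_norm \<Omega> \<equiv> dual_norm (H10 \<Omega>) (h1_norm \<Omega>)"

abbreviation dual_vV :: "(real^3) set \<Rightarrow> ((real^3 \<Rightarrow> real^3) \<Rightarrow> real) set" where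
  "dual_vV \<Omega> \<equiv> dual (vH10 \<Omega>) (vh1_norm \<Omega>)"

abbreviation dual_vV_norm :: "(real^3) set \<Rightarrow> ((real^3 \<Rightarrow> real^3) \<Rightarrow> real) \<Rightarrow> real" where
  "dual_vV_norm \<Omega> \<equiv> dual_norm (vH10 \<Omega>) (vh1_norm \<Omega>)"


section \<open>The poroelastic system\<close>

definition e_form :: "(real^3) set \<Rightarrow> (real^3 \<Rightarrow> real^3) \<Rightarrow> (real^3 \<Rightarrow> real^3) \<Rightarrow> real" where
  "e_form \<Omega> u w = l2_inner \<Omega> (divg \<Omega> u) (divg \<Omega> w) + l2_inner \<Omega> (vgrad \<Omega> u) (vgrad \<Omega> w)
     + l2_inner \<Omega> (vgrad \<Omega> u) (\<lambda>x. transpose (vgrad \<Omega> w x))"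

definition fluid_content ::
    "(real^3) set \<Rightarrow> real \<Rightarrow> (real \<Rightarrow> real^3 \<Rightarrow> real^3) \<Rightarrow> (real \<Rightarrow> real^3 \<Rightarrow> real) \<Rightarrow> real \<Rightarrow> real^3 \<Rightarrow> real" where
  "fluid_content \<Omega> c0 u p t x = c0 * p t x + divg \<Omega> (u t) x"

definition weak_solution ::
    "(real^3) set \<Rightarrow> real \<Rightarrow> real \<Rightarrow> (real \<Rightarrow> real^3 \<Rightarrow> real^3) \<Rightarrow> (real \<Rightarrow> (real^3 \<Rightarrow> real) \<Rightarrow> real) \<Rightarrow>
      (real^3 \<Rightarrow> real) \<Rightarrow> (real \<Rightarrow> real) \<Rightarrow>
      (real \<Rightarrow> real^3 \<Rightarrow> real^3) \<Rightarrow> (real \<Rightarrow> real^3 \<Rightarrow> real) \<Rightarrow> bool" where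
  "weak_solution \<Omega> T c0 F S d0 k u p \<longleftrightarrow>
     (let \<zeta> = fluid_content \<Omega> c0 u p in
      u \<in> L2_vV T \<Omega> \<and> p \<in> L2_V T \<Omega> \<and> \<zeta> \<in> L2_L2 T \<Omega> \<and>
      embed_dual \<Omega> \<zeta> \<in> H1_time T (dual_V \<Omega>) (dual_V_norm \<Omega>) \<and>
      (\<forall>w\<in>L2_vV T \<Omega>.
         (LINT t|time T. e_form \<Omega> (u t) (w t)) - (LINT t|time T. l2_inner \<Omega> (p t) (divg \<Omega> (w t)))
         = (LINT t|time T. l2_inner \<Omega> (F t) (w t))) \<and>
      (\<exists>\<zeta>t\<in>L2_time T (dual_V \<Omega>) (dual_V_norm \<Omega>).
         has_weak_time_deriv T (dual_V \<Omega>) (dual_V_norm \<Omega>) (embed_dual \<Omega> \<zeta>) \<zeta>t \<and>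
         (\<forall>q\<in>L2_V T \<Omega>.
            (LINT t|time T. \<zeta>t t (q t))
            + (LINT t|time T. l2_inner \<Omega> (\<lambda>x. k (\<zeta> t x) *\<^sub>R grad \<Omega> (p t) x) (grad \<Omega> (q t)))
            = (LINT t|time T. S t (q t)))) \<and>
      (\<forall>q\<in>H10 \<Omega>. \<exists>g. abs_continuous 0 T g \<and> (AE t in time T. g t = l2_inner \<Omega> (\<zeta> t) q) \<and>
         (\<forall>h. abs_continuous 0 T h \<longrightarrow> (AE t in time T. h t = l2_inner \<Omega> (\<zeta> t) q) \<longrightarrow>
            (\<forall>t\<in>{0..T}. h t = g t)) \<and>
         g 0 = l2_inner \<Omega> d0 q))"

definition W_class ::
    "(real^3) set \<Rightarrow> real \<Rightarrow> real \<Rightarrow> (real \<Rightarrow> real^3 \<Rightarrow> real^3) \<Rightarrow> (real \<Rightarrow> (real^3 \<Rightarrow> real) \<Rightarrow> real) \<Rightarrow>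
      (real^3 \<Rightarrow> real) \<Rightarrow> (real \<Rightarrow> real) \<Rightarrow>
      ((real \<Rightarrow> real^3 \<Rightarrow> real^3) \<times> (real \<Rightarrow> real^3 \<Rightarrow> real)) set" where
  "W_class \<Omega> T c0 F S d0 k = {(u, p). weak_solution \<Omega> T c0 F S d0 k u p \<and>
     (\<exists>pt\<in>L2_L2 T \<Omega>. has_weak_time_deriv T (L2 \<Omega>) (l2_norm \<Omega>) p pt)}"

text \<open>Equality of solutions as elements of the Bochner spaces.\<close>

definition sol_eq ::
    "(real^3) set \<Rightarrow> real \<Rightarrow> (real \<Rightarrow> real^3 \<Rightarrow> real^3) \<times> (real \<Rightarrow> real^3 \<Rightarrow> real) \<Rightarrow>
      (real \<Rightarrow> real^3 \<Rightarrow> real^3) \<times> (real \<Rightarrow> real^3 \<Rightarrow> real) \<Rightarrow> bool" where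
  "sol_eq \<Omega> T z z' \<longleftrightarrow> (AE t in time T. AE x in lebesgue_on \<Omega>.
     fst z t x = fst z' t x \<and> snd z t x = snd z' t x)"

end

theory Submission
  imports Defs
begin

text \<open>Let \<open>(u\<^sub>1, p\<^sub>1)\<close> and \<open>(u\<^sub>2, p\<^sub>2)\<close> be two solutions, the first with bounded pressure gradient, and let
  \<open>U\<close>, \<open>P\<close>, \<open>Z = c\<^sub>0 P + \<nabla>\<cdot>U\<close> be the differences of displacement, pressure and fluid content. The elastic
  equation \<open>e(U(t), w) = (P(t), \<nabla>\<cdot>w)\<close> holds at almost every time; inserting the displacement at another
  time shows that \<open>(Z(a), P(b)) = c\<^sub>0 (P(a), P(b)) + e(U(b), U(a))\<close> is symmetric in \<open>a\<close> and \<open>b\<close>. Hence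
  \<open>E = (Z, P) = c\<^sub>0 \<parallel>P\<parallel>\<^sup>2 + e(U, U)\<close> is a quadratic energy, and since \<open>Z(0) = 0\<close> it should satisfy
  \<open>E(b) = 2 \<integral>\<^sub>0\<^sup>b \<langle>Z\<^sub>t, P\<rangle>\<close>.

  This identity (\<open>energy_identity\<close>) is where \<open>p\<^sub>t \<in> L\<^sup>2(0,T;L\<^sup>2)\<close> is used. Differentiating
  \<open>(Z(a), P(r)) = (Z(r), P(a))\<close> in \<open>a\<close> shows \<open>\<langle>Z\<^sub>t(s), P(r)\<rangle> = (P\<^sub>t(s), Z(r))\<close> for almost all \<open>s\<close> and \<open>r\<close>, so
  the energy is differentiated in \<open>L\<^sup>2\<close>: the increment of \<open>E\<close> over \<open>[a,b]\<close> differs from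
  \<open>2 \<integral>\<^sub>a\<^sup>b \<langle>Z\<^sub>t, P\<rangle>\<close> by at most a multiple of \<open>(\<integral>\<^sub>a\<^sup>b \<parallel>P\<^sub>t\<parallel>)\<^sup>2\<close>, which is negligible after subdivision.

  Testing the flow equation with \<open>P\<close> on \<open>(0,b)\<close> turns the right-hand side into the flux difference, and
  \<open>k(\<zeta>\<^sub>1)\<nabla>p\<^sub>1 - k(\<zeta>\<^sub>2)\<nabla>p\<^sub>2 = k(\<zeta>\<^sub>2)\<nabla>P + (k(\<zeta>\<^sub>1) - k(\<zeta>\<^sub>2))\<nabla>p\<^sub>1\<close> gives
  \<open>E(b) + k\<^sub>1 \<integral>\<^sub>0\<^sup>b \<parallel>\<nabla>P\<parallel>\<^sup>2 \<le> C \<integral>\<^sub>0\<^sup>b \<parallel>\<nabla>p\<^sub>1\<parallel>\<^sub>\<infinity>\<^sup>2 \<parallel>Z\<parallel>\<^sup>2\<close> with \<open>\<parallel>Z\<parallel>\<^sup>2 \<le> 2(c\<^sub>0 + 1) E\<close>. The factor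
  \<open>\<parallel>\<nabla>p\<^sub>1\<parallel>\<^sub>\<infinity>\<^sup>2\<close> is integrable in time, so Gronwall's lemma gives \<open>E = 0\<close> and then \<open>\<nabla>P = 0\<close>; the Poincare
  inequality yields \<open>P = 0\<close> and \<open>U = 0\<close> (\<open>solutions_agree\<close>).

  The analysis behind this rests on four tools: the fundamental lemma of the calculus of variations
  (\<open>fundamental_lemma_variations\<close>), which makes weak derivatives unique and linear; the description of
  weakly differentiable functions of time as primitives (\<open>weak_derivative_primitive\<close>); the
  interchange of bounded functionals with the Bochner integral (\<open>has_bochner_dual\<close>); and a separability
  argument (\<open>common_null_set\<close>) by which relations known for each test function up to a null set hold
  outside one null set when the solution itself, taken at other times, is the test function.\<close>

section \<open>Smooth functions and bump functions\<close>

abbreviation smooth :: "('a::euclidean_space \<Rightarrow> real) \<Rightarrow> bool" where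
  "smooth f \<equiv> \<forall>k. C_k k f"

lemma dir_deriv_eq: "(f has_derivative f') (at x) \<Longrightarrow> dir_deriv b f x = f' b"
  unfolding dir_deriv_def using frechet_derivative_at by metis

lemma has_derivative_dir_deriv:
  "f differentiable (at x) \<Longrightarrow> (f has_derivative (\<lambda>b. dir_deriv b f x)) (at x)"
  unfolding dir_deriv_def by (metis frechet_derivative_works)

text \<open>Iterated partial derivatives are awkward to compute. Smoothness is the largest property of
  differentiable functions that is inherited by partial derivatives, which gives a coinduction rule:
  it is enough to exhibit a family of differentiable functions closed under partial derivatives.\<close>

lemma smooth_coinduct:
  assumes "f \<in> A" and "\<And>f x. f \<in> A \<Longrightarrow> f differentiable (at x)"
    and "\<And>f b. f \<in> A \<Longrightarrow> b \<in> Basis \<Longrightarrow> dir_deriv b f \<in> A"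
  shows "smooth f"
proof -
  have "set bs \<subseteq> Basis \<Longrightarrow> iter_pd bs f \<in> A" for bs
    by (induction bs) (auto simp: iter_pd_def assms)
  moreover have "continuous_on UNIV g" if "g \<in> A" for g
    using assms(2)[OF that] by (meson continuous_at_imp_continuous_on differentiable_imp_continuous_within)
  ultimately show ?thesis
    unfolding C_k_def using assms(2) by blast
qed

lemma smooth_differentiable: "smooth f \<Longrightarrow> f differentiable (at x)"
  by (drule spec[of _ 1]) (auto simp: C_k_def iter_pd_def dest!: spec[of _ "[]"])

lemma smooth_continuous: "smooth f \<Longrightarrow> continuous_on A f"
  by (drule spec[of _ 0], rule continuous_on_subset[of UNIV])
    (auto simp: C_k_def iter_pd_def dest!: spec[of _ "[]"])

lemma smooth_dir_deriv:
  assumes "smooth f" "b \<in> Basis"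
  shows "smooth (dir_deriv b f)"
proof
  fix k
  have "iter_pd bs (dir_deriv b f) = iter_pd (bs @ [b]) f" for bs
    by (simp add: iter_pd_def)
  moreover have "C_k (Suc k) f" using assms by blast
  ultimately show "C_k k (dir_deriv b f)"
    unfolding C_k_def using assms(2) by fastforce
qed

lemma smooth_const: "smooth (\<lambda>x::'a::euclidean_space. c)"
proof (rule smooth_coinduct[where A="range (\<lambda>c x. c)"])
  fix f :: "'a \<Rightarrow> real" and b :: 'a assume "f \<in> range (\<lambda>c x. c)"
  then obtain d where f: "f = (\<lambda>x. d)" by auto
  have "dir_deriv b f = (\<lambda>x. 0)"
    unfolding f by (rule ext, rule dir_deriv_eq[where f'="\<lambda>x. 0"]) auto
  then show "dir_deriv b f \<in> range (\<lambda>c x. c)" by blast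
qed auto

text \<open>The algebra generated by the smooth functions and by smooth functions of one affine
  coordinate is closed under partial derivatives, so by coinduction it adds nothing new.\<close>

inductive_set smooth_algebra :: "('a::euclidean_space \<Rightarrow> real) set" where
  smooth: "smooth f \<Longrightarrow> f \<in> smooth_algebra"
| affine: "smooth g \<Longrightarrow> (\<lambda>x. g (v \<bullet> x + c)) \<in> smooth_algebra" for g :: "real \<Rightarrow> real"
| add: "f \<in> smooth_algebra \<Longrightarrow> g \<in> smooth_algebra \<Longrightarrow> (\<lambda>x. f x + g x) \<in> smooth_algebra"
| mult: "f \<in> smooth_algebra \<Longrightarrow> g \<in> smooth_algebra \<Longrightarrow> (\<lambda>x. f x * g x) \<in> smooth_algebra"

lemma smooth_algebra_differentiable: "f \<in> smooth_algebra \<Longrightarrow> f differentiable (at x)"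
proof (induction rule: smooth_algebra.induct)
  case (affine g v c)
  show ?case
    by (rule differentiable_chain_at[where g=g and f="\<lambda>x. v \<bullet> x + c", unfolded comp_def])
      (auto simp: smooth_differentiable[OF affine])
qed (auto simp: smooth_differentiable)

lemma smooth_algebra_dir_deriv:
  "f \<in> smooth_algebra \<Longrightarrow> b \<in> Basis \<Longrightarrow> dir_deriv b f \<in> smooth_algebra"
proof (induction rule: smooth_algebra.induct)
  case (smooth f) then show ?case using smooth_dir_deriv smooth_algebra.smooth by blast
next
  case (affine g v c)
  have "dir_deriv b (\<lambda>x. g (v \<bullet> x + c)) x = (v \<bullet> b) * dir_deriv 1 g (v \<bullet> x + c)" for x
  proof (rule dir_deriv_eq[where f'="\<lambda>h. (v \<bullet> h) * dir_deriv 1 g (v \<bullet> x + c)", THEN trans])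
    have g: "(g has_derivative (\<lambda>b. dir_deriv b g (v \<bullet> x + c))) (at (v \<bullet> x + c))"
      using has_derivative_dir_deriv smooth_differentiable affine by blast
    have "dir_deriv h g (v \<bullet> x + c) = h * dir_deriv 1 g (v \<bullet> x + c)" for h
      using linear_scale[OF has_derivative_linear[OF g], of h 1] by simp
    then have "(\<lambda>h. dir_deriv h g (v \<bullet> x + c)) = (\<lambda>h. h * dir_deriv 1 g (v \<bullet> x + c))" by (rule ext)
    with g have g': "(g has_derivative (\<lambda>h. h * dir_deriv 1 g (v \<bullet> x + c))) (at (v \<bullet> x + c))"
      by (simp only:)
    have "((\<lambda>x. v \<bullet> x + c) has_derivative (\<lambda>h. v \<bullet> h)) (at x)"
      by (auto intro!: derivative_eq_intros)
    from has_derivative_compose[OF this g']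
    show "((\<lambda>x. g (v \<bullet> x + c)) has_derivative (\<lambda>h. (v \<bullet> h) * dir_deriv 1 g (v \<bullet> x + c))) (at x)" .
  qed auto
  then have "dir_deriv b (\<lambda>x. g (v \<bullet> x + c)) = (\<lambda>x. (v \<bullet> b) * dir_deriv 1 g (v \<bullet> x + c))"
    by blast
  moreover have "smooth (dir_deriv 1 g)"
    using affine smooth_dir_deriv by force
  ultimately show ?case
    using smooth_algebra.mult[OF smooth_algebra.smooth[OF smooth_const] smooth_algebra.affine] by metis
next
  case (add f g)
  have "dir_deriv b (\<lambda>x. f x + g x) = (\<lambda>x. dir_deriv b f x + dir_deriv b g x)"
    by (rule ext, rule dir_deriv_eq[where f'="\<lambda>h. dir_deriv h f x + dir_deriv h g x" for x])
      (intro has_derivative_add has_derivative_dir_deriv smooth_algebra_differentiable add)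
  then show ?case using smooth_algebra.add add by simp
next
  case (mult f g)
  have "dir_deriv b (\<lambda>x. f x * g x) = (\<lambda>x. f x * dir_deriv b g x + dir_deriv b f x * g x)"
    by (rule ext, rule dir_deriv_eq[where f'="\<lambda>h. f x * dir_deriv h g x + dir_deriv h f x * g x" for x])
      (intro has_derivative_mult has_derivative_dir_deriv smooth_algebra_differentiable mult)
  then show ?case
    by (simp only:, intro smooth_algebra.add smooth_algebra.mult mult)
qed

lemma smooth_algebra_smooth: "f \<in> smooth_algebra \<Longrightarrow> smooth f"
  by (rule smooth_coinduct[of f smooth_algebra])
    (auto simp: smooth_algebra_differentiable smooth_algebra_dir_deriv)

lemma smooth_add: "smooth f \<Longrightarrow> smooth g \<Longrightarrow> smooth (\<lambda>x. f x + g x)"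
  by (rule smooth_algebra_smooth, intro smooth_algebra.intros) auto

lemma smooth_mult: "smooth f \<Longrightarrow> smooth g \<Longrightarrow> smooth (\<lambda>x. f x * g x)"
  by (rule smooth_algebra_smooth, intro smooth_algebra.intros) auto

lemma smooth_affine: "smooth g \<Longrightarrow> smooth (\<lambda>x. g (v \<bullet> x + c))" for g :: "real \<Rightarrow> real"
  by (rule smooth_algebra_smooth, intro smooth_algebra.intros) auto

lemma smooth_prod: "finite I \<Longrightarrow> (\<And>i. i \<in> I \<Longrightarrow> smooth (f i)) \<Longrightarrow> smooth (\<lambda>x. \<Prod>i\<in>I. f i x)"
proof (induction rule: finite_induct)
  case empty then show ?case by (simp add: smooth_const)
next
  case (insert i I)
  then show ?case using smooth_mult[of "f i" "\<lambda>x. \<Prod>i\<in>I. f i x"] by simp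
qed

subsection \<open>A smooth function vanishing on the negative half line\<close>

text \<open>The functions \<open>Q(1/t) exp(-1/t)\<close>, extended by zero, with \<open>Q\<close> an arbitrary polynomial: this family is
  closed under differentiation.\<close>

definition exp_flat :: "real poly \<Rightarrow> real \<Rightarrow> real" where
  "exp_flat P t = (if t > 0 then poly P (1 / t) * exp (- 1 / t) else 0)"

lemma poly_div_exp_at_top: "((\<lambda>y. poly P y / exp y) \<longlongrightarrow> (0::real)) at_top"
proof (induction P)
  case (pCons a P)
  have "((\<lambda>y. a * (y ^ 0 / exp y) + y * poly P y / exp y) \<longlongrightarrow> a * 0 + 0) at_top"
  proof (intro tendsto_add tendsto_mult tendsto_const tendsto_power_div_exp_0)
    have "((\<lambda>y. \<Sum>i\<le>degree P. coeff P i * (y ^ Suc i / exp y)) \<longlongrightarrow> (\<Sum>i\<le>degree P. coeff P i * 0)) at_top"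
      by (intro tendsto_sum tendsto_mult tendsto_const tendsto_power_div_exp_0)
    moreover have "y * poly P y / exp y = (\<Sum>i\<le>degree P. coeff P i * (y ^ Suc i / exp y))" for y
      by (simp add: poly_altdef sum_distrib_left sum_divide_distrib algebra_simps)
    ultimately show "((\<lambda>y. y * poly P y / exp y) \<longlongrightarrow> 0) at_top" by simp
  qed
  then show ?case by (simp add: add_divide_distrib)
qed simp

lemma exp_flat_deriv:
  "(exp_flat P has_real_derivative exp_flat ([:0, 0, 1:] * (P - pderiv P)) t) (at t)"
proof -
  consider "t < 0" | "t > 0" | "t = 0" by linarith
  then show ?thesis
  proof cases
    case 1
    then have "exp_flat ([:0, 0, 1:] * (P - pderiv P)) t = 0" by (simp add: exp_flat_def)
    moreover have "(exp_flat P has_real_derivative 0) (at t)"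
      by (rule has_field_derivative_transform_within_open[where f="\<lambda>x. 0" and S="{..<0}"])
        (use 1 in \<open>auto simp: exp_flat_def\<close>)
    ultimately show ?thesis by simp
  next
    case 2
    have "((\<lambda>t. poly P (1 / t) * exp (- 1 / t)) has_real_derivative
        exp_flat ([:0, 0, 1:] * (P - pderiv P)) t) (at t)"
      using 2 by (auto intro!: derivative_eq_intros simp: exp_flat_def field_simps power2_eq_square)
    then show ?thesis
      by (rule has_field_derivative_transform_within_open[where S="{0<..}"])
        (use 2 in \<open>auto simp: exp_flat_def\<close>)
  next
    case 3
    have "((\<lambda>h. exp_flat P h / h) \<longlongrightarrow> 0) (at_right 0)"
    proof -
      have "((\<lambda>h. poly ([:0, 1:] * P) (inverse h) / exp (inverse h)) \<longlongrightarrow> 0) (at_right 0)"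
        using filterlim_compose[OF poly_div_exp_at_top filterlim_inverse_at_top_right] .
      then show ?thesis
        by (rule Lim_transform_eventually)
          (auto simp: exp_flat_def eventually_at_right_less exp_minus field_simps
            intro!: eventually_mono[OF eventually_at_right_less[of 0]])
    qed
    moreover have "((\<lambda>h. exp_flat P h / h) \<longlongrightarrow> 0) (at_left 0)"
      by (rule Lim_transform_eventually[OF tendsto_const])
        (auto simp: exp_flat_def eventually_at_filter intro!: always_eventually)
    ultimately have "((\<lambda>h. exp_flat P h / h) \<longlongrightarrow> 0) (at 0)"
      by (simp add: filterlim_at_split)
    then show ?thesis
      using 3 by (simp add: DERIV_def exp_flat_def)
  qed
qed

lemma smooth_exp_flat: "smooth (exp_flat P)"
proof (rule smooth_coinduct[where A="range exp_flat"])
  fix f :: "real \<Rightarrow> real" and b x :: real assume "f \<in> range exp_flat"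
  then obtain P where f: "f = exp_flat P" by auto
  note d = exp_flat_deriv[of P, unfolded has_field_derivative_def]
  show "f differentiable (at x)"
    unfolding f using d differentiable_def by blast
  assume "b \<in> Basis"
  then have "dir_deriv b f = exp_flat ([:0, 0, 1:] * (P - pderiv P))"
    unfolding f by (intro ext) (simp add: dir_deriv_eq[OF d])
  then show "dir_deriv b f \<in> range exp_flat" by blast
qed auto

text \<open>The plateau functions below increase to the indicator of the open box as \<open>n\<close> grows.\<close>

definition box_bump :: "nat \<Rightarrow> 'a::euclidean_space \<Rightarrow> 'a \<Rightarrow> 'a \<Rightarrow> real" where
  "box_bump n a b x = (\<Prod>i\<in>Basis. exp_flat 1 (real (Suc n) * (x \<bullet> i - a \<bullet> i)) * exp_flat 1 (real (Suc n) * (b \<bullet> i - x \<bullet> i)))"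

lemma exp_flat_1: "exp_flat 1 t \<le> 1" "0 \<le> exp_flat 1 t" "exp_flat 1 t \<noteq> 0 \<longleftrightarrow> t > 0"
  by (auto simp: exp_flat_def)

lemma exp_flat_1_LIMSEQ: "(\<lambda>n. exp_flat 1 (real (Suc n) * t)) \<longlonglongrightarrow> (if t > 0 then 1 else 0)"
proof (cases "t > 0")
  case True
  have "(\<lambda>n. exp ((- 1 / t) * inverse (real (Suc n)))) \<longlonglongrightarrow> exp ((- 1 / t) * 0)"
    by (intro tendsto_intros LIMSEQ_inverse_real_of_nat)
  moreover have "exp_flat 1 (real (Suc n) * t) = exp ((- 1 / t) * inverse (real (Suc n)))" for n
    using True by (simp add: exp_flat_def divide_inverse zero_less_mult_iff mult.commute del: of_nat_Suc)
  ultimately show ?thesis using True by simp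
qed (auto simp: exp_flat_def zero_less_mult_iff)

lemma smooth_box_bump: "smooth (box_bump n a b)"
proof -
  have "smooth (\<lambda>x::'a. exp_flat 1 (real (Suc n) * (x \<bullet> i - a \<bullet> i)))" for i
    using smooth_affine[OF smooth_exp_flat[of 1], of "real (Suc n) *\<^sub>R i" "- real (Suc n) * (a \<bullet> i)"]
    by (simp add: inner_commute algebra_simps)
  moreover have "smooth (\<lambda>x::'a. exp_flat 1 (real (Suc n) * (b \<bullet> i - x \<bullet> i)))" for i
    using smooth_affine[OF smooth_exp_flat[of 1], of "- real (Suc n) *\<^sub>R i" "real (Suc n) * (b \<bullet> i)"]
    by (simp add: inner_commute algebra_simps)
  ultimately show ?thesis
    unfolding box_bump_def by (intro smooth_prod smooth_mult finite_Basis)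
qed

lemma box_bump_bounds: "0 \<le> box_bump n a b x" "box_bump n a b x \<le> 1"
  unfolding box_bump_def
  by (auto intro!: prod_nonneg prod_le_1 mult_nonneg_nonneg mult_le_one simp: exp_flat_1)

lemma box_bump_nonzero: "box_bump n a b x \<noteq> 0 \<longleftrightarrow> x \<in> box a b"
  unfolding box_bump_def
  by (simp add: exp_flat_1 zero_less_mult_iff mem_box)

lemma box_bump_LIMSEQ: "(\<lambda>n. box_bump n a b x) \<longlonglongrightarrow> indicator (box a b) x"
proof -
  have "(\<lambda>n. box_bump n a b x) \<longlonglongrightarrow> (\<Prod>i\<in>Basis. (if x \<bullet> i - a \<bullet> i > 0 then 1 else 0) * (if b \<bullet> i - x \<bullet> i > 0 then 1 else 0))"
    unfolding box_bump_def by (intro tendsto_prod tendsto_mult exp_flat_1_LIMSEQ)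
  moreover have "(\<Prod>i\<in>Basis. (if x \<bullet> i - a \<bullet> i > 0 then 1 else 0) * (if b \<bullet> i - x \<bullet> i > 0 then 1 else 0)) = (indicator (box a b) x :: real)"
    by (auto simp: indicator_def mem_box intro!: prod.neutral)
  ultimately show ?thesis by simp
qed

lemma box_bump_test_functions:
  assumes "cbox a b \<subseteq> U"
  shows "box_bump n a b \<in> test_functions U"
proof -
  have s: "closure {x. box_bump n a b x \<noteq> 0} \<subseteq> cbox a b"
    by (rule closure_minimal) (auto simp: box_bump_nonzero box_subset_cbox[THEN subsetD])
  then have "compact (closure {x. box_bump n a b x \<noteq> 0})"
    by (meson bounded_cbox bounded_subset closed_closure compact_eq_bounded_closed)
  then show ?thesis
    using s assms smooth_box_bump[of n a b] by (auto simp: test_functions_def)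
qed

section \<open>Integration against test functions\<close>

text \<open>Completeness allows functions to be changed on null sets without losing measurability.\<close>

lemma complete_measure_lebesgue_on:
  assumes "S \<in> sets lebesgue"
  shows "complete_measure (lebesgue_on S)"
proof
  fix A B assume "A \<subseteq> B" "B \<in> null_sets (lebesgue_on S)"
  then have "B \<subseteq> S" "B \<in> null_sets lebesgue"
    using assms by (auto simp: null_sets_restrict_space)
  then have "A \<in> null_sets lebesgue" "A \<subseteq> S"
    using \<open>A \<subseteq> B\<close> by (auto intro: completion.complete2)
  then show "A \<in> sets (lebesgue_on S)"
    using assms by (auto simp: null_sets_restrict_space sets_restrict_space)
qed

lemma borel_measurable_AE_eq:
  fixes f g :: "'a \<Rightarrow> 'b::topological_space"
  assumes "complete_measure M" "f \<in> borel_measurable M" "AE x in M. f x = g x"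
  shows "g \<in> borel_measurable M"
proof (rule measurableI)
  fix A :: "'b set" assume "A \<in> sets borel"
  then have "f -` A \<inter> space M \<in> sets M" using assms(2) by (auto dest: measurable_sets)
  then show "g -` A \<inter> space M \<in> sets M"
    by (rule complete_measure.in_sets_AE[OF assms(1), rotated]) (use assms(3) in auto)
qed auto

lemma open_sets_lebesgue: "open S \<Longrightarrow> S \<in> sets lebesgue"
  by (metis borel_open sets_completionI_sets sets_lborel)

lemma AE_lebesgue_on_negligible:
  assumes "S \<in> sets lebesgue"
  shows "(AE x in lebesgue_on S. P x) \<longleftrightarrow> negligible {x \<in> S. \<not> P x}"
proof -
  have "(AE x in lebesgue_on S. P x) \<longleftrightarrow> {x \<in> S. \<not> P x} \<in> null_sets (lebesgue_on S)"
    using complete_measure.AE_iff_null_sets[OF complete_measure_lebesgue_on[OF assms]] by simp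
  then show ?thesis
    using assms by (simp add: null_sets_restrict_space negligible_iff_null_sets)
qed

lemma integral_lebesgue_on_support:
  fixes f :: "'a::euclidean_space \<Rightarrow> 'b::euclidean_space"
  assumes "S \<in> sets lebesgue" "\<And>x. x \<notin> S \<Longrightarrow> f x = 0"
  shows "integral\<^sup>L (lebesgue_on S) f = integral\<^sup>L lebesgue f"
    and "integrable (lebesgue_on S) f \<longleftrightarrow> integrable lebesgue f"
proof -
  have "(\<lambda>x. indicator S x *\<^sub>R f x) = f"
    using assms(2) by (auto simp: indicator_def fun_eq_iff)
  then show "integral\<^sup>L (lebesgue_on S) f = integral\<^sup>L lebesgue f"
    "integrable (lebesgue_on S) f \<longleftrightarrow> integrable lebesgue f"
    using assms(1) by (simp_all add: integral_restrict_space integrable_restrict_space)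
qed

lemma test_functions_smooth: "\<phi> \<in> test_functions U \<Longrightarrow> smooth \<phi>"
  by (simp add: test_functions_def)

lemma test_functions_support:
  assumes "\<phi> \<in> test_functions U"
  obtains K where "compact K" "K \<subseteq> U" "\<And>x. x \<notin> K \<Longrightarrow> \<phi> x = 0" "\<And>x b. x \<notin> K \<Longrightarrow> dir_deriv b \<phi> x = 0"
proof
  let ?K = "closure {x. \<phi> x \<noteq> 0}"
  show "compact ?K" "?K \<subseteq> U" using assms by (auto simp: test_functions_def)
  show z: "\<phi> x = 0" if "x \<notin> ?K" for x using that closure_subset[of "{x. \<phi> x \<noteq> 0}"] by blast
  show "dir_deriv b \<phi> x = 0" if "x \<notin> ?K" for x b
  proof (rule dir_deriv_eq[where f'="\<lambda>h. 0"])
    show "(\<phi> has_derivative (\<lambda>h. 0)) (at x)"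
    proof (rule has_derivative_transform_within_open)
      show "((\<lambda>x. 0) has_derivative (\<lambda>h. 0)) (at x)" by simp
      show "open (- ?K)" "x \<in> - ?K" using that by auto
      show "0 = \<phi> y" if "y \<in> - ?K" for y using z[of y] that by simp
    qed
  qed
qed

lemma test_functionsI:
  assumes "smooth \<phi>" "compact K" "K \<subseteq> U" "\<And>x. x \<notin> K \<Longrightarrow> \<phi> x = 0"
  shows "\<phi> \<in> test_functions U"
proof -
  have "closure {x. \<phi> x \<noteq> 0} \<subseteq> K"
    by (rule closure_minimal) (use assms in \<open>auto simp: compact_imp_closed\<close>)
  moreover from this have "compact (closure {x. \<phi> x \<noteq> 0})"
    by (meson assms(2) bounded_subset closed_closure compact_eq_bounded_closed)
  ultimately show ?thesis
    unfolding test_functions_def using assms by auto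
qed

lemma test_functions_dir_deriv:
  assumes "\<phi> \<in> test_functions U" "b \<in> Basis"
  shows "dir_deriv b \<phi> \<in> test_functions U"
proof -
  obtain K where K: "compact K" "K \<subseteq> U" "\<And>x b. x \<notin> K \<Longrightarrow> dir_deriv b \<phi> x = 0"
    using test_functions_support[OF assms(1)] by metis
  show ?thesis
    by (rule test_functionsI[OF smooth_dir_deriv[OF test_functions_smooth[OF assms(1)] assms(2)] K(1,2)]) (rule K(3))
qed

lemma test_functions_mult:
  assumes "\<phi> \<in> test_functions U" "smooth \<psi>"
  shows "(\<lambda>x. \<phi> x * \<psi> x) \<in> test_functions U"
proof -
  obtain K where K: "compact K" "K \<subseteq> U" "\<And>x. x \<notin> K \<Longrightarrow> \<phi> x = 0"
    using test_functions_support[OF assms(1)] by metis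
  show ?thesis
    by (rule test_functionsI[OF smooth_mult[OF test_functions_smooth[OF assms(1)] assms(2)] K(1,2)])
      (simp add: K)
qed

lemma test_functions_add:
  assumes "\<phi> \<in> test_functions U" "\<psi> \<in> test_functions U"
  shows "(\<lambda>x. \<phi> x + \<psi> x) \<in> test_functions U"
proof -
  obtain K where K: "compact K" "K \<subseteq> U" "\<And>x. x \<notin> K \<Longrightarrow> \<phi> x = 0"
    using test_functions_support[OF assms(1)] by metis
  obtain L where L: "compact L" "L \<subseteq> U" "\<And>x. x \<notin> L \<Longrightarrow> \<psi> x = 0"
    using test_functions_support[OF assms(2)] by metis
  show ?thesis
    by (rule test_functionsI[OF smooth_add[OF test_functions_smooth[OF assms(1)] test_functions_smooth[OF assms(2)]] compact_Un[OF K(1) L(1)]])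
      (use K L in auto)
qed

lemma test_functions_scale:
  assumes "\<phi> \<in> test_functions U"
  shows "(\<lambda>x. c * \<phi> x) \<in> test_functions U"
  using test_functions_mult[OF assms smooth_const[of c]] by (simp add: mult.commute)

lemma test_functions_bounded:
  assumes "\<phi> \<in> test_functions U"
  obtains B where "\<And>x. \<bar>\<phi> x\<bar> \<le> B" "B \<ge> 0"
proof -
  obtain K where K: "compact K" "\<And>x. x \<notin> K \<Longrightarrow> \<phi> x = 0"
    using test_functions_support[OF assms] by metis
  have "bounded (\<phi> ` K)"
    by (intro compact_imp_bounded compact_continuous_image K smooth_continuous test_functions_smooth[OF assms])
  then obtain B where B: "\<And>x. x \<in> K \<Longrightarrow> norm (\<phi> x) \<le> B"
    by (auto simp: bounded_iff)
  have "\<bar>\<phi> x\<bar> \<le> max B 0" for x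
    by (cases "x \<in> K") (use B[of x] K(2)[of x] in auto)
  then show ?thesis using that[of "max B 0"] by simp
qed

lemma test_functions_measurable: "\<phi> \<in> test_functions U \<Longrightarrow> \<phi> \<in> borel_measurable borel"
  by (intro borel_measurable_continuous_onI smooth_continuous test_functions_smooth)

lemma test_functions_measurable_lebesgue: "\<phi> \<in> test_functions U \<Longrightarrow> \<phi> \<in> borel_measurable lebesgue"
  by (rule measurable_completion) (simp add: test_functions_measurable)

lemma test_functions_integrable:
  assumes "\<phi> \<in> test_functions U"
  shows "integrable lborel \<phi>"
proof -
  obtain K where K: "compact K" "\<And>x. x \<notin> K \<Longrightarrow> \<phi> x = 0"
    using test_functions_support[OF assms] by metis
  have "integrable lborel (\<lambda>x. indicator K x *\<^sub>R \<phi> x)"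
    by (intro borel_integrable_compact K smooth_continuous test_functions_smooth[OF assms])
  also have "(\<lambda>x. indicator K x *\<^sub>R \<phi> x) = \<phi>"
    using K(2) by (auto simp: indicator_def fun_eq_iff)
  finally show ?thesis .
qed

text \<open>By translation invariance the difference quotients in a direction integrate to zero; they
  are dominated by the Lipschitz constant on a bounded set.\<close>

lemma integral_dir_deriv:
  fixes \<phi> :: "'a::euclidean_space \<Rightarrow> real"
  assumes "\<phi> \<in> test_functions U" "b \<in> Basis"
  shows "(LINT x|lborel. dir_deriv b \<phi> x) = 0"
proof -
  obtain K where K: "compact K" "\<And>x. x \<notin> K \<Longrightarrow> \<phi> x = 0"
    using test_functions_support[OF assms(1)] by metis
  then obtain R where R: "\<And>x. x \<in> K \<Longrightarrow> norm x \<le> R"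
    by (meson bounded_iff compact_imp_bounded)
  obtain B where B: "\<And>x. \<bar>dir_deriv b \<phi> x\<bar> \<le> B" "B \<ge> 0"
    using test_functions_bounded[OF test_functions_dir_deriv[OF assms]] by metis
  define D where "D n x = real (Suc n) * (\<phi> (inverse (real (Suc n)) *\<^sub>R b + x) - \<phi> x)" for n x
  have line: "((\<lambda>t. \<phi> (t *\<^sub>R b + x)) has_real_derivative dir_deriv b \<phi> (t *\<^sub>R b + x)) (at t)" for t x
  proof -
    let ?D = "\<lambda>h. dir_deriv h \<phi> (t *\<^sub>R b + x)"
    have d: "(\<phi> has_derivative ?D) (at (t *\<^sub>R b + x))"
      using has_derivative_dir_deriv smooth_differentiable[OF test_functions_smooth[OF assms(1)]] by blast
    have "((\<lambda>t. t *\<^sub>R b + x) has_derivative (\<lambda>h. h *\<^sub>R b)) (at t)"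
      by (auto intro!: derivative_eq_intros)
    from has_derivative_compose[OF this d]
    have "((\<lambda>t. \<phi> (t *\<^sub>R b + x)) has_derivative (\<lambda>h. ?D (h *\<^sub>R b))) (at t)" .
    moreover have "?D (h *\<^sub>R b) = ?D b * h" for h
      using linear_scale[OF has_derivative_linear[OF d], of h b] by simp
    ultimately show ?thesis by (simp add: has_field_derivative_def)
  qed
  have "(\<lambda>n. LINT x|lborel. D n x) \<longlonglongrightarrow> (LINT x|lborel. dir_deriv b \<phi> x)"
  proof (rule integral_dominated_convergence[where w="\<lambda>x. B * indicator (cball 0 (R + 1)) x"])
    show "dir_deriv b \<phi> \<in> borel_measurable lborel"
      using test_functions_measurable[OF test_functions_dir_deriv[OF assms]] by simp
    show "D n \<in> borel_measurable lborel" for n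
      unfolding D_def using test_functions_measurable[OF assms(1)] by measurable
    show "integrable lborel (\<lambda>x. B * indicator (cball (0::'a) (R + 1)) x)"
      using emeasure_bounded_finite[OF bounded_cball]
      by (intro integrable_mult_right integrable_real_indicator) (auto simp: less_top[symmetric])
    show "AE x in lborel. (\<lambda>n. D n x) \<longlonglongrightarrow> dir_deriv b \<phi> x"
    proof (rule AE_I2)
      fix x
      have "((\<lambda>h. (\<phi> (h *\<^sub>R b + x) - \<phi> x) / h) \<longlongrightarrow> dir_deriv b \<phi> x) (at 0)"
        using line[of x 0] by (simp add: DERIV_def)
      then have "((\<lambda>n. (\<phi> (inverse (real (Suc n)) *\<^sub>R b + x) - \<phi> x) / inverse (real (Suc n))) \<longlonglongrightarrow> dir_deriv b \<phi> x)"
        by (rule filterlim_compose) (auto simp: filterlim_at LIMSEQ_inverse_real_of_nat simp del: of_nat_Suc)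
      then show "(\<lambda>n. D n x) \<longlonglongrightarrow> dir_deriv b \<phi> x"
        unfolding D_def by (simp add: field_simps del: of_nat_Suc)
    qed
    show "AE x in lborel. norm (D n x) \<le> B * indicator (cball 0 (R + 1)) x" for n
    proof (rule AE_I2)
      fix x
      have n: "inverse (real (Suc n)) \<le> 1" "0 < inverse (real (Suc n))" by (auto simp: field_simps)
      show "norm (D n x) \<le> B * indicator (cball 0 (R + 1)) x"
      proof (cases "norm x \<le> R + 1")
        case False
        have "norm x \<le> norm (inverse (real (Suc n)) *\<^sub>R b + x) + norm (inverse (real (Suc n)) *\<^sub>R b)"
          by (metis add_diff_cancel_left' norm_triangle_ineq4 add.commute)
        moreover have "norm (inverse (real (Suc n)) *\<^sub>R b) \<le> 1"
          using n assms(2) by (simp del: of_nat_Suc)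
        ultimately have "x \<notin> K" "inverse (real (Suc n)) *\<^sub>R b + x \<notin> K"
          using False R[of x] R[of "inverse (real (Suc n)) *\<^sub>R b + x"] by auto
        then show ?thesis using B(2) by (simp add: D_def K(2))
      next
        case True
        obtain t where "\<phi> (inverse (real (Suc n)) *\<^sub>R b + x) - \<phi> (0 *\<^sub>R b + x) = (inverse (real (Suc n)) - 0) * dir_deriv b \<phi> (t *\<^sub>R b + x)"
          using MVT2[OF n(2) line] by blast
        then have "D n x = dir_deriv b \<phi> (t *\<^sub>R b + x)" by (simp add: D_def del: of_nat_Suc)
        then show ?thesis using B True by (simp add: dist_norm)
      qed
    qed
  qed
  moreover have "(LINT x|lborel. D n x) = 0" for n
  proof -
    let ?c = "inverse (real (Suc n)) *\<^sub>R b"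
    have i: "integrable lborel \<phi>" using test_functions_integrable[OF assms(1)] .
    have m: "(+) ?c \<in> borel_measurable (lborel :: 'a measure)" by measurable
    have m2: "\<phi> \<in> borel_measurable borel" using test_functions_measurable[OF assms(1)] .
    have "integrable lborel (\<lambda>x. \<phi> (?c + x))"
      using i integrable_distr_eq[OF m m2] lborel_distr_plus[of ?c] by simp
    moreover have "(LINT x|lborel. \<phi> (?c + x)) = (LINT x|lborel. \<phi> x)"
      using integral_distr[OF m m2] lborel_distr_plus[of ?c] by simp
    ultimately show ?thesis unfolding D_def using i by simp
  qed
  ultimately show ?thesis by (simp add: LIMSEQ_const_iff)
qed

lemma dir_deriv_mult:
  assumes "smooth f" "smooth g"
  shows "dir_deriv b (\<lambda>x. f x * g x) x = f x * dir_deriv b g x + dir_deriv b f x * g x"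
  by (rule dir_deriv_eq[where f'="\<lambda>h. f x * dir_deriv h g x + dir_deriv h f x * g x"])
    (intro has_derivative_mult has_derivative_dir_deriv smooth_differentiable assms)

lemma integral_by_parts:
  assumes "\<phi> \<in> test_functions U" "smooth \<psi>" "b \<in> Basis"
  shows "(LINT x|lborel. \<phi> x * dir_deriv b \<psi> x) = - (LINT x|lborel. dir_deriv b \<phi> x * \<psi> x)"
proof -
  note s = test_functions_smooth[OF assms(1)]
  have "(LINT x|lborel. \<phi> x * dir_deriv b \<psi> x + dir_deriv b \<phi> x * \<psi> x) = 0"
    using integral_dir_deriv[OF test_functions_mult[OF assms(1,2)] assms(3)]
    by (simp add: dir_deriv_mult[OF s assms(2)])
  moreover have "integrable lborel (\<lambda>x. \<phi> x * dir_deriv b \<psi> x)" "integrable lborel (\<lambda>x. dir_deriv b \<phi> x * \<psi> x)"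
    by (intro test_functions_integrable[of _ U] test_functions_mult test_functions_dir_deriv smooth_dir_deriv assms)+
  ultimately show ?thesis by simp
qed

text \<open>The box bumps turn the hypothesis into vanishing integrals over small boxes, and almost
  every point is a Lebesgue point.\<close>

lemma fundamental_lemma_variations:
  fixes g :: "'a::euclidean_space \<Rightarrow> real"
  assumes "open \<Omega>" "locally_integrable \<Omega> g"
    and orth: "\<And>\<phi>. \<phi> \<in> test_functions \<Omega> \<Longrightarrow> (LINT x|lebesgue_on \<Omega>. g x * \<phi> x) = 0"
  shows "AE x in lebesgue_on \<Omega>. g x = 0"
proof -
  have \<Omega>: "\<Omega> \<in> sets lebesgue" using assms(1) by (rule open_sets_lebesgue)
  have box0: "integral (cbox a b) g = 0" if ab: "cbox a b \<subseteq> \<Omega>" for a b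
  proof -
    have ai: "g absolutely_integrable_on cbox a b"
      using assms(2) ab by (auto simp: locally_integrable_def)
    define h where "h x = indicator (cbox a b) x * g x" for x
    have hi: "integrable lebesgue h" using ai unfolding h_def by (simp add: set_integrable_def)
    note hm = borel_measurable_integrable[OF hi]
    have "(\<lambda>n. LINT x|lebesgue. h x * box_bump n a b x) \<longlonglongrightarrow> (LINT x|lebesgue. h x * indicator (box a b) x)"
    proof (rule integral_dominated_convergence[where w="\<lambda>x. \<bar>h x\<bar>"])
      have "box_bump n a b \<in> borel_measurable lebesgue" for n
        by (rule test_functions_measurable_lebesgue[OF box_bump_test_functions[OF order_refl]])
      then show "(\<lambda>x. h x * box_bump n a b x) \<in> borel_measurable lebesgue" for n
        using hm by (intro borel_measurable_times)
      show "(\<lambda>x. h x * indicator (box a b) x) \<in> borel_measurable lebesgue"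
        using hm by (intro borel_measurable_times borel_measurable_indicator) auto
      show "integrable lebesgue (\<lambda>x. \<bar>h x\<bar>)" using hi by (rule integrable_abs)
      show "AE x in lebesgue. (\<lambda>n. h x * box_bump n a b x) \<longlonglongrightarrow> h x * indicator (box a b) x"
        by (intro AE_I2 tendsto_mult tendsto_const box_bump_LIMSEQ)
      show "AE x in lebesgue. norm (h x * box_bump n a b x) \<le> \<bar>h x\<bar>" for n
        by (intro AE_I2) (auto simp: abs_mult box_bump_bounds intro!: mult_left_le)
    qed
    moreover have "(LINT x|lebesgue. h x * box_bump n a b x) = 0" for n
    proof -
      have "h x * box_bump n a b x = g x * box_bump n a b x" for x
        using box_bump_nonzero[of n a b x] box_subset_cbox[of a b] by (auto simp: indicator_def h_def)
      then have eq: "(\<lambda>x. h x * box_bump n a b x) = (\<lambda>x. g x * box_bump n a b x)" by (rule ext)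
      have "g x * box_bump n a b x = 0" if "x \<notin> \<Omega>" for x
        using that ab box_bump_nonzero[of n a b x] box_subset_cbox[of a b] by auto
      then have "(LINT x|lebesgue. h x * box_bump n a b x) = (LINT x|lebesgue_on \<Omega>. g x * box_bump n a b x)"
        unfolding eq by (rule integral_lebesgue_on_support(1)[OF \<Omega>, symmetric])
      then show ?thesis using orth[OF box_bump_test_functions[OF ab]] by simp
    qed
    ultimately have "(LINT x|lebesgue. h x * indicator (box a b) x) = 0"
      by (simp add: LIMSEQ_const_iff)
    moreover have "h x * indicator (box a b) x = indicator (box a b) x *\<^sub>R g x" for x
      using box_subset_cbox[of a b] by (auto simp: indicator_def h_def)
    ultimately have "(LINT x:box a b|lebesgue. g x) = 0"
      by (simp add: set_lebesgue_integral_def)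
    then show ?thesis
      using set_lebesgue_integral_eq_integral(2)[of "box a b" g] ai
      by (simp add: absolutely_integrable_on_open_interval integral_open_interval)
  qed
  have neg: "negligible {x \<in> cbox a b. g x \<noteq> 0}" if ab: "cbox a b \<subseteq> \<Omega>" for a b
  proof -
    have ai: "g absolutely_integrable_on cbox a b"
      using assms(2) ab by (auto simp: locally_integrable_def)
    define f where "f x = (if x \<in> cbox a b then g x else 0)" for x
    have "f integrable_on UNIV"
      unfolding f_def integrable_restrict_UNIV using ai absolutely_integrable_on_def by blast
    then have "f integrable_on cbox c d" for c d
      using integrable_on_subcbox by blast
    then obtain N where N: "negligible N" and lim:
      "\<And>x e. \<lbrakk>x \<notin> N; 0 < e\<rbrakk> \<Longrightarrow> \<exists>d>0. \<forall>h. 0 < h \<and> h < d \<longrightarrow>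
          norm (integral (cbox x (x + h *\<^sub>R One)) f /\<^sub>R h ^ DIM('a) - f x) < e"
      by (rule integrable_ccontinuous_explicit[of f]) auto
    have "g x = 0" if x: "x \<in> box a b" "x \<notin> N" for x
    proof (rule ccontr)
      assume "g x \<noteq> 0"
      then obtain d where d: "d > 0" "\<And>h. 0 < h \<Longrightarrow> h < d \<Longrightarrow>
          norm (integral (cbox x (x + h *\<^sub>R One)) f /\<^sub>R h ^ DIM('a) - f x) < \<bar>g x\<bar>"
        using lim[OF x(2), of "\<bar>g x\<bar>"] by auto
      obtain e where e: "e > 0" "ball x e \<subseteq> box a b"
        using open_box x(1) by (meson open_contains_ball)
      define h where "h = min d (e / (real DIM('a))) / 2"
      have h: "0 < h" "h < d" "h * real DIM('a) < e"
        using d(1) e(1) by (auto simp: h_def min_def field_simps)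
      have sub: "cbox x (x + h *\<^sub>R One) \<subseteq> cbox a b"
      proof
        fix y assume y: "y \<in> cbox x (x + h *\<^sub>R One)"
        have "norm (y - x) \<le> (\<Sum>i\<in>Basis. \<bar>(y - x) \<bullet> i\<bar>)" by (rule norm_le_l1)
        also have "\<dots> \<le> (\<Sum>i\<in>(Basis::'a set). h)"
          using y by (intro sum_mono) (auto simp: mem_box inner_diff_left inner_add_left)
        also have "\<dots> < e" using h by (simp add: mult.commute)
        finally have "y \<in> ball x e" by (simp add: dist_norm norm_minus_commute)
        then show "y \<in> cbox a b" using e(2) box_subset_cbox[of a b] by blast
      qed
      have "integral (cbox x (x + h *\<^sub>R One)) f = integral (cbox x (x + h *\<^sub>R One)) g"
        by (rule integral_cong) (use sub in \<open>auto simp: f_def\<close>)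
      also have "\<dots> = 0" using sub ab by (intro box0) auto
      finally show False using d(2)[OF h(1,2)] x(1) box_subset_cbox[of a b] by (auto simp: f_def)
    qed
    then have "{x \<in> cbox a b. g x \<noteq> 0} \<subseteq> N \<union> (cbox a b - box a b)" by auto
    then show ?thesis
      using N negligible_frontier_interval negligible_subset negligible_Un by metis
  qed
  obtain \<D> where D: "countable \<D>" "\<D> \<subseteq> Pow \<Omega>" "\<And>X. X \<in> \<D> \<Longrightarrow> \<exists>a b. X = cbox a b" "\<Union>\<D> = \<Omega>"
    using open_countable_Union_open_cbox[OF assms(1)] by metis
  have "negligible (\<Union>X\<in>\<D>. {x \<in> X. g x \<noteq> 0})"
    by (intro negligible_countable_Union countable_image D(1)) (use neg D in \<open>force simp: image_iff\<close>)
  moreover have "(\<Union>X\<in>\<D>. {x \<in> X. g x \<noteq> 0}) = {x \<in> \<Omega>. g x \<noteq> 0}" using D(4) by auto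
  ultimately show ?thesis by (simp add: AE_lebesgue_on_negligible[OF \<Omega>])
qed

section \<open>Seminormed function spaces\<close>

text \<open>Representatives of Sobolev functions and functionals on them are both functions with pointwise
  linear operations and a seminorm; this common structure lets the theory of vector-valued functions
  of time be developed once for all of them.\<close>

locale seminormed =
  fixes X :: "('a \<Rightarrow> 'b::real_vector) set" and N :: "('a \<Rightarrow> 'b) \<Rightarrow> real"
  assumes zero_mem: "(\<lambda>x. 0) \<in> X"
    and lincomb_mem: "f \<in> X \<Longrightarrow> g \<in> X \<Longrightarrow> (\<lambda>x. a *\<^sub>R f x + b *\<^sub>R g x) \<in> X"
    and triangle: "f \<in> X \<Longrightarrow> g \<in> X \<Longrightarrow> N (\<lambda>x. f x + g x) \<le> N f + N g"
    and scale: "f \<in> X \<Longrightarrow> N (\<lambda>x. a *\<^sub>R f x) = \<bar>a\<bar> * N f"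
begin

lemma scale_mem: "f \<in> X \<Longrightarrow> (\<lambda>x. a *\<^sub>R f x) \<in> X"
  using lincomb_mem[of f f a 0] by simp

lemma add_mem: "f \<in> X \<Longrightarrow> g \<in> X \<Longrightarrow> (\<lambda>x. f x + g x) \<in> X"
  using lincomb_mem[of f g 1 1] by simp

lemma diff_mem: "f \<in> X \<Longrightarrow> g \<in> X \<Longrightarrow> (\<lambda>x. f x - g x) \<in> X"
  using lincomb_mem[of f g 1 "-1"] by simp

lemma norm_zero: "N (\<lambda>x. 0) = 0"
  using scale[OF zero_mem, of 0] by simp

lemma norm_minus_commute: "f \<in> X \<Longrightarrow> g \<in> X \<Longrightarrow> N (\<lambda>x. f x - g x) = N (\<lambda>x. g x - f x)"
  using scale[OF diff_mem, of g f "-1"] by simp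

lemma nonneg: "f \<in> X \<Longrightarrow> 0 \<le> N f"
  using triangle[OF _ scale_mem, of f f "-1"] scale[of f "-1"] norm_zero by simp

lemma diff_triangle:
  assumes "f \<in> X" "g \<in> X" "h \<in> X"
  shows "N (\<lambda>x. f x - h x) \<le> N (\<lambda>x. f x - g x) + N (\<lambda>x. g x - h x)"
  using triangle[OF diff_mem[OF assms(1,2)] diff_mem[OF assms(2,3)]] by simp

lemma norm_diff_le:
  assumes "f \<in> X" "g \<in> X"
  shows "N (\<lambda>x. f x - g x) \<le> N f + N g"
  using triangle[OF assms(1) scale_mem[OF assms(2)], of "-1"] scale[OF assms(2), of "-1"] by simp

lemma reverse_triangle:
  assumes "f \<in> X" "g \<in> X"
  shows "\<bar>N f - N g\<bar> \<le> N (\<lambda>x. f x - g x)"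
  using triangle[OF diff_mem[OF assms] assms(2)] triangle[OF diff_mem[OF assms(2,1)] assms(1)]
    norm_minus_commute[OF assms] by simp

lemma lincomb_le:
  assumes "f \<in> X" "g \<in> X"
  shows "N (\<lambda>x. a *\<^sub>R f x + b *\<^sub>R g x) \<le> \<bar>a\<bar> * N f + \<bar>b\<bar> * N g"
  using triangle[OF scale_mem[OF assms(1)] scale_mem[OF assms(2)], of a b] scale assms by simp

lemma norm_LIMSEQ:
  assumes "\<And>n. f n \<in> X" "g \<in> X" "(\<lambda>n. N (\<lambda>x. f n x - g x)) \<longlonglongrightarrow> 0"
  shows "(\<lambda>n. N (f n)) \<longlonglongrightarrow> N g"
proof -
  have "(\<lambda>n. N (f n) - N g) \<longlonglongrightarrow> 0"
    by (rule Lim_null_comparison[OF _ assms(3)]) (use reverse_triangle assms in simp)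
  then show ?thesis by (simp add: LIM_zero_iff)
qed

lemma dual_lincomb:
  assumes "l \<in> dual X N" "f \<in> X" "g \<in> X"
  shows "l (\<lambda>x. a *\<^sub>R f x + b *\<^sub>R g x) = a * l f + b * l g"
  using assms by (auto simp: dual_def)

lemma dual_diff:
  assumes "l \<in> dual X N" "f \<in> X" "g \<in> X"
  shows "l (\<lambda>x. f x - g x) = l f - l g"
  using dual_lincomb[OF assms, of 1 "-1"] by simp

lemma dual_norm_upper:
  assumes "l \<in> dual X N" "f \<in> X" "N f \<le> 1"
  shows "\<bar>l f\<bar> \<le> dual_norm X N l"
  unfolding dual_norm_def
proof (rule cSUP_upper)
  obtain C where C: "\<forall>f\<in>X. \<bar>l f\<bar> \<le> C * N f"
    using assms(1) unfolding dual_def by blast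
  show "bdd_above ((\<lambda>f. \<bar>l f\<bar>) ` {f \<in> X. N f \<le> 1})"
  proof (rule bdd_aboveI2)
    fix f assume f: "f \<in> {f \<in> X. N f \<le> 1}"
    then have "\<bar>l f\<bar> \<le> C * N f" using C by blast
    also have "\<dots> \<le> \<bar>C\<bar> * 1" using f nonneg[of f] by (intro mult_mono) auto
    finally show "\<bar>l f\<bar> \<le> \<bar>C\<bar>" by simp
  qed
qed (use assms in auto)

lemma dual_norm_least:
  assumes "\<And>f. f \<in> X \<Longrightarrow> N f \<le> 1 \<Longrightarrow> \<bar>l f\<bar> \<le> c"
  shows "dual_norm X N l \<le> c"
  unfolding dual_norm_def
  by (rule cSUP_least) (use assms zero_mem norm_zero in auto)

lemma dual_norm_nonneg: "l \<in> dual X N \<Longrightarrow> 0 \<le> dual_norm X N l"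
  using dual_norm_upper[OF _ zero_mem] norm_zero by fastforce

lemma dual_bound:
  assumes "l \<in> dual X N" "f \<in> X"
  shows "\<bar>l f\<bar> \<le> dual_norm X N l * N f"
proof (cases "N f = 0")
  case True
  then show ?thesis using assms by (force simp: dual_def)
next
  case False
  then have p: "N f > 0" using nonneg[OF assms(2)] by simp
  have "\<bar>l (\<lambda>x. (1 / N f) *\<^sub>R f x)\<bar> \<le> dual_norm X N l"
    by (rule dual_norm_upper[OF assms(1) scale_mem[OF assms(2)]]) (use p scale[OF assms(2)] in simp)
  moreover have "l (\<lambda>x. (1 / N f) *\<^sub>R f x) = l f / N f"
    using dual_lincomb[OF assms(1,2,2), of "1 / N f" 0] by simp
  ultimately show ?thesis using p by (simp add: field_simps)
qed

lemma seminormed_dual: "seminormed (dual X N) (dual_norm X N)"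
proof
  show "(\<lambda>x. 0) \<in> dual X N" by (auto simp: dual_def intro!: exI[of _ 0])
  show lin: "(\<lambda>x. a *\<^sub>R l x + b *\<^sub>R m x) \<in> dual X N" if l: "l \<in> dual X N" and m: "m \<in> dual X N" for l m a b
  proof -
    have "\<bar>a *\<^sub>R l f + b *\<^sub>R m f\<bar> \<le> (\<bar>a\<bar> * dual_norm X N l + \<bar>b\<bar> * dual_norm X N m) * N f" if "f \<in> X" for f
    proof -
      have "\<bar>a * l f\<bar> \<le> \<bar>a\<bar> * (dual_norm X N l * N f)" "\<bar>b * m f\<bar> \<le> \<bar>b\<bar> * (dual_norm X N m * N f)"
        using dual_bound[OF l that] dual_bound[OF m that] by (auto simp: abs_mult intro: mult_left_mono)
      then show ?thesis by (simp add: algebra_simps)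
    qed
    then have "\<exists>C. \<forall>f\<in>X. \<bar>a *\<^sub>R l f + b *\<^sub>R m f\<bar> \<le> C * N f" by blast
    moreover have "a *\<^sub>R l (\<lambda>x. c *\<^sub>R f x + d *\<^sub>R g x) + b *\<^sub>R m (\<lambda>x. c *\<^sub>R f x + d *\<^sub>R g x)
        = c * (a *\<^sub>R l f + b *\<^sub>R m f) + d * (a *\<^sub>R l g + b *\<^sub>R m g)" if "f \<in> X" "g \<in> X" for f g c d
      using dual_lincomb[OF l that] dual_lincomb[OF m that] by (simp add: algebra_simps)
    ultimately show ?thesis unfolding dual_def by blast
  qed
  show "dual_norm X N (\<lambda>x. l x + m x) \<le> dual_norm X N l + dual_norm X N m"
    if "l \<in> dual X N" "m \<in> dual X N" for l m
    by (rule dual_norm_least) (use dual_norm_upper[OF that(1)] dual_norm_upper[OF that(2)] in \<open>smt (verit)\<close>)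
  have le: "dual_norm X N (\<lambda>x. a *\<^sub>R l x) \<le> \<bar>a\<bar> * dual_norm X N l" if "l \<in> dual X N" for l a
    by (rule dual_norm_least) (use dual_norm_upper[OF that] in \<open>auto simp: abs_mult intro: mult_left_mono\<close>)
  show "dual_norm X N (\<lambda>x. a *\<^sub>R l x) = \<bar>a\<bar> * dual_norm X N l" if l: "l \<in> dual X N" for l a
  proof (cases "a = 0")
    case True
    then show ?thesis using le[OF l, of a] dual_norm_nonneg[OF lin[OF l l, of a 0]] by simp
  next
    case False
    have "dual_norm X N l \<le> \<bar>1 / a\<bar> * dual_norm X N (\<lambda>x. a *\<^sub>R l x)"
      using le[OF lin[OF l l, of a 0], of "1 / a"] False by simp
    then have "\<bar>a\<bar> * dual_norm X N l \<le> dual_norm X N (\<lambda>x. a *\<^sub>R l x)"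
      using False by (simp add: field_simps)
    then show ?thesis using le[OF l, of a] by simp
  qed
qed

end

section \<open>Square integrable functions\<close>

text \<open>A nonnegative quadratic polynomial has nonpositive discriminant.\<close>

lemma semidefinite_cauchy_schwarz:
  fixes a b c :: real
  assumes "\<And>t. 0 \<le> a + 2 * t * b + t\<^sup>2 * c" "c \<ge> 0"
  shows "\<bar>b\<bar> \<le> sqrt a * sqrt c"
proof -
  have "b\<^sup>2 \<le> a * c"
  proof (cases "c = 0")
    case True
    have "b = 0"
    proof (rule ccontr)
      assume "b \<noteq> 0"
      then show False using assms(1)[of "- (a + 1) / (2 * b)"] True by (simp add: field_simps)
    qed
    then show ?thesis using True by simp
  next
    case False
    have "0 \<le> a + 2 * (- b / c) * b + (- b / c)\<^sup>2 * c" by (rule assms(1))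
    also have "\<dots> = a - b\<^sup>2 / c" using False by (simp add: power2_eq_square field_simps)
    finally show ?thesis using False assms(2) by (simp add: field_simps)
  qed
  then have "sqrt (b\<^sup>2) \<le> sqrt (a * c)" by (rule real_sqrt_le_mono)
  then show ?thesis by (simp add: real_sqrt_mult)
qed

locale open_domain =
  fixes \<Omega> :: "'a::euclidean_space set"
  assumes open_domain: "open \<Omega>"
begin

lemma domain_sets: "\<Omega> \<in> sets lebesgue"
  by (rule open_sets_lebesgue[OF open_domain])

lemmas complete_domain = complete_measure_lebesgue_on[OF domain_sets]

lemmas measurable_AE_eq = borel_measurable_AE_eq[OF complete_domain]

lemma L2_measurable: "f \<in> L2 \<Omega> \<Longrightarrow> f \<in> borel_measurable (lebesgue_on \<Omega>)"
  by (simp add: L2_def)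

lemma L2_norm_prod_integrable:
  assumes "f \<in> L2 \<Omega>" "g \<in> L2 \<Omega>"
  shows "integrable (lebesgue_on \<Omega>) (\<lambda>x. norm (f x) * norm (g x))"
proof (rule Bochner_Integration.integrable_bound)
  show "integrable (lebesgue_on \<Omega>) (\<lambda>x. (norm (f x))\<^sup>2 + (norm (g x))\<^sup>2)"
    using assms by (auto simp: L2_def)
  show "(\<lambda>x. norm (f x) * norm (g x)) \<in> borel_measurable (lebesgue_on \<Omega>)"
    using L2_measurable[OF assms(1)] L2_measurable[OF assms(2)] by measurable
  have "\<bar>s * t\<bar> \<le> s\<^sup>2 + t\<^sup>2" if "s \<ge> 0" "t \<ge> 0" for s t :: real
    using sum_squares_bound[of s t] mult_nonneg_nonneg[OF that] by (simp only: abs_of_nonneg)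
  then show "AE x in lebesgue_on \<Omega>. norm (norm (f x) * norm (g x)) \<le> norm ((norm (f x))\<^sup>2 + (norm (g x))\<^sup>2)"
    by simp
qed

lemma L2_inner_integrable:
  assumes "f \<in> L2 \<Omega>" "g \<in> L2 \<Omega>"
  shows "integrable (lebesgue_on \<Omega>) (\<lambda>x. f x \<bullet> g x)"
proof (rule Bochner_Integration.integrable_bound[OF L2_norm_prod_integrable[OF assms]])
  show "(\<lambda>x. f x \<bullet> g x) \<in> borel_measurable (lebesgue_on \<Omega>)"
    using L2_measurable[OF assms(1)] L2_measurable[OF assms(2)] by measurable
qed (simp add: Cauchy_Schwarz_ineq2)

lemma L2_lincomb:
  assumes f: "f \<in> L2 \<Omega>" and g: "g \<in> L2 \<Omega>"
  shows "(\<lambda>x. a *\<^sub>R f x + b *\<^sub>R g x) \<in> L2 \<Omega>"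
proof -
  have m: "(\<lambda>x. a *\<^sub>R f x + b *\<^sub>R g x) \<in> borel_measurable (lebesgue_on \<Omega>)"
    using L2_measurable[OF f] L2_measurable[OF g] by measurable
  have "integrable (lebesgue_on \<Omega>) (\<lambda>x. a\<^sup>2 * (norm (f x))\<^sup>2 + (2 * a * b) * (f x \<bullet> g x) + b\<^sup>2 * (norm (g x))\<^sup>2)"
    using f g L2_inner_integrable[OF f g] by (auto simp: L2_def)
  also have "(\<lambda>x. a\<^sup>2 * (norm (f x))\<^sup>2 + (2 * a * b) * (f x \<bullet> g x) + b\<^sup>2 * (norm (g x))\<^sup>2)
      = (\<lambda>x. (norm (a *\<^sub>R f x + b *\<^sub>R g x))\<^sup>2)"
    unfolding power2_norm_eq_inner
    by (simp add: inner_add_left inner_add_right inner_commute power2_eq_square algebra_simps)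
  finally show ?thesis using m by (simp add: L2_def)
qed

lemma L2_scale: "f \<in> L2 \<Omega> \<Longrightarrow> (\<lambda>x. a *\<^sub>R f x) \<in> L2 \<Omega>"
  using L2_lincomb[of f f a 0] by simp

lemma L2_AE:
  assumes "f \<in> L2 \<Omega>" "AE x in lebesgue_on \<Omega>. f x = g x"
  shows "g \<in> L2 \<Omega>"
proof -
  have g: "g \<in> borel_measurable (lebesgue_on \<Omega>)"
    using measurable_AE_eq[OF L2_measurable[OF assms(1)] assms(2)] .
  have "integrable (lebesgue_on \<Omega>) (\<lambda>x. (norm (g x))\<^sup>2)"
  proof (rule integrable_cong_AE_imp)
    show "integrable (lebesgue_on \<Omega>) (\<lambda>x. (norm (f x))\<^sup>2)" using assms(1) by (simp add: L2_def)
    show "(\<lambda>x. (norm (g x))\<^sup>2) \<in> borel_measurable (lebesgue_on \<Omega>)" using g by measurable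
    show "AE x in lebesgue_on \<Omega>. (norm (f x))\<^sup>2 = (norm (g x))\<^sup>2"
      using assms(2) by eventually_elim simp
  qed
  then show ?thesis using g by (simp add: L2_def)
qed

lemma l2_inner_cong:
  assumes "f \<in> L2 \<Omega>" "g \<in> L2 \<Omega>" "AE x in lebesgue_on \<Omega>. f x = f' x" "AE x in lebesgue_on \<Omega>. g x = g' x"
  shows "l2_inner \<Omega> f g = l2_inner \<Omega> f' g'"
  unfolding l2_inner_def
proof (rule integral_cong_AE)
  note m = L2_measurable[OF assms(1)] L2_measurable[OF assms(2)]
    L2_measurable[OF L2_AE[OF assms(1,3)]] L2_measurable[OF L2_AE[OF assms(2,4)]]
  show "(\<lambda>x. f x \<bullet> g x) \<in> borel_measurable (lebesgue_on \<Omega>)" using m by measurable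
  show "(\<lambda>x. f' x \<bullet> g' x) \<in> borel_measurable (lebesgue_on \<Omega>)" using m by measurable
  show "AE x in lebesgue_on \<Omega>. f x \<bullet> g x = f' x \<bullet> g' x"
    using assms(3,4) by eventually_elim simp
qed

lemma l2_norm_sq: "(l2_norm \<Omega> f)\<^sup>2 = l2_inner \<Omega> f f"
  unfolding l2_norm_def l2_inner_def by (simp add: power2_norm_eq_inner)

lemma l2_norm_nonneg: "0 \<le> l2_norm \<Omega> f"
  unfolding l2_norm_def by (simp add: integral_nonneg_AE)

lemma l2_norm_eq_sqrt: "l2_norm \<Omega> f = sqrt (l2_inner \<Omega> f f)"
  unfolding l2_norm_def l2_inner_def by (simp add: power2_norm_eq_inner)

lemma l2_norm_cong:
  assumes "f \<in> L2 \<Omega>" "AE x in lebesgue_on \<Omega>. f x = g x"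
  shows "l2_norm \<Omega> f = l2_norm \<Omega> g"
  unfolding l2_norm_eq_sqrt using l2_inner_cong[OF assms(1,1,2,2)] by simp

lemma l2_inner_commute: "l2_inner \<Omega> f g = l2_inner \<Omega> g f"
  by (simp add: l2_inner_def inner_commute)

lemma l2_inner_lincomb_left:
  assumes "f \<in> L2 \<Omega>" "g \<in> L2 \<Omega>" "h \<in> L2 \<Omega>"
  shows "l2_inner \<Omega> (\<lambda>x. a *\<^sub>R f x + b *\<^sub>R g x) h = a * l2_inner \<Omega> f h + b * l2_inner \<Omega> g h"
  unfolding l2_inner_def using L2_inner_integrable[OF assms(1,3)] L2_inner_integrable[OF assms(2,3)]
  by (simp add: inner_add_left)

lemma l2_inner_lincomb_right:
  assumes "f \<in> L2 \<Omega>" "g \<in> L2 \<Omega>" "h \<in> L2 \<Omega>"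
  shows "l2_inner \<Omega> h (\<lambda>x. a *\<^sub>R f x + b *\<^sub>R g x) = a * l2_inner \<Omega> h f + b * l2_inner \<Omega> h g"
  using l2_inner_lincomb_left[OF assms] by (simp add: l2_inner_commute)

lemma l2_inner_diff_left:
  assumes "f \<in> L2 \<Omega>" "g \<in> L2 \<Omega>" "h \<in> L2 \<Omega>"
  shows "l2_inner \<Omega> (\<lambda>x. f x - g x) h = l2_inner \<Omega> f h - l2_inner \<Omega> g h"
  using l2_inner_lincomb_left[OF assms, of 1 "-1"] by simp

lemma l2_inner_diff_right:
  assumes "f \<in> L2 \<Omega>" "g \<in> L2 \<Omega>" "h \<in> L2 \<Omega>"
  shows "l2_inner \<Omega> h (\<lambda>x. f x - g x) = l2_inner \<Omega> h f - l2_inner \<Omega> h g"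
  using l2_inner_diff_left[OF assms] by (simp add: l2_inner_commute)

lemma l2_cauchy_schwarz:
  assumes "f \<in> L2 \<Omega>" "g \<in> L2 \<Omega>"
  shows "\<bar>l2_inner \<Omega> f g\<bar> \<le> l2_norm \<Omega> f * l2_norm \<Omega> g"
  unfolding l2_norm_eq_sqrt
proof (rule semidefinite_cauchy_schwarz)
  fix t
  define s where "s = (\<lambda>x. 1 *\<^sub>R f x + t *\<^sub>R g x)"
  have s: "s \<in> L2 \<Omega>" unfolding s_def by (rule L2_lincomb[OF assms])
  have "0 \<le> l2_inner \<Omega> s s"
    unfolding l2_inner_def by (rule integral_nonneg_AE) simp
  also have "l2_inner \<Omega> s s = 1 * l2_inner \<Omega> f s + t * l2_inner \<Omega> g s"
    using l2_inner_lincomb_left[OF assms s, of 1 t] by (simp only: s_def)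
  also have "l2_inner \<Omega> f s = 1 * l2_inner \<Omega> f f + t * l2_inner \<Omega> f g"
    unfolding s_def by (rule l2_inner_lincomb_right[OF assms assms(1)])
  also have "l2_inner \<Omega> g s = 1 * l2_inner \<Omega> g f + t * l2_inner \<Omega> g g"
    unfolding s_def by (rule l2_inner_lincomb_right[OF assms assms(2)])
  finally show "0 \<le> l2_inner \<Omega> f f + 2 * t * l2_inner \<Omega> f g + t\<^sup>2 * l2_inner \<Omega> g g"
    by (simp add: l2_inner_commute[of g f] power2_eq_square algebra_simps)
qed (simp add: l2_inner_def integral_nonneg_AE)

lemma l2_norm_prod:
  assumes "f \<in> L2 \<Omega>" "g \<in> L2 \<Omega>"
  shows "(LINT x|lebesgue_on \<Omega>. norm (f x) * norm (g x)) \<le> l2_norm \<Omega> f * l2_norm \<Omega> g"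
proof -
  have "(\<lambda>x. norm (f x)) \<in> L2 \<Omega>" "(\<lambda>x. norm (g x)) \<in> L2 \<Omega>"
    using assms by (auto simp: L2_def)
  from l2_cauchy_schwarz[OF this] show ?thesis
    by (simp add: l2_inner_def l2_norm_def)
qed

lemma seminormed_L2: "seminormed (L2 \<Omega>) (l2_norm \<Omega> :: ('a \<Rightarrow> 'b::euclidean_space) \<Rightarrow> real)"
proof
  show "(\<lambda>x. 0) \<in> L2 \<Omega>" by (simp add: L2_def)
  show "l2_norm \<Omega> (\<lambda>x. f x + g x) \<le> l2_norm \<Omega> f + l2_norm \<Omega> g"
    if fg: "f \<in> L2 \<Omega>" "g \<in> L2 \<Omega>" for f g :: "'a \<Rightarrow> 'b"
  proof (rule power2_le_imp_le)
    have s: "(\<lambda>x. f x + g x) \<in> L2 \<Omega>" using L2_lincomb[OF fg, of 1 1] by simp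
    have "(l2_norm \<Omega> (\<lambda>x. f x + g x))\<^sup>2 = l2_inner \<Omega> f f + 2 * l2_inner \<Omega> f g + l2_inner \<Omega> g g"
      using l2_inner_lincomb_left[OF fg s, of 1 1] l2_inner_lincomb_right[OF fg fg(1), of 1 1] l2_inner_lincomb_right[OF fg fg(2), of 1 1]
      by (simp add: l2_norm_sq l2_inner_commute[of g f])
    also have "\<dots> \<le> (l2_norm \<Omega> f + l2_norm \<Omega> g)\<^sup>2"
      using l2_cauchy_schwarz[OF fg] by (simp add: power2_sum l2_norm_sq)
    finally show "(l2_norm \<Omega> (\<lambda>x. f x + g x))\<^sup>2 \<le> (l2_norm \<Omega> f + l2_norm \<Omega> g)\<^sup>2" .
  qed (simp add: l2_norm_nonneg)
  show "l2_norm \<Omega> (\<lambda>x. a *\<^sub>R f x) = \<bar>a\<bar> * l2_norm \<Omega> f" for a and f :: "'a \<Rightarrow> 'b"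
    unfolding l2_norm_def by (simp add: power_mult_distrib real_sqrt_mult)
qed (rule L2_lincomb)

lemma l2_norm_eq_0:
  assumes "f \<in> L2 \<Omega>" "l2_norm \<Omega> f = 0"
  shows "AE x in lebesgue_on \<Omega>. f x = 0"
proof -
  have "(LINT x|lebesgue_on \<Omega>. (norm (f x))\<^sup>2) = 0"
    using assms(2) by (simp add: l2_norm_def)
  then have "AE x in lebesgue_on \<Omega>. (norm (f x))\<^sup>2 = 0"
    using integral_nonneg_eq_0_iff_AE[of "lebesgue_on \<Omega>" "\<lambda>x. (norm (f x))\<^sup>2"] assms(1) by (simp add: L2_def)
  then show ?thesis by simp
qed

text \<open>Componentwise reasoning for vector and matrix fields; for matrices it is applied twice.\<close>

lemma l2_inner_vec:
  fixes f g :: "'a \<Rightarrow> 'b::euclidean_space ^ 'n"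
  assumes "f \<in> L2 \<Omega>" "g \<in> L2 \<Omega>"
  shows "(\<And>i. (\<lambda>x. f x $ i) \<in> L2 \<Omega>)" "l2_inner \<Omega> f g = (\<Sum>i\<in>UNIV. l2_inner \<Omega> (\<lambda>x. f x $ i) (\<lambda>x. g x $ i))"
proof -
  have c: "(\<lambda>x. f x $ i) \<in> L2 \<Omega>" if f: "f \<in> L2 \<Omega>" for i and f :: "'a \<Rightarrow> 'b ^ 'n"
  proof -
    have m: "(\<lambda>x. f x $ i) \<in> borel_measurable (lebesgue_on \<Omega>)"
      by (rule borel_measurable_continuous_onI[of "\<lambda>v. v $ i", THEN measurable_compose[OF L2_measurable[OF f]]])
        (intro continuous_intros)
    have "integrable (lebesgue_on \<Omega>) (\<lambda>x. (norm (f x $ i))\<^sup>2)"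
    proof (rule Bochner_Integration.integrable_bound)
      show "integrable (lebesgue_on \<Omega>) (\<lambda>x. (norm (f x))\<^sup>2)" using f by (simp add: L2_def)
      show "(\<lambda>x. (norm (f x $ i))\<^sup>2) \<in> borel_measurable (lebesgue_on \<Omega>)" using m by measurable
      show "AE x in lebesgue_on \<Omega>. norm ((norm (f x $ i))\<^sup>2) \<le> norm ((norm (f x))\<^sup>2)"
        by (auto intro!: power_mono Finite_Cartesian_Product.norm_nth_le)
    qed
    then show ?thesis using m by (simp add: L2_def)
  qed
  show "(\<lambda>x. f x $ i) \<in> L2 \<Omega>" for i by (rule c[OF assms(1)])
  show "l2_inner \<Omega> f g = (\<Sum>i\<in>UNIV. l2_inner \<Omega> (\<lambda>x. f x $ i) (\<lambda>x. g x $ i))"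
    unfolding l2_inner_def inner_vec_def
    by (rule Bochner_Integration.integral_sum) (intro L2_inner_integrable c assms)
qed

lemma l2_norm_nth:
  fixes f :: "'a \<Rightarrow> 'b::euclidean_space ^ 'n"
  assumes "f \<in> L2 \<Omega>"
  shows "l2_norm \<Omega> (\<lambda>x. f x $ i) \<le> l2_norm \<Omega> f"
proof (rule power2_le_imp_le)
  have "(l2_norm \<Omega> (\<lambda>x. f x $ i))\<^sup>2 \<le> (\<Sum>i\<in>UNIV. (l2_norm \<Omega> (\<lambda>x. f x $ i))\<^sup>2)"
    by (rule member_le_sum) auto
  then show "(l2_norm \<Omega> (\<lambda>x. f x $ i))\<^sup>2 \<le> (l2_norm \<Omega> f)\<^sup>2"
    by (simp add: l2_norm_sq l2_inner_vec(2)[OF assms assms])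
qed (rule l2_norm_nonneg)

lemma borel_measurable_vec:
  fixes f :: "'n::finite \<Rightarrow> 'c \<Rightarrow> 'b::euclidean_space"
  assumes "\<And>i. f i \<in> borel_measurable M"
  shows "(\<lambda>x. \<chi> i. f i x) \<in> borel_measurable M"
proof (subst borel_measurable_euclidean_space, rule ballI)
  fix b :: "'b ^ 'n" assume "b \<in> Basis"
  then obtain i u where "b = axis i u" by (auto simp: Basis_vec_def)
  then have "(\<lambda>x. (\<chi> i. f i x) \<bullet> b) = (\<lambda>x. f i x \<bullet> u)" by (simp add: inner_axis)
  then show "(\<lambda>x. (\<chi> i. f i x) \<bullet> b) \<in> borel_measurable M" using assms by simp
qed

lemma L2_vec:
  fixes f :: "'n::finite \<Rightarrow> 'a \<Rightarrow> 'b::euclidean_space"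
  assumes "\<And>i. f i \<in> L2 \<Omega>"
  shows "(\<lambda>x. \<chi> i. f i x) \<in> L2 \<Omega>"
proof -
  have "(\<lambda>x. \<chi> i. f i x) \<in> borel_measurable (lebesgue_on \<Omega>)"
    using assms by (intro borel_measurable_vec L2_measurable)
  moreover have "integrable (lebesgue_on \<Omega>) (\<lambda>x. \<Sum>i\<in>UNIV. f i x \<bullet> f i x)"
    by (intro Bochner_Integration.integrable_sum L2_inner_integrable assms)
  ultimately show ?thesis by (simp add: L2_def power2_norm_eq_inner inner_vec_def)
qed

lemma L2_locally_integrable:
  assumes "f \<in> L2 \<Omega>"
  shows "locally_integrable \<Omega> f"
  unfolding locally_integrable_def
proof (intro allI impI)
  fix K assume K: "compact K" "K \<subseteq> \<Omega>"
  have Ks: "K \<in> sets lebesgue" using K(1) by (simp add: borel_compact)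
  have i: "integrable (lebesgue_on K) (\<lambda>x. 1 + (norm (f x))\<^sup>2)"
  proof (rule Bochner_Integration.integrable_add)
    have "finite_measure (lebesgue_on K)"
      using K(1) by (intro finite_measure_lebesgue_on lmeasurable_compact)
    then show "integrable (lebesgue_on K) (\<lambda>x. 1::real)"
      by (rule finite_measure.integrable_const)
    have "set_integrable lebesgue \<Omega> (\<lambda>x. (norm (f x))\<^sup>2)"
      using assms domain_sets by (simp add: L2_def integrable_restrict_space set_integrable_def)
    then have "set_integrable lebesgue K (\<lambda>x. (norm (f x))\<^sup>2)"
      using Ks K(2) by (rule set_integrable_subset)
    then show "integrable (lebesgue_on K) (\<lambda>x. (norm (f x))\<^sup>2)"
      using Ks by (rule absolutely_integrable_imp_integrable)
  qed
  have "integrable (lebesgue_on K) f"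
  proof (rule Bochner_Integration.integrable_bound[OF i])
    show "f \<in> borel_measurable (lebesgue_on K)"
      using L2_measurable[OF assms] K(2) by (rule measurable_restrict_mono)
    have "\<bar>s\<bar> \<le> 1 + s\<^sup>2" for s :: real
      using sum_squares_bound[of 1 "\<bar>s\<bar>"] by (simp add: power2_eq_square)
    then show "AE x in lebesgue_on K. norm (f x) \<le> norm (1 + (norm (f x))\<^sup>2)" by simp
  qed
  then show "f absolutely_integrable_on K"
    using Ks by (simp add: integrable_restrict_space set_integrable_def)
qed

end

section \<open>Weak derivatives\<close>

context open_domain
begin

lemma locally_integrable_test:
  assumes "locally_integrable \<Omega> g" "\<phi> \<in> test_functions \<Omega>"
  shows "integrable (lebesgue_on \<Omega>) (\<lambda>x. g x * \<phi> x)"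
proof -
  obtain K where K: "compact K" "K \<subseteq> \<Omega>" "\<And>x. x \<notin> K \<Longrightarrow> \<phi> x = 0"
    using test_functions_support[OF assms(2)] by metis
  obtain B where B: "\<And>x. \<bar>\<phi> x\<bar> \<le> B" "B \<ge> 0"
    using test_functions_bounded[OF assms(2)] by metis
  have i: "integrable lebesgue (\<lambda>x. indicator K x * g x)"
    using assms(1) K(1,2) by (simp add: locally_integrable_def set_integrable_def)
  have "integrable lebesgue (\<lambda>x. (indicator K x * g x) * \<phi> x)"
  proof (rule Bochner_Integration.integrable_bound[OF integrable_mult_right[OF i, of B]])
    show "(\<lambda>x. (indicator K x * g x) * \<phi> x) \<in> borel_measurable lebesgue"
      using borel_measurable_integrable[OF i] test_functions_measurable_lebesgue[OF assms(2)]
      by (rule borel_measurable_times)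
    have "\<bar>(indicator K x * g x) * \<phi> x\<bar> \<le> \<bar>B * (indicator K x * g x)\<bar>" for x
    proof -
      have "\<bar>indicator K x * g x\<bar> * \<bar>\<phi> x\<bar> \<le> \<bar>indicator K x * g x\<bar> * B"
        by (rule mult_left_mono[OF B(1)]) simp
      then show ?thesis using B(2) by (simp add: abs_mult mult.commute)
    qed
    then show "AE x in lebesgue. norm ((indicator K x * g x) * \<phi> x) \<le> norm (B * (indicator K x * g x))"
      by simp
  qed
  also have "(\<lambda>x. (indicator K x * g x) * \<phi> x) = (\<lambda>x. g x * \<phi> x)"
    using K(3) by (force simp: indicator_def)
  finally have "integrable lebesgue (\<lambda>x. g x * \<phi> x)" .
  moreover have "g x * \<phi> x = 0" if "x \<notin> \<Omega>" for x using K(2,3) that by auto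
  ultimately show ?thesis
    using integral_lebesgue_on_support(2)[OF domain_sets, of "\<lambda>x. g x * \<phi> x"] by simp
qed

lemma locally_integrable_lincomb:
  assumes "locally_integrable \<Omega> f" "locally_integrable \<Omega> g"
  shows "locally_integrable \<Omega> (\<lambda>x. a * f x + b * g x)"
  using assms unfolding locally_integrable_def by (intro allI impI set_integral_add(1) set_integrable_mult_right) auto

lemma integral_test_lborel:
  assumes "\<phi> \<in> test_functions \<Omega>"
  shows "(LINT x|lebesgue_on \<Omega>. \<phi> x) = (LINT x|lborel. \<phi> x)" "integrable (lebesgue_on \<Omega>) \<phi>"
proof -
  obtain K where K: "K \<subseteq> \<Omega>" "\<And>x. x \<notin> K \<Longrightarrow> \<phi> x = 0"
    using test_functions_support[OF assms] by metis
  then have z: "\<And>x. x \<notin> \<Omega> \<Longrightarrow> \<phi> x = 0" by blast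
  have m: "\<phi> \<in> borel_measurable lborel" using test_functions_measurable[OF assms] by simp
  show "(LINT x|lebesgue_on \<Omega>. \<phi> x) = (LINT x|lborel. \<phi> x)"
    using integral_lebesgue_on_support(1)[OF domain_sets z] integral_completion[OF m] by simp
  show "integrable (lebesgue_on \<Omega>) \<phi>"
    using integral_lebesgue_on_support(2)[OF domain_sets z] test_functions_integrable[OF assms] integrable_completion[OF m] by simp
qed

lemma test_functions_L2:
  assumes "\<phi> \<in> test_functions \<Omega>"
  shows "\<phi> \<in> L2 \<Omega>"
proof -
  have "\<phi> \<in> borel_measurable (lebesgue_on \<Omega>)"
    by (rule measurable_restrict_space1[OF test_functions_measurable_lebesgue[OF assms]])
  then show ?thesis
    using integral_test_lborel(2)[OF test_functions_mult[OF assms test_functions_smooth[OF assms]]]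
    by (simp add: L2_def power2_eq_square)
qed

text \<open>Testing with \<open>x\<^sub>b \<phi>\<^sup>2\<close>: its derivative in direction \<open>b\<close> integrates to zero, so
  \<open>\<integral> \<phi>\<^sup>2 = - 2 \<integral> x\<^sub>b \<phi> \<partial>\<^sub>b \<phi>\<close>.\<close>

lemma poincare_test_functions:
  assumes "\<phi> \<in> test_functions \<Omega>" "b \<in> Basis" and R: "\<And>x. x \<in> \<Omega> \<Longrightarrow> norm x \<le> R" "R \<ge> 0"
  shows "l2_norm \<Omega> \<phi> \<le> 2 * R * l2_norm \<Omega> (dir_deriv b \<phi>)"
proof -
  note s = test_functions_smooth[OF assms(1)]
  note d = test_functions_dir_deriv[OF assms(1,2)]
  have idr: "dir_deriv c (\<lambda>t::real. t) = (\<lambda>t. c)" for c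
    by (rule ext, rule dir_deriv_eq) simp
  have id: "smooth (\<lambda>t::real. t)"
  proof (rule smooth_coinduct[where A="insert (\<lambda>t. t) (range (\<lambda>c t. c))"])
    fix f :: "real \<Rightarrow> real" and c x :: real assume f: "f \<in> insert (\<lambda>t. t) (range (\<lambda>c t. c))"
    then show "f differentiable at x" by auto
    show "dir_deriv c f \<in> insert (\<lambda>t. t) (range (\<lambda>c t. c))"
    proof (cases "f = (\<lambda>t. t)")
      case True then show ?thesis using idr by auto
    next
      case False
      then obtain e where "f = (\<lambda>t. e)" using f by auto
      then have "dir_deriv c f = (\<lambda>t. 0)"
        by (auto intro!: ext dir_deriv_eq[where f'="\<lambda>h. 0"])
      then show ?thesis by blast
    qed
  qed simp
  define X where "X x = b \<bullet> x" for x :: 'a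
  have X: "smooth X" using smooth_affine[OF id, of b 0] by (simp add: X_def[abs_def])
  have dX: "dir_deriv b X x = 1" for x
    using assms(2) by (subst dir_deriv_eq[where f'="\<lambda>h. b \<bullet> h"]) (auto simp: X_def[abs_def] intro!: derivative_eq_intros)
  have t1: "(\<lambda>x. \<phi> x * \<phi> x) \<in> test_functions \<Omega>"
    and t2: "(\<lambda>x. \<phi> x * (X x * dir_deriv b \<phi> x)) \<in> test_functions \<Omega>"
    and t3: "(\<lambda>x. X x * \<phi> x) \<in> test_functions \<Omega>"
    using test_functions_mult[OF assms(1) s] test_functions_mult[OF assms(1) smooth_mult[OF X test_functions_smooth[OF d]]]
      test_functions_mult[OF assms(1) X] by (auto simp: mult.commute)
  have "(LINT x|lborel. \<phi> x * dir_deriv b (\<lambda>x. X x * \<phi> x) x) = - (LINT x|lborel. dir_deriv b \<phi> x * (X x * \<phi> x))"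
    by (rule integral_by_parts[OF assms(1) smooth_mult[OF X s] assms(2)])
  also have "(\<lambda>x. \<phi> x * dir_deriv b (\<lambda>x. X x * \<phi> x) x) = (\<lambda>x. \<phi> x * \<phi> x + \<phi> x * (X x * dir_deriv b \<phi> x))"
    by (simp add: dir_deriv_mult[OF X s] dX algebra_simps)
  also have "(LINT x|lborel. \<phi> x * \<phi> x + \<phi> x * (X x * dir_deriv b \<phi> x))
      = (LINT x|lborel. \<phi> x * \<phi> x) + (LINT x|lborel. \<phi> x * (X x * dir_deriv b \<phi> x))"
    by (rule Bochner_Integration.integral_add[OF test_functions_integrable[OF t1] test_functions_integrable[OF t2]])
  finally have "(LINT x|lborel. \<phi> x * \<phi> x) = - 2 * (LINT x|lborel. \<phi> x * (X x * dir_deriv b \<phi> x))"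
    by (simp add: mult.commute mult.left_commute)
  then have "l2_inner \<Omega> \<phi> \<phi> = - 2 * l2_inner \<Omega> (\<lambda>x. X x * \<phi> x) (dir_deriv b \<phi>)"
    using integral_test_lborel(1)[OF t1] integral_test_lborel(1)[OF t2]
    by (simp add: l2_inner_def mult.commute mult.left_commute)
  also have "\<dots> \<le> 2 * (l2_norm \<Omega> (\<lambda>x. X x * \<phi> x) * l2_norm \<Omega> (dir_deriv b \<phi>))"
    using l2_cauchy_schwarz[OF test_functions_L2[OF t3] test_functions_L2[OF d]] by linarith
  also have "l2_norm \<Omega> (\<lambda>x. X x * \<phi> x) \<le> R * l2_norm \<Omega> \<phi>"
  proof -
    have "l2_norm \<Omega> (\<lambda>x. X x * \<phi> x) \<le> l2_norm \<Omega> (\<lambda>x. R *\<^sub>R \<phi> x)"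
      unfolding l2_norm_def
    proof (intro real_sqrt_le_mono integral_mono_AE)
      show "integrable (lebesgue_on \<Omega>) (\<lambda>x. (norm (X x * \<phi> x))\<^sup>2)"
        using test_functions_L2[OF t3] by (simp add: L2_def)
      show "integrable (lebesgue_on \<Omega>) (\<lambda>x. (norm (R *\<^sub>R \<phi> x))\<^sup>2)"
        using L2_scale[OF test_functions_L2[OF assms(1)], of R] by (simp add: L2_def)
      show "AE x in lebesgue_on \<Omega>. (norm (X x * \<phi> x))\<^sup>2 \<le> (norm (R *\<^sub>R \<phi> x))\<^sup>2"
      proof (rule AE_I2, simp only: space_lebesgue_on)
        fix x assume "x \<in> \<Omega>"
        have "\<bar>X x\<bar> \<le> norm b * norm x" unfolding X_def by (rule Cauchy_Schwarz_ineq2)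
        then have "\<bar>X x\<bar> \<le> R" using R(1)[OF \<open>x \<in> \<Omega>\<close>] assms(2) by simp
        then show "(norm (X x * \<phi> x))\<^sup>2 \<le> (norm (R *\<^sub>R \<phi> x))\<^sup>2"
          using R(2) by (intro power_mono) (auto simp: abs_mult intro: mult_right_mono)
      qed
    qed
    also have "\<dots> = R * l2_norm \<Omega> \<phi>" using R(2) seminormed.scale[OF seminormed_L2 test_functions_L2[OF assms(1)], of R] by simp
    finally show ?thesis .
  qed
  finally have le: "l2_norm \<Omega> \<phi> * l2_norm \<Omega> \<phi> \<le> (2 * R * l2_norm \<Omega> (dir_deriv b \<phi>)) * l2_norm \<Omega> \<phi>"
    using l2_norm_nonneg[of "dir_deriv b \<phi>"]
    by (simp add: l2_norm_sq[symmetric] power2_eq_square mult.assoc mult.commute mult.left_commute mult_right_mono mult_left_mono)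
  show ?thesis
  proof (cases "l2_norm \<Omega> \<phi> = 0")
    case True then show ?thesis using R(2) l2_norm_nonneg[of "dir_deriv b \<phi>"] by simp
  next
    case False
    then have "l2_norm \<Omega> \<phi> > 0" using l2_norm_nonneg[of \<phi>] by simp
    then show ?thesis using le by (rule mult_right_le_imp_le[rotated])
  qed
qed

end

locale sobolev_domain = open_domain \<Omega> for \<Omega> :: "(real^'n::finite) set"
begin

lemma axis_Basis: "axis i (1::real) \<in> (Basis :: (real^'n) set)"
  by (auto simp: Basis_vec_def)

lemma has_weak_partial_lincomb:
  assumes "has_weak_partial \<Omega> i f f'" "has_weak_partial \<Omega> i g g'"
  shows "has_weak_partial \<Omega> i (\<lambda>x. a * f x + b * g x) (\<lambda>x. a * f' x + b * g' x)"
proof -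
  have l: "locally_integrable \<Omega> f" "locally_integrable \<Omega> f'" "locally_integrable \<Omega> g" "locally_integrable \<Omega> g'"
    using assms by (auto simp: has_weak_partial_def)
  have "(LINT x|lebesgue_on \<Omega>. (a * f x + b * g x) * dir_deriv (axis i 1) \<phi> x)
      = - (LINT x|lebesgue_on \<Omega>. (a * f' x + b * g' x) * \<phi> x)" if \<phi>: "\<phi> \<in> test_functions \<Omega>" for \<phi>
  proof -
    note d = test_functions_dir_deriv[OF \<phi> axis_Basis[of i]]
    have "(LINT x|lebesgue_on \<Omega>. (a * f x + b * g x) * dir_deriv (axis i 1) \<phi> x)
      = a * (LINT x|lebesgue_on \<Omega>. f x * dir_deriv (axis i 1) \<phi> x) + b * (LINT x|lebesgue_on \<Omega>. g x * dir_deriv (axis i 1) \<phi> x)"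
      using locally_integrable_test[OF l(1) d] locally_integrable_test[OF l(3) d] by (simp add: distrib_right mult.assoc)
    also have "\<dots> = - (a * (LINT x|lebesgue_on \<Omega>. f' x * \<phi> x) + b * (LINT x|lebesgue_on \<Omega>. g' x * \<phi> x))"
      using assms \<phi> by (simp add: has_weak_partial_def)
    also have "\<dots> = - (LINT x|lebesgue_on \<Omega>. (a * f' x + b * g' x) * \<phi> x)"
      using locally_integrable_test[OF l(2) \<phi>] locally_integrable_test[OF l(4) \<phi>] by (simp add: distrib_right mult.assoc)
    finally show ?thesis .
  qed
  then show ?thesis using l by (simp add: has_weak_partial_def locally_integrable_lincomb)
qed

text \<open>The difference of two weak derivatives is orthogonal to all test functions.\<close>

lemma has_weak_partial_unique:
  assumes "has_weak_partial \<Omega> i f g" "has_weak_partial \<Omega> i f h"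
  shows "AE x in lebesgue_on \<Omega>. g x = h x"
proof -
  have "has_weak_partial \<Omega> i (\<lambda>x. 1 * f x + - 1 * f x) (\<lambda>x. 1 * g x + - 1 * h x)"
    by (rule has_weak_partial_lincomb[OF assms])
  then have "has_weak_partial \<Omega> i (\<lambda>x. 0) (\<lambda>x. g x - h x)" by simp
  then have "AE x in lebesgue_on \<Omega>. g x - h x = 0"
    by (intro fundamental_lemma_variations[OF open_domain]) (auto simp: has_weak_partial_def)
  then show ?thesis by simp
qed

text \<open>The representative chosen by the operator agrees with any weak derivative at hand.\<close>

lemma weak_partial_AE:
  assumes "has_weak_partial \<Omega> i f g"
  shows "has_weak_partial \<Omega> i f (weak_partial \<Omega> i f)" "AE x in lebesgue_on \<Omega>. weak_partial \<Omega> i f x = g x"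
proof -
  show 1: "has_weak_partial \<Omega> i f (weak_partial \<Omega> i f)"
    unfolding weak_partial_def using assms by (rule someI[of "has_weak_partial \<Omega> i f"])
  show "AE x in lebesgue_on \<Omega>. weak_partial \<Omega> i f x = g x"
    by (rule has_weak_partial_unique[OF 1 assms])
qed

text \<open>Integration by parts identifies the weak derivative of a test function with the classical one.\<close>

lemma has_weak_partial_test:
  assumes "\<phi> \<in> test_functions \<Omega>"
  shows "has_weak_partial \<Omega> i \<phi> (dir_deriv (axis i 1) \<phi>)"
proof -
  note d = test_functions_dir_deriv[OF assms axis_Basis[of i]]
  have "(LINT x|lebesgue_on \<Omega>. \<phi> x * dir_deriv (axis i 1) \<psi> x) = - (LINT x|lebesgue_on \<Omega>. dir_deriv (axis i 1) \<phi> x * \<psi> x)"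
    if \<psi>: "\<psi> \<in> test_functions \<Omega>" for \<psi>
    using integral_test_lborel(1)[OF test_functions_mult[OF assms smooth_dir_deriv[OF test_functions_smooth[OF \<psi>] axis_Basis]]]
      integral_test_lborel(1)[OF test_functions_mult[OF d test_functions_smooth[OF \<psi>]]]
      integral_by_parts[OF assms test_functions_smooth[OF \<psi>] axis_Basis]
    by simp
  then show ?thesis
    using L2_locally_integrable[OF test_functions_L2[OF assms]] L2_locally_integrable[OF test_functions_L2[OF d]]
    by (simp add: has_weak_partial_def)
qed

section \<open>Sobolev spaces\<close>

lemma H1_L2: "f \<in> H1 \<Omega> \<Longrightarrow> f \<in> L2 \<Omega>"
  by (simp add: H1_def)

lemma H1_weak_partial:
  assumes "f \<in> H1 \<Omega>"
  shows "has_weak_partial \<Omega> i f (weak_partial \<Omega> i f)" "weak_partial \<Omega> i f \<in> L2 \<Omega>"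
proof -
  obtain g where g: "g \<in> L2 \<Omega>" "has_weak_partial \<Omega> i f g"
    using assms by (auto simp: H1_def)
  show "has_weak_partial \<Omega> i f (weak_partial \<Omega> i f)" by (rule weak_partial_AE(1)[OF g(2)])
  have "AE x in lebesgue_on \<Omega>. g x = weak_partial \<Omega> i f x"
    using weak_partial_AE(2)[OF g(2)] by eventually_elim simp
  then show "weak_partial \<Omega> i f \<in> L2 \<Omega>" by (rule L2_AE[OF g(1)])
qed

lemma H1_lincomb:
  assumes "f \<in> H1 \<Omega>" "g \<in> H1 \<Omega>"
  shows "(\<lambda>x. a * f x + b * g x) \<in> H1 \<Omega>"
    and "AE x in lebesgue_on \<Omega>. weak_partial \<Omega> i (\<lambda>x. a * f x + b * g x) x = a * weak_partial \<Omega> i f x + b * weak_partial \<Omega> i g x"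
proof -
  note w = has_weak_partial_lincomb[OF H1_weak_partial(1)[OF assms(1)] H1_weak_partial(1)[OF assms(2)], of _ a b]
  have L: "(\<lambda>x. a * weak_partial \<Omega> i f x + b * weak_partial \<Omega> i g x) \<in> L2 \<Omega>" for i
    using L2_lincomb[OF H1_weak_partial(2)[OF assms(1)] H1_weak_partial(2)[OF assms(2)]] by simp
  have "(\<lambda>x. a * f x + b * g x) \<in> L2 \<Omega>"
    using L2_lincomb[OF H1_L2[OF assms(1)] H1_L2[OF assms(2)]] by simp
  then show "(\<lambda>x. a * f x + b * g x) \<in> H1 \<Omega>" unfolding H1_def using w L by blast
  show "AE x in lebesgue_on \<Omega>. weak_partial \<Omega> i (\<lambda>x. a * f x + b * g x) x = a * weak_partial \<Omega> i f x + b * weak_partial \<Omega> i g x"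
    by (rule weak_partial_AE(2)[OF w])
qed

lemma grad_L2: "f \<in> H1 \<Omega> \<Longrightarrow> grad \<Omega> f \<in> L2 \<Omega>"
  unfolding grad_def[abs_def] by (intro L2_vec H1_weak_partial)

lemma grad_lincomb:
  assumes "f \<in> H1 \<Omega>" "g \<in> H1 \<Omega>"
  shows "AE x in lebesgue_on \<Omega>. grad \<Omega> (\<lambda>x. a * f x + b * g x) x = a *\<^sub>R grad \<Omega> f x + b *\<^sub>R grad \<Omega> g x"
proof -
  have "AE x in lebesgue_on \<Omega>. \<forall>i\<in>UNIV. weak_partial \<Omega> i (\<lambda>x. a * f x + b * g x) x = a * weak_partial \<Omega> i f x + b * weak_partial \<Omega> i g x"
    by (rule AE_finite_allI) (auto intro: H1_lincomb(2)[OF assms])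
  then show ?thesis by eventually_elim (simp add: grad_def vec_eq_iff)
qed

lemma sqrt_sum_squares_mono: "0 \<le> a \<Longrightarrow> 0 \<le> b \<Longrightarrow> a \<le> c \<Longrightarrow> b \<le> d \<Longrightarrow> sqrt (a\<^sup>2 + b\<^sup>2) \<le> sqrt (c\<^sup>2 + d\<^sup>2)"
  by (intro real_sqrt_le_mono add_mono power_mono)

lemma h1_norm_triangle:
  assumes "f \<in> H1 \<Omega>" "g \<in> H1 \<Omega>"
  shows "h1_norm \<Omega> (\<lambda>x. f x + g x) \<le> h1_norm \<Omega> f + h1_norm \<Omega> g"
proof -
  have s: "(\<lambda>x. f x + g x) \<in> H1 \<Omega>" using H1_lincomb(1)[OF assms, of 1 1] by simp
  have "l2_norm \<Omega> (grad \<Omega> (\<lambda>x. f x + g x)) = l2_norm \<Omega> (\<lambda>x. grad \<Omega> f x + grad \<Omega> g x)"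
    by (rule l2_norm_cong[OF grad_L2[OF s]]) (use grad_lincomb[OF assms, of 1 1] in simp)
  also have "\<dots> \<le> l2_norm \<Omega> (grad \<Omega> f) + l2_norm \<Omega> (grad \<Omega> g)"
    by (rule seminormed.triangle[OF seminormed_L2 grad_L2[OF assms(1)] grad_L2[OF assms(2)]])
  finally have "h1_norm \<Omega> (\<lambda>x. f x + g x) \<le> sqrt ((l2_norm \<Omega> f + l2_norm \<Omega> g)\<^sup>2 + (l2_norm \<Omega> (grad \<Omega> f) + l2_norm \<Omega> (grad \<Omega> g))\<^sup>2)"
    unfolding h1_norm_def
    using seminormed.triangle[OF seminormed_L2 H1_L2[OF assms(1)] H1_L2[OF assms(2)]]
    by (intro sqrt_sum_squares_mono l2_norm_nonneg)
  also have "\<dots> \<le> h1_norm \<Omega> f + h1_norm \<Omega> g"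
    unfolding h1_norm_def by (rule real_sqrt_sum_squares_triangle_ineq)
  finally show ?thesis .
qed

lemma h1_norm_scale:
  assumes "f \<in> H1 \<Omega>"
  shows "h1_norm \<Omega> (\<lambda>x. a * f x) = \<bar>a\<bar> * h1_norm \<Omega> f"
proof -
  have s: "(\<lambda>x. a * f x) \<in> H1 \<Omega>" using H1_lincomb(1)[OF assms assms, of a 0] by simp
  have "l2_norm \<Omega> (grad \<Omega> (\<lambda>x. a * f x)) = l2_norm \<Omega> (\<lambda>x. a *\<^sub>R grad \<Omega> f x)"
    by (rule l2_norm_cong[OF grad_L2[OF s]]) (use grad_lincomb[OF assms assms, of a 0] in simp)
  also have "\<dots> = \<bar>a\<bar> * l2_norm \<Omega> (grad \<Omega> f)"
    by (rule seminormed.scale[OF seminormed_L2 grad_L2[OF assms]])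
  finally have g: "l2_norm \<Omega> (grad \<Omega> (\<lambda>x. a * f x)) = \<bar>a\<bar> * l2_norm \<Omega> (grad \<Omega> f)" .
  have f: "l2_norm \<Omega> (\<lambda>x. a * f x) = \<bar>a\<bar> * l2_norm \<Omega> f"
    using seminormed.scale[OF seminormed_L2 H1_L2[OF assms], of a] by simp
  have "h1_norm \<Omega> (\<lambda>x. a * f x) = sqrt (a\<^sup>2 * ((l2_norm \<Omega> f)\<^sup>2 + (l2_norm \<Omega> (grad \<Omega> f))\<^sup>2))"
    unfolding h1_norm_def f g by (simp add: power_mult_distrib distrib_left)
  then show ?thesis by (simp add: real_sqrt_mult h1_norm_def)
qed

lemma h1_norm_ge:
  shows "l2_norm \<Omega> f \<le> h1_norm \<Omega> f" "l2_norm \<Omega> (grad \<Omega> f) \<le> h1_norm \<Omega> f" "0 \<le> h1_norm \<Omega> f"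
  unfolding h1_norm_def by (auto intro!: real_le_rsqrt)

lemma weak_partial_le_h1_norm:
  assumes "f \<in> H1 \<Omega>"
  shows "l2_norm \<Omega> (weak_partial \<Omega> i f) \<le> h1_norm \<Omega> f"
  using l2_norm_nth[OF grad_L2[OF assms], of i] h1_norm_ge(2)[of f] by (simp add: grad_def)

lemma test_functions_H1: "\<phi> \<in> test_functions \<Omega> \<Longrightarrow> \<phi> \<in> H1 \<Omega>"
  unfolding H1_def using has_weak_partial_test test_functions_L2 test_functions_dir_deriv axis_Basis by blast

lemma H10_H1: "f \<in> H10 \<Omega> \<Longrightarrow> f \<in> H1 \<Omega>"
  by (simp add: H10_def)

lemma seminormed_H10: "seminormed (H10 \<Omega>) (h1_norm \<Omega>)"
proof
  have z: "(\<lambda>x. 0) \<in> test_functions \<Omega>"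
    by (rule test_functionsI[OF smooth_const compact_empty]) auto
  have "(\<lambda>x. 0 - 0 :: real) = (\<lambda>x::real^'n. 0 * 0)" by simp
  then have "h1_norm \<Omega> (\<lambda>x. 0 - 0) = 0" using h1_norm_scale[OF test_functions_H1[OF z], of 0] by simp
  then show "(\<lambda>x. 0) \<in> H10 \<Omega>"
    unfolding H10_def using z test_functions_H1[OF z] by (auto intro!: exI[of _ "\<lambda>n x. 0"])
  show "(\<lambda>x. a *\<^sub>R f x + b *\<^sub>R g x) \<in> H10 \<Omega>" if f: "f \<in> H10 \<Omega>" and g: "g \<in> H10 \<Omega>" for f g a b
  proof -
    obtain \<phi> where \<phi>: "\<And>n. \<phi> n \<in> test_functions \<Omega>" "(\<lambda>n::nat. h1_norm \<Omega> (\<lambda>x. f x - \<phi> n x)) \<longlonglongrightarrow> 0"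
      using f unfolding H10_def by blast
    obtain \<psi> where \<psi>: "\<And>n. \<psi> n \<in> test_functions \<Omega>" "(\<lambda>n::nat. h1_norm \<Omega> (\<lambda>x. g x - \<psi> n x)) \<longlonglongrightarrow> 0"
      using g unfolding H10_def by blast
    let ?\<chi> = "\<lambda>n x. a * \<phi> n x + b * \<psi> n x"
    have t: "?\<chi> n \<in> test_functions \<Omega>" for n
      by (intro test_functions_add test_functions_scale \<phi> \<psi>)
    have bound: "h1_norm \<Omega> (\<lambda>x. (a * f x + b * g x) - ?\<chi> n x)
        \<le> \<bar>a\<bar> * h1_norm \<Omega> (\<lambda>x. f x - \<phi> n x) + \<bar>b\<bar> * h1_norm \<Omega> (\<lambda>x. g x - \<psi> n x)" for n
    proof -
      have F: "(\<lambda>x. f x - \<phi> n x) \<in> H1 \<Omega>"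
        using H1_lincomb(1)[OF H10_H1[OF f] test_functions_H1[OF \<phi>(1)], of 1 "-1"] by simp
      have G: "(\<lambda>x. g x - \<psi> n x) \<in> H1 \<Omega>"
        using H1_lincomb(1)[OF H10_H1[OF g] test_functions_H1[OF \<psi>(1)], of 1 "-1"] by simp
      have aF: "(\<lambda>x. a * (f x - \<phi> n x)) \<in> H1 \<Omega>" and bG: "(\<lambda>x. b * (g x - \<psi> n x)) \<in> H1 \<Omega>"
        using H1_lincomb(1)[OF F F, of a 0] H1_lincomb(1)[OF G G, of b 0] by simp_all
      have "(\<lambda>x. (a * f x + b * g x) - ?\<chi> n x) = (\<lambda>x. a * (f x - \<phi> n x) + b * (g x - \<psi> n x))"
        by (simp add: algebra_simps)
      then show ?thesis
        using h1_norm_triangle[OF aF bG] h1_norm_scale[OF F, of a] h1_norm_scale[OF G, of b] by simp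
    qed
    have "(\<lambda>n. h1_norm \<Omega> (\<lambda>x. (a * f x + b * g x) - ?\<chi> n x)) \<longlonglongrightarrow> 0"
    proof (rule tendsto_sandwich[OF _ _ tendsto_const])
      show "(\<lambda>n. \<bar>a\<bar> * h1_norm \<Omega> (\<lambda>x. f x - \<phi> n x) + \<bar>b\<bar> * h1_norm \<Omega> (\<lambda>x. g x - \<psi> n x)) \<longlonglongrightarrow> 0"
        using tendsto_add[OF tendsto_mult_right[OF \<phi>(2), of "\<bar>a\<bar>"] tendsto_mult_right[OF \<psi>(2), of "\<bar>b\<bar>"]]
        by (simp add: mult.commute)
    qed (use bound h1_norm_ge(3) in auto)
    then show ?thesis
      unfolding H10_def using H1_lincomb(1)[OF H10_H1[OF f] H10_H1[OF g], of a b] t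
      by (auto intro!: exI[of _ ?\<chi>])
  qed
  show "h1_norm \<Omega> (\<lambda>x. f x + g x) \<le> h1_norm \<Omega> f + h1_norm \<Omega> g" if "f \<in> H10 \<Omega>" "g \<in> H10 \<Omega>" for f g
    using h1_norm_triangle that H10_H1 by blast
  show "h1_norm \<Omega> (\<lambda>x. a *\<^sub>R f x) = \<bar>a\<bar> * h1_norm \<Omega> f" if "f \<in> H10 \<Omega>" for f a
    using h1_norm_scale[OF H10_H1[OF that]] by simp
qed

text \<open>The approximating test functions have a small \<open>i\<close>-th derivative, hence a small norm by the
  Poincare inequality.\<close>

lemma H10_partial_zero:
  assumes "bounded \<Omega>" "f \<in> H10 \<Omega>" "AE x in lebesgue_on \<Omega>. weak_partial \<Omega> i f x = 0"
  shows "AE x in lebesgue_on \<Omega>. f x = 0"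
proof (rule l2_norm_eq_0)
  show L: "f \<in> L2 \<Omega>" using assms(2) H10_H1 H1_L2 by blast
  obtain R0 where "\<And>x. x \<in> \<Omega> \<Longrightarrow> norm x \<le> R0" using assms(1) bounded_iff by blast
  then have R: "\<And>x. x \<in> \<Omega> \<Longrightarrow> norm x \<le> max R0 0" "max R0 0 \<ge> 0" by (auto intro: max.coboundedI1)
  define R where "R = max R0 0"
  note R = R[folded R_def]
  obtain \<phi> where \<phi>: "\<And>n. \<phi> n \<in> test_functions \<Omega>" "(\<lambda>n::nat. h1_norm \<Omega> (\<lambda>x. f x - \<phi> n x)) \<longlonglongrightarrow> 0"
    using assms(2) unfolding H10_def by blast
  have "l2_norm \<Omega> f \<le> (1 + 2 * R) * h1_norm \<Omega> (\<lambda>x. f x - \<phi> n x)" for n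
  proof -
    note d = test_functions_dir_deriv[OF \<phi>(1)[of n] axis_Basis[of i]]
    have F: "(\<lambda>x. f x - \<phi> n x) \<in> H1 \<Omega>"
      using H1_lincomb(1)[OF H10_H1[OF assms(2)] test_functions_H1[OF \<phi>(1)[of n]], of 1 "-1"] by simp
    have "AE x in lebesgue_on \<Omega>. weak_partial \<Omega> i (\<lambda>x. f x - \<phi> n x) x = (-1) *\<^sub>R dir_deriv (axis i 1) (\<phi> n) x"
      using H1_lincomb(2)[OF H10_H1[OF assms(2)] test_functions_H1[OF \<phi>(1)[of n]], of i 1 "-1"] assms(3)
        weak_partial_AE(2)[OF has_weak_partial_test[OF \<phi>(1)[of n], of i]]
      by eventually_elim simp
    then have "l2_norm \<Omega> (weak_partial \<Omega> i (\<lambda>x. f x - \<phi> n x)) = l2_norm \<Omega> (\<lambda>x. (-1) *\<^sub>R dir_deriv (axis i 1) (\<phi> n) x)"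
      by (rule l2_norm_cong[OF H1_weak_partial(2)[OF F]])
    also have "\<dots> = l2_norm \<Omega> (dir_deriv (axis i 1) (\<phi> n))"
      using seminormed.scale[OF seminormed_L2 test_functions_L2[OF d], of "-1"] by simp
    finally have D: "l2_norm \<Omega> (dir_deriv (axis i 1) (\<phi> n)) \<le> h1_norm \<Omega> (\<lambda>x. f x - \<phi> n x)"
      using weak_partial_le_h1_norm[OF F, of i] by simp
    have "l2_norm \<Omega> f \<le> l2_norm \<Omega> (\<lambda>x. f x - \<phi> n x) + l2_norm \<Omega> (\<phi> n)"
      using seminormed.triangle[OF seminormed_L2 H1_L2[OF F] test_functions_L2[OF \<phi>(1)[of n]]] by simp
    also have "l2_norm \<Omega> (\<phi> n) \<le> 2 * R * l2_norm \<Omega> (dir_deriv (axis i 1) (\<phi> n))"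
      by (rule poincare_test_functions[OF \<phi>(1) axis_Basis R])
    also have "\<dots> \<le> 2 * R * h1_norm \<Omega> (\<lambda>x. f x - \<phi> n x)"
      using D R(2) by (intro mult_left_mono) auto
    finally show ?thesis
      using h1_norm_ge(1)[of "\<lambda>x. f x - \<phi> n x"] by (simp add: algebra_simps)
  qed
  moreover have "(\<lambda>n. (1 + 2 * R) * h1_norm \<Omega> (\<lambda>x. f x - \<phi> n x)) \<longlonglongrightarrow> 0"
    using tendsto_mult_right[OF \<phi>(2), of "1 + 2 * R"] by (simp add: mult.commute)
  ultimately have "l2_norm \<Omega> f \<le> 0" using LIMSEQ_le_const[of _ 0 "l2_norm \<Omega> f"] by blast
  then show "l2_norm \<Omega> f = 0" using l2_norm_nonneg[of f] by simp
qed

end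

section \<open>Essentially bounded functions\<close>

context open_domain
begin

lemma Linf_measurable: "f \<in> Linf \<Omega> \<Longrightarrow> f \<in> borel_measurable (lebesgue_on \<Omega>)"
  by (simp add: Linf_def)

lemma linf_norm_AE:
  assumes "f \<in> Linf \<Omega>"
  shows "AE x in lebesgue_on \<Omega>. norm (f x) \<le> linf_norm \<Omega> f"
proof -
  let ?e = "esssup (lebesgue_on \<Omega>) (\<lambda>x. ereal (norm (f x)))"
  have "AE x in lebesgue_on \<Omega>. ereal (norm (f x)) \<le> ?e" by (rule esssup_AE)
  then show ?thesis unfolding linf_norm_def
  proof eventually_elim
    case (elim x)
    then show ?case using assms by (cases ?e) (auto simp: Linf_def)
  qed
qed

text \<open>On the empty domain the essential supremum is \<open>-\<infinity>\<close>, whose real part is \<open>0\<close>; this is why the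
  upper bound \<open>C\<close> below has to be nonnegative.\<close>

lemma LinfI:
  assumes "f \<in> borel_measurable (lebesgue_on \<Omega>)" "AE x in lebesgue_on \<Omega>. norm (f x) \<le> C" "C \<ge> 0"
  shows "f \<in> Linf \<Omega>" "linf_norm \<Omega> f \<le> C"
proof -
  let ?e = "esssup (lebesgue_on \<Omega>) (\<lambda>x. ereal (norm (f x)))"
  have e: "?e \<le> ereal C"
    using assms by (intro esssup_I) auto
  then show "f \<in> Linf \<Omega>" using assms(1) by (auto simp: Linf_def intro: le_less_trans)
  show "linf_norm \<Omega> f \<le> C" unfolding linf_norm_def using e assms(3) by (cases ?e) auto
qed

lemma linf_norm_nonneg:
  assumes "f \<in> Linf \<Omega>"
  shows "0 \<le> linf_norm \<Omega> f"
proof (rule ccontr)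
  assume neg: "\<not> 0 \<le> linf_norm \<Omega> f"
  have "AE x in lebesgue_on \<Omega>. False"
    using linf_norm_AE[OF assms] by eventually_elim (use neg in \<open>smt (verit) norm_ge_zero\<close>)
  then have "negligible \<Omega>" by (simp add: AE_lebesgue_on_negligible[OF domain_sets])
  then have "\<Omega> = {}" using open_not_negligible[OF open_domain] by blast
  then have "emeasure (lebesgue_on \<Omega>) (space (lebesgue_on \<Omega>)) = 0" by simp
  then have "esssup (lebesgue_on \<Omega>) (\<lambda>x. ereal (norm (f x))) = - \<infinity>"
    by (rule esssup_zero_space) (use Linf_measurable[OF assms] in measurable)
  then show False using neg by (simp add: linf_norm_def)
qed

lemma Linf_lincomb:
  assumes "f \<in> Linf \<Omega>" "g \<in> Linf \<Omega>"
  shows "(\<lambda>x. a *\<^sub>R f x + b *\<^sub>R g x) \<in> Linf \<Omega>"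
    and "linf_norm \<Omega> (\<lambda>x. a *\<^sub>R f x + b *\<^sub>R g x) \<le> \<bar>a\<bar> * linf_norm \<Omega> f + \<bar>b\<bar> * linf_norm \<Omega> g"
proof -
  have m: "(\<lambda>x. a *\<^sub>R f x + b *\<^sub>R g x) \<in> borel_measurable (lebesgue_on \<Omega>)"
    using Linf_measurable[OF assms(1)] Linf_measurable[OF assms(2)] by measurable
  have b: "AE x in lebesgue_on \<Omega>. norm (a *\<^sub>R f x + b *\<^sub>R g x) \<le> \<bar>a\<bar> * linf_norm \<Omega> f + \<bar>b\<bar> * linf_norm \<Omega> g"
    using linf_norm_AE[OF assms(1)] linf_norm_AE[OF assms(2)]
  proof eventually_elim
    case (elim x)
    have "norm (a *\<^sub>R f x + b *\<^sub>R g x) \<le> \<bar>a\<bar> * norm (f x) + \<bar>b\<bar> * norm (g x)"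
      using norm_triangle_ineq[of "a *\<^sub>R f x" "b *\<^sub>R g x"] by simp
    also have "\<dots> \<le> \<bar>a\<bar> * linf_norm \<Omega> f + \<bar>b\<bar> * linf_norm \<Omega> g"
      by (intro add_mono mult_left_mono elim) auto
    finally show ?case .
  qed
  have c: "0 \<le> \<bar>a\<bar> * linf_norm \<Omega> f + \<bar>b\<bar> * linf_norm \<Omega> g"
    using linf_norm_nonneg assms by (intro add_nonneg_nonneg mult_nonneg_nonneg) auto
  show "(\<lambda>x. a *\<^sub>R f x + b *\<^sub>R g x) \<in> Linf \<Omega>"
    "linf_norm \<Omega> (\<lambda>x. a *\<^sub>R f x + b *\<^sub>R g x) \<le> \<bar>a\<bar> * linf_norm \<Omega> f + \<bar>b\<bar> * linf_norm \<Omega> g"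
    using LinfI[OF m b c] by auto
qed

lemma Linf_AE:
  assumes "f \<in> Linf \<Omega>" "AE x in lebesgue_on \<Omega>. f x = g x"
  shows "g \<in> Linf \<Omega>" "linf_norm \<Omega> g = linf_norm \<Omega> f"
proof -
  have le: "g \<in> Linf \<Omega> \<and> linf_norm \<Omega> g \<le> linf_norm \<Omega> f"
    if "f \<in> Linf \<Omega>" "AE x in lebesgue_on \<Omega>. f x = g x" for f g :: "'a \<Rightarrow> 'b"
  proof -
    have "AE x in lebesgue_on \<Omega>. norm (g x) \<le> linf_norm \<Omega> f"
      using linf_norm_AE[OF that(1)] that(2) by eventually_elim simp
    then show ?thesis
      using LinfI[OF measurable_AE_eq[OF Linf_measurable[OF that(1)] that(2)]] linf_norm_nonneg[OF that(1)] by blast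
  qed
  show g: "g \<in> Linf \<Omega>" using le[OF assms] by blast
  have "AE x in lebesgue_on \<Omega>. g x = f x" using assms(2) by eventually_elim simp
  then show "linf_norm \<Omega> g = linf_norm \<Omega> f" using le[OF assms] le[OF g] by force
qed

lemma linf_norm_scale:
  assumes "f \<in> Linf \<Omega>"
  shows "linf_norm \<Omega> (\<lambda>x. a *\<^sub>R f x) = \<bar>a\<bar> * linf_norm \<Omega> f"
proof -
  have le: "linf_norm \<Omega> (\<lambda>x. a *\<^sub>R f x) \<le> \<bar>a\<bar> * linf_norm \<Omega> f" if "f \<in> Linf \<Omega>" for a and f :: "'a \<Rightarrow> 'b"
    using Linf_lincomb(2)[OF that that, of a 0] by simp
  have af: "(\<lambda>x. a *\<^sub>R f x) \<in> Linf \<Omega>" using Linf_lincomb(1)[OF assms assms, of a 0] by simp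
  show ?thesis
  proof (cases "a = 0")
    case True
    then show ?thesis using le[OF assms, of a] linf_norm_nonneg[OF af] by simp
  next
    case False
    have "linf_norm \<Omega> f \<le> \<bar>1 / a\<bar> * linf_norm \<Omega> (\<lambda>x. a *\<^sub>R f x)"
      using le[OF af, of "1 / a"] False by simp
    then have "\<bar>a\<bar> * linf_norm \<Omega> f \<le> linf_norm \<Omega> (\<lambda>x. a *\<^sub>R f x)"
      using False by (simp add: field_simps)
    then show ?thesis using le[OF assms, of a] by simp
  qed
qed

lemma Linf_vec:
  fixes f :: "'n::finite \<Rightarrow> 'a \<Rightarrow> real"
  assumes "\<And>i. f i \<in> Linf \<Omega>"
  shows "(\<lambda>x. \<chi> i. f i x) \<in> Linf \<Omega>"
proof (rule LinfI(1))
  show "(\<lambda>x. \<chi> i. f i x) \<in> borel_measurable (lebesgue_on \<Omega>)"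
    using assms by (intro borel_measurable_vec Linf_measurable)
  have "AE x in lebesgue_on \<Omega>. \<forall>i\<in>UNIV. norm (f i x) \<le> linf_norm \<Omega> (f i)"
    by (rule AE_finite_allI) (auto intro: linf_norm_AE assms simp del: real_norm_def)
  then show "AE x in lebesgue_on \<Omega>. norm (\<chi> i. f i x) \<le> (\<Sum>i\<in>UNIV. linf_norm \<Omega> (f i))"
  proof eventually_elim
    case (elim x)
    have "norm (\<chi> i. f i x) \<le> (\<Sum>i\<in>UNIV. \<bar>(\<chi> i. f i x) $ i\<bar>)" by (rule norm_le_l1_cart)
    also have "\<dots> \<le> (\<Sum>i\<in>UNIV. linf_norm \<Omega> (f i))" using elim by (intro sum_mono) simp
    finally show ?case .
  qed
  show "0 \<le> (\<Sum>i\<in>UNIV. linf_norm \<Omega> (f i))" using linf_norm_nonneg[OF assms] by (rule sum_nonneg)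
qed

end

context sobolev_domain
begin

lemma W1inf_weak_partial:
  assumes "f \<in> W1inf \<Omega>"
  shows "f \<in> Linf \<Omega>" "has_weak_partial \<Omega> i f (weak_partial \<Omega> i f)" "weak_partial \<Omega> i f \<in> Linf \<Omega>" "grad \<Omega> f \<in> Linf \<Omega>"
proof -
  have *: "has_weak_partial \<Omega> i f (weak_partial \<Omega> i f) \<and> weak_partial \<Omega> i f \<in> Linf \<Omega>" for i
  proof -
    obtain g where g: "g \<in> Linf \<Omega>" "has_weak_partial \<Omega> i f g"
      using assms by (auto simp: W1inf_def)
    have "AE x in lebesgue_on \<Omega>. g x = weak_partial \<Omega> i f x"
      using weak_partial_AE(2)[OF g(2)] by eventually_elim simp
    then show ?thesis using Linf_AE(1)[OF g(1)] weak_partial_AE(1)[OF g(2)] by blast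
  qed
  then show "has_weak_partial \<Omega> i f (weak_partial \<Omega> i f)" "weak_partial \<Omega> i f \<in> Linf \<Omega>" by auto
  show "f \<in> Linf \<Omega>" using assms by (simp add: W1inf_def)
  show "grad \<Omega> f \<in> Linf \<Omega>" unfolding grad_def[abs_def] using * by (intro Linf_vec) blast
qed

lemma W1inf_lincomb:
  assumes "f \<in> W1inf \<Omega>" "g \<in> W1inf \<Omega>"
  shows "(\<lambda>x. a * f x + b * g x) \<in> W1inf \<Omega>"
    and "AE x in lebesgue_on \<Omega>. a *\<^sub>R grad \<Omega> f x + b *\<^sub>R grad \<Omega> g x = grad \<Omega> (\<lambda>x. a * f x + b * g x) x"
proof -
  note w = has_weak_partial_lincomb[OF W1inf_weak_partial(2)[OF assms(1)] W1inf_weak_partial(2)[OF assms(2)], of _ a b]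
  have L: "(\<lambda>x. a * weak_partial \<Omega> i f x + b * weak_partial \<Omega> i g x) \<in> Linf \<Omega>" for i
    using Linf_lincomb(1)[OF W1inf_weak_partial(3)[OF assms(1)] W1inf_weak_partial(3)[OF assms(2)]] by simp
  have "(\<lambda>x. a * f x + b * g x) \<in> Linf \<Omega>"
    using Linf_lincomb(1)[OF W1inf_weak_partial(1)[OF assms(1)] W1inf_weak_partial(1)[OF assms(2)]] by simp
  then show "(\<lambda>x. a * f x + b * g x) \<in> W1inf \<Omega>" unfolding W1inf_def using w L by blast
  have "AE x in lebesgue_on \<Omega>. \<forall>i\<in>UNIV. weak_partial \<Omega> i (\<lambda>x. a * f x + b * g x) x = a * weak_partial \<Omega> i f x + b * weak_partial \<Omega> i g x"
    by (rule AE_finite_allI) (auto intro: weak_partial_AE(2)[OF w])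
  then show "AE x in lebesgue_on \<Omega>. a *\<^sub>R grad \<Omega> f x + b *\<^sub>R grad \<Omega> g x = grad \<Omega> (\<lambda>x. a * f x + b * g x) x"
    by eventually_elim (simp add: grad_def vec_eq_iff)
qed

lemma seminormed_W1inf: "seminormed (W1inf \<Omega>) (w1inf_norm \<Omega>)"
proof
  have z: "(\<lambda>x::real^'n. 0) \<in> Linf \<Omega>" by (rule LinfI(1)[of _ 0]) auto
  have "(\<lambda>x. 0) \<in> test_functions \<Omega>"
    by (rule test_functionsI[OF smooth_const compact_empty]) auto
  moreover have "dir_deriv b (\<lambda>x::real^'n. 0) = (\<lambda>x. 0)" for b
    by (rule ext, rule dir_deriv_eq[where f'="\<lambda>x. 0"]) auto
  ultimately show "(\<lambda>x. 0) \<in> W1inf \<Omega>"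
    unfolding W1inf_def using z has_weak_partial_test[of "\<lambda>x. 0"] by fastforce
  show "(\<lambda>x. a *\<^sub>R f x + b *\<^sub>R g x) \<in> W1inf \<Omega>" if "f \<in> W1inf \<Omega>" "g \<in> W1inf \<Omega>" for f g a b
    using W1inf_lincomb(1)[OF that] by simp
  show "w1inf_norm \<Omega> (\<lambda>x. f x + g x) \<le> w1inf_norm \<Omega> f + w1inf_norm \<Omega> g"
    if fg: "f \<in> W1inf \<Omega>" "g \<in> W1inf \<Omega>" for f g
  proof -
    note w = W1inf_weak_partial(1)[OF fg(1)] W1inf_weak_partial(1)[OF fg(2)]
    note v = W1inf_weak_partial(4)[OF fg(1)] W1inf_weak_partial(4)[OF fg(2)]
    have "linf_norm \<Omega> (grad \<Omega> (\<lambda>x. f x + g x)) \<le> linf_norm \<Omega> (grad \<Omega> f) + linf_norm \<Omega> (grad \<Omega> g)"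
      using Linf_AE(2)[OF Linf_lincomb(1)[OF v, of 1 1] W1inf_lincomb(2)[OF fg, of 1 1]] Linf_lincomb(2)[OF v, of 1 1]
      by simp
    moreover have "linf_norm \<Omega> (\<lambda>x. f x + g x) \<le> linf_norm \<Omega> f + linf_norm \<Omega> g"
      using Linf_lincomb(2)[OF w, of 1 1] by simp
    ultimately show ?thesis unfolding w1inf_norm_def by linarith
  qed
  show "w1inf_norm \<Omega> (\<lambda>x. a *\<^sub>R f x) = \<bar>a\<bar> * w1inf_norm \<Omega> f" if f: "f \<in> W1inf \<Omega>" for f a
  proof -
    note v = W1inf_weak_partial(4)[OF f]
    have "linf_norm \<Omega> (grad \<Omega> (\<lambda>x. a *\<^sub>R f x)) = \<bar>a\<bar> * linf_norm \<Omega> (grad \<Omega> f)"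
      using Linf_AE(2)[OF Linf_lincomb(1)[OF v v, of a 0] W1inf_lincomb(2)[OF f f, of a 0]] linf_norm_scale[OF v, of a]
      by simp
    then show ?thesis
      using linf_norm_scale[OF W1inf_weak_partial(1)[OF f], of a]
      by (simp add: w1inf_norm_def max_mult_distrib_left)
  qed
qed

section \<open>Vector fields and the elastic form\<close>

lemma vH10_nth: "u \<in> vH10 \<Omega> \<Longrightarrow> (\<lambda>x. u x $ i) \<in> H10 \<Omega>"
  by (simp add: vH10_def)

lemma vH10_L2:
  assumes "u \<in> vH10 \<Omega>"
  shows "u \<in> L2 \<Omega>"
  using L2_vec[of "\<lambda>i x. u x $ i"] H1_L2[OF H10_H1[OF vH10_nth[OF assms]]] by simp

lemma vgrad_L2: "u \<in> vH10 \<Omega> \<Longrightarrow> vgrad \<Omega> u \<in> L2 \<Omega>"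
  unfolding vgrad_def[abs_def] by (intro L2_vec H1_weak_partial H10_H1 vH10_nth)

lemma vH10_lincomb:
  assumes "u \<in> vH10 \<Omega>" "v \<in> vH10 \<Omega>"
  shows "(\<lambda>x. a *\<^sub>R u x + b *\<^sub>R v x) \<in> vH10 \<Omega>"
  unfolding vH10_def
  using seminormed.lincomb_mem[OF seminormed_H10 vH10_nth[OF assms(1)] vH10_nth[OF assms(2)]] by simp

lemma vgrad_lincomb:
  assumes "u \<in> vH10 \<Omega>" "v \<in> vH10 \<Omega>"
  shows "AE x in lebesgue_on \<Omega>. vgrad \<Omega> (\<lambda>x. a *\<^sub>R u x + b *\<^sub>R v x) x = a *\<^sub>R vgrad \<Omega> u x + b *\<^sub>R vgrad \<Omega> v x"
proof -
  have "AE x in lebesgue_on \<Omega>. \<forall>i\<in>UNIV. \<forall>j\<in>UNIV. weak_partial \<Omega> j (\<lambda>x. a * u x $ i + b * v x $ i) x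
      = a * weak_partial \<Omega> j (\<lambda>x. u x $ i) x + b * weak_partial \<Omega> j (\<lambda>x. v x $ i) x"
    by (intro AE_finite_allI) (auto intro: H1_lincomb(2)[OF H10_H1[OF vH10_nth[OF assms(1)]] H10_H1[OF vH10_nth[OF assms(2)]]])
  then show ?thesis by eventually_elim (simp add: vgrad_def vec_eq_iff)
qed

lemma divg_eq_trace: "divg \<Omega> u x = (\<Sum>i\<in>UNIV. vgrad \<Omega> u x $ i $ i)"
  by (simp add: divg_def vgrad_def)

lemma L2_sum:
  assumes "\<And>i. i \<in> I \<Longrightarrow> f i \<in> L2 \<Omega>"
  shows "(\<lambda>x. \<Sum>i\<in>I. f i x) \<in> L2 \<Omega>" "l2_norm \<Omega> (\<lambda>x. \<Sum>i\<in>I. f i x) \<le> (\<Sum>i\<in>I. l2_norm \<Omega> (f i))"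
  using assms
proof (induction I rule: infinite_finite_induct)
  case (insert i I)
  { case 1 then show ?case using insert seminormed.add_mem[OF seminormed_L2, of "f i" "\<lambda>x. \<Sum>i\<in>I. f i x"] by simp }
  { case 2 then show ?case using insert seminormed.triangle[OF seminormed_L2, of "f i" "\<lambda>x. \<Sum>i\<in>I. f i x"] by fastforce }
qed (auto simp: L2_def l2_norm_def)

lemma divg_L2:
  assumes "u \<in> vH10 \<Omega>"
  shows "divg \<Omega> u \<in> L2 \<Omega>"
  unfolding divg_def[abs_def] by (intro L2_sum H1_weak_partial H10_H1 vH10_nth assms)

lemma divg_lincomb:
  assumes "u \<in> vH10 \<Omega>" "v \<in> vH10 \<Omega>"
  shows "AE x in lebesgue_on \<Omega>. divg \<Omega> (\<lambda>x. a *\<^sub>R u x + b *\<^sub>R v x) x = a *\<^sub>R divg \<Omega> u x + b *\<^sub>R divg \<Omega> v x"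
  using vgrad_lincomb[OF assms, of a b]
  by eventually_elim (simp add: divg_eq_trace sum.distrib sum_distrib_left)

lemma vh1_norm_ge:
  shows "l2_norm \<Omega> u \<le> vh1_norm \<Omega> u" "l2_norm \<Omega> (vgrad \<Omega> u) \<le> vh1_norm \<Omega> u" "0 \<le> vh1_norm \<Omega> u"
  unfolding vh1_norm_def by (auto intro!: real_le_rsqrt)

lemma divg_bound:
  assumes "u \<in> vH10 \<Omega>"
  shows "l2_norm \<Omega> (divg \<Omega> u) \<le> real CARD('n) * vh1_norm \<Omega> u"
proof -
  have w: "(\<lambda>x. vgrad \<Omega> u x $ i $ j) \<in> L2 \<Omega>" for i j
    using l2_inner_vec(1)[OF l2_inner_vec(1)[OF vgrad_L2[OF assms] vgrad_L2[OF assms]] l2_inner_vec(1)[OF vgrad_L2[OF assms] vgrad_L2[OF assms]]] .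
  have "divg \<Omega> u = (\<lambda>x. \<Sum>i\<in>UNIV. vgrad \<Omega> u x $ i $ i)" by (rule ext) (rule divg_eq_trace)
  then have "l2_norm \<Omega> (divg \<Omega> u) \<le> (\<Sum>i\<in>UNIV. l2_norm \<Omega> (\<lambda>x. vgrad \<Omega> u x $ i $ i))"
    using L2_sum(2)[of UNIV "\<lambda>i x. vgrad \<Omega> u x $ i $ i"] w by simp
  also have "\<dots> \<le> (\<Sum>i\<in>(UNIV::'n set). vh1_norm \<Omega> u)"
  proof (rule sum_mono)
    fix i
    have "l2_norm \<Omega> (\<lambda>x. vgrad \<Omega> u x $ i $ i) \<le> l2_norm \<Omega> (\<lambda>x. vgrad \<Omega> u x $ i)"
      by (rule l2_norm_nth[OF l2_inner_vec(1)[OF vgrad_L2[OF assms] vgrad_L2[OF assms]]])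
    also have "\<dots> \<le> l2_norm \<Omega> (vgrad \<Omega> u)" by (rule l2_norm_nth[OF vgrad_L2[OF assms]])
    also have "\<dots> \<le> vh1_norm \<Omega> u" by (rule vh1_norm_ge)
    finally show "l2_norm \<Omega> (\<lambda>x. vgrad \<Omega> u x $ i $ i) \<le> vh1_norm \<Omega> u" .
  qed
  finally show ?thesis by simp
qed

lemma seminormed_vH10: "seminormed (vH10 \<Omega>) (vh1_norm \<Omega>)"
proof
  show "(\<lambda>x. 0) \<in> vH10 \<Omega>" unfolding vH10_def using seminormed.zero_mem[OF seminormed_H10] by simp
  show "(\<lambda>x. a *\<^sub>R u x + b *\<^sub>R v x) \<in> vH10 \<Omega>" if "u \<in> vH10 \<Omega>" "v \<in> vH10 \<Omega>" for u v a b
    by (rule vH10_lincomb[OF that])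
  show "vh1_norm \<Omega> (\<lambda>x. u x + v x) \<le> vh1_norm \<Omega> u + vh1_norm \<Omega> v" if uv: "u \<in> vH10 \<Omega>" "v \<in> vH10 \<Omega>" for u v
  proof -
    have s: "(\<lambda>x. u x + v x) \<in> vH10 \<Omega>" using vH10_lincomb[OF uv, of 1 1] by simp
    have "l2_norm \<Omega> (vgrad \<Omega> (\<lambda>x. u x + v x)) = l2_norm \<Omega> (\<lambda>x. vgrad \<Omega> u x + vgrad \<Omega> v x)"
      by (rule l2_norm_cong[OF vgrad_L2[OF s]]) (use vgrad_lincomb[OF uv, of 1 1] in simp)
    also have "\<dots> \<le> l2_norm \<Omega> (vgrad \<Omega> u) + l2_norm \<Omega> (vgrad \<Omega> v)"
      by (rule seminormed.triangle[OF seminormed_L2 vgrad_L2[OF uv(1)] vgrad_L2[OF uv(2)]])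
    finally have "vh1_norm \<Omega> (\<lambda>x. u x + v x) \<le> sqrt ((l2_norm \<Omega> u + l2_norm \<Omega> v)\<^sup>2 + (l2_norm \<Omega> (vgrad \<Omega> u) + l2_norm \<Omega> (vgrad \<Omega> v))\<^sup>2)"
      unfolding vh1_norm_def
      using seminormed.triangle[OF seminormed_L2 vH10_L2[OF uv(1)] vH10_L2[OF uv(2)]]
      by (intro sqrt_sum_squares_mono l2_norm_nonneg)
    also have "\<dots> \<le> vh1_norm \<Omega> u + vh1_norm \<Omega> v"
      unfolding vh1_norm_def by (rule real_sqrt_sum_squares_triangle_ineq)
    finally show ?thesis .
  qed
  show "vh1_norm \<Omega> (\<lambda>x. a *\<^sub>R u x) = \<bar>a\<bar> * vh1_norm \<Omega> u" if u: "u \<in> vH10 \<Omega>" for u a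
  proof -
    have s: "(\<lambda>x. a *\<^sub>R u x) \<in> vH10 \<Omega>" using vH10_lincomb[OF u u, of a 0] by simp
    have "l2_norm \<Omega> (vgrad \<Omega> (\<lambda>x. a *\<^sub>R u x)) = l2_norm \<Omega> (\<lambda>x. a *\<^sub>R vgrad \<Omega> u x)"
      by (rule l2_norm_cong[OF vgrad_L2[OF s]]) (use vgrad_lincomb[OF u u, of a 0] in simp)
    also have "\<dots> = \<bar>a\<bar> * l2_norm \<Omega> (vgrad \<Omega> u)"
      by (rule seminormed.scale[OF seminormed_L2 vgrad_L2[OF u]])
    finally have g: "l2_norm \<Omega> (vgrad \<Omega> (\<lambda>x. a *\<^sub>R u x)) = \<bar>a\<bar> * l2_norm \<Omega> (vgrad \<Omega> u)" .
    have f: "l2_norm \<Omega> (\<lambda>x. a *\<^sub>R u x) = \<bar>a\<bar> * l2_norm \<Omega> u"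
      by (rule seminormed.scale[OF seminormed_L2 vH10_L2[OF u]])
    have "vh1_norm \<Omega> (\<lambda>x. a *\<^sub>R u x) = sqrt (a\<^sup>2 * ((l2_norm \<Omega> u)\<^sup>2 + (l2_norm \<Omega> (vgrad \<Omega> u))\<^sup>2))"
      unfolding vh1_norm_def f g by (simp add: power_mult_distrib distrib_left)
    then show ?thesis by (simp add: real_sqrt_mult vh1_norm_def)
  qed
qed

lemma inner_transpose: "transpose A \<bullet> transpose B = A \<bullet> (B :: real^'n^'n)"
  unfolding inner_vec_def transpose_def by simp (rule sum.swap)

lemma norm_transpose: "norm (transpose A) = norm (A :: real^'n^'n)"
  by (simp add: norm_eq_sqrt_inner inner_transpose)

lemma L2_transpose:
  assumes "M \<in> L2 \<Omega>"
  shows "(\<lambda>x. transpose (M x :: real^'n^'n)) \<in> L2 \<Omega>" "l2_norm \<Omega> (\<lambda>x. transpose (M x)) = l2_norm \<Omega> M"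
proof -
  have "(\<lambda>x. M x $ j $ i) \<in> L2 \<Omega>" for i j
    by (rule l2_inner_vec(1)[OF l2_inner_vec(1)[OF assms assms] l2_inner_vec(1)[OF assms assms]])
  then show "(\<lambda>x. transpose (M x)) \<in> L2 \<Omega>"
    unfolding transpose_def by (intro L2_vec)
  show "l2_norm \<Omega> (\<lambda>x. transpose (M x)) = l2_norm \<Omega> M" by (simp add: l2_norm_def norm_transpose)
qed

end

locale poro_domain = sobolev_domain \<Omega> for \<Omega> :: "(real^3) set" +
  assumes bounded_domain: "bounded \<Omega>"
begin

lemma e_form_commute: "e_form \<Omega> u w = e_form \<Omega> w u"
proof -
  have "A \<bullet> transpose B = B \<bullet> transpose A" for A B :: "real^3^3"
    using inner_transpose[of A "transpose B"] by (simp add: inner_commute)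
  then show ?thesis
    unfolding e_form_def by (simp add: l2_inner_commute[of "divg \<Omega> u"] l2_inner_commute[of "vgrad \<Omega> u" "vgrad \<Omega> w"])
      (simp add: l2_inner_def)
qed

lemma e_form_lincomb:
  assumes "u \<in> vH10 \<Omega>" "v \<in> vH10 \<Omega>" "w \<in> vH10 \<Omega>"
  shows "e_form \<Omega> (\<lambda>x. a *\<^sub>R u x + b *\<^sub>R v x) w = a * e_form \<Omega> u w + b * e_form \<Omega> v w"
proof -
  note s = vH10_lincomb[OF assms(1,2), of a b]
  have D: "l2_inner \<Omega> (divg \<Omega> (\<lambda>x. a *\<^sub>R u x + b *\<^sub>R v x)) h = a * l2_inner \<Omega> (divg \<Omega> u) h + b * l2_inner \<Omega> (divg \<Omega> v) h"
    if "h \<in> L2 \<Omega>" for h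
    using l2_inner_cong[OF divg_L2[OF s] that divg_lincomb[OF assms(1,2)] AE_I2[OF refl]]
      l2_inner_lincomb_left[OF divg_L2[OF assms(1)] divg_L2[OF assms(2)] that, of a b] by simp
  have G: "l2_inner \<Omega> (vgrad \<Omega> (\<lambda>x. a *\<^sub>R u x + b *\<^sub>R v x)) h = a * l2_inner \<Omega> (vgrad \<Omega> u) h + b * l2_inner \<Omega> (vgrad \<Omega> v) h"
    if "h \<in> L2 \<Omega>" for h
    using l2_inner_cong[OF vgrad_L2[OF s] that vgrad_lincomb[OF assms(1,2)] AE_I2[OF refl]]
      l2_inner_lincomb_left[OF vgrad_L2[OF assms(1)] vgrad_L2[OF assms(2)] that, of a b] by simp
  show ?thesis
    unfolding e_form_def D[OF divg_L2[OF assms(3)]] G[OF vgrad_L2[OF assms(3)]] G[OF L2_transpose(1)[OF vgrad_L2[OF assms(3)]]]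
    by (simp add: algebra_simps)
qed

lemma e_form_diff_left:
  assumes "u \<in> vH10 \<Omega>" "v \<in> vH10 \<Omega>" "w \<in> vH10 \<Omega>"
  shows "e_form \<Omega> (\<lambda>x. u x - v x) w = e_form \<Omega> u w - e_form \<Omega> v w"
  using e_form_lincomb[OF assms, of 1 "-1"] by simp

text \<open>The constant is \<open>3 \<cdot> 3 + 1 + 1\<close>, the divergence being a sum of three entries of the gradient.\<close>

lemma e_form_bound:
  assumes "u \<in> vH10 \<Omega>" "w \<in> vH10 \<Omega>"
  shows "\<bar>e_form \<Omega> u w\<bar> \<le> 11 * (vh1_norm \<Omega> u * vh1_norm \<Omega> w)"
proof -
  let ?p = "vh1_norm \<Omega> u * vh1_norm \<Omega> w"
  have "\<bar>l2_inner \<Omega> (divg \<Omega> u) (divg \<Omega> w)\<bar> \<le> l2_norm \<Omega> (divg \<Omega> u) * l2_norm \<Omega> (divg \<Omega> w)"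
    by (rule l2_cauchy_schwarz[OF divg_L2[OF assms(1)] divg_L2[OF assms(2)]])
  also have "\<dots> \<le> (3 * vh1_norm \<Omega> u) * (3 * vh1_norm \<Omega> w)"
    using divg_bound[OF assms(1)] divg_bound[OF assms(2)] by (intro mult_mono) (auto simp: l2_norm_nonneg vh1_norm_ge)
  finally have 1: "\<bar>l2_inner \<Omega> (divg \<Omega> u) (divg \<Omega> w)\<bar> \<le> 9 * ?p" by simp
  have p: "l2_norm \<Omega> (vgrad \<Omega> u) * l2_norm \<Omega> (vgrad \<Omega> w) \<le> ?p"
    by (intro mult_mono) (auto simp: l2_norm_nonneg vh1_norm_ge)
  have 2: "\<bar>l2_inner \<Omega> (vgrad \<Omega> u) (vgrad \<Omega> w)\<bar> \<le> ?p"
    using l2_cauchy_schwarz[OF vgrad_L2[OF assms(1)] vgrad_L2[OF assms(2)]] p by linarith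
  have 3: "\<bar>l2_inner \<Omega> (vgrad \<Omega> u) (\<lambda>x. transpose (vgrad \<Omega> w x))\<bar> \<le> ?p"
    using l2_cauchy_schwarz[OF vgrad_L2[OF assms(1)] L2_transpose(1)[OF vgrad_L2[OF assms(2)]]] p
    by (simp add: L2_transpose(2)[OF vgrad_L2[OF assms(2)]])
  show ?thesis unfolding e_form_def using 1 2 3 by linarith
qed

text \<open>The elastic energy is \<open>\<parallel>\<nabla>\<cdot>u\<parallel>\<^sup>2 + \<parallel>\<nabla>u + \<nabla>u\<^sup>T\<parallel>\<^sup>2 / 2\<close>. It controls the divergence, and if it
  vanishes then so do the diagonal entries \<open>\<partial>\<^sub>i u\<^sub>i\<close> of the symmetric gradient, and the Poincare inequality
  in direction \<open>i\<close> gives \<open>u\<^sub>i = 0\<close>.\<close>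

lemma e_form_self:
  assumes "u \<in> vH10 \<Omega>"
  shows "e_form \<Omega> u u = (l2_norm \<Omega> (divg \<Omega> u))\<^sup>2 + (l2_norm \<Omega> (\<lambda>x. vgrad \<Omega> u x + transpose (vgrad \<Omega> u x)))\<^sup>2 / 2"
proof -
  let ?A = "vgrad \<Omega> u"
  note A = vgrad_L2[OF assms] and T = L2_transpose(1)[OF vgrad_L2[OF assms]]
  have "(A + transpose A) \<bullet> (A + transpose A) = 2 * (A \<bullet> A) + 2 * (A \<bullet> transpose A)" for A :: "real^3^3"
    using inner_transpose[of A A] by (simp add: inner_add_left inner_add_right inner_commute)
  then have "(l2_norm \<Omega> (\<lambda>x. ?A x + transpose (?A x)))\<^sup>2 = 2 * l2_inner \<Omega> ?A ?A + 2 * l2_inner \<Omega> ?A (\<lambda>x. transpose (?A x))"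
    unfolding l2_norm_sq using L2_inner_integrable[OF A A] L2_inner_integrable[OF A T] by (simp add: l2_inner_def)
  then show ?thesis unfolding e_form_def l2_norm_sq by simp
qed

lemma e_form_ge:
  assumes "u \<in> vH10 \<Omega>"
  shows "(l2_norm \<Omega> (divg \<Omega> u))\<^sup>2 \<le> e_form \<Omega> u u"
  using e_form_self[OF assms] by simp

lemma e_form_zero:
  assumes "u \<in> vH10 \<Omega>" "e_form \<Omega> u u = 0"
  shows "AE x in lebesgue_on \<Omega>. u x = 0"
proof -
  let ?M = "\<lambda>x. vgrad \<Omega> u x + transpose (vgrad \<Omega> u x)"
  have "?M \<in> L2 \<Omega>"
    using seminormed.add_mem[OF seminormed_L2 vgrad_L2[OF assms(1)] L2_transpose(1)[OF vgrad_L2[OF assms(1)]]] .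
  moreover have "l2_norm \<Omega> ?M = 0"
    using e_form_self[OF assms(1)] assms(2) by (smt (verit) half_gt_zero zero_le_power2 zero_less_power2)
  ultimately have M: "AE x in lebesgue_on \<Omega>. ?M x = 0" by (rule l2_norm_eq_0)
  have "AE x in lebesgue_on \<Omega>. \<forall>i\<in>UNIV. u x $ i = 0"
  proof (rule AE_finite_allI)
    fix i :: 3
    have "AE x in lebesgue_on \<Omega>. weak_partial \<Omega> i (\<lambda>x. u x $ i) x = 0"
      using M
    proof eventually_elim
      case (elim x)
      have "?M x $ i $ i = 0" by (simp only: elim zero_index)
      then show ?case by (simp add: vgrad_def transpose_def)
    qed
    then show "AE x in lebesgue_on \<Omega>. u x $ i = 0"
      by (rule H10_partial_zero[OF bounded_domain vH10_nth[OF assms(1)]])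
  qed simp
  then show ?thesis by eventually_elim (simp add: vec_eq_iff)
qed

end

section \<open>Functions of time\<close>

lemma (in open_domain) L2_dominated:
  assumes "h \<in> L2 \<Omega>" "g \<in> borel_measurable (lebesgue_on \<Omega>)" "AE x in lebesgue_on \<Omega>. norm (g x) \<le> norm (h x)"
  shows "g \<in> L2 \<Omega>"
proof -
  have "integrable (lebesgue_on \<Omega>) (\<lambda>x. (norm (g x))\<^sup>2)"
  proof (rule Bochner_Integration.integrable_bound)
    show "integrable (lebesgue_on \<Omega>) (\<lambda>x. (norm (h x))\<^sup>2)" using assms(1) by (simp add: L2_def)
    show "(\<lambda>x. (norm (g x))\<^sup>2) \<in> borel_measurable (lebesgue_on \<Omega>)" using assms(2) by measurable
    show "AE x in lebesgue_on \<Omega>. norm ((norm (g x))\<^sup>2) \<le> norm ((norm (h x))\<^sup>2)"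
      using assms(3) by eventually_elim (simp add: power_mono)
  qed
  then show ?thesis using assms(2) by (simp add: L2_def)
qed

text \<open>The time interval is a one-dimensional domain, so the results on \<open>L\<^sup>2\<close> and on test functions apply
  to functions of time as well.\<close>

interpretation interval: open_domain "{0<..<T}" for T :: real
  by unfold_locales simp

lemma finite_measure_time: "finite_measure (time T)"
  by (rule finite_measure_lebesgue_on) (metis box_real(1) lmeasurable_box)

lemma borel_measurable_AE_LIMSEQ:
  fixes s :: "nat \<Rightarrow> 'a \<Rightarrow> real"
  assumes "complete_measure M" "\<And>n. s n \<in> borel_measurable M" "AE t in M. (\<lambda>n. s n t) \<longlonglongrightarrow> f t"
  shows "f \<in> borel_measurable M"
proof (rule borel_measurable_AE_eq[OF assms(1)])
  show "(\<lambda>t. lim (\<lambda>n. s n t)) \<in> borel_measurable M"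
    by (rule borel_measurable_lim_metric) (rule assms(2))
  show "AE t in M. lim (\<lambda>n. s n t) = f t"
    using assms(3) by eventually_elim (rule limI)
qed

text \<open>Along the simple functions that approximate its arguments the form is a real simple function, and
  continuity makes it converge. Three arguments suffice for the flux, which depends on \<open>\<zeta>\<close>, \<open>p\<close> and the
  test function.\<close>

lemma strongly_measurable_form:
  fixes f :: "real \<Rightarrow> 'a \<Rightarrow> 'b::real_vector" and g :: "real \<Rightarrow> 'c \<Rightarrow> 'd::real_vector" and h :: "real \<Rightarrow> 'e \<Rightarrow> 'f::real_vector"
  assumes f: "strongly_measurable X N T f" and g: "strongly_measurable Y M T g" and h: "strongly_measurable Z L T h"
    and cont: "\<And>xs x ys y zs z. (\<And>n. xs n \<in> X) \<Longrightarrow> x \<in> X \<Longrightarrow> (\<lambda>n. N (\<lambda>a. xs n a - x a)) \<longlonglongrightarrow> 0 \<Longrightarrow>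
      (\<And>n. ys n \<in> Y) \<Longrightarrow> y \<in> Y \<Longrightarrow> (\<lambda>n. M (\<lambda>a. ys n a - y a)) \<longlonglongrightarrow> 0 \<Longrightarrow>
      (\<And>n. zs n \<in> Z) \<Longrightarrow> z \<in> Z \<Longrightarrow> (\<lambda>n. L (\<lambda>a. zs n a - z a)) \<longlonglongrightarrow> 0 \<Longrightarrow>
      (\<lambda>n. B (xs n) (ys n) (zs n)) \<longlonglongrightarrow> B x y z"
  shows "(\<lambda>t. B (f t) (g t) (h t) :: real) \<in> borel_measurable (time T)"
proof -
  obtain s where s: "\<And>n. simple_in X T (s n)" "AE t in time T. (\<lambda>n. N (\<lambda>a. s n t a - f t a)) \<longlonglongrightarrow> 0"
    using f unfolding strongly_measurable_def by blast
  obtain r where r: "\<And>n. simple_in Y T (r n)" "AE t in time T. (\<lambda>n. M (\<lambda>a. r n t a - g t a)) \<longlonglongrightarrow> 0"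
    using g unfolding strongly_measurable_def by blast
  obtain q where q: "\<And>n. simple_in Z T (q n)" "AE t in time T. (\<lambda>n. L (\<lambda>a. q n t a - h t a)) \<longlonglongrightarrow> 0"
    using h unfolding strongly_measurable_def by blast
  have m: "AE t in time T. f t \<in> X" "AE t in time T. g t \<in> Y" "AE t in time T. h t \<in> Z"
    using f g h unfolding strongly_measurable_def by blast+
  show ?thesis
  proof (rule borel_measurable_AE_LIMSEQ[OF interval.complete_domain])
    fix n
    have "simple_function (time T) (\<lambda>t. (s n t, r n t, q n t))"
      using s(1)[of n] r(1)[of n] q(1)[of n] unfolding simple_in_def by (intro simple_function_Pair) auto
    then have "simple_function (time T) (\<lambda>t. (\<lambda>(x, y, z). B x y z) (s n t, r n t, q n t))"
      by (rule simple_function_compose1)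
    then show "(\<lambda>t. B (s n t) (r n t) (q n t)) \<in> borel_measurable (time T)"
      by (simp add: borel_measurable_simple_function)
  next
    show "AE t in time T. (\<lambda>n. B (s n t) (r n t) (q n t)) \<longlonglongrightarrow> B (f t) (g t) (h t)"
      using m s(2) r(2) q(2) AE_space
    proof eventually_elim
      case (elim t)
      have "s n t \<in> X" "r n t \<in> Y" "q n t \<in> Z" for n
        using elim(7) s(1)[of n] r(1)[of n] q(1)[of n] unfolding simple_in_def by auto
      then show ?case using elim by (intro cont) auto
    qed
  qed
qed

lemma L2_time_mem: "f \<in> L2_time T X N \<Longrightarrow> AE t in time T. f t \<in> X"
  by (simp add: L2_time_def strongly_measurable_def)

lemma L2_time_strongly_measurable: "f \<in> L2_time T X N \<Longrightarrow> strongly_measurable X N T f"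
  by (simp add: L2_time_def)

context seminormed
begin

lemma strongly_measurable_norm:
  assumes "strongly_measurable X N T f"
  shows "(\<lambda>t. N (f t)) \<in> borel_measurable (time T)"
  by (rule strongly_measurable_form[OF assms assms assms, where B="\<lambda>x y z. N x"]) (rule norm_LIMSEQ)

lemma L2_time_norm:
  assumes "f \<in> L2_time T X N"
  shows "(\<lambda>t. N (f t)) \<in> L2 {0<..<T}"
proof -
  have m: "(\<lambda>t. N (f t)) \<in> borel_measurable (time T)"
    by (rule strongly_measurable_norm[OF L2_time_strongly_measurable[OF assms]])
  have "integrable (time T) (\<lambda>t. (N (f t))\<^sup>2)"
    by (rule integrableI_nonneg) (use m assms in \<open>auto simp: L2_time_def\<close>)
  then show ?thesis using m by (simp add: L2_def)
qed

lemma L2_timeI: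
  assumes "strongly_measurable X N T f" "(\<lambda>t. N (f t)) \<in> L2 {0<..<T}"
  shows "f \<in> L2_time T X N"
proof -
  have "integrable (time T) (\<lambda>t. (N (f t))\<^sup>2)" using assms(2) by (simp add: L2_def)
  then have "(\<integral>\<^sup>+t. ennreal (norm ((N (f t))\<^sup>2)) \<partial>time T) < \<infinity>" unfolding integrable_iff_bounded by blast
  then show ?thesis using assms(1) by (simp add: L2_time_def)
qed

lemma strongly_measurable_diff:
  assumes f: "strongly_measurable X N T f" and g: "strongly_measurable X N T g"
  shows "strongly_measurable X N T (\<lambda>t x. f t x - g t x)"
proof -
  obtain s where s: "\<And>n. simple_in X T (s n)" "AE t in time T. (\<lambda>n. N (\<lambda>a. s n t a - f t a)) \<longlonglongrightarrow> 0"
    using f unfolding strongly_measurable_def by blast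
  obtain r where r: "\<And>n. simple_in X T (r n)" "AE t in time T. (\<lambda>n. N (\<lambda>a. r n t a - g t a)) \<longlonglongrightarrow> 0"
    using g unfolding strongly_measurable_def by blast
  have m: "AE t in time T. f t \<in> X" "AE t in time T. g t \<in> X"
    using f g unfolding strongly_measurable_def by blast+
  have sm: "s n t \<in> X" "r n t \<in> X" if "t \<in> {0<..<T}" for n t
    using s(1)[of n] r(1)[of n] that unfolding simple_in_def by auto
  have "simple_function (time T) (\<lambda>t x. s n t x - r n t x)" for n
    using simple_function_compose2[of "time T" "s n" "r n" "\<lambda>u v x. u x - v x"] s(1)[of n] r(1)[of n]
    unfolding simple_in_def by blast
  then have "simple_in X T (\<lambda>t x. s n t x - r n t x)" for n
    unfolding simple_in_def using sm by (auto intro: diff_mem)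
  moreover have "AE t in time T. (\<lambda>n. N (\<lambda>x. (s n t x - r n t x) - (f t x - g t x))) \<longlonglongrightarrow> 0"
    using m s(2) r(2) AE_space
  proof eventually_elim
    case (elim t)
    have t: "t \<in> {0<..<T}" using elim by simp
    have le: "0 \<le> N (\<lambda>x. (s n t x - r n t x) - (f t x - g t x)) \<and>
        N (\<lambda>x. (s n t x - r n t x) - (f t x - g t x)) \<le> N (\<lambda>x. s n t x - f t x) + N (\<lambda>x. r n t x - g t x)" for n
    proof -
      have a: "(\<lambda>x. s n t x - f t x) \<in> X" "(\<lambda>x. r n t x - g t x) \<in> X"
        using elim sm[OF t] by (auto intro: diff_mem)
      have "(\<lambda>x. (s n t x - r n t x) - (f t x - g t x)) = (\<lambda>x. (s n t x - f t x) - (r n t x - g t x))"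
        by (simp add: algebra_simps)
      then show ?thesis using norm_diff_le[OF a] nonneg[OF diff_mem[OF a]] by simp
    qed
    show ?case
      by (rule tendsto_sandwich[OF _ _ tendsto_const, where h="\<lambda>n. N (\<lambda>x. s n t x - f t x) + N (\<lambda>x. r n t x - g t x)"])
        (use le tendsto_add[OF elim(3,4)] in auto)
  qed
  moreover have "AE t in time T. (\<lambda>x. f t x - g t x) \<in> X"
    using m by eventually_elim (rule diff_mem)
  ultimately show ?thesis unfolding strongly_measurable_def
    by (intro conjI exI[of _ "\<lambda>n t x. s n t x - r n t x"]) auto
qed

lemma L2_time_diff:
  assumes "f \<in> L2_time T X N" "g \<in> L2_time T X N"
  shows "(\<lambda>t x. f t x - g t x) \<in> L2_time T X N"
proof (rule L2_timeI)
  show s: "strongly_measurable X N T (\<lambda>t x. f t x - g t x)"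
    by (intro strongly_measurable_diff L2_time_strongly_measurable assms)
  have b: "(\<lambda>t. N (f t) + N (g t)) \<in> L2 {0<..<T}"
    using seminormed.add_mem[OF interval.seminormed_L2 L2_time_norm[OF assms(1)] L2_time_norm[OF assms(2)]] .
  show "(\<lambda>t. N (\<lambda>x. f t x - g t x)) \<in> L2 {0<..<T}"
  proof (rule interval.L2_dominated[OF b strongly_measurable_norm[OF s]])
    show "AE t in time T. norm (N (\<lambda>x. f t x - g t x)) \<le> norm (N (f t) + N (g t))"
      using L2_time_mem[OF assms(1)] L2_time_mem[OF assms(2)]
    proof eventually_elim
      case (elim t)
      then show ?case using norm_diff_le[OF elim] nonneg[OF diff_mem[OF elim]] by simp
    qed
  qed
qed

lemma L2_time_indicator:
  assumes "f \<in> L2_time T X N" "A \<in> sets lebesgue"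
  shows "(\<lambda>t x. indicator A t *\<^sub>R f t x) \<in> L2_time T X N"
proof (rule L2_timeI)
  have f: "strongly_measurable X N T f" by (rule L2_time_strongly_measurable[OF assms(1)])
  obtain s where s: "\<And>n. simple_in X T (s n)" "AE t in time T. (\<lambda>n. N (\<lambda>a. s n t a - f t a)) \<longlonglongrightarrow> 0"
    using f unfolding strongly_measurable_def by blast
  have m: "AE t in time T. f t \<in> X" by (rule L2_time_mem[OF assms(1)])
  have sm: "s n t \<in> X" if "t \<in> {0<..<T}" for n t
    using s(1)[of n] that unfolding simple_in_def by auto
  have "A \<inter> {0<..<T} \<in> sets (time T)"
    using assms(2) by (auto simp: sets_restrict_space)
  then have i: "simple_function (time T) (indicator A :: real \<Rightarrow> real)"
    using simple_function_cong[of "time T" "indicator A :: real \<Rightarrow> real" "indicator (A \<inter> {0<..<T})"]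
    by (simp add: simple_function_indicator split: split_indicator)
  have "simple_function (time T) (\<lambda>t x. indicator A t *\<^sub>R s n t x)" for n
    using simple_function_compose2[OF i, of "s n" "\<lambda>u v x. u *\<^sub>R v x"] s(1)[of n]
    unfolding simple_in_def by blast
  then have "simple_in X T (\<lambda>t x. indicator A t *\<^sub>R s n t x)" for n
    unfolding simple_in_def using sm by (auto intro: scale_mem)
  moreover have "AE t in time T. (\<lambda>n. N (\<lambda>x. indicator A t *\<^sub>R s n t x - indicator A t *\<^sub>R f t x)) \<longlonglongrightarrow> 0"
    using s(2)
    by eventually_elim (auto simp: indicator_def norm_zero)
  moreover have "AE t in time T. (\<lambda>x. indicator A t *\<^sub>R f t x) \<in> X"
    using m by eventually_elim (rule scale_mem)
  ultimately show st: "strongly_measurable X N T (\<lambda>t x. indicator A t *\<^sub>R f t x)" unfolding strongly_measurable_def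
    by (intro conjI exI[of _ "\<lambda>n t x. indicator A t *\<^sub>R s n t x"]) auto
  show "(\<lambda>t. N (\<lambda>x. indicator A t *\<^sub>R f t x)) \<in> L2 {0<..<T}"
  proof (rule interval.L2_dominated[OF L2_time_norm[OF assms(1)] strongly_measurable_norm[OF st]])
    show "AE t in time T. norm (N (\<lambda>x. indicator A t *\<^sub>R f t x)) \<le> norm (N (f t))"
      using m by eventually_elim (auto simp: indicator_def norm_zero)
  qed
qed

lemma L2_time_const:
  assumes "q \<in> X"
  shows "(\<lambda>t. q) \<in> L2_time T X N"
proof (rule L2_timeI)
  show "strongly_measurable X N T (\<lambda>t. q)"
    unfolding strongly_measurable_def simple_in_def using assms
    by (auto simp: norm_zero intro!: exI[of _ "\<lambda>n t. q"])
  show "(\<lambda>t. N q) \<in> L2 {0<..<T}"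
    using finite_measure.integrable_const[OF finite_measure_time] by (simp add: L2_def)
qed

text \<open>Bounded functionals commute with the Bochner integral; applied to a weak time derivative they turn
  it into a scalar weak derivative.\<close>

lemma dual_simple_integral:
  assumes l: "l \<in> dual X N" and s: "simple_in X T s"
  shows "integrable (time T) (\<lambda>t. l (s t))" "(LINT t|time T. l (s t)) = l (simple_integral T s)"
    "simple_integral T s \<in> X"
proof -
  let ?I = "{0<..<T}" let ?A = "\<lambda>y. {t \<in> ?I. s t = y}"
  have fin: "finite (s ` ?I)" and sets: "\<And>y. ?A y \<in> sets (time T)" and mem: "s ` ?I \<subseteq> X"
  proof -
    have sf: "simple_function (time T) s" using s by (simp add: simple_in_def)
    show "finite (s ` ?I)" using simple_functionD(1)[OF sf] by simp
    have "s -` {y} \<inter> space (time T) = ?A y" for y by auto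
    then show "?A y \<in> sets (time T)" for y using simple_functionD(2)[OF sf, of "{y}"] by simp
    show "s ` ?I \<subseteq> X" using s by (simp add: simple_in_def)
  qed
  have ind: "integrable (time T) (indicator (?A y) :: real \<Rightarrow> real)" for y
    using sets finite_measure.emeasure_finite[OF finite_measure_time, of T "?A y"]
    by (intro integrable_real_indicator) (auto simp: less_top[symmetric])
  have eq: "l (s t) = (\<Sum>y\<in>s ` ?I. indicator (?A y) t * l y)" if "t \<in> ?I" for t
  proof -
    have "(\<Sum>y\<in>s ` ?I. indicator (?A y) t * l y) = (\<Sum>y\<in>s ` ?I. if y = s t then l y else 0)"
      using that by (intro sum.cong) (auto simp: indicator_def)
    then show ?thesis using fin that by (simp add: sum.delta)
  qed
  have I: "integrable (time T) (\<lambda>t. \<Sum>y\<in>s ` ?I. indicator (?A y) t * l y)"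
    by (intro Bochner_Integration.integrable_sum integrable_mult_left ind)
  then show "integrable (time T) (\<lambda>t. l (s t))"
    using Bochner_Integration.integrable_cong[OF refl, of "time T" "\<lambda>t. l (s t)" "\<lambda>t. \<Sum>y\<in>s ` ?I. indicator (?A y) t * l y"] eq
    by simp
  have "(LINT t|time T. l (s t)) = (LINT t|time T. (\<Sum>y\<in>s ` ?I. indicator (?A y) t * l y))"
    by (rule Bochner_Integration.integral_cong) (use eq in auto)
  also have "\<dots> = (\<Sum>y\<in>s ` ?I. (LINT t|time T. indicator (?A y) t * l y))"
    by (intro Bochner_Integration.integral_sum integrable_mult_left ind)
  also have "\<dots> = (\<Sum>y\<in>s ` ?I. measure (time T) (?A y) * l y)"
  proof (rule sum.cong[OF refl])
    fix y
    have "?A y \<inter> space (time T) = ?A y" by auto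
    then show "(LINT t|time T. indicator (?A y) t * l y) = measure (time T) (?A y) * l y"
      by (simp only: integral_mult_left_zero Bochner_Integration.integral_indicator)
  qed
  finally have L: "(LINT t|time T. l (s t)) = (\<Sum>y\<in>s ` ?I. measure (time T) (?A y) * l y)" .
  have sum: "(\<lambda>x. \<Sum>y\<in>Y. c y *\<^sub>R y x) \<in> X \<and> l (\<lambda>x. \<Sum>y\<in>Y. c y *\<^sub>R y x) = (\<Sum>y\<in>Y. c y * l y)"
    if "finite Y" "Y \<subseteq> X" for Y and c :: "('a \<Rightarrow> 'b) \<Rightarrow> real"
    using that
  proof (induction rule: finite_induct)
    case empty
    have "l (\<lambda>x. 0) = 0" using dual_lincomb[OF l zero_mem zero_mem, of 0 0] by simp
    then show ?case using zero_mem by simp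
  next
    case (insert y Y)
    then have IH: "(\<lambda>x. \<Sum>y\<in>Y. c y *\<^sub>R y x) \<in> X" "l (\<lambda>x. \<Sum>y\<in>Y. c y *\<^sub>R y x) = (\<Sum>y\<in>Y. c y * l y)" "y \<in> X" by auto
    show ?case
      using lincomb_mem[OF IH(3,1), of "c y" 1] dual_lincomb[OF l IH(3,1), of "c y" 1] insert(1,2) IH(2) by simp
  qed
  have e: "simple_integral T s = (\<lambda>x. \<Sum>y\<in>s ` ?I. measure (time T) (?A y) *\<^sub>R y x)"
    by (rule ext) (simp add: simple_integral_def)
  show "simple_integral T s \<in> X" "(LINT t|time T. l (s t)) = l (simple_integral T s)"
    using sum[OF fin mem] L unfolding e by auto
qed

lemma dual_LIMSEQ:
  assumes l: "l \<in> dual X N" and xs: "\<And>n. xs n \<in> X" "x \<in> X" "(\<lambda>n. N (\<lambda>a. xs n a - x a)) \<longlonglongrightarrow> 0"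
  shows "(\<lambda>n. l (xs n)) \<longlonglongrightarrow> l x"
proof -
  have "(\<lambda>n. dual_norm X N l * N (\<lambda>a. xs n a - x a)) \<longlonglongrightarrow> 0" using tendsto_mult_right_zero[OF xs(3)] .
  then have "(\<lambda>n. l (xs n) - l x) \<longlonglongrightarrow> 0"
    by (rule Lim_null_comparison[rotated])
      (use dual_bound[OF l diff_mem[OF xs(1,2)]] dual_diff[OF l xs(1,2)] in simp)
  then show ?thesis by (simp add: LIM_zero_iff)
qed

lemma dual_time_L2:
  assumes l: "l \<in> dual X N" and f: "f \<in> L2_time T X N"
  shows "(\<lambda>t. l (f t)) \<in> L2 {0<..<T}"
proof (rule interval.L2_dominated)
  note sm = L2_time_strongly_measurable[OF f]
  show "(\<lambda>t. dual_norm X N l *\<^sub>R N (f t)) \<in> L2 {0<..<T}"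
    by (rule interval.L2_scale[OF L2_time_norm[OF f]])
  show "(\<lambda>t. l (f t)) \<in> borel_measurable (time T)"
    by (rule strongly_measurable_form[OF sm sm sm, where B="\<lambda>x y z. l x"]) (rule dual_LIMSEQ[OF l])
  show "AE t in time T. norm (l (f t)) \<le> norm (dual_norm X N l *\<^sub>R N (f t))"
    using L2_time_mem[OF f]
  proof eventually_elim
    case (elim t)
    show ?case using dual_bound[OF l elim] by simp
  qed
qed

lemma eval_dual:
  assumes "q \<in> X"
  shows "(\<lambda>l. l q) \<in> dual (dual X N) (dual_norm X N)"
  unfolding dual_def[of "dual X N"]
  using dual_bound[OF _ assms] by (auto simp: mult.commute intro!: exI[of _ "N q"])

lemma has_bochner_dual:
  assumes l: "l \<in> dual X N" and f: "has_bochner T X N f I"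
  shows "integrable (time T) (\<lambda>t. l (f t))" "(LINT t|time T. l (f t)) = l I"
proof -
  obtain s where s: "\<And>n. simple_in X T (s n)"
    and L1: "(\<lambda>n. \<integral>\<^sup>+t. ennreal (N (\<lambda>x. s n t x - f t x)) \<partial>time T) \<longlonglongrightarrow> 0"
    and lim: "(\<lambda>n. N (\<lambda>x. simple_integral T (s n) x - I x)) \<longlonglongrightarrow> 0"
    using f unfolding has_bochner_def by blast
  have sm: "strongly_measurable X N T f" and I: "I \<in> X" using f by (auto simp: has_bochner_def)
  have mem: "AE t in time T. f t \<in> X" using sm by (simp add: strongly_measurable_def)
  let ?C = "dual_norm X N l"
  have m: "(\<lambda>t. l (f t)) \<in> borel_measurable (time T)"
    by (rule strongly_measurable_form[OF sm sm sm, where B="\<lambda>x y z. l x"]) (rule dual_LIMSEQ[OF l])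
  have le: "(\<integral>\<^sup>+t. ennreal (norm (l (s n t) - l (f t))) \<partial>time T) \<le> ennreal ?C * (\<integral>\<^sup>+t. ennreal (N (\<lambda>x. s n t x - f t x)) \<partial>time T)" for n
  proof -
    have "AE t in time T. ennreal (norm (l (s n t) - l (f t))) \<le> ennreal ?C * ennreal (N (\<lambda>x. s n t x - f t x))"
      using mem AE_space
    proof eventually_elim
      case (elim t)
      have "s n t \<in> X" using elim(2) s[of n] unfolding simple_in_def by auto
      from dual_bound[OF l diff_mem[OF this elim(1)]] dual_diff[OF l this elim(1)]
      show ?case using dual_norm_nonneg[OF l] nonneg[OF diff_mem[OF \<open>s n t \<in> X\<close> elim(1)]]
        by (simp add: ennreal_mult[symmetric] ennreal_leI)
    qed
    then have "(\<integral>\<^sup>+t. ennreal (norm (l (s n t) - l (f t))) \<partial>time T) \<le> (\<integral>\<^sup>+t. ennreal ?C * ennreal (N (\<lambda>x. s n t x - f t x)) \<partial>time T)"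
      by (rule nn_integral_mono_AE)
    moreover have "strongly_measurable X N T (s n)"
      using s[of n] unfolding strongly_measurable_def
      by (auto simp: simple_in_def norm_zero intro!: exI[of _ "\<lambda>k. s n"] AE_I2)
    ultimately show ?thesis
      using strongly_measurable_norm[OF strongly_measurable_diff[OF _ sm, of "s n"]] by (subst (asm) nn_integral_cmult) auto
  qed
  have L1l: "(\<lambda>n. \<integral>\<^sup>+t. ennreal (norm (l (s n t) - l (f t))) \<partial>time T) \<longlonglongrightarrow> 0"
  proof (rule tendsto_sandwich)
    show "\<forall>\<^sub>F n in sequentially. 0 \<le> (\<integral>\<^sup>+t. ennreal (norm (l (s n t) - l (f t))) \<partial>time T)" by simp
    show "\<forall>\<^sub>F n in sequentially. (\<integral>\<^sup>+t. ennreal (norm (l (s n t) - l (f t))) \<partial>time T)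
        \<le> ennreal ?C * (\<integral>\<^sup>+t. ennreal (N (\<lambda>x. s n t x - f t x)) \<partial>time T)"
      using le by (intro always_eventually allI)
    show "(\<lambda>n. ennreal ?C * (\<integral>\<^sup>+t. ennreal (N (\<lambda>x. s n t x - f t x)) \<partial>time T)) \<longlonglongrightarrow> 0"
      using ennreal_tendsto_cmult[OF _ L1, of "ennreal ?C"] by simp
  qed simp
  note si = dual_simple_integral[OF l s]
  obtain n where n: "(\<integral>\<^sup>+t. ennreal (norm (l (s n t) - l (f t))) \<partial>time T) < 1"
    using order_tendstoD(2)[OF L1l, of 1] eventually_happens'[OF sequentially_bot] by auto
  have "integrable (time T) (\<lambda>t. l (s n t) - l (f t))"
    using n m si(1)[of n] unfolding integrable_iff_bounded by (auto intro: less_trans)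
  from Bochner_Integration.integrable_diff[OF si(1)[of n] this]
  show i: "integrable (time T) (\<lambda>t. l (f t))" by simp
  have "(\<lambda>n. LINT t|time T. l (s n t)) \<longlonglongrightarrow> (LINT t|time T. l (f t))"
    by (rule tendsto_L1_int[OF si(1) i L1l])
  moreover have "(\<lambda>n. LINT t|time T. l (s n t)) \<longlonglongrightarrow> l I"
    using dual_LIMSEQ[OF l si(3) I lim] si(2) by simp
  ultimately show "(LINT t|time T. l (f t)) = l I" by (rule LIMSEQ_unique)
qed

lemma weak_time_deriv_dual:
  assumes l: "l \<in> dual X N" and d: "has_weak_time_deriv T X N f g"
    and f: "AE t in time T. f t \<in> X" and g: "AE t in time T. g t \<in> X" and \<phi>: "\<phi> \<in> test_functions {0<..<T}"
  shows "(LINT t|time T. deriv \<phi> t * l (f t)) = - (LINT t|time T. \<phi> t * l (g t))"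
proof -
  obtain I where I: "has_bochner T X N (\<lambda>t x. deriv \<phi> t *\<^sub>R f t x) I" "has_bochner T X N (\<lambda>t x. \<phi> t *\<^sub>R g t x) (\<lambda>x. - I x)"
    using d \<phi> unfolding has_weak_time_deriv_def by blast
  have sc: "l (\<lambda>x. c *\<^sub>R h x) = c * l h" if "h \<in> X" for c h
    using dual_lincomb[OF l that that, of c 0] by simp
  have "I \<in> X" using I(1) by (simp add: has_bochner_def)
  then have "l (\<lambda>x. - I x) = - l I" using sc[of I "-1"] by simp
  note b1 = has_bochner_dual[OF l I(1)] and b2 = has_bochner_dual[OF l I(2)]
  have e1: "AE t in time T. l (\<lambda>x. deriv \<phi> t *\<^sub>R f t x) = deriv \<phi> t * l (f t)"
    using f by eventually_elim (rule sc)
  have e2: "AE t in time T. l (\<lambda>x. \<phi> t *\<^sub>R g t x) = \<phi> t * l (g t)"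
    using g by eventually_elim (rule sc)
  have "(LINT t|time T. deriv \<phi> t * l (f t)) = l I"
    using b1 e1 integral_cong_AE[OF borel_measurable_integrable[OF b1(1)] interval.measurable_AE_eq[OF borel_measurable_integrable[OF b1(1)] e1] e1]
    by simp
  moreover have "(LINT t|time T. \<phi> t * l (g t)) = - l I"
    using b2 e2 integral_cong_AE[OF borel_measurable_integrable[OF b2(1)] interval.measurable_AE_eq[OF borel_measurable_integrable[OF b2(1)] e2] e2]
      \<open>l (\<lambda>x. - I x) = - l I\<close> by simp
  ultimately show ?thesis by simp
qed

end

lemma bilinear_LIMSEQ:
  assumes X: "seminormed X N" and Y: "seminormed Y M"
    and B1: "\<And>x x' y. x \<in> X \<Longrightarrow> x' \<in> X \<Longrightarrow> y \<in> Y \<Longrightarrow> B (\<lambda>a. x a - x' a) y = B x y - B x' y"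
    and B2: "\<And>x y y'. x \<in> X \<Longrightarrow> y \<in> Y \<Longrightarrow> y' \<in> Y \<Longrightarrow> B x (\<lambda>a. y a - y' a) = B x y - (B x y' :: real)"
    and bd: "\<And>x y. x \<in> X \<Longrightarrow> y \<in> Y \<Longrightarrow> \<bar>B x y\<bar> \<le> N x * M y"
    and xs: "\<And>n. xs n \<in> X" "x \<in> X" "(\<lambda>n. N (\<lambda>a. xs n a - x a)) \<longlonglongrightarrow> 0"
    and ys: "\<And>n. ys n \<in> Y" "y \<in> Y" "(\<lambda>n. M (\<lambda>a. ys n a - y a)) \<longlonglongrightarrow> 0"
  shows "(\<lambda>n. B (xs n) (ys n)) \<longlonglongrightarrow> B x y"
proof -
  have "(\<lambda>n. N (\<lambda>a. xs n a - x a) * M (ys n) + N x * M (\<lambda>a. ys n a - y a)) \<longlonglongrightarrow> 0 * M y + N x * 0"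
    by (intro tendsto_add tendsto_mult tendsto_const xs(3) ys(3) seminormed.norm_LIMSEQ[OF Y ys])
  then have lim: "(\<lambda>n. N (\<lambda>a. xs n a - x a) * M (ys n) + N x * M (\<lambda>a. ys n a - y a)) \<longlonglongrightarrow> 0" by simp
  have "norm (B (xs n) (ys n) - B x y) \<le> N (\<lambda>a. xs n a - x a) * M (ys n) + N x * M (\<lambda>a. ys n a - y a)" for n
    using bd[OF seminormed.diff_mem[OF X xs(1)[of n] xs(2)] ys(1)[of n]] bd[OF xs(2) seminormed.diff_mem[OF Y ys(1)[of n] ys(2)]]
      B1[OF xs(1)[of n] xs(2) ys(1)[of n]] B2[OF xs(2) ys(1)[of n] ys(2)] by simp
  then have "(\<lambda>n. B (xs n) (ys n) - B x y) \<longlonglongrightarrow> 0"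
    by (intro Lim_null_comparison[OF always_eventually lim]) simp
  then show ?thesis by (simp add: LIM_zero_iff)
qed

lemma bilinear_time_integrable:
  assumes X: "seminormed X N" and Y: "seminormed Y M"
    and B1: "\<And>x x' y. x \<in> X \<Longrightarrow> x' \<in> X \<Longrightarrow> y \<in> Y \<Longrightarrow> B (\<lambda>a. x a - x' a) y = B x y - B x' y"
    and B2: "\<And>x y y'. x \<in> X \<Longrightarrow> y \<in> Y \<Longrightarrow> y' \<in> Y \<Longrightarrow> B x (\<lambda>a. y a - y' a) = B x y - (B x y' :: real)"
    and bd: "\<And>x y. x \<in> X \<Longrightarrow> y \<in> Y \<Longrightarrow> \<bar>B x y\<bar> \<le> N x * M y"
    and f: "f \<in> L2_time T X N" and g: "g \<in> L2_time T Y M"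
  shows "integrable (time T) (\<lambda>t. B (f t) (g t))"
proof (rule Bochner_Integration.integrable_bound)
  show "integrable (time T) (\<lambda>t. norm (N (f t)) * norm (M (g t)))"
    by (rule interval.L2_norm_prod_integrable[OF seminormed.L2_time_norm[OF X f] seminormed.L2_time_norm[OF Y g]])
  show "(\<lambda>t. B (f t) (g t)) \<in> borel_measurable (time T)"
    by (rule strongly_measurable_form[OF L2_time_strongly_measurable[OF f] L2_time_strongly_measurable[OF g] L2_time_strongly_measurable[OF g],
          where B="\<lambda>x y z. B x y"])
      (rule bilinear_LIMSEQ[OF X Y B1 B2 bd])
  show "AE t in time T. norm (B (f t) (g t)) \<le> norm (norm (N (f t)) * norm (M (g t)))"
    using L2_time_mem[OF f] L2_time_mem[OF g]
  proof eventually_elim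
    case (elim t)
    show ?case using bd[OF elim] seminormed.nonneg[OF X elim(1)] seminormed.nonneg[OF Y elim(2)] by simp
  qed
qed

text \<open>Statements of the form "for each \<open>r\<close>, for almost all \<open>a, b\<close>" can be made uniform: a strongly
  measurable function has essentially separable range, so if the statement survives limits of \<open>f r\<close>
  then countably many \<open>r\<close> decide it, and one null set serves all of them.\<close>

lemma (in seminormed) common_null_set:
  assumes f: "strongly_measurable X N T f" and G0: "AE t in time T. t \<in> G0"
    and ex: "\<And>r. r \<in> G0 \<Longrightarrow> \<exists>H. (AE t in time T. t \<in> H) \<and> (\<forall>a\<in>H. \<forall>b\<in>H. Q a b r)"
    and closed: "\<And>a b r rs. a \<in> G0 \<Longrightarrow> b \<in> G0 \<Longrightarrow> r \<in> G0 \<Longrightarrow> (\<And>n::nat. rs n \<in> G0) \<Longrightarrow>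
      (\<lambda>n. N (\<lambda>x. f (rs n) x - f r x)) \<longlonglongrightarrow> 0 \<Longrightarrow> (\<And>n. Q a b (rs n)) \<Longrightarrow> Q a b r"
  shows "\<exists>G\<subseteq>G0. (AE t in time T. t \<in> G) \<and> (\<forall>a\<in>G. \<forall>b\<in>G. \<forall>r\<in>G. Q a b r)"
proof -
  obtain s where s: "\<And>n. simple_in X T (s n)" "AE t in time T. (\<lambda>n. N (\<lambda>a. s n t a - f t a)) \<longlonglongrightarrow> 0"
    using f unfolding strongly_measurable_def by blast
  define G1 where "G1 = {t \<in> {0<..<T}. t \<in> G0 \<and> f t \<in> X \<and> (\<lambda>n. N (\<lambda>a. s n t a - f t a)) \<longlonglongrightarrow> 0}"
  have "AE t in time T. f t \<in> X" using f by (simp add: strongly_measurable_def)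
  then have G1: "AE t in time T. t \<in> G1"
    using G0 s(2) AE_space by eventually_elim (simp add: G1_def)
  define D where "D = (\<Union>n. s n ` {0<..<T})"
  have D: "countable D"
    unfolding D_def
  proof (rule countable_UN[OF countableI_type], rule countable_finite)
    fix n
    have "simple_function (time T) (s n)" using s(1)[of n] by (simp add: simple_in_def)
    from simple_functionD(1)[OF this] show "finite (s n ` {0<..<T})" by simp
  qed
  have DX: "D \<subseteq> X" unfolding D_def using s(1) by (auto simp: simple_in_def)
  \<comment> \<open>Values of \<open>f\<close> at suitable times take over the role of the dense countable set \<open>D\<close>.\<close>
  define c where "c d n = (SOME r. r \<in> G1 \<and> N (\<lambda>x. d x - f r x) < inverse (real (Suc n)))" for d n
  define R where "R = {r \<in> G1. \<exists>d\<in>D. \<exists>n. r = c d n}"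
  have "R \<subseteq> (\<lambda>(d, n). c d n) ` (D \<times> UNIV)" unfolding R_def by auto
  then have R: "countable R" by (rule countable_subset) (intro countable_image countable_SIGMA D countableI_type)
  have "\<forall>r\<in>R. \<exists>H. (AE t in time T. t \<in> H) \<and> (\<forall>a\<in>H. \<forall>b\<in>H. Q a b r)"
    using ex by (auto simp: R_def G1_def)
  then obtain H where H: "\<And>r. r \<in> R \<Longrightarrow> AE t in time T. t \<in> H r" "\<And>r a b. r \<in> R \<Longrightarrow> a \<in> H r \<Longrightarrow> b \<in> H r \<Longrightarrow> Q a b r"
    by metis
  define G where "G = {t \<in> G1. \<forall>r\<in>R. t \<in> H r}"
  have "AE t in time T. \<forall>r\<in>R. t \<in> H r"
    using R H(1) by (simp add: AE_ball_countable)
  then have AEG: "AE t in time T. t \<in> G"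
    using G1 by eventually_elim (simp add: G_def)
  have "Q a b r" if abr: "a \<in> G" "b \<in> G" "r \<in> G" for a b r
  proof -
    have r: "f r \<in> X" "(\<lambda>n. N (\<lambda>a. s n r a - f r a)) \<longlonglongrightarrow> 0" "r \<in> {0<..<T}" "r \<in> G1"
      using abr(3) by (auto simp: G_def G1_def)
    have "\<exists>r'\<in>R. N (\<lambda>x. f r' x - f r x) \<le> 2 * inverse (real (Suc n))" for n
    proof -
      obtain m where m: "N (\<lambda>a. s m r a - f r a) < inverse (real (Suc n))"
        using order_tendstoD(2)[OF r(2), of "inverse (real (Suc n))"] eventually_happens'[OF sequentially_bot] by fastforce
      let ?d = "s m r"
      have d: "?d \<in> D" using r(3) unfolding D_def by blast
      have "c ?d n \<in> G1 \<and> N (\<lambda>x. ?d x - f (c ?d n) x) < inverse (real (Suc n))"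
        unfolding c_def by (rule someI[of _ r]) (use m r(4) in auto)
      then have cc: "c ?d n \<in> R" "c ?d n \<in> G1" "N (\<lambda>x. ?d x - f (c ?d n) x) < inverse (real (Suc n))"
        using d by (auto simp: R_def)
      have X: "f (c ?d n) \<in> X" "?d \<in> X" using cc(2) d DX by (auto simp: G1_def)
      have "N (\<lambda>x. f (c ?d n) x - f r x) \<le> N (\<lambda>x. f (c ?d n) x - ?d x) + N (\<lambda>x. ?d x - f r x)"
        by (rule diff_triangle[OF X r(1)])
      also have "\<dots> \<le> 2 * inverse (real (Suc n))"
        using m cc(3) norm_minus_commute[OF X] by linarith
      finally show ?thesis using cc(1) by blast
    qed
    then obtain rs where rs: "\<And>n. rs n \<in> R" "\<And>n. N (\<lambda>x. f (rs n) x - f r x) \<le> 2 * inverse (real (Suc n))"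
      by metis
    have rG: "rs n \<in> G0" "f (rs n) \<in> X" for n using rs(1)[of n] by (auto simp: R_def G1_def)
    have "(\<lambda>n. N (\<lambda>x. f (rs n) x - f r x)) \<longlonglongrightarrow> 0"
    proof (rule tendsto_sandwich[OF _ _ tendsto_const])
      show "(\<lambda>n. 2 * inverse (real (Suc n))) \<longlonglongrightarrow> 0"
        using tendsto_mult_right_zero[OF LIMSEQ_inverse_real_of_nat] .
      show "\<forall>\<^sub>F n in sequentially. 0 \<le> N (\<lambda>x. f (rs n) x - f r x)"
        using nonneg[OF diff_mem[OF rG(2) r(1)]] by simp
    qed (use rs(2) in simp)
    then show ?thesis
    proof (rule closed[rotated -2])
      show "Q a b (rs n)" for n using H(2)[OF rs(1)[of n]] abr rs(1)[of n] by (simp add: G_def)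
    qed (use abr rG in \<open>auto simp: G_def G1_def\<close>)
  qed
  moreover have "G \<subseteq> G0" by (auto simp: G_def G1_def)
  ultimately show ?thesis using AEG by blast
qed

section \<open>Primitives of integrable functions of time\<close>

lemma time_integral:
  fixes g :: "real \<Rightarrow> real"
  assumes g: "integrable (time T) g" and ab: "0 \<le> a" "b \<le> T"
  shows "g absolutely_integrable_on {a..b}" "g integrable_on {a..b}"
    "integral {a..b} g = (LINT t|time T. indicator {a<..<b} t * g t)"
proof -
  have "set_integrable lebesgue {0<..<T} g"
    using g by (simp add: integrable_restrict_space set_integrable_def)
  then have s: "set_integrable lebesgue {a<..<b} g"
    by (rule set_integrable_subset) (use ab in auto)
  then show ai: "g absolutely_integrable_on {a..b}"
    using absolutely_integrable_on_open_interval[of a b g] by (simp add: box_real)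
  then show "g integrable_on {a..b}" using absolutely_integrable_on_def by blast
  have "(LINT t|time T. indicator {a<..<b} t * g t) = (LINT t|lebesgue. indicator {0<..<T} t *\<^sub>R (indicator {a<..<b} t * g t))"
    by (subst integral_restrict_space) auto
  also have "\<dots> = (LINT t:{a<..<b}|lebesgue. g t)"
    unfolding set_lebesgue_integral_def
    by (intro Bochner_Integration.integral_cong refl) (use ab in \<open>auto split: split_indicator\<close>)
  also have "\<dots> = integral {a<..<b} g" by (rule set_lebesgue_integral_eq_integral(2)[OF s])
  also have "\<dots> = integral {a..b} g" using integral_open_interval[of a b g] by (simp add: box_real)
  finally show "integral {a..b} g = (LINT t|time T. indicator {a<..<b} t * g t)" by simp
qed

lemma time_integrable_indicator:
  fixes g :: "real \<Rightarrow> real"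
  assumes "integrable (time T) g" "0 \<le> a" "b \<le> T"
  shows "integrable (time T) (\<lambda>t. indicator {a<..<b} t * g t)"
proof -
  have "{a<..<b} \<in> sets (time T)" using assms(2,3) by (auto simp: sets_restrict_space_iff)
  from integrable_mult_indicator[OF this assms(1)] show ?thesis by simp
qed

lemma time_integral_le:
  assumes "integrable (time T) g" "integrable (time T) h" "0 \<le> a" "b \<le> T" "AE t in time T. a < t \<longrightarrow> t < b \<longrightarrow> g t \<le> h t"
  shows "integral {a..b} g \<le> integral {a..b} (h :: real \<Rightarrow> real)"
proof -
  note i = time_integrable_indicator[OF _ assms(3,4)]
  show ?thesis
    unfolding time_integral(3)[OF assms(1,3,4)] time_integral(3)[OF assms(2,3,4)]
  proof (rule integral_mono_AE[OF i[OF assms(1)] i[OF assms(2)]])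
    show "AE t in time T. indicator {a<..<b} t * g t \<le> indicator {a<..<b} t * h t"
      using assms(5) by eventually_elim (simp split: split_indicator)
  qed
qed

lemma time_integral_nonneg:
  fixes h :: "real \<Rightarrow> real"
  assumes "integrable (time T) h" "0 \<le> a" "b \<le> T" "AE t in time T. 0 \<le> h t"
  shows "0 \<le> integral {a..b} h"
proof -
  have "AE t in time T. a < t \<longrightarrow> t < b \<longrightarrow> 0 \<le> h t" using assms(4) by eventually_elim simp
  from time_integral_le[OF integrable_zero assms(1-3) this] show ?thesis by simp
qed

lemma time_integral_cong:
  assumes "integrable (time T) g" "integrable (time T) h" "0 \<le> a" "b \<le> T" "AE t in time T. a < t \<longrightarrow> t < b \<longrightarrow> g t = h t"
  shows "integral {a..b} g = integral {a..b} (h :: real \<Rightarrow> real)"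
proof (rule antisym)
  show "integral {a..b} g \<le> integral {a..b} h"
    by (rule time_integral_le[OF assms(1-4)]) (use assms(5) in \<open>eventually_elim, auto\<close>)
  show "integral {a..b} h \<le> integral {a..b} g"
    by (rule time_integral_le[OF assms(2,1,3,4)]) (use assms(5) in \<open>eventually_elim, auto\<close>)
qed

lemma time_integral_abs_le:
  assumes "integrable (time T) g" "integrable (time T) h" "0 \<le> a" "b \<le> T" "AE t in time T. a < t \<longrightarrow> t < b \<longrightarrow> \<bar>g t\<bar> \<le> h t"
  shows "\<bar>integral {a..b} g\<bar> \<le> integral {a..b} (h :: real \<Rightarrow> real)"
proof -
  have "integral {a..b} g \<le> integral {a..b} h"
    by (rule time_integral_le[OF assms(1-4)]) (use assms(5) in \<open>eventually_elim, auto\<close>)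
  moreover have "integral {a..b} (\<lambda>t. - g t) \<le> integral {a..b} h"
    by (rule time_integral_le[OF _ assms(2-4)]) (use assms(1) in simp, use assms(5) in \<open>eventually_elim, auto\<close>)
  ultimately show ?thesis by simp
qed

lemma time_integral_combine:
  fixes g :: "real \<Rightarrow> real"
  assumes "integrable (time T) g" "0 \<le> a" "a \<le> b" "b \<le> c" "c \<le> T"
  shows "integral {a..b} g + integral {b..c} g = integral {a..c} g"
  using Henstock_Kurzweil_Integration.integral_combine[OF assms(3,4) time_integral(2)[OF assms(1,2,5)]] .

lemma time_integral_continuous:
  fixes g :: "real \<Rightarrow> real"
  assumes "integrable (time T) g"
  shows "continuous_on {0..T} (\<lambda>t. integral {0..t} g)"
  by (rule indefinite_integral_continuous_1[OF time_integral(2)[OF assms]]) auto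

lemma smooth_has_real_derivative:
  fixes \<phi> :: "real \<Rightarrow> real"
  assumes "smooth \<phi>"
  shows "(\<phi> has_real_derivative dir_deriv 1 \<phi> t) (at t)" "deriv \<phi> t = dir_deriv 1 \<phi> t"
proof -
  have d: "(\<phi> has_derivative (\<lambda>b. dir_deriv b \<phi> t)) (at t)"
    using has_derivative_dir_deriv[OF smooth_differentiable[OF assms]] .
  have "dir_deriv h \<phi> t = dir_deriv 1 \<phi> t * h" for h
    using linear_scale[OF has_derivative_linear[OF d], of h 1] by simp
  then have e: "(\<lambda>b. dir_deriv b \<phi> t) = (\<lambda>h. dir_deriv 1 \<phi> t * h)" by (rule ext)
  show "(\<phi> has_real_derivative dir_deriv 1 \<phi> t) (at t)"
    using d unfolding e has_field_derivative_def by simp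
  then show "deriv \<phi> t = dir_deriv 1 \<phi> t" by (rule DERIV_imp_deriv)
qed

lemma test_functions_FTC:
  fixes \<phi> :: "real \<Rightarrow> real"
  assumes "\<phi> \<in> test_functions {0<..<T}" "a \<le> b"
  shows "integral {a..b} (dir_deriv 1 \<phi>) = \<phi> b - \<phi> a"
proof (rule integral_unique)
  have "(\<phi> has_vector_derivative dir_deriv 1 \<phi> x) (at x within {a..b})" for x
    using smooth_has_real_derivative(1)[OF test_functions_smooth[OF assms(1)], of x]
    by (simp add: has_real_derivative_iff_has_vector_derivative has_vector_derivative_at_within)
  then show "(dir_deriv 1 \<phi> has_integral \<phi> b - \<phi> a) {a..b}"
    using assms(2) by (intro fundamental_theorem_of_calculus)
qed

text \<open>Fubini over the triangle \<open>s < t\<close>.\<close>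

lemma integral_by_parts_primitive:
  fixes g :: "real \<Rightarrow> real"
  assumes g: "integrable (time T) g" and \<phi>: "\<phi> \<in> test_functions {0<..<T}"
  shows "(LINT t|time T. dir_deriv 1 \<phi> t * integral {0..t} g) = - (LINT t|time T. \<phi> t * g t)"
proof -
  let ?M = "time T" and ?d = "dir_deriv 1 \<phi>"
  have d: "?d \<in> test_functions {0<..<T}" by (rule test_functions_dir_deriv[OF \<phi>]) simp
  obtain B where B: "\<And>t. \<bar>?d t\<bar> \<le> B" "B \<ge> 0" using test_functions_bounded[OF d] by metis
  have di: "integrable ?M ?d" by (rule interval.integral_test_lborel(2)[OF d])
  have dm: "?d \<in> borel_measurable ?M" and gm: "g \<in> borel_measurable ?M"
    using di g by auto
  interpret F: finite_measure ?M by (rule finite_measure_time)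
  interpret P: pair_sigma_finite ?M ?M ..
  define f where "f s t = (if s < t then g s * ?d t else 0)" for s t
  have idm: "(\<lambda>t. t) \<in> borel_measurable ?M" using id_borel_measurable_lebesgue_on by (simp add: id_def)
  have fm: "(\<lambda>(s, t). f s t) \<in> borel_measurable (?M \<Otimes>\<^sub>M ?M)"
    unfolding f_def using idm gm dm by measurable
  have fi: "integrable (?M \<Otimes>\<^sub>M ?M) (\<lambda>(s, t). f s t)"
  proof (rule P.Fubini_integrable[OF fm])
    have inn: "integrable ?M (\<lambda>t. f s t)" for s
    proof (rule Bochner_Integration.integrable_bound)
      show "integrable ?M (\<lambda>t. \<bar>g s\<bar> * B)" by simp
      show "(\<lambda>t. f s t) \<in> borel_measurable ?M" unfolding f_def using idm dm by measurable
      show "AE t in ?M. norm (f s t) \<le> norm (\<bar>g s\<bar> * B)"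
        using B by (intro AE_I2) (auto simp: f_def abs_mult intro: mult_left_mono)
    qed
    then show "AE s in ?M. integrable ?M (\<lambda>t. (\<lambda>(s, t). f s t) (s, t))" by simp
    show "integrable ?M (\<lambda>s. LINT t|?M. norm ((\<lambda>(s, t). f s t) (s, t)))"
    proof (rule Bochner_Integration.integrable_bound)
      show "integrable ?M (\<lambda>s. g s * (B * measure ?M (space ?M)))" using g by simp
      show "(\<lambda>s. LINT t|?M. norm ((\<lambda>(s, t). f s t) (s, t))) \<in> borel_measurable ?M"
        by (rule F.borel_measurable_lebesgue_integral) (use fm in \<open>simp add: case_prod_beta'\<close>)
      have "\<bar>LINT t|?M. \<bar>f s t\<bar>\<bar> \<le> \<bar>g s * (B * measure ?M (space ?M))\<bar>" for s
      proof -
        have "(LINT t|?M. \<bar>f s t\<bar>) \<le> (LINT t|?M. \<bar>g s\<bar> * B)"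
          by (rule integral_mono) (use inn B in \<open>auto simp: f_def abs_mult intro: mult_left_mono\<close>)
        moreover have "0 \<le> (LINT t|?M. \<bar>f s t\<bar>)" by (simp add: integral_nonneg_AE)
        ultimately show ?thesis using B(2) by (simp add: abs_mult mult.commute mult.left_commute)
      qed
      then show "AE s in ?M. norm (LINT t|?M. norm ((\<lambda>(s, t). f s t) (s, t))) \<le> norm (g s * (B * measure ?M (space ?M)))"
        by simp
    qed
  qed
  have 1: "(LINT s|?M. f s t) = ?d t * integral {0..t} g" if t: "t \<in> {0<..<T}" for t
  proof -
    have "(LINT s|?M. f s t) = (LINT s|?M. ?d t * (indicator {0<..<t} s * g s))"
      by (rule Bochner_Integration.integral_cong) (auto simp: f_def split: split_indicator)
    then show ?thesis using t time_integral(3)[OF g, of 0 t] by simp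
  qed
  have 2: "(LINT t|?M. f s t) = - (\<phi> s * g s)" if s: "s \<in> {0<..<T}" for s
  proof -
    have "(LINT t|?M. f s t) = (LINT t|?M. g s * (indicator {s<..<T} t * ?d t))"
      by (rule Bochner_Integration.integral_cong) (auto simp: f_def split: split_indicator)
    also have "\<dots> = g s * integral {s..T} ?d" using s time_integral(3)[OF di, of s T] by simp
    also have "integral {s..T} ?d = \<phi> T - \<phi> s" using s by (intro test_functions_FTC[OF \<phi>]) auto
    also have "\<phi> T = 0" using test_functions_support[OF \<phi>] by (metis greaterThanLessThan_iff less_irrefl subsetD)
    finally show ?thesis by simp
  qed
  have "(LINT t|?M. ?d t * integral {0..t} g) = (LINT t|?M. LINT s|?M. f s t)"
    by (rule Bochner_Integration.integral_cong) (use 1 in auto)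
  also have "\<dots> = (LINT s|?M. LINT t|?M. f s t)" by (rule P.Fubini_integral[OF fi])
  also have "\<dots> = (LINT s|?M. - (\<phi> s * g s))"
    by (rule Bochner_Integration.integral_cong) (use 2 in auto)
  finally show ?thesis by simp
qed

lemma locally_integrable_time:
  assumes "integrable (time T) (F :: real \<Rightarrow> real)"
  shows "locally_integrable {0<..<T} F"
proof -
  have "set_integrable lebesgue {0<..<T} F"
    using assms by (simp add: integrable_restrict_space set_integrable_def)
  then show ?thesis
    unfolding locally_integrable_def
    by (intro allI impI, elim set_integrable_subset) (auto simp: borel_compact)
qed

text \<open>Test functions of mean zero are derivatives of test functions, so a function orthogonal to all
  derivatives is orthogonal to mean-zero test functions and hence constant.\<close>

lemma weakly_constant:
  assumes T: "T > 0" and F: "integrable (time T) F"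
    and orth: "\<And>\<phi>. \<phi> \<in> test_functions {0<..<T} \<Longrightarrow> (LINT t|time T. dir_deriv 1 \<phi> t * F t) = 0"
  shows "\<exists>c. AE t in time T. F t = (c::real)"
proof -
  define \<psi>1 where "\<psi>1 = box_bump 0 (T / 4) (3 * T / 4)"
  have \<psi>1: "\<psi>1 \<in> test_functions {0<..<T}"
    unfolding \<psi>1_def by (rule box_bump_test_functions) (use T in auto)
  have "0 < (LINT t|lborel. \<psi>1 t)"
  proof -
    have "(LINT t|lborel. \<psi>1 t) \<noteq> 0"
    proof
      assume "(LINT t|lborel. \<psi>1 t) = 0"
      then have "AE t in lborel. \<psi>1 t = 0"
        using integral_nonneg_eq_0_iff_AE[OF test_functions_integrable[OF \<psi>1]]
        by (simp add: \<psi>1_def box_bump_bounds)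
      then have "AE t in lborel. t \<notin> box (T / 4) (3 * T / 4)"
        using box_bump_nonzero[of 0 "T / 4" "3 * T / 4"] unfolding \<psi>1_def by (elim eventually_mono) blast
      then have "box (T / 4) (3 * T / 4) \<in> null_sets lborel" by (subst AE_iff_null_sets) auto
      then show False using T by (auto simp: null_sets_def emeasure_lborel_Ioo)
    qed
    moreover have "0 \<le> (LINT t|lborel. \<psi>1 t)" by (simp add: \<psi>1_def box_bump_bounds integral_nonneg_AE)
    ultimately show ?thesis by simp
  qed
  then have m: "0 < (LINT t|time T. \<psi>1 t)" by (simp add: interval.integral_test_lborel(1)[OF \<psi>1])
  define \<psi>0 where "\<psi>0 t = inverse (LINT t|time T. \<psi>1 t) * \<psi>1 t" for t
  have \<psi>0: "\<psi>0 \<in> test_functions {0<..<T}"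
    unfolding \<psi>0_def[abs_def] by (rule test_functions_scale[OF \<psi>1])
  have \<psi>0_1: "(LINT t|time T. \<psi>0 t) = 1" unfolding \<psi>0_def using m by simp
  have antider: "\<exists>\<Phi>\<in>test_functions {0<..<T}. dir_deriv 1 \<Phi> = \<eta>"
    if \<eta>: "\<eta> \<in> test_functions {0<..<T}" and mean: "(LINT t|time T. \<eta> t) = 0" for \<eta>
  proof -
    have "\<exists>F. \<forall>x::real. - \<infinity> < ereal x \<longrightarrow> ereal x < \<infinity> \<longrightarrow> (F has_vector_derivative \<eta> x) (at x)"
      by (rule einterval_antiderivative)
        (use smooth_continuous[OF test_functions_smooth[OF \<eta>], of UNIV] in \<open>auto simp: continuous_on_eq_continuous_at\<close>)
    then obtain \<Phi>1 where \<Phi>1: "\<And>x. (\<Phi>1 has_vector_derivative \<eta> x) (at x)" by auto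
    define \<Phi> where "\<Phi> x = \<Phi>1 x - \<Phi>1 0" for x
    have \<Phi>: "(\<Phi> has_real_derivative \<eta> x) (at x)" for x
      unfolding \<Phi>_def using \<Phi>1[of x]
      by (auto intro!: derivative_eq_intros simp: has_real_derivative_iff_has_vector_derivative)
    have dd: "dir_deriv 1 \<Phi> = \<eta>"
      by (rule ext) (use dir_deriv_eq[OF \<Phi>[unfolded has_field_derivative_def], of 1] in simp)
    have sm: "smooth \<Phi>"
    proof (rule smooth_coinduct[where A="insert \<Phi> {f. smooth f}"])
      fix f :: "real \<Rightarrow> real" and b x :: real assume f: "f \<in> insert \<Phi> {f. smooth f}"
      show "f differentiable at x"
        using f \<Phi>[of x] smooth_differentiable[of f x] by (auto simp: real_differentiable_def)
      assume b: "b \<in> Basis"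
      show "dir_deriv b f \<in> insert \<Phi> {f. smooth f}"
        using f b dd test_functions_smooth[OF \<eta>] smooth_dir_deriv[of f b] by auto
    qed simp
    obtain K where K: "compact K" "K \<subseteq> {0<..<T}" "\<And>x. x \<notin> K \<Longrightarrow> \<eta> x = 0"
      using test_functions_support[OF \<eta>] by metis
    have Kc: "compact (insert (T / 2) K)" using K(1) by (rule compact_insert)
    obtain a where a: "a \<in> insert (T / 2) K" "\<And>x. x \<in> insert (T / 2) K \<Longrightarrow> a \<le> x"
      using compact_attains_inf[OF Kc] by blast
    obtain b where b: "b \<in> insert (T / 2) K" "\<And>x. x \<in> insert (T / 2) K \<Longrightarrow> x \<le> b"
      using compact_attains_sup[OF Kc] by blast
    have ab: "0 < a" "a \<le> b" "b < T" using a b K(2) T by auto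
    have ftc: "(\<eta> has_integral \<Phi> d - \<Phi> c) {c..d}" if "c \<le> d" for c d
      by (rule fundamental_theorem_of_calculus[OF that])
        (use \<Phi> in \<open>auto simp: has_real_derivative_iff_has_vector_derivative[symmetric] intro: has_field_derivative_at_within\<close>)
    have \<Phi>T: "\<Phi> T = \<Phi> 0"
    proof -
      have "integral {0..T} \<eta> = 0"
        using time_integral(3)[OF interval.integral_test_lborel(2)[OF \<eta>], of 0 T] mean
          Bochner_Integration.integral_cong[OF refl, of "time T" "\<lambda>t. indicator {0<..<T} t * \<eta> t" \<eta>] by simp
      then show ?thesis using integral_unique[OF ftc[of 0 T]] T by simp
    qed
    have z: "\<Phi> x = 0" if x: "x \<notin> {a..b}" for x
    proof -
      have const: "\<Phi> c = \<Phi> d" if "c \<le> d" "{c..d} \<inter> K = {}" for c d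
      proof -
        have "integral {c..d} \<eta> = integral {c..d} (\<lambda>x. 0)"
          by (rule integral_cong) (use that K(3) in blast)
        then show ?thesis using integral_unique[OF ftc[OF that(1)]] by simp
      qed
      consider "x < a" | "x > b" using x by force
      then show ?thesis
      proof cases
        case 1
        then have "{min x 0..max x 0} \<inter> K = {}" using a(2) ab by force
        then have "\<Phi> (min x 0) = \<Phi> (max x 0)" by (intro const) auto
        then have "\<Phi> x = \<Phi> 0" by (cases "x \<le> 0") (auto simp: min_def max_def)
        then show ?thesis by (simp add: \<Phi>_def)
      next
        case 2
        then have "{min x T..max x T} \<inter> K = {}" using b(2) ab by force
        then have "\<Phi> (min x T) = \<Phi> (max x T)" by (intro const) auto
        then have "\<Phi> x = \<Phi> T" by (cases "x \<le> T") (auto simp: min_def max_def)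
        then show ?thesis using \<Phi>T by (simp add: \<Phi>_def)
      qed
    qed
    have "\<Phi> \<in> test_functions {0<..<T}"
      by (rule test_functionsI[OF sm compact_Icc[of a b]]) (use ab z in auto)
    then show ?thesis using dd by blast
  qed
  define c where "c = (LINT t|time T. \<psi>0 t * F t)"
  have Fc: "integrable (time T) (\<lambda>t. F t - c)"
    by (intro Bochner_Integration.integrable_diff F finite_measure.integrable_const[OF finite_measure_time])
  have "AE t in time T. F t - c = 0"
  proof (rule fundamental_lemma_variations[OF interval.open_domain locally_integrable_time[OF Fc]])
    fix \<psi> :: "real \<Rightarrow> real" assume \<psi>: "\<psi> \<in> test_functions {0<..<T}"
    let ?m = "LINT t|time T. \<psi> t"
    note i0 = interval.integral_test_lborel(2)[OF \<psi>0] and i = interval.integral_test_lborel(2)[OF \<psi>]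
    have p: "integrable (time T) (\<lambda>t. F t * \<phi> t)" if "\<phi> \<in> test_functions {0<..<T}" for \<phi>
      by (rule interval.locally_integrable_test[OF locally_integrable_time[OF F] that])
    have "(\<lambda>t. \<psi> t + (- ?m) * \<psi>0 t) \<in> test_functions {0<..<T}"
      by (rule test_functions_add[OF \<psi> test_functions_scale[OF \<psi>0]])
    moreover have "(LINT t|time T. \<psi> t + (- ?m) * \<psi>0 t) = 0"
      using i i0 \<psi>0_1 by simp
    ultimately obtain \<Phi> where "\<Phi> \<in> test_functions {0<..<T}" "dir_deriv 1 \<Phi> = (\<lambda>t. \<psi> t + (- ?m) * \<psi>0 t)"
      using antider by blast
    then have "(LINT t|time T. (\<psi> t + (- ?m) * \<psi>0 t) * F t) = 0" using orth by metis
    then have "(LINT t|time T. F t * \<psi> t - ?m * (F t * \<psi>0 t)) = 0" by (simp add: algebra_simps)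
    then have "(LINT t|time T. F t * \<psi> t) = ?m * c"
      using p[OF \<psi>] p[OF \<psi>0] by (simp add: c_def mult.commute)
    then show "(LINT t|time T. (F t - c) * \<psi> t) = 0"
      using p[OF \<psi>] i by (simp add: left_diff_distrib)
  qed
  then show ?thesis by (intro exI[of _ c]) simp
qed

lemma weak_derivative_primitive:
  fixes f g :: "real \<Rightarrow> real"
  assumes T: "T > 0" and f: "integrable (time T) f" and g: "integrable (time T) g"
    and wd: "\<And>\<phi>. \<phi> \<in> test_functions {0<..<T} \<Longrightarrow> (LINT t|time T. deriv \<phi> t * f t) = - (LINT t|time T. \<phi> t * g t)"
  shows "\<exists>c. AE t in time T. f t = c + integral {0..t} g"
proof -
  let ?G = "\<lambda>t. integral {0..t} g"
  have "compact (?G ` {0..T})"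
    by (intro compact_continuous_image time_integral_continuous[OF g] compact_Icc)
  then obtain B where B: "\<And>t. t \<in> {0..T} \<Longrightarrow> \<bar>?G t\<bar> \<le> B"
    using compact_imp_bounded bounded_iff by (metis (no_types, lifting) imageI real_norm_def)
  have Gm: "?G \<in> borel_measurable (time T)"
    by (rule continuous_imp_measurable_on_sets_lebesgue)
      (rule continuous_on_subset[OF time_integral_continuous[OF g]], auto)
  have Gi: "integrable (time T) ?G"
    by (rule finite_measure.integrable_const_bound[OF finite_measure_time _ Gm, of B])
      (use B in \<open>auto intro!: AE_I2\<close>)
  have "(LINT t|time T. dir_deriv 1 \<phi> t * (f t - ?G t)) = 0" if \<phi>: "\<phi> \<in> test_functions {0<..<T}" for \<phi>
  proof -
    have d: "dir_deriv 1 \<phi> \<in> test_functions {0<..<T}" by (rule test_functions_dir_deriv[OF \<phi>]) simp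
    have p: "integrable (time T) (\<lambda>t. dir_deriv 1 \<phi> t * F t)" if "integrable (time T) F" for F
      using interval.locally_integrable_test[OF locally_integrable_time[OF that] d] by (simp add: mult.commute)
    have "(LINT t|time T. dir_deriv 1 \<phi> t * f t) = - (LINT t|time T. \<phi> t * g t)"
      using wd[OF \<phi>] smooth_has_real_derivative(2)[OF test_functions_smooth[OF \<phi>]] by simp
    moreover have "(LINT t|time T. dir_deriv 1 \<phi> t * ?G t) = - (LINT t|time T. \<phi> t * g t)"
      by (rule integral_by_parts_primitive[OF g \<phi>])
    ultimately show ?thesis using p[OF f] p[OF Gi] by (simp add: right_diff_distrib)
  qed
  from weakly_constant[OF T Bochner_Integration.integrable_diff[OF f Gi] this]
  obtain c where c: "AE t in time T. f t - ?G t = c" by blast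
  show ?thesis by (rule exI[of _ c]) (use c in eventually_elim, simp)
qed

text \<open>Integrating by parts, \<open>h\<close> is orthogonal to all test functions because derivatives of test functions
  have mean zero.\<close>

lemma primitive_zero_imp_zero:
  fixes h :: "real \<Rightarrow> real"
  assumes h: "integrable (time T) h" and c: "AE t in time T. integral {0..t} h = c"
  shows "AE t in time T. h t = 0"
proof (rule fundamental_lemma_variations[OF interval.open_domain locally_integrable_time[OF h]])
  fix \<phi> :: "real \<Rightarrow> real" assume \<phi>: "\<phi> \<in> test_functions {0<..<T}"
  have d: "dir_deriv 1 \<phi> \<in> test_functions {0<..<T}" by (rule test_functions_dir_deriv[OF \<phi>]) simp
  have e: "AE t in time T. dir_deriv 1 \<phi> t * c = dir_deriv 1 \<phi> t * integral {0..t} h"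
    using c by eventually_elim simp
  have m: "(\<lambda>t. dir_deriv 1 \<phi> t * c) \<in> borel_measurable (time T)"
    using interval.integral_test_lborel(2)[OF d] by auto
  have "- (LINT t|time T. \<phi> t * h t) = (LINT t|time T. dir_deriv 1 \<phi> t * integral {0..t} h)"
    using integral_by_parts_primitive[OF h \<phi>] by simp
  also have "\<dots> = (LINT t|time T. dir_deriv 1 \<phi> t * c)"
    by (rule integral_cong_AE[OF m interval.measurable_AE_eq[OF m e] e, symmetric])
  also have "\<dots> = 0"
    using interval.integral_test_lborel(1)[OF d] integral_dir_deriv[OF \<phi>, of 1] by simp
  finally show "(LINT t|time T. h t * \<phi> t) = 0" by (simp add: mult.commute)
qed

text \<open>Absolute continuity with the explicit modulus \<open>\<surd>\<delta> \<parallel>g\<parallel>\<close>, by the Cauchy-Schwarz inequality on the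
  union of the intervals.\<close>

lemma primitive_abs_continuous:
  assumes T: "T > 0" and g: "g \<in> L2 {0<..<T}" "integrable (time T) (g :: real \<Rightarrow> real)"
  shows "abs_continuous 0 T (\<lambda>t. c + integral {0..t} g)"
  unfolding abs_continuous_def
proof (intro allI impI)
  fix \<epsilon> :: real assume \<epsilon>: "\<epsilon> > 0"
  let ?N = "l2_norm {0<..<T} g"
  define \<delta> where "\<delta> = (\<epsilon> / (?N + 1))\<^sup>2"
  have N: "?N \<ge> 0" by (rule interval.l2_norm_nonneg)
  have \<delta>: "\<delta> > 0" unfolding \<delta>_def using \<epsilon> N by (intro zero_less_power divide_pos_pos) auto
  show "\<exists>\<delta>>0. \<forall>(n::nat) l r. (\<forall>i<n. 0 \<le> l i \<and> l i \<le> r i \<and> r i \<le> T) \<longrightarrow>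
     disjoint_family_on (\<lambda>i. {l i<..<r i}) {..<n} \<longrightarrow> (\<Sum>i<n. r i - l i) < \<delta> \<longrightarrow>
     (\<Sum>i<n. \<bar>(c + integral {0..r i} g) - (c + integral {0..l i} g)\<bar>) < \<epsilon>"
  proof (intro exI[of _ \<delta>] conjI \<delta> allI impI)
    fix n :: nat and l r :: "nat \<Rightarrow> real"
    assume lr: "\<forall>i<n. 0 \<le> l i \<and> l i \<le> r i \<and> r i \<le> T"
      and disj: "disjoint_family_on (\<lambda>i. {l i<..<r i}) {..<n}" and small: "(\<Sum>i<n. r i - l i) < \<delta>"
    define I where "I t = (\<Sum>i<n. indicator {l i<..<r i} t :: real)" for t
    have ii: "integrable (time T) (indicator {a<..<b} :: real \<Rightarrow> real)" "(LINT t|time T. indicator {a<..<b} t) = b - a"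
      if "0 \<le> a" "a \<le> b" "b \<le> T" for a b
    proof -
      have "integrable (time T) (\<lambda>t. indicator {a<..<b} t *\<^sub>R (1::real))"
        using finite_measure.integrable_const[OF finite_measure_time] that
        by (intro integrable_mult_indicator) (auto simp: sets_restrict_space_iff)
      then show "integrable (time T) (indicator {a<..<b} :: real \<Rightarrow> real)" by simp
      show "(LINT t|time T. indicator {a<..<b} t) = b - a"
        using time_integral(3)[OF finite_measure.integrable_const[OF finite_measure_time, of T "1::real"], of a b] that by simp
    qed
    have II: "I t * I t = I t" for t
    proof -
      have "indicator {l i<..<r i} t * (indicator {l j<..<r j} t :: real) = (if i = j then indicator {l i<..<r i} t else 0)"
        if "i < n" "j < n" for i j
      proof (cases "i = j")
        case False
        then have "{l i<..<r i} \<inter> {l j<..<r j} = {}" using disj that unfolding disjoint_family_on_def by blast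
        then have "t \<notin> {l i<..<r i} \<or> t \<notin> {l j<..<r j}" by blast
        then show ?thesis using False by (auto simp: indicator_def)
      qed (simp add: indicator_def)
      then have "I t * I t = (\<Sum>i<n. \<Sum>j<n. if i = j then indicator {l i<..<r i} t else 0)"
        unfolding I_def sum_product by (intro sum.cong refl) auto
      then show ?thesis by (simp add: I_def sum.delta)
    qed
    have Ii: "integrable (time T) I" "(LINT t|time T. I t) = (\<Sum>i<n. r i - l i)"
    proof -
      show "integrable (time T) I" unfolding I_def[abs_def]
        by (intro Bochner_Integration.integrable_sum) (use lr ii(1) in auto)
      have "(LINT t|time T. I t) = (\<Sum>i<n. (LINT t|time T. indicator {l i<..<r i} t))"
        unfolding I_def by (intro Bochner_Integration.integral_sum) (use lr ii(1) in auto)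
      then show "(LINT t|time T. I t) = (\<Sum>i<n. r i - l i)" using ii(2) lr by simp
    qed
    have IL: "I \<in> L2 {0<..<T}" using Ii(1) by (simp add: L2_def power2_eq_square II del: mult_cancel_left mult_cancel_right mult_eq_self_implies_10)
    have gL: "(\<lambda>t. \<bar>g t\<bar>) \<in> L2 {0<..<T}" using g(1) by (simp add: L2_def borel_measurable_abs)
    have gi: "integrable (time T) (\<lambda>t. indicator {a<..<b} t * \<bar>g t\<bar>)" if "0 \<le> a" "b \<le> T" for a b
      by (rule time_integrable_indicator[OF integrable_abs[OF g(2)] that])
    have "(\<Sum>i<n. \<bar>(c + integral {0..r i} g) - (c + integral {0..l i} g)\<bar>) \<le> (\<Sum>i<n. (LINT t|time T. indicator {l i<..<r i} t * \<bar>g t\<bar>))"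
    proof (rule sum_mono)
      fix i assume i: "i \<in> {..<n}"
      then have b: "0 \<le> l i" "l i \<le> r i" "r i \<le> T" using lr by auto
      have "(c + integral {0..r i} g) - (c + integral {0..l i} g) = integral {l i..r i} g"
        using time_integral_combine[OF g(2) order_refl b] by simp
      also have "\<bar>\<dots>\<bar> \<le> integral {l i..r i} (\<lambda>t. \<bar>g t\<bar>)"
        by (rule time_integral_abs_le[OF g(2) integrable_abs[OF g(2)] b(1,3)]) simp
      also have "\<dots> = (LINT t|time T. indicator {l i<..<r i} t * \<bar>g t\<bar>)"
        by (rule time_integral(3)[OF integrable_abs[OF g(2)] b(1,3)])
      finally show "\<bar>(c + integral {0..r i} g) - (c + integral {0..l i} g)\<bar> \<le> (LINT t|time T. indicator {l i<..<r i} t * \<bar>g t\<bar>)" .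
    qed
    also have "\<dots> = (LINT t|time T. (\<Sum>i<n. indicator {l i<..<r i} t * \<bar>g t\<bar>))"
      by (rule Bochner_Integration.integral_sum[symmetric]) (use gi lr in auto)
    also have "\<dots> = l2_inner {0<..<T} I (\<lambda>t. \<bar>g t\<bar>)"
      by (simp add: l2_inner_def I_def sum_distrib_right)
    also have "\<dots> \<le> l2_norm {0<..<T} I * l2_norm {0<..<T} (\<lambda>t. \<bar>g t\<bar>)"
      using interval.l2_cauchy_schwarz[OF IL gL] by simp
    also have "l2_norm {0<..<T} (\<lambda>t. \<bar>g t\<bar>) = ?N" by (simp add: l2_norm_def)
    also have "l2_norm {0<..<T} I = sqrt (\<Sum>i<n. r i - l i)"
      using Ii(2) by (simp add: l2_norm_def power2_eq_square II)
    also have "sqrt (\<Sum>i<n. r i - l i) * ?N \<le> sqrt \<delta> * ?N"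
      using small N by (intro mult_right_mono real_sqrt_le_mono) auto
    also have "sqrt \<delta> = \<epsilon> / (?N + 1)" unfolding \<delta>_def using \<epsilon> N by (simp add: real_sqrt_abs)
    also have "\<epsilon> / (?N + 1) * ?N < \<epsilon>" using \<epsilon> N by (simp add: field_simps)
    finally show "(\<Sum>i<n. \<bar>(c + integral {0..r i} g) - (c + integral {0..l i} g)\<bar>) < \<epsilon>" .
  qed
qed

lemma conull_dense:
  assumes "AE t in time T. t \<in> G" "0 \<le> a" "a < b" "b \<le> T"
  shows "\<exists>t\<in>G. a < t \<and> t < b"
proof (rule ccontr)
  assume none: "\<not> ?thesis"
  have "{a<..<b} \<subseteq> {t \<in> {0<..<T}. \<not> t \<in> G}" using none assms(2-4) by auto
  then have "negligible {a<..<b}"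
    using assms(1) by (auto simp: AE_lebesgue_on_negligible[OF interval.domain_sets] intro: negligible_subset)
  then show False using assms(3) open_not_negligible[of "{a<..<b}"] by auto
qed

text \<open>A function whose increments are quadratically small relative to a continuous primitive is
  constant: subdividing an interval makes the sum of the bounds arbitrarily small.\<close>

lemma quadratic_increments_constant:
  fixes h \<Phi> :: "real \<Rightarrow> real"
  assumes h: "integrable (time T) h" "AE t in time T. 0 \<le> h t" and G: "AE t in time T. t \<in> G" "G \<subseteq> {0<..<T}"
    and incr: "\<And>a b. a \<in> G \<Longrightarrow> b \<in> G \<Longrightarrow> a < b \<Longrightarrow> \<bar>\<Phi> b - \<Phi> a\<bar> \<le> C * (integral {a..b} h)\<^sup>2" and C: "C \<ge> 0"
    and ab: "a \<in> G" "b \<in> G" "a < b"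
  shows "\<Phi> b = \<Phi> a"
proof -
  have nn: "0 \<le> integral {a..b} h" if "0 \<le> a" "b \<le> T" for a b
    by (rule time_integral_nonneg[OF h(1) that h(2)])
  have uc: "uniformly_continuous_on {0..T} (\<lambda>t. integral {0..t} h)"
    by (rule compact_uniformly_continuous[OF time_integral_continuous[OF h(1)] compact_Icc])
  have le: "\<bar>\<Phi> b - \<Phi> a\<bar> \<le> \<epsilon> * (C * integral {a..b} h)" if \<epsilon>: "\<epsilon> > 0" for \<epsilon>
  proof -
    obtain \<delta> where \<delta>: "\<delta> > 0" "\<And>s t. s \<in> {0..T} \<Longrightarrow> t \<in> {0..T} \<Longrightarrow> \<bar>t - s\<bar> < \<delta> \<Longrightarrow>
        \<bar>integral {0..t} h - integral {0..s} h\<bar> < \<epsilon>"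
      using uc \<epsilon> unfolding uniformly_continuous_on_def dist_real_def by metis
    have local: "\<bar>\<Phi> t - \<Phi> s\<bar> \<le> \<epsilon> * (C * integral {s..t} h)" if st: "s \<in> G" "t \<in> G" "s < t" "t - s < \<delta>" for s t
    proof -
      have b: "0 \<le> s" "s \<le> t" "t \<le> T" using st G(2) by auto
      have "integral {s..t} h \<le> \<epsilon>"
        using time_integral_combine[OF h(1) order_refl b] \<delta>(2)[of s t] b st(4) by auto
      then have "(integral {s..t} h)\<^sup>2 \<le> \<epsilon> * integral {s..t} h"
        using nn[OF b(1,3)] by (simp add: power2_eq_square mult_right_mono)
      then have "C * (integral {s..t} h)\<^sup>2 \<le> C * (\<epsilon> * integral {s..t} h)" using C by (rule mult_left_mono)
      then show ?thesis using incr[OF st(1-3)] by (simp add: mult.left_commute)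
    qed
    have "\<bar>\<Phi> t - \<Phi> s\<bar> \<le> \<epsilon> * (C * integral {s..t} h)"
      if "s \<in> G" "t \<in> G" "s < t" "t - s < real (Suc n) * (\<delta> / 2)" for n s t
      using that
    proof (induction n arbitrary: t)
      case 0
      then show ?case using local[of s t] \<delta>(1) by simp
    next
      case (Suc n)
      show ?case
      proof (cases "t - s < \<delta>")
        case True
        then show ?thesis using local Suc.prems by blast
      next
        case False
        have st: "0 < s" "t < T" using Suc.prems G(2) by auto
        \<comment> \<open>The last step stays below \<open>\<delta>\<close>, while the remaining interval shrinks by at least \<open>\<delta> / 2\<close>.\<close>
        obtain m where m: "m \<in> G" "t - 3 * \<delta> / 4 < m" "m < t - \<delta> / 2"
          using conull_dense[OF G(1), of "t - 3 * \<delta> / 4" "t - \<delta> / 2"] \<delta>(1) False st by auto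
        have sm: "s < m" "m < t" using m False \<delta>(1) by auto
        have "m - s < real (Suc n) * (\<delta> / 2)" using m(3) Suc.prems(4) by (simp add: algebra_simps)
        then have 1: "\<bar>\<Phi> m - \<Phi> s\<bar> \<le> \<epsilon> * (C * integral {s..m} h)" using Suc.IH[OF Suc.prems(1) m(1) sm(1)] by blast
        have 2: "\<bar>\<Phi> t - \<Phi> m\<bar> \<le> \<epsilon> * (C * integral {m..t} h)"
          by (rule local[OF m(1) Suc.prems(2) sm(2)]) (use m(2) \<delta>(1) in linarith)
        have "\<bar>\<Phi> t - \<Phi> s\<bar> \<le> \<epsilon> * (C * (integral {s..m} h + integral {m..t} h))"
          using 1 2 by (simp add: distrib_left)
        also have "integral {s..m} h + integral {m..t} h = integral {s..t} h"
          by (rule time_integral_combine[OF h(1)]) (use st sm in auto)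
        finally show ?thesis .
      qed
    qed
    moreover obtain n where "(b - a) / (\<delta> / 2) < real n" using reals_Archimedean2 by blast
    then have "b - a < real (Suc n) * (\<delta> / 2)" using \<delta>(1) by (simp add: field_simps)
    ultimately show ?thesis using ab by blast
  qed
  have "0 \<le> a" "b \<le> T" using ab G(2) by auto
  then have J: "0 \<le> C * integral {a..b} h" using nn C by (intro mult_nonneg_nonneg)
  have "\<bar>\<Phi> b - \<Phi> a\<bar> \<le> 0 + e" if "e > 0" for e
  proof -
    have "\<bar>\<Phi> b - \<Phi> a\<bar> \<le> e / (C * integral {a..b} h + 1) * (C * integral {a..b} h)"
      by (rule le) (use that J in auto)
    also have "\<dots> \<le> e" using that J by (simp add: field_simps)
    finally show ?thesis by simp
  qed
  then have "\<bar>\<Phi> b - \<Phi> a\<bar> \<le> 0" by (rule field_le_epsilon)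
  then show ?thesis by simp
qed

text \<open>On an interval where \<open>m\<close> has integral at most \<open>1/2\<close>, the inequality halves any bound for \<open>y\<close>;
  finitely many such intervals cover \<open>(0,T)\<close>.\<close>

lemma gronwall_zero:
  fixes y m :: "real \<Rightarrow> real"
  assumes m: "integrable (time T) m" "AE t in time T. 0 \<le> m t" and my: "integrable (time T) (\<lambda>t. m t * y t)"
    and G: "AE t in time T. t \<in> G" "G \<subseteq> {0<..<T}"
    and y: "\<And>t. t \<in> G \<Longrightarrow> 0 \<le> y t" "\<And>t. t \<in> G \<Longrightarrow> y t \<le> B"
    and ineq: "\<And>t. t \<in> G \<Longrightarrow> y t \<le> integral {0..t} (\<lambda>s. m s * y s)" and t: "t \<in> G"
  shows "y t = 0"
proof -
  have uc: "uniformly_continuous_on {0..T} (\<lambda>t. integral {0..t} m)"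
    by (rule compact_uniformly_continuous[OF time_integral_continuous[OF m(1)] compact_Icc])
  obtain \<delta> where \<delta>: "\<delta> > 0" "\<And>s t. s \<in> {0..T} \<Longrightarrow> t \<in> {0..T} \<Longrightarrow> \<bar>t - s\<bar> < \<delta> \<Longrightarrow>
      \<bar>integral {0..t} m - integral {0..s} m\<bar> < 1 / 2"
    using uc unfolding uniformly_continuous_on_def dist_real_def by (metis half_gt_zero_iff zero_less_one)
  have B: "0 \<le> B" using y t by force
  have step: "y t = 0" if zero: "\<And>s. s \<in> G \<Longrightarrow> s \<le> \<tau> \<Longrightarrow> y s = 0" and t: "t \<in> G" "t < \<tau> + \<delta>" and \<tau>: "0 \<le> \<tau>" for \<tau> t
  proof (cases "t \<le> \<tau>")
    case True then show ?thesis using zero t by blast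
  next
    case False
    have "y s \<le> B * (1 / 2) ^ n" if "s \<in> G" "s < \<tau> + \<delta>" for n s
      using that
    proof (induction n arbitrary: s)
      case 0 then show ?case using y by simp
    next
      case (Suc n)
      show ?case
      proof (cases "s \<le> \<tau>")
        case True then show ?thesis using zero Suc.prems B by simp
      next
        case False
        have s: "0 < s" "s < T" using Suc.prems G(2) by auto
        have "integral {0..\<tau>} (\<lambda>s. m s * y s) = integral {0..\<tau>} (\<lambda>s. 0)"
        proof -
          have "integral {0..\<tau>} (\<lambda>s. m s * y s) = (LINT r|time T. indicator {0<..<\<tau>} r * (m r * y r))"
            by (rule time_integral(3)[OF my]) (use False s in auto)
          also have "\<dots> = (LINT r|time T. 0)"
          proof (rule integral_cong_AE)
            show "(\<lambda>r. indicator {0<..<\<tau>} r * (m r * y r)) \<in> borel_measurable (time T)"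
            proof (rule borel_measurable_times)
              show "(\<lambda>r. m r * y r) \<in> borel_measurable (time T)" using my by (rule borel_measurable_integrable)
              show "indicator {0<..<\<tau>} \<in> borel_measurable (time T)"
                by (rule borel_measurable_indicator) (use False s in \<open>auto simp: sets_restrict_space_iff\<close>)
            qed
            show "AE r in time T. indicator {0<..<\<tau>} r * (m r * y r) = 0"
              using G(1) by eventually_elim (auto split: split_indicator simp: zero)
          qed simp
          finally show ?thesis by simp
        qed
        then have "integral {0..s} (\<lambda>s. m s * y s) = integral {\<tau>..s} (\<lambda>s. m s * y s)"
          using time_integral_combine[OF my order_refl \<tau>, of s] False s by simp
        also have "\<dots> = (LINT r|time T. indicator {\<tau><..<s} r * (m r * y r))"
          by (rule time_integral(3)[OF my \<tau>]) (use s in auto)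
        also have "\<dots> \<le> (LINT r|time T. indicator {\<tau><..<s} r * (m r * (B * (1 / 2) ^ n)))"
        proof (rule integral_mono_AE)
          have I: "integrable (time T) (\<lambda>r. indicator {\<tau><..<s} r * f r)" if "integrable (time T) f" for f :: "real \<Rightarrow> real"
            by (rule time_integrable_indicator[OF that \<tau>]) (use s in simp)
          show "integrable (time T) (\<lambda>r. indicator {\<tau><..<s} r * (m r * y r))" by (rule I[OF my])
          show "integrable (time T) (\<lambda>r. indicator {\<tau><..<s} r * (m r * (B * (1 / 2) ^ n)))"
            by (rule I) (use m(1) in simp)
          show "AE r in time T. indicator {\<tau><..<s} r * (m r * y r) \<le> indicator {\<tau><..<s} r * (m r * (B * (1 / 2) ^ n))"
            using G(1) m(2)
            by eventually_elim (use Suc in \<open>auto split: split_indicator intro: mult_left_mono\<close>)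
        qed
        also have "\<dots> = integral {\<tau>..s} (\<lambda>r. m r * (B * (1 / 2) ^ n))"
          by (rule time_integral(3)[symmetric]) (use m(1) \<tau> s in auto)
        also have "\<dots> = integral {\<tau>..s} m * (B * (1 / 2) ^ n)" by simp
        also have "\<dots> \<le> 1 / 2 * (B * (1 / 2) ^ n)"
        proof (rule mult_right_mono)
          show "integral {\<tau>..s} m \<le> 1 / 2"
          proof -
            have "\<bar>integral {0..s} m - integral {0..\<tau>} m\<bar> < 1 / 2"
              by (rule \<delta>(2)) (use False s \<tau> Suc.prems in auto)
            moreover have "integral {0..\<tau>} m + integral {\<tau>..s} m = integral {0..s} m"
              by (rule time_integral_combine[OF m(1)]) (use False s \<tau> in auto)
            ultimately show ?thesis by linarith
          qed
        qed (use B in simp)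
        finally show ?thesis using ineq[OF Suc.prems(1)] by simp
      qed
    qed
    then have "y t \<le> B * (1 / 2) ^ n" for n using t by blast
    moreover have "(\<lambda>n. B * (1 / 2) ^ n) \<longlonglongrightarrow> 0"
      by (intro tendsto_mult_right_zero LIMSEQ_power_zero) simp
    ultimately have "y t \<le> 0" by (intro LIMSEQ_le_const) auto
    then show ?thesis using y(1)[OF t(1)] by simp
  qed
  have "y s = 0" if "s \<in> G" "s \<le> real n * (\<delta> / 2)" for n s
    using that
  proof (induction n arbitrary: s)
    case 0 then show ?case using G(2) by auto
  next
    case (Suc n)
    show ?case
      by (rule step[of "real n * (\<delta> / 2)"]) (use Suc \<delta>(1) in \<open>auto simp: algebra_simps\<close>)
  qed
  moreover obtain n where "t / (\<delta> / 2) < real n" using reals_Archimedean2 by blast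
  then have "t \<le> real n * (\<delta> / 2)" using \<delta>(1) by (simp add: field_simps)
  ultimately show ?thesis using t by blast
qed

section \<open>The energy identity for the linear part\<close>

lemma interval_L2_integrable:
  assumes "g \<in> L2 {0<..<T}"
  shows "integrable (time T) (g :: real \<Rightarrow> real)"
proof -
  have "(\<lambda>t. 1) \<in> L2 {0<..<T}"
    using finite_measure.integrable_const[OF finite_measure_time] by (simp add: L2_def)
  from interval.L2_inner_integrable[OF assms this] show ?thesis by simp
qed

lemma (in open_domain) l2_inner_dual: "g \<in> L2 \<Omega> \<Longrightarrow> (\<lambda>f. l2_inner \<Omega> f g) \<in> dual (L2 \<Omega>) (l2_norm \<Omega>)"
  unfolding dual_def
  using l2_inner_lincomb_left l2_cauchy_schwarz by (auto simp: mult.commute intro!: exI[of _ "l2_norm \<Omega> g"])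

lemma (in sobolev_domain) divg_dual:
  assumes "h \<in> L2 \<Omega>"
  shows "(\<lambda>w. l2_inner \<Omega> h (divg \<Omega> w)) \<in> dual (vH10 \<Omega>) (vh1_norm \<Omega>)"
  unfolding dual_def
proof (intro CollectI conjI ballI allI)
  fix f g :: "real^'n \<Rightarrow> real^'n" and a b :: real assume fg: "f \<in> vH10 \<Omega>" "g \<in> vH10 \<Omega>"
  have "l2_inner \<Omega> h (divg \<Omega> (\<lambda>x. a *\<^sub>R f x + b *\<^sub>R g x)) = l2_inner \<Omega> h (\<lambda>x. a *\<^sub>R divg \<Omega> f x + b *\<^sub>R divg \<Omega> g x)"
    by (rule l2_inner_cong[OF assms divg_L2[OF vH10_lincomb[OF fg]] AE_I2[OF refl] divg_lincomb[OF fg]])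
  also have "\<dots> = a * l2_inner \<Omega> h (divg \<Omega> f) + b * l2_inner \<Omega> h (divg \<Omega> g)"
    by (rule l2_inner_lincomb_right[OF divg_L2[OF fg(1)] divg_L2[OF fg(2)] assms])
  finally show "l2_inner \<Omega> h (divg \<Omega> (\<lambda>x. a *\<^sub>R f x + b *\<^sub>R g x)) = a * l2_inner \<Omega> h (divg \<Omega> f) + b * l2_inner \<Omega> h (divg \<Omega> g)" .
next
  have "\<bar>l2_inner \<Omega> h (divg \<Omega> w)\<bar> \<le> l2_norm \<Omega> h * real CARD('n) * vh1_norm \<Omega> w" if "w \<in> vH10 \<Omega>" for w
  proof -
    have "\<bar>l2_inner \<Omega> h (divg \<Omega> w)\<bar> \<le> l2_norm \<Omega> h * l2_norm \<Omega> (divg \<Omega> w)"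
      by (rule l2_cauchy_schwarz[OF assms divg_L2[OF that]])
    also have "\<dots> \<le> l2_norm \<Omega> h * (real CARD('n) * vh1_norm \<Omega> w)"
      by (rule mult_left_mono[OF divg_bound[OF that] l2_norm_nonneg])
    finally show ?thesis by (simp add: mult.assoc)
  qed
  then show "\<exists>C. \<forall>f\<in>vH10 \<Omega>. \<bar>l2_inner \<Omega> h (divg \<Omega> f)\<bar> \<le> C * vh1_norm \<Omega> f" by blast
qed

lemma (in poro_domain) e_form_dual:
  assumes "v \<in> vH10 \<Omega>"
  shows "e_form \<Omega> v \<in> dual (vH10 \<Omega>) (vh1_norm \<Omega>)"
  unfolding dual_def
proof (intro CollectI conjI ballI allI)
  show "e_form \<Omega> v (\<lambda>x. a *\<^sub>R f x + b *\<^sub>R g x) = a * e_form \<Omega> v f + b * e_form \<Omega> v g"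
    if "f \<in> vH10 \<Omega>" "g \<in> vH10 \<Omega>" for f g a b
    using e_form_lincomb[OF that assms] by (simp add: e_form_commute[of v])
  show "\<exists>C. \<forall>f\<in>vH10 \<Omega>. \<bar>e_form \<Omega> v f\<bar> \<le> C * vh1_norm \<Omega> f"
    using e_form_bound[OF assms] by (intro exI[of _ "11 * vh1_norm \<Omega> v"]) (simp add: mult.assoc)
qed

text \<open>The difference of two solutions satisfies the linear relations collected here. \<open>Zt\<close> is the time
  derivative of the fluid content \<open>Z\<close> in \<open>V'\<close>, and \<open>Pt\<close> that of the pressure \<open>P\<close>; both enter in
  integrated form. Since both solutions have the same initial fluid content, \<open>Z\<close> starts from zero, while
  the constant of integration of the pressure is left open.\<close>

locale linear_poro = poro_domain \<Omega> for \<Omega> +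
  fixes T c0 :: real and U :: "real \<Rightarrow> real^3 \<Rightarrow> real^3" and P Z Pt :: "real \<Rightarrow> real^3 \<Rightarrow> real"
    and Zt :: "real \<Rightarrow> (real^3 \<Rightarrow> real) \<Rightarrow> real"
  assumes T: "T > 0" and c0: "c0 \<ge> 0"
    and U: "U \<in> L2_vV T \<Omega>" and P: "P \<in> L2_V T \<Omega>" and Z: "Z \<in> L2_L2 T \<Omega>" and Pt: "Pt \<in> L2_L2 T \<Omega>"
    and Zt: "Zt \<in> L2_time T (dual_V \<Omega>) (dual_V_norm \<Omega>)"
    and Z_eq: "AE t in time T. AE x in lebesgue_on \<Omega>. Z t x = c0 * P t x + divg \<Omega> (U t) x"
    and elastic: "w \<in> vH10 \<Omega> \<Longrightarrow> AE t in time T. e_form \<Omega> (U t) w = l2_inner \<Omega> (P t) (divg \<Omega> w)"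
    and content: "q \<in> H10 \<Omega> \<Longrightarrow> AE t in time T. l2_inner \<Omega> (Z t) q = integral {0..t} (\<lambda>s. Zt s q)"
    and pressure: "q \<in> L2 \<Omega> \<Longrightarrow> \<exists>c. AE t in time T. l2_inner \<Omega> (P t) q = c + integral {0..t} (\<lambda>s. l2_inner \<Omega> (Pt s) q)"
begin

lemmas dualV = seminormed.seminormed_dual[OF seminormed_H10]

definition good :: "real set" where
  "good = {t \<in> {0<..<T}. U t \<in> vH10 \<Omega> \<and> P t \<in> H10 \<Omega> \<and> Z t \<in> L2 \<Omega> \<and> Pt t \<in> L2 \<Omega> \<and> Zt t \<in> dual_V \<Omega> \<and>
    (AE x in lebesgue_on \<Omega>. Z t x = c0 * P t x + divg \<Omega> (U t) x)}"

lemma AE_good: "AE t in time T. t \<in> good"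
  using L2_time_mem[OF U] L2_time_mem[OF P] L2_time_mem[OF Z] L2_time_mem[OF Pt] L2_time_mem[OF Zt] Z_eq AE_space
  by eventually_elim (simp add: good_def)

lemma goodD:
  assumes "t \<in> good"
  shows "0 < t" "t < T" "U t \<in> vH10 \<Omega>" "P t \<in> H10 \<Omega>" "P t \<in> L2 \<Omega>" "Z t \<in> L2 \<Omega>" "Pt t \<in> L2 \<Omega>" "Zt t \<in> dual_V \<Omega>"
    "divg \<Omega> (U t) \<in> L2 \<Omega>" "AE x in lebesgue_on \<Omega>. Z t x = c0 * P t x + divg \<Omega> (U t) x"
  using assms H1_L2[OF H10_H1] divg_L2 by (auto simp: good_def)

definition h :: "real \<Rightarrow> real" where "h t = l2_norm \<Omega> (Pt t)"

lemma h: "h \<in> L2 {0<..<T}" "integrable (time T) h" "0 \<le> h t"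
  using seminormed.L2_time_norm[OF seminormed_L2 Pt] interval_L2_integrable[of h T]
  by (auto simp: h_def[abs_def] l2_norm_nonneg)

lemma h_integral_nonneg: "0 \<le> a \<Longrightarrow> b \<le> T \<Longrightarrow> 0 \<le> integral {a..b} h"
  by (rule time_integral_nonneg[OF h(2)]) (auto simp: h(3))

lemma Zt_integrable: "q \<in> H10 \<Omega> \<Longrightarrow> integrable (time T) (\<lambda>s. Zt s q)"
  using interval_L2_integrable[OF seminormed.dual_time_L2[OF dualV seminormed.eval_dual[OF seminormed_H10] Zt]] by simp

lemma Pt_integrable: "q \<in> L2 \<Omega> \<Longrightarrow> integrable (time T) (\<lambda>s. l2_inner \<Omega> (Pt s) q)"
  using interval_L2_integrable[OF seminormed.dual_time_L2[OF seminormed_L2 l2_inner_dual Pt]] by simp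

lemma Zt_P_integrable: "integrable (time T) (\<lambda>s. Zt s (P s))"
  by (rule bilinear_time_integrable[OF dualV seminormed_H10 _ _ _ Zt P, where B="\<lambda>l q. l q"])
    (use seminormed.dual_diff[OF seminormed_H10] seminormed.dual_bound[OF seminormed_H10] in auto)

lemma Pt_bound: "q \<in> L2 \<Omega> \<Longrightarrow> AE s in time T. \<bar>l2_inner \<Omega> (Pt s) q\<bar> \<le> h s * l2_norm \<Omega> q"
  using AE_good by eventually_elim (auto simp: h_def goodD l2_cauchy_schwarz)

subsection \<open>Relations holding simultaneously at almost all times\<close>

text \<open>Each relation is known for a fixed test function up to a null set. It is continuous in the test
  function, so the solution at time \<open>r\<close> may be inserted with a null set that does not depend on \<open>r\<close>.\<close>

lemma elastic_common:
  "\<exists>G\<subseteq>good. (AE t in time T. t \<in> G) \<and> (\<forall>a\<in>G. \<forall>r\<in>G. e_form \<Omega> (U a) (U r) = l2_inner \<Omega> (P a) (divg \<Omega> (U r)))"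
proof -
  have "\<exists>G\<subseteq>good. (AE t in time T. t \<in> G) \<and>
      (\<forall>a\<in>G. \<forall>b\<in>G. \<forall>r\<in>G. e_form \<Omega> (U a) (U r) = l2_inner \<Omega> (P a) (divg \<Omega> (U r)))"
  proof (rule seminormed.common_null_set[OF seminormed_vH10 L2_time_strongly_measurable[OF U] AE_good])
    fix r assume "r \<in> good"
    then show "\<exists>H. (AE t in time T. t \<in> H) \<and> (\<forall>a\<in>H. \<forall>b\<in>H. e_form \<Omega> (U a) (U r) = l2_inner \<Omega> (P a) (divg \<Omega> (U r)))"
      using elastic[OF goodD(3)] by (intro exI[of _ "{t. e_form \<Omega> (U t) (U r) = l2_inner \<Omega> (P t) (divg \<Omega> (U r))}"]) auto
  next
    fix a b r and rs :: "nat \<Rightarrow> real"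
    assume a: "a \<in> good" and r: "r \<in> good" and rs: "\<And>n. rs n \<in> good"
      and lim: "(\<lambda>n. vh1_norm \<Omega> (\<lambda>x. U (rs n) x - U r x)) \<longlonglongrightarrow> 0"
      and eq: "\<And>n. e_form \<Omega> (U a) (U (rs n)) = l2_inner \<Omega> (P a) (divg \<Omega> (U (rs n)))"
    have "(\<lambda>n. e_form \<Omega> (U a) (U (rs n))) \<longlonglongrightarrow> e_form \<Omega> (U a) (U r)"
      by (rule seminormed.dual_LIMSEQ[OF seminormed_vH10 e_form_dual[OF goodD(3)[OF a]] goodD(3)[OF rs] goodD(3)[OF r] lim])
    moreover have "(\<lambda>n. l2_inner \<Omega> (P a) (divg \<Omega> (U (rs n)))) \<longlonglongrightarrow> l2_inner \<Omega> (P a) (divg \<Omega> (U r))"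
      by (rule seminormed.dual_LIMSEQ[OF seminormed_vH10 divg_dual[OF goodD(5)[OF a]] goodD(3)[OF rs] goodD(3)[OF r] lim])
    ultimately show "e_form \<Omega> (U a) (U r) = l2_inner \<Omega> (P a) (divg \<Omega> (U r))"
      unfolding eq by (rule LIMSEQ_unique)
  qed
  then show ?thesis by blast
qed

lemma content_common:
  "\<exists>G\<subseteq>good. (AE t in time T. t \<in> G) \<and> (\<forall>a\<in>G. \<forall>r\<in>G. l2_inner \<Omega> (Z a) (P r) = integral {0..a} (\<lambda>s. Zt s (P r)))"
proof -
  let ?n = "\<lambda>s. dual_V_norm \<Omega> (Zt s)"
  have ni: "integrable (time T) ?n" by (rule interval_L2_integrable[OF seminormed.L2_time_norm[OF dualV Zt]])
  have "\<exists>G\<subseteq>good. (AE t in time T. t \<in> G) \<and>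
      (\<forall>a\<in>G. \<forall>b\<in>G. \<forall>r\<in>G. l2_inner \<Omega> (Z a) (P r) = integral {0..a} (\<lambda>s. Zt s (P r)))"
  proof (rule seminormed.common_null_set[OF seminormed_H10 L2_time_strongly_measurable[OF P] AE_good])
    fix r assume "r \<in> good"
    then show "\<exists>H. (AE t in time T. t \<in> H) \<and> (\<forall>a\<in>H. \<forall>b\<in>H. l2_inner \<Omega> (Z a) (P r) = integral {0..a} (\<lambda>s. Zt s (P r)))"
      using content[OF goodD(4)] by (intro exI[of _ "{t. l2_inner \<Omega> (Z t) (P r) = integral {0..t} (\<lambda>s. Zt s (P r))}"]) auto
  next
    fix a b r and rs :: "nat \<Rightarrow> real"
    assume a: "a \<in> good" and r: "r \<in> good" and rs: "\<And>n. rs n \<in> good"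
      and lim: "(\<lambda>n. h1_norm \<Omega> (\<lambda>x. P (rs n) x - P r x)) \<longlonglongrightarrow> 0"
      and eq: "\<And>n. l2_inner \<Omega> (Z a) (P (rs n)) = integral {0..a} (\<lambda>s. Zt s (P (rs n)))"
    note d = seminormed.diff_mem[OF seminormed_H10 goodD(4)[OF rs] goodD(4)[OF r]]
    have lim2: "(\<lambda>n. l2_norm \<Omega> (\<lambda>x. P (rs n) x - P r x)) \<longlonglongrightarrow> 0"
      by (rule tendsto_sandwich[OF _ _ tendsto_const lim]) (auto simp: l2_norm_nonneg h1_norm_ge)
    have "(\<lambda>n. l2_inner \<Omega> (P (rs n)) (Z a)) \<longlonglongrightarrow> l2_inner \<Omega> (P r) (Z a)"
      by (rule seminormed.dual_LIMSEQ[OF seminormed_L2 l2_inner_dual[OF goodD(6)[OF a]] goodD(5)[OF rs] goodD(5)[OF r] lim2])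
    then have 1: "(\<lambda>n. l2_inner \<Omega> (Z a) (P (rs n))) \<longlonglongrightarrow> l2_inner \<Omega> (Z a) (P r)" by (simp add: l2_inner_commute)
    have bd: "\<bar>integral {0..a} (\<lambda>s. Zt s (P (rs n))) - integral {0..a} (\<lambda>s. Zt s (P r))\<bar>
        \<le> integral {0..a} ?n * h1_norm \<Omega> (\<lambda>x. P (rs n) x - P r x)" for n
    proof -
      note i = Zt_integrable[OF goodD(4)[OF rs[of n]]] Zt_integrable[OF goodD(4)[OF r]]
      have a': "0 \<le> (0::real)" "a \<le> T" using goodD(2)[OF a] by auto
      have "integral {0..a} (\<lambda>s. Zt s (P (rs n))) - integral {0..a} (\<lambda>s. Zt s (P r)) = integral {0..a} (\<lambda>s. Zt s (P (rs n)) - Zt s (P r))"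
        by (rule integral_diff[symmetric]) (rule time_integral(2)[OF i(1) a'], rule time_integral(2)[OF i(2) a'])
      also have "\<bar>\<dots>\<bar> \<le> integral {0..a} (\<lambda>s. ?n s * h1_norm \<Omega> (\<lambda>x. P (rs n) x - P r x))"
      proof (rule time_integral_abs_le[OF Bochner_Integration.integrable_diff[OF i] integrable_mult_left[OF ni] a'])
        show "AE s in time T. 0 < s \<longrightarrow> s < a \<longrightarrow> \<bar>Zt s (P (rs n)) - Zt s (P r)\<bar> \<le> ?n s * h1_norm \<Omega> (\<lambda>x. P (rs n) x - P r x)"
          using AE_good
        proof eventually_elim
          case (elim s)
          show ?case
            using seminormed.dual_bound[OF seminormed_H10 goodD(8)[OF elim] d[of n]]
              seminormed.dual_diff[OF seminormed_H10 goodD(8)[OF elim] goodD(4)[OF rs[of n]] goodD(4)[OF r]] by simp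
        qed
      qed
      finally show ?thesis by simp
    qed
    have "(\<lambda>n. integral {0..a} (\<lambda>s. Zt s (P (rs n))) - integral {0..a} (\<lambda>s. Zt s (P r))) \<longlonglongrightarrow> 0"
      by (rule Lim_null_comparison[OF always_eventually tendsto_mult_right_zero[OF lim, of "integral {0..a} ?n"]]) (use bd in simp)
    then have "(\<lambda>n. integral {0..a} (\<lambda>s. Zt s (P (rs n)))) \<longlonglongrightarrow> integral {0..a} (\<lambda>s. Zt s (P r))"
      by (simp add: LIM_zero_iff)
    with 1 show "l2_inner \<Omega> (Z a) (P r) = integral {0..a} (\<lambda>s. Zt s (P r))"
      unfolding eq by (rule LIMSEQ_unique)
  qed
  then show ?thesis by blast
qed

text \<open>Applied with \<open>f = P\<close> in the norm of \<open>H\<^sup>1\<close> and with \<open>f = Z\<close> in the norm of \<open>L\<^sup>2\<close>. Comparing two times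
  eliminates the constant of integration, which depends on the test function.\<close>

lemma pressure_common:
  assumes X: "seminormed X N" and f: "strongly_measurable X N T f" and L: "\<And>t. t \<in> good \<Longrightarrow> f t \<in> L2 \<Omega>"
    and N: "\<And>g. l2_norm \<Omega> g \<le> N g"
  shows "\<exists>G\<subseteq>good. (AE t in time T. t \<in> G) \<and> (\<forall>a\<in>G. \<forall>b\<in>G. \<forall>r\<in>G. a \<le> b \<longrightarrow>
      l2_inner \<Omega> (P b) (f r) - l2_inner \<Omega> (P a) (f r) = integral {a..b} (\<lambda>s. l2_inner \<Omega> (Pt s) (f r)))"
proof (rule seminormed.common_null_set[OF X f AE_good])
  fix r assume r: "r \<in> good"
  obtain c where c: "AE t in time T. l2_inner \<Omega> (P t) (f r) = c + integral {0..t} (\<lambda>s. l2_inner \<Omega> (Pt s) (f r))"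
    using pressure[OF L[OF r]] by blast
  define H where "H = {t \<in> {0<..<T}. l2_inner \<Omega> (P t) (f r) = c + integral {0..t} (\<lambda>s. l2_inner \<Omega> (Pt s) (f r))}"
  have "AE t in time T. t \<in> H" using c AE_space by eventually_elim (simp add: H_def)
  moreover have "l2_inner \<Omega> (P b) (f r) - l2_inner \<Omega> (P a) (f r) = integral {a..b} (\<lambda>s. l2_inner \<Omega> (Pt s) (f r))"
    if "a \<in> H" "b \<in> H" "a \<le> b" for a b
    using time_integral_combine[OF Pt_integrable[OF L[OF r]], of 0 a b] that by (simp add: H_def)
  ultimately show "\<exists>H. (AE t in time T. t \<in> H) \<and> (\<forall>a\<in>H. \<forall>b\<in>H. a \<le> b \<longrightarrow>
      l2_inner \<Omega> (P b) (f r) - l2_inner \<Omega> (P a) (f r) = integral {a..b} (\<lambda>s. l2_inner \<Omega> (Pt s) (f r)))" by blast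
next
  fix a b r and rs :: "nat \<Rightarrow> real"
  assume a: "a \<in> good" and b: "b \<in> good" and r: "r \<in> good" and rs: "\<And>n. rs n \<in> good"
    and lim: "(\<lambda>n. N (\<lambda>x. f (rs n) x - f r x)) \<longlonglongrightarrow> 0"
    and eq: "\<And>n. a \<le> b \<longrightarrow> l2_inner \<Omega> (P b) (f (rs n)) - l2_inner \<Omega> (P a) (f (rs n)) = integral {a..b} (\<lambda>s. l2_inner \<Omega> (Pt s) (f (rs n)))"
  show "a \<le> b \<longrightarrow> l2_inner \<Omega> (P b) (f r) - l2_inner \<Omega> (P a) (f r) = integral {a..b} (\<lambda>s. l2_inner \<Omega> (Pt s) (f r))"
  proof
    assume ab: "a \<le> b"
    have lim2: "(\<lambda>n. l2_norm \<Omega> (\<lambda>x. f (rs n) x - f r x)) \<longlonglongrightarrow> 0"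
      by (rule tendsto_sandwich[OF _ _ tendsto_const lim]) (auto simp: l2_norm_nonneg N)
    note d = seminormed.diff_mem[OF seminormed_L2 L[OF rs] L[OF r]]
    have t: "(\<lambda>n. l2_inner \<Omega> (P t) (f (rs n))) \<longlonglongrightarrow> l2_inner \<Omega> (P t) (f r)" if "t \<in> good" for t
      using seminormed.dual_LIMSEQ[OF seminormed_L2 l2_inner_dual[OF goodD(5)[OF that]] L[OF rs] L[OF r] lim2]
      by (simp add: l2_inner_commute)
    have bd: "\<bar>integral {a..b} (\<lambda>s. l2_inner \<Omega> (Pt s) (f (rs n))) - integral {a..b} (\<lambda>s. l2_inner \<Omega> (Pt s) (f r))\<bar>
        \<le> integral {a..b} h * l2_norm \<Omega> (\<lambda>x. f (rs n) x - f r x)" for n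
    proof -
      note i = Pt_integrable[OF L[OF rs[of n]]] Pt_integrable[OF L[OF r]]
      have a': "0 \<le> a" "b \<le> T" using goodD(1)[OF a] goodD(2)[OF b] by auto
      have "integral {a..b} (\<lambda>s. l2_inner \<Omega> (Pt s) (f (rs n))) - integral {a..b} (\<lambda>s. l2_inner \<Omega> (Pt s) (f r))
          = integral {a..b} (\<lambda>s. l2_inner \<Omega> (Pt s) (f (rs n)) - l2_inner \<Omega> (Pt s) (f r))"
        by (rule integral_diff[symmetric]) (rule time_integral(2)[OF i(1) a'], rule time_integral(2)[OF i(2) a'])
      also have "\<bar>\<dots>\<bar> \<le> integral {a..b} (\<lambda>s. h s * l2_norm \<Omega> (\<lambda>x. f (rs n) x - f r x))"
      proof (rule time_integral_abs_le[OF Bochner_Integration.integrable_diff[OF i] integrable_mult_left[OF h(2)] a'])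
        show "AE s in time T. a < s \<longrightarrow> s < b \<longrightarrow> \<bar>l2_inner \<Omega> (Pt s) (f (rs n)) - l2_inner \<Omega> (Pt s) (f r)\<bar> \<le> h s * l2_norm \<Omega> (\<lambda>x. f (rs n) x - f r x)"
          using AE_good
        proof eventually_elim
          case (elim s)
          show ?case
            using l2_cauchy_schwarz[OF goodD(7)[OF elim] d[of n]]
              l2_inner_diff_right[OF L[OF rs[of n]] L[OF r] goodD(7)[OF elim]] by (simp add: h_def)
        qed
      qed
      finally show ?thesis by simp
    qed
    have "(\<lambda>n. integral {a..b} (\<lambda>s. l2_inner \<Omega> (Pt s) (f (rs n))) - integral {a..b} (\<lambda>s. l2_inner \<Omega> (Pt s) (f r))) \<longlonglongrightarrow> 0"
      by (rule Lim_null_comparison[OF always_eventually tendsto_mult_right_zero[OF lim2, of "integral {a..b} h"]]) (use bd in simp)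
    then have "(\<lambda>n. integral {a..b} (\<lambda>s. l2_inner \<Omega> (Pt s) (f (rs n)))) \<longlonglongrightarrow> integral {a..b} (\<lambda>s. l2_inner \<Omega> (Pt s) (f r))"
      by (simp add: LIM_zero_iff)
    moreover have "(\<lambda>n. l2_inner \<Omega> (P b) (f (rs n)) - l2_inner \<Omega> (P a) (f (rs n))) \<longlonglongrightarrow> l2_inner \<Omega> (P b) (f r) - l2_inner \<Omega> (P a) (f r)"
      by (intro tendsto_diff t a b)
    ultimately show "l2_inner \<Omega> (P b) (f r) - l2_inner \<Omega> (P a) (f r) = integral {a..b} (\<lambda>s. l2_inner \<Omega> (Pt s) (f r))"
      using eq ab by (auto intro: LIMSEQ_unique)
  qed
qed

end

text \<open>The times in \<open>G\<close> may be combined freely: the state at one of them serves as test function at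
  another.\<close>

locale linear_poro_common = linear_poro +
  fixes G
  assumes G: "G \<subseteq> good" and AE_G: "AE t in time T. t \<in> G"
    and e: "\<And>a r. a \<in> G \<Longrightarrow> r \<in> G \<Longrightarrow> e_form \<Omega> (U a) (U r) = l2_inner \<Omega> (P a) (divg \<Omega> (U r))"
    and con: "\<And>a r. a \<in> G \<Longrightarrow> r \<in> G \<Longrightarrow> l2_inner \<Omega> (Z a) (P r) = integral {0..a} (\<lambda>s. Zt s (P r))"
    and prP: "\<And>a b r. a \<in> G \<Longrightarrow> b \<in> G \<Longrightarrow> r \<in> G \<Longrightarrow> a \<le> b \<Longrightarrow>
      l2_inner \<Omega> (P b) (P r) - l2_inner \<Omega> (P a) (P r) = integral {a..b} (\<lambda>s. l2_inner \<Omega> (Pt s) (P r))"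
    and prZ: "\<And>a b r. a \<in> G \<Longrightarrow> b \<in> G \<Longrightarrow> r \<in> G \<Longrightarrow> a \<le> b \<Longrightarrow>
      l2_inner \<Omega> (P b) (Z r) - l2_inner \<Omega> (P a) (Z r) = integral {a..b} (\<lambda>s. l2_inner \<Omega> (Pt s) (Z r))"

lemma (in linear_poro) common: "\<exists>G. linear_poro_common \<Omega> T c0 U P Z Pt Zt G"
proof -
  obtain G1 where 1: "G1 \<subseteq> good" "AE t in time T. t \<in> G1"
    "\<forall>a\<in>G1. \<forall>r\<in>G1. e_form \<Omega> (U a) (U r) = l2_inner \<Omega> (P a) (divg \<Omega> (U r))"
    using elastic_common by blast
  obtain G2 where 2: "AE t in time T. t \<in> G2"
    "\<forall>a\<in>G2. \<forall>r\<in>G2. l2_inner \<Omega> (Z a) (P r) = integral {0..a} (\<lambda>s. Zt s (P r))"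
    using content_common by blast
  obtain G3 where 3: "AE t in time T. t \<in> G3"
    "\<forall>a\<in>G3. \<forall>b\<in>G3. \<forall>r\<in>G3. a \<le> b \<longrightarrow> l2_inner \<Omega> (P b) (P r) - l2_inner \<Omega> (P a) (P r) = integral {a..b} (\<lambda>s. l2_inner \<Omega> (Pt s) (P r))"
    using pressure_common[OF seminormed_H10 L2_time_strongly_measurable[OF P] goodD(5) h1_norm_ge(1)] by blast
  obtain G4 where 4: "AE t in time T. t \<in> G4"
    "\<forall>a\<in>G4. \<forall>b\<in>G4. \<forall>r\<in>G4. a \<le> b \<longrightarrow> l2_inner \<Omega> (P b) (Z r) - l2_inner \<Omega> (P a) (Z r) = integral {a..b} (\<lambda>s. l2_inner \<Omega> (Pt s) (Z r))"
    using pressure_common[OF seminormed_L2 L2_time_strongly_measurable[OF Z] goodD(6) order_refl] by blast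
  have "linear_poro_common \<Omega> T c0 U P Z Pt Zt (G1 \<inter> G2 \<inter> G3 \<inter> G4)"
  proof unfold_locales
    show "AE t in time T. t \<in> G1 \<inter> G2 \<inter> G3 \<inter> G4"
      using 1(2) 2(1) 3(1) 4(1) by eventually_elim simp
  qed (use 1 2(2) 3(2) 4(2) in auto)
  then show ?thesis by blast
qed

context linear_poro_common
begin

lemmas GD = goodD[OF G[THEN subsetD]]

lemma Z_P:
  assumes "a \<in> G" "b \<in> G"
  shows "l2_inner \<Omega> (Z a) (P b) = c0 * l2_inner \<Omega> (P a) (P b) + e_form \<Omega> (U b) (U a)"
proof -
  have "l2_inner \<Omega> (Z a) (P b) = l2_inner \<Omega> (\<lambda>x. c0 *\<^sub>R P a x + 1 *\<^sub>R divg \<Omega> (U a) x) (P b)"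
    using l2_inner_cong[OF GD(6)[OF assms(1)] GD(5)[OF assms(2)] GD(10)[OF assms(1)] AE_I2[OF refl]] by simp
  also have "\<dots> = c0 * l2_inner \<Omega> (P a) (P b) + 1 * l2_inner \<Omega> (divg \<Omega> (U a)) (P b)"
    by (rule l2_inner_lincomb_left[OF GD(5)[OF assms(1)] GD(9)[OF assms(1)] GD(5)[OF assms(2)]])
  finally show ?thesis using e[OF assms(2,1)] by (simp add: l2_inner_commute)
qed

text \<open>Both the pressure and the elastic form are symmetric, so the two times can be exchanged. This is
  what makes \<open>(Z, P)\<close> a quadratic energy.\<close>

lemma symmetric:
  assumes "a \<in> G" "b \<in> G"
  shows "l2_inner \<Omega> (Z a) (P b) = l2_inner \<Omega> (Z b) (P a)"
  using Z_P[OF assms] Z_P[OF assms(2,1)] by (simp add: l2_inner_commute[of "P a"] e_form_commute[of "U a"])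

text \<open>The energy \<open>c\<^sub>0 \<parallel>P\<parallel>\<^sup>2 + e(U, U)\<close>, written as a pairing whose increments in either factor are known.\<close>

definition E :: "real \<Rightarrow> real" where "E t = l2_inner \<Omega> (Z t) (P t)"

lemma E_eq: "t \<in> G \<Longrightarrow> E t = c0 * (l2_norm \<Omega> (P t))\<^sup>2 + e_form \<Omega> (U t) (U t)"
  using Z_P[of t t] by (simp add: E_def l2_norm_sq)

lemma E_ge: "t \<in> G \<Longrightarrow> c0 * (l2_norm \<Omega> (P t))\<^sup>2 + (l2_norm \<Omega> (divg \<Omega> (U t)))\<^sup>2 \<le> E t"
  using E_eq e_form_ge[OF GD(3)] by simp

lemma E_nonneg: "t \<in> G \<Longrightarrow> 0 \<le> E t"
  using E_ge[of t] c0 by (smt (verit) mult_nonneg_nonneg zero_le_power2)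

lemma Z_le_E:
  assumes "t \<in> G"
  shows "(l2_norm \<Omega> (Z t))\<^sup>2 \<le> 2 * (c0 + 1) * E t"
proof -
  let ?p = "l2_norm \<Omega> (P t)" and ?d = "l2_norm \<Omega> (divg \<Omega> (U t))"
  have "l2_norm \<Omega> (Z t) = l2_norm \<Omega> (\<lambda>x. c0 *\<^sub>R P t x + 1 *\<^sub>R divg \<Omega> (U t) x)"
    using l2_norm_cong[OF GD(6)[OF assms] GD(10)[OF assms]] by simp
  also have "\<dots> \<le> \<bar>c0\<bar> * ?p + \<bar>1\<bar> * ?d"
    by (rule seminormed.lincomb_le[OF seminormed_L2 GD(5)[OF assms] GD(9)[OF assms]])
  finally have "(l2_norm \<Omega> (Z t))\<^sup>2 \<le> (c0 * ?p + ?d)\<^sup>2"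
    using c0 l2_norm_nonneg[of "Z t"] by (intro power_mono) auto
  also have "\<dots> \<le> 2 * (c0 * ?p)\<^sup>2 + 2 * ?d\<^sup>2"
    using sum_squares_bound[of "c0 * ?p" ?d] by (simp add: power2_sum)
  also have "\<dots> \<le> 2 * (c0 + 1) * (c0 * ?p\<^sup>2 + ?d\<^sup>2)"
    using c0 by (simp add: algebra_simps power2_eq_square)
  also have "\<dots> \<le> 2 * (c0 + 1) * E t"
    using E_ge[OF assms] c0 by (intro mult_left_mono) auto
  finally show ?thesis .
qed

text \<open>By coercivity and the elastic equation at both times,
  \<open>\<parallel>\<nabla>\<cdot>(U(a) - U(b))\<parallel>\<^sup>2 \<le> e(U(a) - U(b), U(a) - U(b)) = (P(a) - P(b), \<nabla>\<cdot>(U(a) - U(b)))\<close>.\<close>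

lemma Z_lipschitz:
  assumes "a \<in> G" "b \<in> G"
  shows "l2_norm \<Omega> (\<lambda>x. Z a x - Z b x) \<le> (c0 + 1) * l2_norm \<Omega> (\<lambda>x. P a x - P b x)"
proof -
  note a = GD[OF assms(1)] and b = GD[OF assms(2)]
  let ?p = "l2_norm \<Omega> (\<lambda>x. P a x - P b x)" and ?d = "l2_norm \<Omega> (\<lambda>x. divg \<Omega> (U a) x - divg \<Omega> (U b) x)"
  have pd: "(\<lambda>x. P a x - P b x) \<in> L2 \<Omega>" and dd: "(\<lambda>x. divg \<Omega> (U a) x - divg \<Omega> (U b) x) \<in> L2 \<Omega>"
    and ud: "(\<lambda>x. U a x - U b x) \<in> vH10 \<Omega>"
    by (rule seminormed.diff_mem[OF seminormed_L2 a(5) b(5)], rule seminormed.diff_mem[OF seminormed_L2 a(9) b(9)],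
        rule seminormed.diff_mem[OF seminormed_vH10 a(3) b(3)])
  have "?d\<^sup>2 = (l2_norm \<Omega> (divg \<Omega> (\<lambda>x. U a x - U b x)))\<^sup>2"
    using l2_norm_cong[OF divg_L2[OF ud], of "\<lambda>x. divg \<Omega> (U a) x - divg \<Omega> (U b) x"] divg_lincomb[OF a(3) b(3), of 1 "-1"] by simp
  also have "\<dots> \<le> e_form \<Omega> (\<lambda>x. U a x - U b x) (\<lambda>x. U a x - U b x)" by (rule e_form_ge[OF ud])
  also have "\<dots> = (e_form \<Omega> (U a) (U a) - e_form \<Omega> (U a) (U b)) - (e_form \<Omega> (U b) (U a) - e_form \<Omega> (U b) (U b))"
    using e_form_diff_left[OF a(3) b(3) ud] e_form_diff_left[OF a(3) b(3) a(3)] e_form_diff_left[OF a(3) b(3) b(3)]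
      e_form_commute[of "U a" "\<lambda>x. U a x - U b x"] e_form_commute[of "U b" "\<lambda>x. U a x - U b x"] e_form_commute[of "U a" "U b"]
    by linarith
  also have "\<dots> = l2_inner \<Omega> (\<lambda>x. P a x - P b x) (\<lambda>x. divg \<Omega> (U a) x - divg \<Omega> (U b) x)"
    unfolding e[OF assms] e[OF assms(1,1)] e[OF assms(2,2)] e[OF assms(2,1)]
      l2_inner_diff_left[OF a(5) b(5) dd] l2_inner_diff_right[OF a(9) b(9) a(5)] l2_inner_diff_right[OF a(9) b(9) b(5)] ..
  also have "\<dots> \<le> ?p * ?d" using l2_cauchy_schwarz[OF pd dd] by simp
  finally have "?d * ?d \<le> ?p * ?d" by (simp add: power2_eq_square)
  then have D: "?d \<le> ?p"
    using l2_norm_nonneg[of "\<lambda>x. divg \<Omega> (U a) x - divg \<Omega> (U b) x"] l2_norm_nonneg[of "\<lambda>x. P a x - P b x"]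
    by (cases "?d = 0") (auto dest: mult_right_le_imp_le)
  have "AE x in lebesgue_on \<Omega>. Z a x - Z b x = c0 *\<^sub>R (P a x - P b x) + 1 *\<^sub>R (divg \<Omega> (U a) x - divg \<Omega> (U b) x)"
    using a(10) b(10) by eventually_elim (simp add: algebra_simps)
  then have "l2_norm \<Omega> (\<lambda>x. Z a x - Z b x) = l2_norm \<Omega> (\<lambda>x. c0 *\<^sub>R (P a x - P b x) + 1 *\<^sub>R (divg \<Omega> (U a) x - divg \<Omega> (U b) x))"
    by (rule l2_norm_cong[OF seminormed.diff_mem[OF seminormed_L2 a(6) b(6)]])
  also have "\<dots> \<le> \<bar>c0\<bar> * ?p + \<bar>1\<bar> * ?d" by (rule seminormed.lincomb_le[OF seminormed_L2 pd dd])
  also have "\<dots> \<le> (c0 + 1) * ?p" using D c0 by (simp add: distrib_right)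
  finally show ?thesis .
qed

text \<open>The increment of the pressure is tested with itself.\<close>

lemma P_increment:
  assumes "a \<in> G" "b \<in> G" "a \<le> b"
  shows "l2_norm \<Omega> (\<lambda>x. P b x - P a x) \<le> integral {a..b} h"
proof -
  let ?D = "\<lambda>x. P b x - P a x"
  note a = GD[OF assms(1)] and b = GD[OF assms(2)]
  have D: "?D \<in> L2 \<Omega>" by (rule seminormed.diff_mem[OF seminormed_L2 b(5) a(5)])
  have a': "0 \<le> a" "b \<le> T" using a(1) b(2) by auto
  have "(l2_norm \<Omega> ?D)\<^sup>2 = (l2_inner \<Omega> (P b) (P b) - l2_inner \<Omega> (P a) (P b)) - (l2_inner \<Omega> (P b) (P a) - l2_inner \<Omega> (P a) (P a))"
    unfolding l2_norm_sq l2_inner_diff_right[OF b(5) a(5) D] l2_inner_diff_left[OF b(5) a(5) a(5)] l2_inner_diff_left[OF b(5) a(5) b(5)] ..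
  also have "\<dots> = integral {a..b} (\<lambda>s. l2_inner \<Omega> (Pt s) (P b)) - integral {a..b} (\<lambda>s. l2_inner \<Omega> (Pt s) (P a))"
    using prP[OF assms(1,2,2,3)] prP[OF assms(1,2,1,3)] by simp
  also have "\<dots> = integral {a..b} (\<lambda>s. l2_inner \<Omega> (Pt s) (P b) - l2_inner \<Omega> (Pt s) (P a))"
    by (rule integral_diff[symmetric]) (rule time_integral(2)[OF Pt_integrable[OF b(5)] a'], rule time_integral(2)[OF Pt_integrable[OF a(5)] a'])
  also have "\<dots> \<le> integral {a..b} (\<lambda>s. h s * l2_norm \<Omega> ?D)"
  proof (rule time_integral_le[OF Bochner_Integration.integrable_diff[OF Pt_integrable[OF b(5)] Pt_integrable[OF a(5)]] integrable_mult_left[OF h(2)] a'])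
    show "AE s in time T. a < s \<longrightarrow> s < b \<longrightarrow> l2_inner \<Omega> (Pt s) (P b) - l2_inner \<Omega> (Pt s) (P a) \<le> h s * l2_norm \<Omega> ?D"
      using Pt_bound[OF D] AE_good
    proof eventually_elim
      case (elim s)
      show ?case using elim(1) l2_inner_diff_right[OF b(5) a(5) goodD(7)[OF elim(2)]] by (intro impI) linarith
    qed
  qed
  finally have "l2_norm \<Omega> ?D * l2_norm \<Omega> ?D \<le> integral {a..b} h * l2_norm \<Omega> ?D" by (simp add: power2_eq_square)
  then show ?thesis
    using l2_norm_nonneg[of ?D] h_integral_nonneg[OF a']
    by (cases "l2_norm \<Omega> ?D = 0") (auto dest: mult_right_le_imp_le)
qed

lemma Z_increment:
  assumes "a \<in> G" "b \<in> G" "a \<le> b"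
  shows "l2_norm \<Omega> (\<lambda>x. Z b x - Z a x) \<le> (c0 + 1) * integral {a..b} h"
proof -
  have "l2_norm \<Omega> (\<lambda>x. Z b x - Z a x) \<le> (c0 + 1) * l2_norm \<Omega> (\<lambda>x. P b x - P a x)" by (rule Z_lipschitz[OF assms(2,1)])
  also have "\<dots> \<le> (c0 + 1) * integral {a..b} h" using P_increment[OF assms] c0 by (intro mult_left_mono) auto
  finally show ?thesis .
qed

lemma bounded:
  "\<exists>B. \<forall>t\<in>G. l2_norm \<Omega> (Z t) \<le> B \<and> l2_norm \<Omega> (P t) \<le> B"
proof -
  obtain r where r: "r \<in> G" using conull_dense[OF AE_G order_refl T order_refl] by blast
  define H where "H = integral {0..T} h"
  have le: "integral {a..b} h \<le> H" if "0 \<le> a" "a \<le> b" "b \<le> T" for a b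
    using time_integral_combine[OF h(2) order_refl that(1), of b] time_integral_combine[OF h(2) order_refl _ that(3)]
      h_integral_nonneg[of 0 a] h_integral_nonneg[of b T] that by (simp add: H_def)
  have H: "0 \<le> H" unfolding H_def by (rule h_integral_nonneg) auto
  have "l2_norm \<Omega> (Z t) \<le> l2_norm \<Omega> (Z r) + (c0 + 1) * H \<and> l2_norm \<Omega> (P t) \<le> l2_norm \<Omega> (P r) + H" if t: "t \<in> G" for t
  proof -
    have P: "l2_norm \<Omega> (\<lambda>x. P t x - P r x) \<le> H"
    proof (cases "t \<le> r")
      case True
      then show ?thesis using P_increment[OF t r] le[of t r] GD(1,2)[OF t] GD(1,2)[OF r]
          seminormed.norm_minus_commute[OF seminormed_L2 GD(5)[OF t] GD(5)[OF r]] by linarith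
    next
      case False
      then show ?thesis using P_increment[OF r t] le[of r t] GD(1,2)[OF t] GD(1,2)[OF r] by linarith
    qed
    have "l2_norm \<Omega> (\<lambda>x. Z t x - Z r x) \<le> (c0 + 1) * l2_norm \<Omega> (\<lambda>x. P t x - P r x)" by (rule Z_lipschitz[OF t r])
    also have "\<dots> \<le> (c0 + 1) * H" using P c0 by (intro mult_left_mono) auto
    finally show ?thesis
      using P seminormed.reverse_triangle[OF seminormed_L2 GD(6)[OF t] GD(6)[OF r]]
        seminormed.reverse_triangle[OF seminormed_L2 GD(5)[OF t] GD(5)[OF r]] by linarith
  qed
  then show ?thesis
    by (intro exI[of _ "max (l2_norm \<Omega> (Z r) + (c0 + 1) * H) (l2_norm \<Omega> (P r) + H)"]) (auto simp: le_max_iff_disj)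
qed

text \<open>Differentiating the symmetric function \<open>(Z a, P r)\<close> in either variable gives the same result, so the
  duality pairing of \<open>Z\<^sub>t\<close> with the pressure is an ordinary inner product with \<open>P\<^sub>t\<close>.\<close>

lemma pairing_common:
  "\<exists>G'\<subseteq>G. (AE t in time T. t \<in> G') \<and> (\<forall>s\<in>G'. \<forall>r\<in>G'. Zt s (P r) = l2_inner \<Omega> (Pt s) (Z r))"
proof -
  have "\<exists>G'\<subseteq>G. (AE t in time T. t \<in> G') \<and> (\<forall>s\<in>G'. \<forall>b\<in>G'. \<forall>r\<in>G'. Zt s (P r) = l2_inner \<Omega> (Pt s) (Z r))"
  proof (rule seminormed.common_null_set[OF seminormed_H10 L2_time_strongly_measurable[OF P] AE_G])
    fix r assume r: "r \<in> G"
    note i = Zt_integrable[OF GD(4)[OF r]] Pt_integrable[OF GD(6)[OF r]]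
    obtain a where a: "a \<in> G" using conull_dense[OF AE_G order_refl T order_refl] by blast
    define c where "c = l2_inner \<Omega> (P a) (Z r) - integral {0..a} (\<lambda>s. l2_inner \<Omega> (Pt s) (Z r))"
    have "AE b in time T. integral {0..b} (\<lambda>s. Zt s (P r) - l2_inner \<Omega> (Pt s) (Z r)) = c"
      using AE_G
    proof eventually_elim
      case (elim b)
      have b': "0 \<le> (0::real)" "b \<le> T" using GD(2)[OF elim] by auto
      have "integral {0..b} (\<lambda>s. Zt s (P r) - l2_inner \<Omega> (Pt s) (Z r))
          = integral {0..b} (\<lambda>s. Zt s (P r)) - integral {0..b} (\<lambda>s. l2_inner \<Omega> (Pt s) (Z r))"
        by (rule integral_diff) (rule time_integral(2)[OF i(1) b'], rule time_integral(2)[OF i(2) b'])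
      also have "integral {0..b} (\<lambda>s. Zt s (P r)) = l2_inner \<Omega> (P b) (Z r)"
        using con[OF elim r] symmetric[OF elim r] by (simp add: l2_inner_commute)
      also have "integral {0..b} (\<lambda>s. l2_inner \<Omega> (Pt s) (Z r)) = l2_inner \<Omega> (P b) (Z r) - c"
      proof (cases "a \<le> b")
        case True
        then show ?thesis using prZ[OF a elim r] time_integral_combine[OF i(2) order_refl, of a b] GD(1)[OF a] b'
          by (simp add: c_def)
      next
        case False
        then show ?thesis using prZ[OF elim a r] time_integral_combine[OF i(2) order_refl, of b a] GD(1)[OF elim] GD(2)[OF a]
          by (simp add: c_def)
      qed
      finally show ?case by simp
    qed
    from primitive_zero_imp_zero[OF Bochner_Integration.integrable_diff[OF i] this]
    have "AE s in time T. Zt s (P r) = l2_inner \<Omega> (Pt s) (Z r)" by simp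
    then show "\<exists>H. (AE t in time T. t \<in> H) \<and> (\<forall>s\<in>H. \<forall>b\<in>H. Zt s (P r) = l2_inner \<Omega> (Pt s) (Z r))"
      by (intro exI[of _ "{s. Zt s (P r) = l2_inner \<Omega> (Pt s) (Z r)}"]) auto
  next
    fix s b r and rs :: "nat \<Rightarrow> real"
    assume s: "s \<in> G" and r: "r \<in> G" and rs: "\<And>n. rs n \<in> G"
      and lim: "(\<lambda>n. h1_norm \<Omega> (\<lambda>x. P (rs n) x - P r x)) \<longlonglongrightarrow> 0"
      and eq: "\<And>n. Zt s (P (rs n)) = l2_inner \<Omega> (Pt s) (Z (rs n))"
    have "(\<lambda>n. l2_norm \<Omega> (\<lambda>x. Z (rs n) x - Z r x)) \<longlonglongrightarrow> 0"
    proof (rule tendsto_sandwich[OF _ _ tendsto_const tendsto_mult_right_zero[OF lim]])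
      show "\<forall>\<^sub>F n in sequentially. l2_norm \<Omega> (\<lambda>x. Z (rs n) x - Z r x) \<le> (c0 + 1) * h1_norm \<Omega> (\<lambda>x. P (rs n) x - P r x)"
      proof (intro always_eventually allI)
        fix n
        have "(c0 + 1) * l2_norm \<Omega> (\<lambda>x. P (rs n) x - P r x) \<le> (c0 + 1) * h1_norm \<Omega> (\<lambda>x. P (rs n) x - P r x)"
          using c0 h1_norm_ge(1) by (intro mult_left_mono) auto
        then show "l2_norm \<Omega> (\<lambda>x. Z (rs n) x - Z r x) \<le> (c0 + 1) * h1_norm \<Omega> (\<lambda>x. P (rs n) x - P r x)"
          using Z_lipschitz[OF rs[of n] r] by linarith
      qed
    qed (simp add: l2_norm_nonneg)
    from seminormed.dual_LIMSEQ[OF seminormed_L2 l2_inner_dual[OF GD(7)[OF s]] GD(6)[OF rs] GD(6)[OF r] this]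
    have "(\<lambda>n. l2_inner \<Omega> (Pt s) (Z (rs n))) \<longlonglongrightarrow> l2_inner \<Omega> (Pt s) (Z r)" by (simp add: l2_inner_commute)
    moreover have "(\<lambda>n. Zt s (P (rs n))) \<longlonglongrightarrow> Zt s (P r)"
      by (rule seminormed.dual_LIMSEQ[OF seminormed_H10 GD(8)[OF s] GD(4)[OF rs] GD(4)[OF r] lim])
    ultimately show "Zt s (P r) = l2_inner \<Omega> (Pt s) (Z r)" unfolding eq by (auto intro: LIMSEQ_unique)
  qed
  then show ?thesis by blast
qed

text \<open>The increment of the energy differs from \<open>2 \<integral> \<langle>Z\<^sub>t, P\<rangle>\<close> by a quadratic term in \<open>\<integral> \<parallel>P\<^sub>t\<parallel>\<close>, which
  disappears under subdivision. The initial energy vanishes because \<open>Z(0) = 0\<close>.\<close>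

theorem energy_identity:
  "\<exists>G'\<subseteq>G. (AE t in time T. t \<in> G') \<and> (\<forall>b\<in>G'. E b = 2 * integral {0..b} (\<lambda>s. Zt s (P s)))"
proof -
  obtain G' where G': "G' \<subseteq> G" "AE t in time T. t \<in> G'" and K: "\<And>s r. s \<in> G' \<Longrightarrow> r \<in> G' \<Longrightarrow> Zt s (P r) = l2_inner \<Omega> (Pt s) (Z r)"
    using pairing_common by blast
  define w where "w s = Zt s (P s)" for s
  have w: "integrable (time T) w" unfolding w_def by (rule Zt_P_integrable)
  define \<Phi> where "\<Phi> b = E b - 2 * integral {0..b} w" for b
  have incr: "\<bar>\<Phi> b - \<Phi> a\<bar> \<le> (2 * (c0 + 1)) * (integral {a..b} h)\<^sup>2" if ab: "a \<in> G'" "b \<in> G'" "a < b" for a b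
  proof -
    have aG: "a \<in> G" and bG: "b \<in> G" using ab G' by auto
    note a = GD[OF aG] and b = GD[OF bG]
    have a': "0 \<le> a" "b \<le> T" "a \<le> b" using a(1) b(2) ab(3) by auto
    let ?m = "integral {a..b} h"
    note i = Pt_integrable[OF a(6)] Pt_integrable[OF b(6)]
    have "E b - E a = (l2_inner \<Omega> (P b) (Z a) - l2_inner \<Omega> (P a) (Z a)) + (l2_inner \<Omega> (P b) (Z b) - l2_inner \<Omega> (P a) (Z b))"
      using symmetric[OF aG bG] by (simp add: E_def l2_inner_commute)
    also have "\<dots> = integral {a..b} (\<lambda>s. l2_inner \<Omega> (Pt s) (Z a)) + integral {a..b} (\<lambda>s. l2_inner \<Omega> (Pt s) (Z b))"
      using prZ[OF aG bG aG a'(3)] prZ[OF aG bG bG a'(3)] by simp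
    also have "\<dots> = integral {a..b} (\<lambda>s. l2_inner \<Omega> (Pt s) (Z a) + l2_inner \<Omega> (Pt s) (Z b))"
      by (rule integral_add[symmetric]) (rule time_integral(2)[OF i(1) a'(1,2)], rule time_integral(2)[OF i(2) a'(1,2)])
    finally have EE: "E b - E a = integral {a..b} (\<lambda>s. l2_inner \<Omega> (Pt s) (Z a) + l2_inner \<Omega> (Pt s) (Z b))" .
    have "integral {0..b} w - integral {0..a} w = integral {a..b} w"
      using time_integral_combine[OF w order_refl a'(1,3,2)] by simp
    then have "\<Phi> b - \<Phi> a = integral {a..b} (\<lambda>s. l2_inner \<Omega> (Pt s) (Z a) + l2_inner \<Omega> (Pt s) (Z b)) - integral {a..b} (\<lambda>s. 2 * w s)"
      using EE by (simp add: \<Phi>_def)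
    also have "\<dots> = integral {a..b} (\<lambda>s. l2_inner \<Omega> (Pt s) (Z a) + l2_inner \<Omega> (Pt s) (Z b) - 2 * w s)"
      by (rule integral_diff[symmetric]) (rule time_integral(2)[OF _ a'(1,2)], use i w in simp)+
    also have "\<bar>\<dots>\<bar> \<le> integral {a..b} (\<lambda>s. h s * (2 * ((c0 + 1) * ?m)))"
    proof (rule time_integral_abs_le[OF _ integrable_mult_left[OF h(2)] a'(1,2)])
      show "integrable (time T) (\<lambda>s. l2_inner \<Omega> (Pt s) (Z a) + l2_inner \<Omega> (Pt s) (Z b) - 2 * w s)" using i w by simp
      show "AE s in time T. a < s \<longrightarrow> s < b \<longrightarrow> \<bar>l2_inner \<Omega> (Pt s) (Z a) + l2_inner \<Omega> (Pt s) (Z b) - 2 * w s\<bar> \<le> h s * (2 * ((c0 + 1) * ?m))"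
        using G'(2)
      proof (eventually_elim, intro impI)
        fix s assume s: "s \<in> G'" and sab: "a < s" "s < b"
        have sG: "s \<in> G" using s G' by auto
        note sD = GD[OF sG]
        have sub: "integral {a..s} h \<le> ?m" "integral {s..b} h \<le> ?m"
          using time_integral_combine[OF h(2) a'(1), of s b] sab a' h_integral_nonneg[of a s] h_integral_nonneg[of s b] sD(1,2) by auto
        have c: "(c0 + 1) * integral {a..s} h \<le> (c0 + 1) * ?m" "(c0 + 1) * integral {s..b} h \<le> (c0 + 1) * ?m"
          using sub c0 by (auto intro: mult_left_mono)
        have "\<bar>l2_inner \<Omega> (Pt s) (\<lambda>x. Z s x - Z a x)\<bar> \<le> h s * l2_norm \<Omega> (\<lambda>x. Z s x - Z a x)"
          unfolding h_def by (rule l2_cauchy_schwarz[OF sD(7) seminormed.diff_mem[OF seminormed_L2 sD(6) a(6)]])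
        also have "\<dots> \<le> h s * ((c0 + 1) * ?m)"
          using Z_increment[OF aG sG] sab c(1) h(3)[of s] by (intro mult_left_mono) auto
        finally have 1: "\<bar>l2_inner \<Omega> (Pt s) (Z s) - l2_inner \<Omega> (Pt s) (Z a)\<bar> \<le> h s * ((c0 + 1) * ?m)"
          using l2_inner_diff_right[OF sD(6) a(6) sD(7)] by simp
        have "\<bar>l2_inner \<Omega> (Pt s) (\<lambda>x. Z b x - Z s x)\<bar> \<le> h s * l2_norm \<Omega> (\<lambda>x. Z b x - Z s x)"
          unfolding h_def by (rule l2_cauchy_schwarz[OF sD(7) seminormed.diff_mem[OF seminormed_L2 b(6) sD(6)]])
        also have "\<dots> \<le> h s * ((c0 + 1) * ?m)"
          using Z_increment[OF sG bG] sab c(2) h(3)[of s] by (intro mult_left_mono) auto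
        finally have 2: "\<bar>l2_inner \<Omega> (Pt s) (Z b) - l2_inner \<Omega> (Pt s) (Z s)\<bar> \<le> h s * ((c0 + 1) * ?m)"
          using l2_inner_diff_right[OF b(6) sD(6) sD(7)] by simp
        have "w s = l2_inner \<Omega> (Pt s) (Z s)" unfolding w_def by (rule K[OF s s])
        moreover have "h s * (2 * ((c0 + 1) * ?m)) = 2 * (h s * ((c0 + 1) * ?m))" by simp
        ultimately show "\<bar>l2_inner \<Omega> (Pt s) (Z a) + l2_inner \<Omega> (Pt s) (Z b) - 2 * w s\<bar> \<le> h s * (2 * ((c0 + 1) * ?m))"
          using 1 2 by linarith
      qed
    qed
    also have "\<dots> = (2 * (c0 + 1)) * ?m\<^sup>2" by (simp add: power2_eq_square)
    finally show ?thesis .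
  qed
  obtain B where B: "\<And>t. t \<in> G \<Longrightarrow> l2_norm \<Omega> (Z t) \<le> B" using bounded by blast
  have small: "\<exists>d>0. \<forall>a\<in>G'. a < d \<longrightarrow> \<bar>\<Phi> a\<bar> < \<epsilon>" if \<epsilon>: "\<epsilon> > 0" for \<epsilon>
  proof -
    let ?f = "\<lambda>a. \<bar>B\<bar> * integral {0..a} h + 2 * \<bar>integral {0..a} w\<bar>"
    have "continuous_on {0..T} ?f"
      by (intro continuous_intros time_integral_continuous h(2) w)
    then obtain d where d: "d > 0" "\<And>a. a \<in> {0..T} \<Longrightarrow> dist a 0 < d \<Longrightarrow> dist (?f a) (?f 0) < \<epsilon>"
      using T \<epsilon> unfolding continuous_on_iff by (metis atLeastAtMost_iff less_imp_le order_refl)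
    have "\<bar>\<Phi> a\<bar> < \<epsilon>" if a: "a \<in> G'" "a < d" for a
    proof -
      have aG: "a \<in> G" using a G' by auto
      note aD = GD[OF aG]
      have a': "0 \<le> (0::real)" "a \<le> T" using aD by auto
      have "E a = integral {0..a} (\<lambda>s. Zt s (P a))" using con[OF aG aG] by (simp add: E_def)
      also have "\<bar>\<dots>\<bar> \<le> integral {0..a} (\<lambda>s. h s * l2_norm \<Omega> (Z a))"
      proof (rule time_integral_abs_le[OF Zt_integrable[OF aD(4)] integrable_mult_left[OF h(2)] a'])
        show "AE s in time T. 0 < s \<longrightarrow> s < a \<longrightarrow> \<bar>Zt s (P a)\<bar> \<le> h s * l2_norm \<Omega> (Z a)"
          using G'(2) Pt_bound[OF aD(6)] by eventually_elim (simp add: K a(1))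
      qed
      also have "\<dots> = integral {0..a} h * l2_norm \<Omega> (Z a)" by simp
      also have "\<dots> \<le> integral {0..a} h * \<bar>B\<bar>"
        using B[OF aG] h_integral_nonneg[OF a'] by (intro mult_left_mono) auto
      finally have "\<bar>\<Phi> a\<bar> \<le> ?f a" by (simp add: \<Phi>_def mult.commute)
      moreover have "?f a < \<epsilon>" using d(2)[of a] aD(1,2) a(2) by (simp add: dist_real_def)
      ultimately show ?thesis by linarith
    qed
    then show ?thesis using d(1) by blast
  qed
  have "\<Phi> b = 0" if b: "b \<in> G'" for b
  proof -
    have bT: "0 < b" "b < T" using GD(1,2) b G' by auto
    have "\<bar>\<Phi> b\<bar> \<le> 0 + \<epsilon>" if \<epsilon>: "\<epsilon> > 0" for \<epsilon>
    proof -
      obtain d where d: "d > 0" "\<forall>a\<in>G'. a < d \<longrightarrow> \<bar>\<Phi> a\<bar> < \<epsilon>" using small[OF \<epsilon>] by blast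
      obtain a where a: "a \<in> G'" "a < min d b"
        using conull_dense[OF G'(2) order_refl, of "min d b"] d(1) bT by (auto simp: min_le_iff_disj)
      have "\<Phi> b = \<Phi> a"
      proof (rule quadratic_increments_constant[OF h(2) _ G'(2) _ incr])
        show "AE t in time T. 0 \<le> h t" by (simp add: h(3))
        show "G' \<subseteq> {0<..<T}" using GD(1,2) G' by auto
      qed (use a b c0 in auto)
      then show ?thesis using d(2) a by auto
    qed
    then have "\<bar>\<Phi> b\<bar> \<le> 0" by (rule field_le_epsilon)
    then show ?thesis by simp
  qed
  then have "\<forall>b\<in>G'. E b = 2 * integral {0..b} (\<lambda>s. Zt s (P s))" by (simp add: \<Phi>_def w_def[abs_def])
  then show ?thesis using G' by blast
qed

end

section \<open>The nonlinear flux\<close>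

locale permeable_domain = open_domain \<Omega> for \<Omega> :: "'a::euclidean_space set" +
  fixes k :: "real \<Rightarrow> real" and k1 k2 L :: real
  assumes k1: "0 < k1" and k_bounds: "k1 \<le> k x" "k x \<le> k2" and lipschitz: "L-lipschitz_on UNIV k"
begin

lemma k_abs: "\<bar>k x\<bar> \<le> k2" "0 \<le> k2" "\<bar>k x - k y\<bar> \<le> k2"
  using k1 k_bounds[of x] k_bounds[of y] by auto

lemma L_nonneg: "0 \<le> L" using lipschitz by (rule lipschitz_on_nonneg)

lemma k_lipschitz: "\<bar>k x - k y\<bar> \<le> L * \<bar>x - y\<bar>"
  using lipschitz_onD[OF lipschitz, of x y] by (simp add: dist_real_def)

lemma k_measurable: "z \<in> borel_measurable M \<Longrightarrow> (\<lambda>x. k (z x)) \<in> borel_measurable M"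
  by (rule measurable_compose[OF _ borel_measurable_continuous_onI[OF lipschitz_on_continuous_on[OF lipschitz]]])

lemma flux_L2:
  assumes "z \<in> L2 \<Omega>" "a \<in> L2 \<Omega>"
  shows "(\<lambda>x. k (z x) *\<^sub>R a x) \<in> L2 \<Omega>"
proof (rule L2_dominated)
  show "(\<lambda>x. k2 *\<^sub>R a x) \<in> L2 \<Omega>" by (rule L2_scale[OF assms(2)])
  show "(\<lambda>x. k (z x) *\<^sub>R a x) \<in> borel_measurable (lebesgue_on \<Omega>)"
    using k_measurable[OF L2_measurable[OF assms(1)]] L2_measurable[OF assms(2)] by measurable
  show "AE x in lebesgue_on \<Omega>. norm (k (z x) *\<^sub>R a x) \<le> norm (k2 *\<^sub>R a x)"
    using k_abs by (auto intro!: AE_I2 mult_right_mono)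
qed

lemma flux_bound:
  assumes "z \<in> L2 \<Omega>" "a \<in> L2 \<Omega>" "b \<in> L2 \<Omega>"
  shows "\<bar>l2_inner \<Omega> (\<lambda>x. k (z x) *\<^sub>R a x) b\<bar> \<le> k2 * (l2_norm \<Omega> a * l2_norm \<Omega> b)"
proof -
  have "\<bar>l2_inner \<Omega> (\<lambda>x. k (z x) *\<^sub>R a x) b\<bar> \<le> (LINT x|lebesgue_on \<Omega>. k2 * (norm (a x) * norm (b x)))"
    unfolding l2_inner_def
  proof (rule order_trans[OF integral_abs_bound integral_mono_AE])
    show "integrable (lebesgue_on \<Omega>) (\<lambda>x. \<bar>(k (z x) *\<^sub>R a x) \<bullet> b x\<bar>)"
      by (rule integrable_abs[OF L2_inner_integrable[OF flux_L2[OF assms(1,2)] assms(3)]])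
    show "integrable (lebesgue_on \<Omega>) (\<lambda>x. k2 * (norm (a x) * norm (b x)))"
      by (rule integrable_mult_right[OF L2_norm_prod_integrable[OF assms(2,3)]])
    show "AE x in lebesgue_on \<Omega>. \<bar>(k (z x) *\<^sub>R a x) \<bullet> b x\<bar> \<le> k2 * (norm (a x) * norm (b x))"
      using k_abs Cauchy_Schwarz_ineq2 by (auto simp: abs_mult intro!: AE_I2 mult_mono)
  qed
  also have "\<dots> \<le> k2 * (l2_norm \<Omega> a * l2_norm \<Omega> b)"
    using l2_norm_prod[OF assms(2,3)] k_abs(2) by (simp add: mult_left_mono)
  finally show ?thesis .
qed

text \<open>The Nemytskii operator is Lipschitz on \<open>L\<^sup>2\<close> but here multiplies a product that is merely integrable.
  Splitting off the large values of that product leaves an \<open>L\<^sup>2\<close> function.\<close>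

lemma nemytskii_LIMSEQ:
  assumes zs: "\<And>n. zs n \<in> L2 \<Omega>" "z \<in> L2 \<Omega>" "(\<lambda>n. l2_norm \<Omega> (\<lambda>x. zs n x - z x)) \<longlonglongrightarrow> 0"
    and g: "integrable (lebesgue_on \<Omega>) g"
  shows "(\<lambda>n. LINT x|lebesgue_on \<Omega>. (k (zs n x) - k (z x)) * g x) \<longlonglongrightarrow> 0"
proof (rule LIMSEQ_I)
  fix \<epsilon> :: real assume \<epsilon>: "\<epsilon> > 0"
  note gm = borel_measurable_integrable[OF g]
  have "(\<lambda>n. LINT x|lebesgue_on \<Omega>. \<bar>g x\<bar> * indicator {x. real n < \<bar>g x\<bar>} x) \<longlonglongrightarrow> (LINT x|lebesgue_on \<Omega>. 0)"
  proof (rule integral_dominated_convergence[where w="\<lambda>x. \<bar>g x\<bar>"])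
    show "(\<lambda>x. \<bar>g x\<bar> * indicator {x. real n < \<bar>g x\<bar>} x) \<in> borel_measurable (lebesgue_on \<Omega>)" for n
    proof -
      have "(\<lambda>x. if real n < \<bar>g x\<bar> then \<bar>g x\<bar> else 0) \<in> borel_measurable (lebesgue_on \<Omega>)"
        using gm by measurable
      moreover have "(\<lambda>x. \<bar>g x\<bar> * indicator {x. real n < \<bar>g x\<bar>} x) = (\<lambda>x. if real n < \<bar>g x\<bar> then \<bar>g x\<bar> else 0)"
        by (auto simp: indicator_def fun_eq_iff)
      ultimately show ?thesis by simp
    qed
    show "AE x in lebesgue_on \<Omega>. (\<lambda>n. \<bar>g x\<bar> * indicator {x. real n < \<bar>g x\<bar>} x) \<longlonglongrightarrow> 0"
    proof (rule AE_I2)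
      fix x
      obtain m where "\<bar>g x\<bar> \<le> real m" using real_arch_simple by blast
      then have "\<forall>\<^sub>F n in sequentially. \<bar>g x\<bar> * indicator {x. real n < \<bar>g x\<bar>} x = 0"
        by (intro eventually_sequentiallyI[of m]) (auto simp: indicator_def)
      then show "(\<lambda>n. \<bar>g x\<bar> * indicator {x. real n < \<bar>g x\<bar>} x) \<longlonglongrightarrow> 0" by (rule tendsto_eventually)
    qed
    show "AE x in lebesgue_on \<Omega>. norm (\<bar>g x\<bar> * indicator {x. real n < \<bar>g x\<bar>} x) \<le> \<bar>g x\<bar>" for n
      by (auto intro!: AE_I2 simp: indicator_def)
  qed (use g in auto)
  then have lim: "(\<lambda>n. LINT x|lebesgue_on \<Omega>. \<bar>g x\<bar> * indicator {x. real n < \<bar>g x\<bar>} x) \<longlonglongrightarrow> 0" by simp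
  have pos: "0 < \<epsilon> / (2 * (k2 + 1))" using \<epsilon> k_abs(2) by (intro divide_pos_pos) auto
  obtain M where M: "(LINT x|lebesgue_on \<Omega>. \<bar>g x\<bar> * indicator {x. real M < \<bar>g x\<bar>} x) < \<epsilon> / (2 * (k2 + 1))"
    using eventually_happens'[OF sequentially_bot order_tendstoD(2)[OF lim pos]] by blast
  define g1 g2 where "g1 x = (if real M < \<bar>g x\<bar> then 0 else g x)" and "g2 x = (if real M < \<bar>g x\<bar> then g x else 0)" for x
  have m12: "g1 \<in> borel_measurable (lebesgue_on \<Omega>)" "g2 \<in> borel_measurable (lebesgue_on \<Omega>)"
    unfolding g1_def[abs_def] g2_def[abs_def] using gm by measurable
  have g2i: "integrable (lebesgue_on \<Omega>) g2"
    by (rule Bochner_Integration.integrable_bound[OF g m12(2)]) (auto simp: g2_def)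
  have "(LINT x|lebesgue_on \<Omega>. \<bar>g2 x\<bar>) = (LINT x|lebesgue_on \<Omega>. \<bar>g x\<bar> * indicator {x. real M < \<bar>g x\<bar>} x)"
    by (rule Bochner_Integration.integral_cong) (auto simp: g2_def indicator_def)
  then have g2: "k2 * (LINT x|lebesgue_on \<Omega>. \<bar>g2 x\<bar>) < \<epsilon> / 2"
  proof -
    have "k2 * (LINT x|lebesgue_on \<Omega>. \<bar>g2 x\<bar>) \<le> k2 * (\<epsilon> / (2 * (k2 + 1)))"
      using M k_abs(2) \<open>(LINT x|lebesgue_on \<Omega>. \<bar>g2 x\<bar>) = _\<close> by (intro mult_left_mono) auto
    also have "\<dots> < \<epsilon> / 2" using \<epsilon> k_abs(2) by (simp add: field_simps)
    finally show ?thesis .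
  qed
  have g1: "g1 \<in> L2 \<Omega>"
  proof -
    have "integrable (lebesgue_on \<Omega>) (\<lambda>x. (norm (g1 x))\<^sup>2)"
    proof (rule Bochner_Integration.integrable_bound)
      show "integrable (lebesgue_on \<Omega>) (\<lambda>x. real M * g x)" using g by simp
      show "(\<lambda>x. (norm (g1 x))\<^sup>2) \<in> borel_measurable (lebesgue_on \<Omega>)" using m12(1) by measurable
      have "\<bar>g1 x\<bar> * \<bar>g1 x\<bar> \<le> real M * \<bar>g x\<bar>" for x
        by (rule mult_mono) (auto simp: g1_def)
      then show "AE x in lebesgue_on \<Omega>. norm ((norm (g1 x))\<^sup>2) \<le> norm (real M * g x)"
        by (simp add: power2_eq_square abs_mult)
    qed
    then show ?thesis using m12(1) by (simp add: L2_def)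
  qed
  have kd: "(\<lambda>x. k (zs n x) - k (z x)) \<in> L2 \<Omega> \<and> l2_norm \<Omega> (\<lambda>x. k (zs n x) - k (z x)) \<le> L * l2_norm \<Omega> (\<lambda>x. zs n x - z x)" for n
  proof -
    have d: "(\<lambda>x. zs n x - z x) \<in> L2 \<Omega>" by (rule seminormed.diff_mem[OF seminormed_L2 zs(1,2)])
    have s: "(\<lambda>x. L *\<^sub>R (zs n x - z x)) \<in> L2 \<Omega>" by (rule L2_scale[OF d])
    have le: "norm (k (zs n x) - k (z x)) \<le> norm (L *\<^sub>R (zs n x - z x))" for x
      using k_lipschitz[of "zs n x" "z x"] L_nonneg by (simp add: abs_mult)
    have m: "(\<lambda>x. k (zs n x) - k (z x)) \<in> borel_measurable (lebesgue_on \<Omega>)"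
      using k_measurable[OF L2_measurable[OF zs(1)[of n]]] k_measurable[OF L2_measurable[OF zs(2)]] by measurable
    have K: "(\<lambda>x. k (zs n x) - k (z x)) \<in> L2 \<Omega>"
      by (rule L2_dominated[OF s m]) (use le in simp)
    have "l2_norm \<Omega> (\<lambda>x. k (zs n x) - k (z x)) \<le> l2_norm \<Omega> (\<lambda>x. L *\<^sub>R (zs n x - z x))"
      unfolding l2_norm_def
      by (intro real_sqrt_le_mono integral_mono_AE AE_I2 power_mono le norm_ge_zero) (use K s in \<open>simp_all add: L2_def\<close>)
    then show ?thesis using K seminormed.scale[OF seminormed_L2 d, of L] L_nonneg by simp
  qed
  have "(\<lambda>n. L * l2_norm \<Omega> (\<lambda>x. zs n x - z x) * l2_norm \<Omega> g1) \<longlonglongrightarrow> L * 0 * l2_norm \<Omega> g1"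
    by (intro tendsto_mult tendsto_const zs(3))
  then have "\<forall>\<^sub>F n in sequentially. L * l2_norm \<Omega> (\<lambda>x. zs n x - z x) * l2_norm \<Omega> g1 < \<epsilon> / 2"
    using order_tendstoD(2)[of _ "L * 0 * l2_norm \<Omega> g1" sequentially "\<epsilon> / 2"] \<epsilon> by simp
  then obtain n0 where n0: "\<And>n. n \<ge> n0 \<Longrightarrow> L * l2_norm \<Omega> (\<lambda>x. zs n x - z x) * l2_norm \<Omega> g1 < \<epsilon> / 2"
    by (auto simp: eventually_sequentially)
  have "norm ((LINT x|lebesgue_on \<Omega>. (k (zs n x) - k (z x)) * g x) - 0) < \<epsilon>" if n: "n \<ge> n0" for n
  proof -
    let ?K = "\<lambda>x. k (zs n x) - k (z x)"
    have i1: "integrable (lebesgue_on \<Omega>) (\<lambda>x. ?K x * g1 x)"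
      using L2_inner_integrable[OF conjunct1[OF kd[of n]] g1] by simp
    have le2: "\<bar>?K x * g2 x\<bar> \<le> k2 * \<bar>g2 x\<bar>" for x
      using k_abs(3) by (simp add: abs_mult mult_right_mono)
    have i2: "integrable (lebesgue_on \<Omega>) (\<lambda>x. ?K x * g2 x)"
    proof (rule Bochner_Integration.integrable_bound)
      show "integrable (lebesgue_on \<Omega>) (\<lambda>x. k2 * \<bar>g2 x\<bar>)" using g2i by simp
      show "(\<lambda>x. ?K x * g2 x) \<in> borel_measurable (lebesgue_on \<Omega>)"
        using L2_measurable[OF conjunct1[OF kd[of n]]] m12(2) by (rule borel_measurable_times)
      show "AE x in lebesgue_on \<Omega>. norm (?K x * g2 x) \<le> norm (k2 * \<bar>g2 x\<bar>)"
        using le2 k_abs(2) by (auto simp: abs_mult intro!: AE_I2)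
    qed
    have "(LINT x|lebesgue_on \<Omega>. ?K x * g x) = (LINT x|lebesgue_on \<Omega>. ?K x * g1 x + ?K x * g2 x)"
      by (rule Bochner_Integration.integral_cong) (auto simp: g1_def g2_def)
    also have "\<dots> = l2_inner \<Omega> ?K g1 + (LINT x|lebesgue_on \<Omega>. ?K x * g2 x)"
      using i1 i2 by (simp add: l2_inner_def)
    finally have eq: "(LINT x|lebesgue_on \<Omega>. ?K x * g x) = l2_inner \<Omega> ?K g1 + (LINT x|lebesgue_on \<Omega>. ?K x * g2 x)" .
    have "\<bar>l2_inner \<Omega> ?K g1\<bar> \<le> l2_norm \<Omega> ?K * l2_norm \<Omega> g1"
      by (rule l2_cauchy_schwarz[OF conjunct1[OF kd] g1])
    also have "\<dots> \<le> L * l2_norm \<Omega> (\<lambda>x. zs n x - z x) * l2_norm \<Omega> g1"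
      by (rule mult_right_mono[OF conjunct2[OF kd] l2_norm_nonneg])
    also have "\<dots> < \<epsilon> / 2" by (rule n0[OF n])
    finally have 1: "\<bar>l2_inner \<Omega> ?K g1\<bar> < \<epsilon> / 2" .
    have "\<bar>LINT x|lebesgue_on \<Omega>. ?K x * g2 x\<bar> \<le> (LINT x|lebesgue_on \<Omega>. k2 * \<bar>g2 x\<bar>)"
      by (rule order_trans[OF integral_abs_bound integral_mono]) (use i2 g2i le2 in auto)
    then have 2: "\<bar>LINT x|lebesgue_on \<Omega>. ?K x * g2 x\<bar> < \<epsilon> / 2" using g2 by simp
    show ?thesis using 1 2 eq by simp
  qed
  then show "\<exists>n0. \<forall>n\<ge>n0. norm ((LINT x|lebesgue_on \<Omega>. (k (zs n x) - k (z x)) * g x) - 0) < \<epsilon>" by blast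
qed

lemma flux_LIMSEQ:
  assumes zs: "\<And>n. zs n \<in> L2 \<Omega>" "z \<in> L2 \<Omega>" "(\<lambda>n. l2_norm \<Omega> (\<lambda>x. zs n x - z x)) \<longlonglongrightarrow> 0"
    and as: "\<And>n. as n \<in> L2 \<Omega>" "a \<in> L2 \<Omega>" "(\<lambda>n. l2_norm \<Omega> (\<lambda>x. as n x - a x)) \<longlonglongrightarrow> 0"
    and bs: "\<And>n. bs n \<in> L2 \<Omega>" "b \<in> L2 \<Omega>" "(\<lambda>n. l2_norm \<Omega> (\<lambda>x. bs n x - b x)) \<longlonglongrightarrow> 0"
  shows "(\<lambda>n. l2_inner \<Omega> (\<lambda>x. k (zs n x) *\<^sub>R as n x) (bs n)) \<longlonglongrightarrow> l2_inner \<Omega> (\<lambda>x. k (z x) *\<^sub>R a x) b"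
proof -
  let ?r = "\<lambda>n. LINT x|lebesgue_on \<Omega>. (k (zs n x) - k (z x)) * (a x \<bullet> b x)"
  let ?e = "\<lambda>n. k2 * (l2_norm \<Omega> (\<lambda>x. as n x - a x) * l2_norm \<Omega> (bs n)) + k2 * (l2_norm \<Omega> a * l2_norm \<Omega> (\<lambda>x. bs n x - b x)) + \<bar>?r n\<bar>"
  have r0: "?r \<longlonglongrightarrow> 0" by (rule nemytskii_LIMSEQ[OF zs L2_inner_integrable[OF as(2) bs(2)]])
  have "?e \<longlonglongrightarrow> k2 * (0 * l2_norm \<Omega> b) + k2 * (l2_norm \<Omega> a * 0) + \<bar>0\<bar>"
    by (intro tendsto_intros as(3) bs(3) r0 seminormed.norm_LIMSEQ[OF seminormed_L2 bs])
  then have e0: "?e \<longlonglongrightarrow> 0" by simp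
  have "\<bar>l2_inner \<Omega> (\<lambda>x. k (zs n x) *\<^sub>R as n x) (bs n) - l2_inner \<Omega> (\<lambda>x. k (z x) *\<^sub>R a x) b\<bar> \<le> ?e n" for n
  proof -
    let ?K = "\<lambda>a x. k (zs n x) *\<^sub>R a x"
    have ad: "(\<lambda>x. as n x - a x) \<in> L2 \<Omega>" and bd: "(\<lambda>x. bs n x - b x) \<in> L2 \<Omega>"
      using seminormed.diff_mem[OF seminormed_L2] as bs by blast+
    note K = flux_L2[OF zs(1)[of n] as(1)[of n]] flux_L2[OF zs(1)[of n] as(2)] flux_L2[OF zs(2) as(2)]
    have "l2_inner \<Omega> (?K (\<lambda>x. as n x - a x)) (bs n) = l2_inner \<Omega> (?K (as n)) (bs n) - l2_inner \<Omega> (?K a) (bs n)"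
      using l2_inner_diff_left[OF K(1,2) bs(1)[of n]] by (simp add: scaleR_diff_right)
    moreover have "l2_inner \<Omega> (?K a) (\<lambda>x. bs n x - b x) = l2_inner \<Omega> (?K a) (bs n) - l2_inner \<Omega> (?K a) b"
      by (rule l2_inner_diff_right[OF bs(1,2) K(2)])
    moreover have "l2_inner \<Omega> (?K a) b - l2_inner \<Omega> (\<lambda>x. k (z x) *\<^sub>R a x) b = ?r n"
      using L2_inner_integrable[OF K(2) bs(2)] L2_inner_integrable[OF K(3) bs(2)]
      by (simp add: l2_inner_def left_diff_distrib)
    ultimately show ?thesis
      using flux_bound[OF zs(1)[of n] ad bs(1)[of n]] flux_bound[OF zs(1)[of n] as(2) bd] by linarith
  qed
  then have "(\<lambda>n. l2_inner \<Omega> (\<lambda>x. k (zs n x) *\<^sub>R as n x) (bs n) - l2_inner \<Omega> (\<lambda>x. k (z x) *\<^sub>R a x) b) \<longlonglongrightarrow> 0"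
    by (intro Lim_null_comparison[OF always_eventually e0]) simp
  then show ?thesis by (simp add: LIM_zero_iff)
qed

text \<open>Writing \<open>k(z\<^sub>1) a\<^sub>1 - k(z\<^sub>2) a\<^sub>2 = k(z\<^sub>2) (a\<^sub>1 - a\<^sub>2) + (k(z\<^sub>1) - k(z\<^sub>2)) a\<^sub>1\<close>, the second term
  is controlled by the bound on \<open>a\<^sub>1\<close> and absorbed by Young's inequality.\<close>

lemma flux_monotone:
  fixes z1 z2 :: "'a \<Rightarrow> real" and a1 a2 :: "'a \<Rightarrow> 'b::euclidean_space"
  assumes z: "z1 \<in> L2 \<Omega>" "z2 \<in> L2 \<Omega>" and a: "a1 \<in> L2 \<Omega>" "a2 \<in> L2 \<Omega>"
    and bd: "AE x in lebesgue_on \<Omega>. norm (a1 x) \<le> B" "B \<ge> 0"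
  defines "D \<equiv> \<lambda>x. a1 x - a2 x"
  shows "k1 / 2 * (l2_norm \<Omega> D)\<^sup>2 - L\<^sup>2 / (2 * k1) * (B\<^sup>2 * (l2_norm \<Omega> (\<lambda>x. z1 x - z2 x))\<^sup>2)
      \<le> l2_inner \<Omega> (\<lambda>x. k (z1 x) *\<^sub>R a1 x) D - l2_inner \<Omega> (\<lambda>x. k (z2 x) *\<^sub>R a2 x) D"
proof -
  let ?z = "\<lambda>x. z1 x - z2 x"
  have D: "D \<in> L2 \<Omega>" unfolding D_def by (rule seminormed.diff_mem[OF seminormed_L2 a])
  have zd: "?z \<in> L2 \<Omega>" by (rule seminormed.diff_mem[OF seminormed_L2 z])
  note i = L2_inner_integrable[OF flux_L2[OF z(1) a(1)] D] L2_inner_integrable[OF flux_L2[OF z(2) a(2)] D]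
  have "(LINT x|lebesgue_on \<Omega>. k1 * (D x \<bullet> D x) - L * B * (norm (?z x) * norm (D x)))
      \<le> (LINT x|lebesgue_on \<Omega>. (k (z1 x) *\<^sub>R a1 x) \<bullet> D x - (k (z2 x) *\<^sub>R a2 x) \<bullet> D x)"
  proof (rule integral_mono_AE)
    show "integrable (lebesgue_on \<Omega>) (\<lambda>x. k1 * (D x \<bullet> D x) - L * B * (norm (?z x) * norm (D x)))"
      using L2_inner_integrable[OF D D] L2_norm_prod_integrable[OF zd D]
      by (intro Bochner_Integration.integrable_diff integrable_mult_right)
    show "integrable (lebesgue_on \<Omega>) (\<lambda>x. (k (z1 x) *\<^sub>R a1 x) \<bullet> D x - (k (z2 x) *\<^sub>R a2 x) \<bullet> D x)"
      using i by simp
    show "AE x in lebesgue_on \<Omega>. k1 * (D x \<bullet> D x) - L * B * (norm (?z x) * norm (D x))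
        \<le> (k (z1 x) *\<^sub>R a1 x) \<bullet> D x - (k (z2 x) *\<^sub>R a2 x) \<bullet> D x"
      using bd(1)
    proof eventually_elim
      case (elim x)
      have "(k (z1 x) *\<^sub>R a1 x) \<bullet> D x - (k (z2 x) *\<^sub>R a2 x) \<bullet> D x = k (z2 x) * (D x \<bullet> D x) + (k (z1 x) - k (z2 x)) * (a1 x \<bullet> D x)"
        by (simp add: D_def inner_diff_left algebra_simps)
      moreover have "k1 * (D x \<bullet> D x) \<le> k (z2 x) * (D x \<bullet> D x)"
        using k_bounds(1) by (rule mult_right_mono) simp
      moreover have "\<bar>(k (z1 x) - k (z2 x)) * (a1 x \<bullet> D x)\<bar> \<le> (L * \<bar>?z x\<bar>) * (B * norm (D x))"
        unfolding abs_mult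
      proof (rule mult_mono[OF k_lipschitz])
        show "\<bar>a1 x \<bullet> D x\<bar> \<le> B * norm (D x)"
          by (rule order_trans[OF Cauchy_Schwarz_ineq2 mult_right_mono[OF elim]]) simp
      qed (use L_nonneg in auto)
      moreover have "(L * \<bar>?z x\<bar>) * (B * norm (D x)) = L * B * (norm (?z x) * norm (D x))" by simp
      ultimately show ?case by linarith
    qed
  qed
  also have "\<dots> = l2_inner \<Omega> (\<lambda>x. k (z1 x) *\<^sub>R a1 x) D - l2_inner \<Omega> (\<lambda>x. k (z2 x) *\<^sub>R a2 x) D"
    using i by (simp add: l2_inner_def)
  also have "(LINT x|lebesgue_on \<Omega>. k1 * (D x \<bullet> D x) - L * B * (norm (?z x) * norm (D x)))
      = k1 * (l2_norm \<Omega> D)\<^sup>2 - L * B * (LINT x|lebesgue_on \<Omega>. norm (?z x) * norm (D x))"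
    using L2_inner_integrable[OF D D] L2_norm_prod_integrable[OF zd D]
    by (subst Bochner_Integration.integral_diff) (auto simp: l2_norm_sq l2_inner_def)
  finally have 1: "k1 * (l2_norm \<Omega> D)\<^sup>2 - L * B * (LINT x|lebesgue_on \<Omega>. norm (?z x) * norm (D x))
      \<le> l2_inner \<Omega> (\<lambda>x. k (z1 x) *\<^sub>R a1 x) D - l2_inner \<Omega> (\<lambda>x. k (z2 x) *\<^sub>R a2 x) D" .
  have "L * B * (LINT x|lebesgue_on \<Omega>. norm (?z x) * norm (D x)) \<le> L * B * (l2_norm \<Omega> ?z * l2_norm \<Omega> D)"
    using l2_norm_prod[OF zd D] L_nonneg bd(2) by (intro mult_left_mono) auto
  also have "\<dots> \<le> k1 / 2 * (l2_norm \<Omega> D)\<^sup>2 + L\<^sup>2 / (2 * k1) * (B\<^sup>2 * (l2_norm \<Omega> ?z)\<^sup>2)"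
  proof -
    define s t where "s = L * B * l2_norm \<Omega> ?z" and "t = l2_norm \<Omega> D"
    have "0 \<le> (k1 * t - s)\<^sup>2" by simp
    then have "2 * k1 * (s * t) \<le> k1\<^sup>2 * t\<^sup>2 + s\<^sup>2" by (simp add: power2_diff power_mult_distrib algebra_simps)
    then have "s * t \<le> k1 / 2 * t\<^sup>2 + s\<^sup>2 / (2 * k1)"
      using k1 by (simp add: field_simps power2_eq_square)
    then show ?thesis by (simp add: s_def t_def power_mult_distrib mult.assoc)
  qed
  finally show ?thesis using 1 by linarith
qed

end

section \<open>Weak solutions\<close>

text \<open>Cutting a test function off at time \<open>b\<close> turns the weak formulation, which is integrated over \<open>(0,T)\<close>,
  into statements about primitives.\<close>

lemma (in seminormed) localized_test:
  assumes l: "AE t in time T. l t \<in> dual X N" and f: "AE t in time T. f t \<in> X"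
    and i: "integrable (time T) (\<lambda>t. l t (f t))" and b: "0 \<le> b" "b \<le> T"
  shows "(LINT t|time T. l t (\<lambda>x. indicator {0<..<b} t *\<^sub>R f t x)) = integral {0..b} (\<lambda>t. l t (f t))"
proof -
  have m: "integrable (time T) (\<lambda>t. indicator {0<..<b} t * l t (f t))"
    by (rule time_integrable_indicator[OF i order_refl b(2)])
  have ae: "AE t in time T. indicator {0<..<b} t * l t (f t) = l t (\<lambda>x. indicator {0<..<b} t *\<^sub>R f t x)"
    using l f
  proof eventually_elim
    case (elim t)
    show ?case using dual_lincomb[OF elim(1,2,2), of "indicator {0<..<b} t" 0] by simp
  qed
  note m' = borel_measurable_integrable[OF m]
  have "(LINT t|time T. l t (\<lambda>x. indicator {0<..<b} t *\<^sub>R f t x)) = (LINT t|time T. indicator {0<..<b} t * l t (f t))"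
    by (rule integral_cong_AE[OF m' interval.measurable_AE_eq[OF m' ae] ae, symmetric])
  then show ?thesis using time_integral(3)[OF i order_refl b(2)] by simp
qed

lemma (in sobolev_domain) grad_dual:
  assumes "a \<in> L2 \<Omega>"
  shows "(\<lambda>q. l2_inner \<Omega> a (grad \<Omega> q)) \<in> dual (H10 \<Omega>) (h1_norm \<Omega>)"
  unfolding dual_def
proof (intro CollectI conjI ballI allI)
  fix f g and c d :: real assume fg: "f \<in> H10 \<Omega>" "g \<in> H10 \<Omega>"
  note F = H10_H1[OF fg(1)] H10_H1[OF fg(2)]
  have "l2_inner \<Omega> a (grad \<Omega> (\<lambda>x. c * f x + d * g x)) = l2_inner \<Omega> a (\<lambda>x. c *\<^sub>R grad \<Omega> f x + d *\<^sub>R grad \<Omega> g x)"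
    by (rule l2_inner_cong[OF assms grad_L2[OF H1_lincomb(1)[OF F]] AE_I2[OF refl] grad_lincomb[OF F]])
  also have "\<dots> = c * l2_inner \<Omega> a (grad \<Omega> f) + d * l2_inner \<Omega> a (grad \<Omega> g)"
    by (rule l2_inner_lincomb_right[OF grad_L2[OF F(1)] grad_L2[OF F(2)] assms])
  finally show "l2_inner \<Omega> a (grad \<Omega> (\<lambda>x. c *\<^sub>R f x + d *\<^sub>R g x)) = c * l2_inner \<Omega> a (grad \<Omega> f) + d * l2_inner \<Omega> a (grad \<Omega> g)"
    by simp
next
  have "\<bar>l2_inner \<Omega> a (grad \<Omega> q)\<bar> \<le> l2_norm \<Omega> a * h1_norm \<Omega> q" if "q \<in> H10 \<Omega>" for q
    by (rule order_trans[OF l2_cauchy_schwarz[OF assms grad_L2[OF H10_H1[OF that]]] mult_left_mono[OF h1_norm_ge(2) l2_norm_nonneg]])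
  then show "\<exists>C. \<forall>q\<in>H10 \<Omega>. \<bar>l2_inner \<Omega> a (grad \<Omega> q)\<bar> \<le> C * h1_norm \<Omega> q" by blast
qed

lemma (in sobolev_domain) grad_diff:
  assumes "f \<in> H10 \<Omega>" "g \<in> H10 \<Omega>"
  shows "AE x in lebesgue_on \<Omega>. grad \<Omega> (\<lambda>x. f x - g x) x = grad \<Omega> f x - grad \<Omega> g x"
    and "l2_norm \<Omega> (\<lambda>x. grad \<Omega> f x - grad \<Omega> g x) \<le> h1_norm \<Omega> (\<lambda>x. f x - g x)"
proof -
  show ae: "AE x in lebesgue_on \<Omega>. grad \<Omega> (\<lambda>x. f x - g x) x = grad \<Omega> f x - grad \<Omega> g x"
    using grad_lincomb[OF H10_H1[OF assms(1)] H10_H1[OF assms(2)], of 1 "-1"] by simp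
  have "(\<lambda>x. f x - g x) \<in> H1 \<Omega>" using seminormed.diff_mem[OF seminormed_H10 assms] H10_H1 by blast
  from l2_norm_cong[OF grad_L2[OF this] ae] h1_norm_ge(2)[of "\<lambda>x. f x - g x"]
  show "l2_norm \<Omega> (\<lambda>x. grad \<Omega> f x - grad \<Omega> g x) \<le> h1_norm \<Omega> (\<lambda>x. f x - g x)" by simp
qed

locale permeable_poro_domain = poro_domain \<Omega> + permeable_domain \<Omega> k k1 k2 L for \<Omega> k k1 k2 L
begin

lemma flux_time_integrable:
  assumes z: "z \<in> L2_L2 T \<Omega>" and p: "p \<in> L2_V T \<Omega>" and q: "q \<in> L2_V T \<Omega>"
  shows "integrable (time T) (\<lambda>t. l2_inner \<Omega> (\<lambda>x. k (z t x) *\<^sub>R grad \<Omega> (p t) x) (grad \<Omega> (q t)))"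
proof (rule Bochner_Integration.integrable_bound)
  show "integrable (time T) (\<lambda>t. k2 * (norm (h1_norm \<Omega> (p t)) * norm (h1_norm \<Omega> (q t))))"
    by (intro integrable_mult_right interval.L2_norm_prod_integrable seminormed.L2_time_norm[OF seminormed_H10] p q)
  show "AE t in time T. norm (l2_inner \<Omega> (\<lambda>x. k (z t x) *\<^sub>R grad \<Omega> (p t) x) (grad \<Omega> (q t)))
      \<le> norm (k2 * (norm (h1_norm \<Omega> (p t)) * norm (h1_norm \<Omega> (q t))))"
    using L2_time_mem[OF z] L2_time_mem[OF p] L2_time_mem[OF q]
  proof eventually_elim
    case (elim t)
    have "\<bar>l2_inner \<Omega> (\<lambda>x. k (z t x) *\<^sub>R grad \<Omega> (p t) x) (grad \<Omega> (q t))\<bar> \<le> k2 * (l2_norm \<Omega> (grad \<Omega> (p t)) * l2_norm \<Omega> (grad \<Omega> (q t)))"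
      by (rule flux_bound[OF elim(1) grad_L2[OF H10_H1[OF elim(2)]] grad_L2[OF H10_H1[OF elim(3)]]])
    also have "\<dots> \<le> k2 * (h1_norm \<Omega> (p t) * h1_norm \<Omega> (q t))"
      by (intro mult_left_mono mult_mono h1_norm_ge l2_norm_nonneg k_abs(2))
    finally show ?case using k_abs(2) h1_norm_ge(3)[of "p t"] h1_norm_ge(3)[of "q t"] by simp
  qed
  show "(\<lambda>t. l2_inner \<Omega> (\<lambda>x. k (z t x) *\<^sub>R grad \<Omega> (p t) x) (grad \<Omega> (q t))) \<in> borel_measurable (time T)"
  proof (rule strongly_measurable_form[OF L2_time_strongly_measurable[OF z] L2_time_strongly_measurable[OF p] L2_time_strongly_measurable[OF q],
        where B="\<lambda>z p q. l2_inner \<Omega> (\<lambda>x. k (z x) *\<^sub>R grad \<Omega> p x) (grad \<Omega> q)"])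
    fix zs :: "nat \<Rightarrow> real^3 \<Rightarrow> real" and z and ps :: "nat \<Rightarrow> real^3 \<Rightarrow> real" and p and qs :: "nat \<Rightarrow> real^3 \<Rightarrow> real" and q
    assume zs: "\<And>n. zs n \<in> L2 \<Omega>" "z \<in> L2 \<Omega>" "(\<lambda>n. l2_norm \<Omega> (\<lambda>a. zs n a - z a)) \<longlonglongrightarrow> 0"
      and ps: "\<And>n. ps n \<in> H10 \<Omega>" "p \<in> H10 \<Omega>" "(\<lambda>n. h1_norm \<Omega> (\<lambda>a. ps n a - p a)) \<longlonglongrightarrow> 0"
      and qs: "\<And>n. qs n \<in> H10 \<Omega>" "q \<in> H10 \<Omega>" "(\<lambda>n. h1_norm \<Omega> (\<lambda>a. qs n a - q a)) \<longlonglongrightarrow> 0"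
    have g: "(\<lambda>n. l2_norm \<Omega> (\<lambda>x. grad \<Omega> (ps n) x - grad \<Omega> p x)) \<longlonglongrightarrow> 0"
      if "\<And>n. ps n \<in> H10 \<Omega>" "p \<in> H10 \<Omega>" "(\<lambda>n. h1_norm \<Omega> (\<lambda>a. ps n a - p a)) \<longlonglongrightarrow> 0" for ps :: "nat \<Rightarrow> real^3 \<Rightarrow> real" and p
      by (rule tendsto_sandwich[OF _ _ tendsto_const that(3)]) (use grad_diff(2)[OF that(1,2)] in \<open>auto simp: l2_norm_nonneg\<close>)
    show "(\<lambda>n. l2_inner \<Omega> (\<lambda>x. k (zs n x) *\<^sub>R grad \<Omega> (ps n) x) (grad \<Omega> (qs n))) \<longlonglongrightarrow> l2_inner \<Omega> (\<lambda>x. k (z x) *\<^sub>R grad \<Omega> p x) (grad \<Omega> q)"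
      by (rule flux_LIMSEQ[OF zs grad_L2[OF H10_H1[OF ps(1)]] grad_L2[OF H10_H1[OF ps(2)]] g[OF ps]
            grad_L2[OF H10_H1[OF qs(1)]] grad_L2[OF H10_H1[OF qs(2)]] g[OF qs]])
  qed
qed

end

lemma W_classE:
  assumes "(u, p) \<in> W_class \<Omega> T c0 F S d0 k"
    and z: "z = fluid_content \<Omega> c0 u p"
  obtains zt pt where
    "u \<in> L2_vV T \<Omega>" "p \<in> L2_V T \<Omega>" "z \<in> L2_L2 T \<Omega>"
    "embed_dual \<Omega> z \<in> L2_time T (dual_V \<Omega>) (dual_V_norm \<Omega>)"
    "\<And>w. w \<in> L2_vV T \<Omega> \<Longrightarrow> (LINT t|time T. e_form \<Omega> (u t) (w t)) - (LINT t|time T. l2_inner \<Omega> (p t) (divg \<Omega> (w t)))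
         = (LINT t|time T. l2_inner \<Omega> (F t) (w t))"
    "zt \<in> L2_time T (dual_V \<Omega>) (dual_V_norm \<Omega>)"
    "has_weak_time_deriv T (dual_V \<Omega>) (dual_V_norm \<Omega>) (embed_dual \<Omega> z) zt"
    "\<And>q. q \<in> L2_V T \<Omega> \<Longrightarrow> (LINT t|time T. zt t (q t))
        + (LINT t|time T. l2_inner \<Omega> (\<lambda>x. k (z t x) *\<^sub>R grad \<Omega> (p t) x) (grad \<Omega> (q t)))
        = (LINT t|time T. S t (q t))"
    "\<And>q. q \<in> H10 \<Omega> \<Longrightarrow> \<exists>g. (\<forall>h. abs_continuous 0 T h \<longrightarrow> (AE t in time T. h t = l2_inner \<Omega> (z t) q) \<longrightarrow>
            (\<forall>t\<in>{0..T}. h t = g t)) \<and> g 0 = l2_inner \<Omega> d0 q"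
    "pt \<in> L2_L2 T \<Omega>" "has_weak_time_deriv T (L2 \<Omega>) (l2_norm \<Omega>) p pt"
proof -
  have w: "weak_solution \<Omega> T c0 F S d0 k u p" and "\<exists>pt\<in>L2_L2 T \<Omega>. has_weak_time_deriv T (L2 \<Omega>) (l2_norm \<Omega>) p pt"
    using assms(1) by (simp_all add: W_class_def)
  then obtain pt where pt: "pt \<in> L2_L2 T \<Omega>" "has_weak_time_deriv T (L2 \<Omega>) (l2_norm \<Omega>) p pt" by (elim bexE)
  note w = w[unfolded weak_solution_def Let_def, folded z]
  note c1 = conjunct1[OF w] and w = conjunct2[OF w]
  note c2 = conjunct1[OF w] and w = conjunct2[OF w]
  note c3 = conjunct1[OF w] and w = conjunct2[OF w]
  note c4 = conjunct1[OF w] and w = conjunct2[OF w]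
  note c5 = conjunct1[OF w] and w = conjunct2[OF w]
  note c6 = conjunct1[OF w] and c7 = conjunct2[OF w]
  obtain zt where zt: "zt \<in> L2_time T (dual_V \<Omega>) (dual_V_norm \<Omega>)"
    and zt': "has_weak_time_deriv T (dual_V \<Omega>) (dual_V_norm \<Omega>) (embed_dual \<Omega> z) zt \<and>
      (\<forall>q\<in>L2_V T \<Omega>. (LINT t|time T. zt t (q t))
        + (LINT t|time T. l2_inner \<Omega> (\<lambda>x. k (z t x) *\<^sub>R grad \<Omega> (p t) x) (grad \<Omega> (q t)))
        = (LINT t|time T. S t (q t)))"
    using c6 by (elim bexE)
  show thesis
  proof (rule that[OF c1 c2 c3 _ bspec[OF c5] zt conjunct1[OF zt'] bspec[OF conjunct2[OF zt']] _ pt])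
    show "embed_dual \<Omega> z \<in> L2_time T (dual_V \<Omega>) (dual_V_norm \<Omega>)"
      using c4 by (simp add: H1_time_def)
    fix q assume q: "q \<in> H10 \<Omega>"
    show "\<exists>g. (\<forall>h. abs_continuous 0 T h \<longrightarrow> (AE t in time T. h t = l2_inner \<Omega> (z t) q) \<longrightarrow>
            (\<forall>t\<in>{0..T}. h t = g t)) \<and> g 0 = l2_inner \<Omega> d0 q"
      by (rule ex_forward[OF bspec[OF c7 q]]) (elim conjE, rule conjI)
  qed
qed

context poro_domain
begin

text \<open>The absolutely continuous representative of \<open>(\<zeta>, q)\<close> is the primitive of \<open>\<langle>\<zeta>\<^sub>t, q\<rangle>\<close>, and uniqueness of
  this representative identifies the constant of integration with the initial datum.\<close>

lemma content_primitive:
  assumes T: "T > 0" and z: "z \<in> L2_L2 T \<Omega>" and ez: "embed_dual \<Omega> z \<in> L2_time T (dual_V \<Omega>) (dual_V_norm \<Omega>)"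
    and zt: "zt \<in> L2_time T (dual_V \<Omega>) (dual_V_norm \<Omega>)"
    and d: "has_weak_time_deriv T (dual_V \<Omega>) (dual_V_norm \<Omega>) (embed_dual \<Omega> z) zt"
    and q: "q \<in> H10 \<Omega>"
    and init: "\<exists>g. (\<forall>h. abs_continuous 0 T h \<longrightarrow> (AE t in time T. h t = l2_inner \<Omega> (z t) q) \<longrightarrow> (\<forall>t\<in>{0..T}. h t = g t)) \<and> g 0 = l2_inner \<Omega> d0 q"
  shows "AE t in time T. l2_inner \<Omega> (z t) q = l2_inner \<Omega> d0 q + integral {0..t} (\<lambda>s. zt s q)"
proof -
  note V = seminormed.seminormed_dual[OF seminormed_H10]
  note ev = seminormed.eval_dual[OF seminormed_H10 q]
  have zt2: "(\<lambda>s. zt s q) \<in> L2 {0<..<T}" by (rule seminormed.dual_time_L2[OF V ev zt])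
  have "(\<lambda>t. l2_inner \<Omega> (z t) q) \<in> L2 {0<..<T}"
    by (rule seminormed.dual_time_L2[OF seminormed_L2 l2_inner_dual[OF H1_L2[OF H10_H1[OF q]]] z])
  then have zi: "integrable (time T) (\<lambda>t. l2_inner \<Omega> (z t) q)" by (rule interval_L2_integrable)
  note zti = interval_L2_integrable[OF zt2]
  have "(LINT t|time T. deriv \<phi> t * l2_inner \<Omega> (z t) q) = - (LINT t|time T. \<phi> t * zt t q)" if "\<phi> \<in> test_functions {0<..<T}" for \<phi>
    using seminormed.weak_time_deriv_dual[OF V ev d L2_time_mem[OF ez] L2_time_mem[OF zt] that] by (simp add: embed_dual_def)
  then obtain c where c: "AE t in time T. l2_inner \<Omega> (z t) q = c + integral {0..t} (\<lambda>s. zt s q)"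
    using weak_derivative_primitive[OF T zi zti] by blast
  obtain g where g: "\<And>h. abs_continuous 0 T h \<Longrightarrow> (AE t in time T. h t = l2_inner \<Omega> (z t) q) \<Longrightarrow> \<forall>t\<in>{0..T}. h t = g t"
    "g 0 = l2_inner \<Omega> d0 q" using init by blast
  have "AE t in time T. c + integral {0..t} (\<lambda>s. zt s q) = l2_inner \<Omega> (z t) q" using c by eventually_elim simp
  from g(1)[OF primitive_abs_continuous[OF T zt2 zti] this] have "c + integral {0..0} (\<lambda>s. zt s q) = g 0"
    using T by (metis atLeastAtMost_iff less_imp_le order_refl)
  then have "c = l2_inner \<Omega> d0 q" using g(2) by simp
  then show ?thesis using c by simp
qed

lemma l2_inner_dual_H10:
  assumes "h \<in> L2 \<Omega>"
  shows "(\<lambda>f. l2_inner \<Omega> f h) \<in> dual (H10 \<Omega>) (h1_norm \<Omega>)"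
  unfolding dual_def
proof (intro CollectI conjI ballI allI)
  show "l2_inner \<Omega> (\<lambda>x. a *\<^sub>R f x + b *\<^sub>R g x) h = a * l2_inner \<Omega> f h + b * l2_inner \<Omega> g h"
    if "f \<in> H10 \<Omega>" "g \<in> H10 \<Omega>" for f g a b
    by (rule l2_inner_lincomb_left[OF H1_L2[OF H10_H1[OF that(1)]] H1_L2[OF H10_H1[OF that(2)]] assms])
  have "\<bar>l2_inner \<Omega> f h\<bar> \<le> l2_norm \<Omega> h * h1_norm \<Omega> f" if "f \<in> H10 \<Omega>" for f
    using l2_cauchy_schwarz[OF H1_L2[OF H10_H1[OF that]] assms] mult_right_mono[OF h1_norm_ge(1)[of f] l2_norm_nonneg[of h]]
    by (simp add: mult.commute)
  then show "\<exists>C. \<forall>f\<in>H10 \<Omega>. \<bar>l2_inner \<Omega> f h\<bar> \<le> C * h1_norm \<Omega> f" by blast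
qed

text \<open>The time derivative of the pressure is taken in \<open>L\<^sup>2\<close>, so it may be tested with all of \<open>L\<^sup>2\<close>.\<close>

lemma pressure_primitive:
  assumes T: "T > 0" and p: "p \<in> L2_V T \<Omega>" and pt: "pt \<in> L2_L2 T \<Omega>"
    and d: "has_weak_time_deriv T (L2 \<Omega>) (l2_norm \<Omega>) p pt" and q: "q \<in> L2 \<Omega>"
  shows "\<exists>c. AE t in time T. l2_inner \<Omega> (p t) q = c + integral {0..t} (\<lambda>s. l2_inner \<Omega> (pt s) q)"
    and "integrable (time T) (\<lambda>t. l2_inner \<Omega> (pt t) q)"
proof -
  note l = l2_inner_dual[OF q]
  show pti: "integrable (time T) (\<lambda>t. l2_inner \<Omega> (pt t) q)"
    by (rule interval_L2_integrable[OF seminormed.dual_time_L2[OF seminormed_L2 l pt]])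
  note lV = l2_inner_dual_H10[OF q]
  have pi: "integrable (time T) (\<lambda>t. l2_inner \<Omega> (p t) q)"
    by (rule interval_L2_integrable[OF seminormed.dual_time_L2[OF seminormed_H10 lV p]])
  have pL: "AE t in time T. p t \<in> L2 \<Omega>" using L2_time_mem[OF p] by eventually_elim (intro H1_L2 H10_H1)
  show "\<exists>c. AE t in time T. l2_inner \<Omega> (p t) q = c + integral {0..t} (\<lambda>s. l2_inner \<Omega> (pt s) q)"
    by (rule weak_derivative_primitive[OF T pi pti])
      (rule seminormed.weak_time_deriv_dual[OF seminormed_L2 l d pL L2_time_mem[OF pt]])
qed

lemma l2_inner_divg_time_integrable:
  assumes p: "p \<in> L2_V T \<Omega>" and w: "w \<in> vH10 \<Omega>"
  shows "integrable (time T) (\<lambda>t. l2_inner \<Omega> (p t) (divg \<Omega> w))"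
  by (rule interval_L2_integrable[OF seminormed.dual_time_L2[OF seminormed_H10 l2_inner_dual_H10[OF divg_L2[OF w]] p]])

text \<open>The elastic equation contains no time derivative; testing with a fixed field on every interval
  \<open>(0,b)\<close> makes it hold at almost every time.\<close>

lemma elastic_difference:
  assumes T: "T > 0" and u: "u1 \<in> L2_vV T \<Omega>" "u2 \<in> L2_vV T \<Omega>" and p: "p1 \<in> L2_V T \<Omega>" "p2 \<in> L2_V T \<Omega>"
    and eq: "\<And>w. w \<in> L2_vV T \<Omega> \<Longrightarrow>
      (LINT t|time T. e_form \<Omega> (u1 t) (w t)) - (LINT t|time T. l2_inner \<Omega> (p1 t) (divg \<Omega> (w t)))
      = (LINT t|time T. e_form \<Omega> (u2 t) (w t)) - (LINT t|time T. l2_inner \<Omega> (p2 t) (divg \<Omega> (w t)))"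
    and w: "w \<in> vH10 \<Omega>"
  shows "AE t in time T. e_form \<Omega> (\<lambda>x. u1 t x - u2 t x) w = l2_inner \<Omega> (\<lambda>x. p1 t x - p2 t x) (divg \<Omega> w)"
proof -
  have ei: "integrable (time T) (\<lambda>t. e_form \<Omega> (u t) w)" if "u \<in> L2_vV T \<Omega>" for u
    using interval_L2_integrable[OF seminormed.dual_time_L2[OF seminormed_vH10 e_form_dual[OF w] that]] by (simp add: e_form_commute)
  note pi = l2_inner_divg_time_integrable[OF _ w]
  have mem: "AE t in time T. w \<in> vH10 \<Omega>" using w by simp
  let ?h = "\<lambda>t. (e_form \<Omega> (u1 t) w - l2_inner \<Omega> (p1 t) (divg \<Omega> w)) - (e_form \<Omega> (u2 t) w - l2_inner \<Omega> (p2 t) (divg \<Omega> w))"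
  have hi: "integrable (time T) ?h" by (intro Bochner_Integration.integrable_diff ei pi u p)
  have "AE b in time T. integral {0..b} ?h = 0"
  proof (rule AE_I2)
    fix b assume "b \<in> space (time T)"
    then have b: "0 \<le> b" "b \<le> T" by auto
    let ?w = "\<lambda>t x. indicator {0<..<b} t *\<^sub>R w x"
    have W: "?w \<in> L2_vV T \<Omega>"
      by (rule seminormed.L2_time_indicator[OF seminormed_vH10 seminormed.L2_time_const[OF seminormed_vH10 w]]) simp
    have le: "(LINT t|time T. e_form \<Omega> (u t) (?w t)) = integral {0..b} (\<lambda>t. e_form \<Omega> (u t) w)" if u: "u \<in> L2_vV T \<Omega>" for u
    proof (rule seminormed.localized_test[where l="\<lambda>t. e_form \<Omega> (u t)" and f="\<lambda>t. w", OF seminormed_vH10 _ mem ei[OF u] b])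
      show "AE t in time T. e_form \<Omega> (u t) \<in> dual (vH10 \<Omega>) (vh1_norm \<Omega>)"
        using L2_time_mem[OF u] by eventually_elim (rule e_form_dual)
    qed
    have lp: "(LINT t|time T. l2_inner \<Omega> (p t) (divg \<Omega> (?w t))) = integral {0..b} (\<lambda>t. l2_inner \<Omega> (p t) (divg \<Omega> w))" if p: "p \<in> L2_V T \<Omega>" for p
    proof (rule seminormed.localized_test[where l="\<lambda>t w. l2_inner \<Omega> (p t) (divg \<Omega> w)" and f="\<lambda>t. w", OF seminormed_vH10 _ mem pi[OF p] b])
      show "AE t in time T. (\<lambda>w. l2_inner \<Omega> (p t) (divg \<Omega> w)) \<in> dual (vH10 \<Omega>) (vh1_norm \<Omega>)"
        using L2_time_mem[OF p] by eventually_elim (intro divg_dual H1_L2 H10_H1)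
    qed
    note on = time_integral(2)[OF ei[OF u(1)] order_refl b(2)] time_integral(2)[OF ei[OF u(2)] order_refl b(2)]
      time_integral(2)[OF pi[OF p(1)] order_refl b(2)] time_integral(2)[OF pi[OF p(2)] order_refl b(2)]
    have "integral {0..b} ?h = (integral {0..b} (\<lambda>t. e_form \<Omega> (u1 t) w) - integral {0..b} (\<lambda>t. l2_inner \<Omega> (p1 t) (divg \<Omega> w)))
        - (integral {0..b} (\<lambda>t. e_form \<Omega> (u2 t) w) - integral {0..b} (\<lambda>t. l2_inner \<Omega> (p2 t) (divg \<Omega> w)))"
      by (simp add: integral_diff integrable_diff on)
    then show "integral {0..b} ?h = 0" using eq[OF W] by (simp add: le[OF u(1)] le[OF u(2)] lp[OF p(1)] lp[OF p(2)])
  qed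
  from primitive_zero_imp_zero[OF hi this] L2_time_mem[OF u(1)] L2_time_mem[OF u(2)] L2_time_mem[OF p(1)] L2_time_mem[OF p(2)]
  show ?thesis
  proof eventually_elim
    case (elim t)
    show ?case
      using elim(1) e_form_diff_left[OF elim(2,3) w] l2_inner_diff_left[OF H1_L2[OF H10_H1[OF elim(4)]] H1_L2[OF H10_H1[OF elim(5)]] divg_L2[OF w]]
      by simp
  qed
qed

end

section \<open>Uniqueness\<close>

context permeable_poro_domain
begin

text \<open>The energy identity, the flow equation tested with the difference of the pressures, and the
  monotonicity of the flux combine to a Gronwall inequality for the energy.\<close>

theorem solutions_agree:
  assumes T: "T > 0" and c0: "c0 \<ge> 0"
    and sol1: "(u1, p1) \<in> W_class \<Omega> T c0 F S d0 k" and sol2: "(u2, p2) \<in> W_class \<Omega> T c0 F S d0 k"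
    and reg: "p1 \<in> L2_W1inf T \<Omega>"
  shows "AE t in time T. AE x in lebesgue_on \<Omega>. u1 t x = u2 t x \<and> p1 t x = p2 t x"
proof -
  define z1 where "z1 = fluid_content \<Omega> c0 u1 p1"
  define z2 where "z2 = fluid_content \<Omega> c0 u2 p2"
  obtain zt1 pt1 where u1: "u1 \<in> L2_vV T \<Omega>" and p1: "p1 \<in> L2_V T \<Omega>" and z1: "z1 \<in> L2_L2 T \<Omega>"
    and ez1: "embed_dual \<Omega> z1 \<in> L2_time T (dual_V \<Omega>) (dual_V_norm \<Omega>)"
    and el1: "\<And>w. w \<in> L2_vV T \<Omega> \<Longrightarrow> (LINT t|time T. e_form \<Omega> (u1 t) (w t)) - (LINT t|time T. l2_inner \<Omega> (p1 t) (divg \<Omega> (w t)))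
         = (LINT t|time T. l2_inner \<Omega> (F t) (w t))"
    and zt1: "zt1 \<in> L2_time T (dual_V \<Omega>) (dual_V_norm \<Omega>)"
    and dz1: "has_weak_time_deriv T (dual_V \<Omega>) (dual_V_norm \<Omega>) (embed_dual \<Omega> z1) zt1"
    and fl1: "\<And>q. q \<in> L2_V T \<Omega> \<Longrightarrow> (LINT t|time T. zt1 t (q t))
        + (LINT t|time T. l2_inner \<Omega> (\<lambda>x. k (z1 t x) *\<^sub>R grad \<Omega> (p1 t) x) (grad \<Omega> (q t))) = (LINT t|time T. S t (q t))"
    and in1: "\<And>q. q \<in> H10 \<Omega> \<Longrightarrow> \<exists>g. (\<forall>h. abs_continuous 0 T h \<longrightarrow> (AE t in time T. h t = l2_inner \<Omega> (z1 t) q) \<longrightarrow>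
            (\<forall>t\<in>{0..T}. h t = g t)) \<and> g 0 = l2_inner \<Omega> d0 q"
    and pt1: "pt1 \<in> L2_L2 T \<Omega>" and dp1: "has_weak_time_deriv T (L2 \<Omega>) (l2_norm \<Omega>) p1 pt1"
  proof (rule W_classE[OF sol1 z1_def], goal_cases)
    case (1 zt pt)
    show ?case by (rule 1(1)[OF 1(2-12)])
  qed
  obtain zt2 pt2 where u2: "u2 \<in> L2_vV T \<Omega>" and p2: "p2 \<in> L2_V T \<Omega>" and z2: "z2 \<in> L2_L2 T \<Omega>"
    and ez2: "embed_dual \<Omega> z2 \<in> L2_time T (dual_V \<Omega>) (dual_V_norm \<Omega>)"
    and el2: "\<And>w. w \<in> L2_vV T \<Omega> \<Longrightarrow> (LINT t|time T. e_form \<Omega> (u2 t) (w t)) - (LINT t|time T. l2_inner \<Omega> (p2 t) (divg \<Omega> (w t)))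
         = (LINT t|time T. l2_inner \<Omega> (F t) (w t))"
    and zt2: "zt2 \<in> L2_time T (dual_V \<Omega>) (dual_V_norm \<Omega>)"
    and dz2: "has_weak_time_deriv T (dual_V \<Omega>) (dual_V_norm \<Omega>) (embed_dual \<Omega> z2) zt2"
    and fl2: "\<And>q. q \<in> L2_V T \<Omega> \<Longrightarrow> (LINT t|time T. zt2 t (q t))
        + (LINT t|time T. l2_inner \<Omega> (\<lambda>x. k (z2 t x) *\<^sub>R grad \<Omega> (p2 t) x) (grad \<Omega> (q t))) = (LINT t|time T. S t (q t))"
    and in2: "\<And>q. q \<in> H10 \<Omega> \<Longrightarrow> \<exists>g. (\<forall>h. abs_continuous 0 T h \<longrightarrow> (AE t in time T. h t = l2_inner \<Omega> (z2 t) q) \<longrightarrow>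
            (\<forall>t\<in>{0..T}. h t = g t)) \<and> g 0 = l2_inner \<Omega> d0 q"
    and pt2: "pt2 \<in> L2_L2 T \<Omega>" and dp2: "has_weak_time_deriv T (L2 \<Omega>) (l2_norm \<Omega>) p2 pt2"
  proof (rule W_classE[OF sol2 z2_def], goal_cases)
    case (1 zt pt)
    show ?case by (rule 1(1)[OF 1(2-12)])
  qed
  note dualV = seminormed.seminormed_dual[OF seminormed_H10]
  define U where "U t x = u1 t x - u2 t x" for t x
  define P where "P t x = p1 t x - p2 t x" for t x
  define Z where "Z t x = z1 t x - z2 t x" for t x
  define Pt where "Pt t x = pt1 t x - pt2 t x" for t x
  define Zt where "Zt t q = zt1 t q - zt2 t q" for t q
  have U: "U \<in> L2_vV T \<Omega>" unfolding U_def[abs_def] by (rule seminormed.L2_time_diff[OF seminormed_vH10 u1 u2])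
  have P: "P \<in> L2_V T \<Omega>" unfolding P_def[abs_def] by (rule seminormed.L2_time_diff[OF seminormed_H10 p1 p2])
  have Z: "Z \<in> L2_L2 T \<Omega>" unfolding Z_def[abs_def] by (rule seminormed.L2_time_diff[OF seminormed_L2 z1 z2])
  have Pt: "Pt \<in> L2_L2 T \<Omega>" unfolding Pt_def[abs_def] by (rule seminormed.L2_time_diff[OF seminormed_L2 pt1 pt2])
  have Zt: "Zt \<in> L2_time T (dual_V \<Omega>) (dual_V_norm \<Omega>)"
    unfolding Zt_def[abs_def] by (rule seminormed.L2_time_diff[OF dualV zt1 zt2])
  interpret lin: linear_poro \<Omega> T c0 U P Z Pt Zt
  proof unfold_locales
    show "AE t in time T. AE x in lebesgue_on \<Omega>. Z t x = c0 * P t x + divg \<Omega> (U t) x"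
      using L2_time_mem[OF u1] L2_time_mem[OF u2]
    proof eventually_elim
      case (elim t)
      have "AE x in lebesgue_on \<Omega>. divg \<Omega> (U t) x = divg \<Omega> (u1 t) x - divg \<Omega> (u2 t) x"
        using divg_lincomb[OF elim, of 1 "-1"] by (simp add: U_def[abs_def])
      then show ?case
        by eventually_elim (simp add: Z_def P_def z1_def z2_def fluid_content_def algebra_simps)
    qed
    show "AE t in time T. e_form \<Omega> (U t) w = l2_inner \<Omega> (P t) (divg \<Omega> w)" if "w \<in> vH10 \<Omega>" for w
      unfolding U_def[abs_def] P_def[abs_def]
      by (rule elastic_difference[OF T u1 u2 p1 p2 _ that]) (simp add: el1 el2)
    show "AE t in time T. l2_inner \<Omega> (Z t) q = integral {0..t} (\<lambda>s. Zt s q)" if q: "q \<in> H10 \<Omega>" for q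
    proof -
      note ev = seminormed.eval_dual[OF seminormed_H10 q]
      note i1 = interval_L2_integrable[OF seminormed.dual_time_L2[OF dualV ev zt1]]
      note i2 = interval_L2_integrable[OF seminormed.dual_time_L2[OF dualV ev zt2]]
      show ?thesis
        using content_primitive[OF T z1 ez1 zt1 dz1 q in1[OF q]] content_primitive[OF T z2 ez2 zt2 dz2 q in2[OF q]]
          L2_time_mem[OF z1] L2_time_mem[OF z2] AE_space
      proof eventually_elim
        case (elim t)
        have t: "t \<le> T" using elim(5) by simp
        have "integral {0..t} (\<lambda>s. Zt s q) = integral {0..t} (\<lambda>s. zt1 s q) - integral {0..t} (\<lambda>s. zt2 s q)"
          unfolding Zt_def
          by (rule integral_diff) (rule time_integral(2)[OF i1 order_refl t], rule time_integral(2)[OF i2 order_refl t])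
        then show ?case
          using elim(1,2) l2_inner_diff_left[OF elim(3,4) H1_L2[OF H10_H1[OF q]]] by (simp add: Z_def[abs_def])
      qed
    qed
    show "\<exists>c. AE t in time T. l2_inner \<Omega> (P t) q = c + integral {0..t} (\<lambda>s. l2_inner \<Omega> (Pt s) q)" if q: "q \<in> L2 \<Omega>" for q
    proof -
      note pp1 = pressure_primitive[OF T p1 pt1 dp1 q] and pp2 = pressure_primitive[OF T p2 pt2 dp2 q]
      obtain c1 where c1: "AE t in time T. l2_inner \<Omega> (p1 t) q = c1 + integral {0..t} (\<lambda>s. l2_inner \<Omega> (pt1 s) q)" using pp1(1) by blast
      obtain c2 where c2: "AE t in time T. l2_inner \<Omega> (p2 t) q = c2 + integral {0..t} (\<lambda>s. l2_inner \<Omega> (pt2 s) q)" using pp2(1) by blast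
      have Pti: "integrable (time T) (\<lambda>t. l2_inner \<Omega> (Pt t) q)"
        by (rule interval_L2_integrable[OF seminormed.dual_time_L2[OF seminormed_L2 l2_inner_dual[OF q] Pt]])
      have ae: "AE s in time T. l2_inner \<Omega> (Pt s) q = l2_inner \<Omega> (pt1 s) q - l2_inner \<Omega> (pt2 s) q"
        using L2_time_mem[OF pt1] L2_time_mem[OF pt2]
        by eventually_elim (simp add: Pt_def[abs_def] l2_inner_diff_left[OF _ _ q])
      have "AE t in time T. l2_inner \<Omega> (P t) q = (c1 - c2) + integral {0..t} (\<lambda>s. l2_inner \<Omega> (Pt s) q)"
        using c1 c2 L2_time_mem[OF p1] L2_time_mem[OF p2] AE_space
      proof eventually_elim
        case (elim t)
        have t: "t \<le> T" using elim(5) by simp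
        have ae': "AE s in time T. 0 < s \<longrightarrow> s < t \<longrightarrow> l2_inner \<Omega> (Pt s) q = l2_inner \<Omega> (pt1 s) q - l2_inner \<Omega> (pt2 s) q"
          using ae by eventually_elim simp
        have "integral {0..t} (\<lambda>s. l2_inner \<Omega> (Pt s) q) = integral {0..t} (\<lambda>s. l2_inner \<Omega> (pt1 s) q - l2_inner \<Omega> (pt2 s) q)"
          by (rule time_integral_cong[OF Pti Bochner_Integration.integrable_diff[OF pp1(2) pp2(2)] order_refl t ae'])
        also have "\<dots> = integral {0..t} (\<lambda>s. l2_inner \<Omega> (pt1 s) q) - integral {0..t} (\<lambda>s. l2_inner \<Omega> (pt2 s) q)"
          by (rule integral_diff) (rule time_integral(2)[OF pp1(2) order_refl t], rule time_integral(2)[OF pp2(2) order_refl t])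
        finally show ?case
          using elim(1,2) l2_inner_diff_left[OF H1_L2[OF H10_H1[OF elim(3)]] H1_L2[OF H10_H1[OF elim(4)]] q] by (simp add: P_def[abs_def])
      qed
      then show ?thesis by blast
    qed
  qed (fact T c0 U P Z Pt Zt)+
  obtain G where "linear_poro_common \<Omega> T c0 U P Z Pt Zt G" using lin.common by blast
  then interpret lin: linear_poro_common \<Omega> T c0 U P Z Pt Zt G .
  obtain G' where G': "G' \<subseteq> G" "AE t in time T. t \<in> G'"
    and E: "\<And>b. b \<in> G' \<Longrightarrow> lin.E b = 2 * integral {0..b} (\<lambda>s. Zt s (P s))"
    using lin.energy_identity by blast
  \<comment> \<open>Testing the flow equation with the difference of the pressures on \<open>(0,b)\<close>.\<close>
  define A where "A t = l2_inner \<Omega> (\<lambda>x. k (z1 t x) *\<^sub>R grad \<Omega> (p1 t) x) (grad \<Omega> (P t))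
      - l2_inner \<Omega> (\<lambda>x. k (z2 t x) *\<^sub>R grad \<Omega> (p2 t) x) (grad \<Omega> (P t))" for t
  note fi1 = flux_time_integrable[OF z1 p1 P] and fi2 = flux_time_integrable[OF z2 p2 P]
  have Ai: "integrable (time T) A" unfolding A_def[abs_def] by (rule Bochner_Integration.integrable_diff[OF fi1 fi2])
  have zi: "integrable (time T) (\<lambda>t. zt t (P t))" if "zt \<in> L2_time T (dual_V \<Omega>) (dual_V_norm \<Omega>)" for zt
    by (rule bilinear_time_integrable[OF dualV seminormed_H10 _ _ _ that P, where B="\<lambda>l q. l q"])
      (use seminormed.dual_diff[OF seminormed_H10] seminormed.dual_bound[OF seminormed_H10] in auto)
  have flow: "integral {0..b} (\<lambda>s. Zt s (P s)) = - integral {0..b} A" if b: "0 \<le> b" "b \<le> T" for b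
  proof -
    let ?q = "\<lambda>t x. indicator {0<..<b} t *\<^sub>R P t x"
    have Q: "?q \<in> L2_V T \<Omega>" by (rule seminormed.L2_time_indicator[OF seminormed_H10 P]) simp
    have lz: "(LINT t|time T. zt t (?q t)) = integral {0..b} (\<lambda>t. zt t (P t))"
      if zt: "zt \<in> L2_time T (dual_V \<Omega>) (dual_V_norm \<Omega>)" for zt
      by (rule seminormed.localized_test[where l=zt and f=P, OF seminormed_H10 L2_time_mem[OF zt] L2_time_mem[OF P] zi[OF zt] b])
    have lf: "(LINT t|time T. l2_inner \<Omega> (\<lambda>x. k (z t x) *\<^sub>R grad \<Omega> (p t) x) (grad \<Omega> (?q t)))
        = integral {0..b} (\<lambda>t. l2_inner \<Omega> (\<lambda>x. k (z t x) *\<^sub>R grad \<Omega> (p t) x) (grad \<Omega> (P t)))"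
      if z: "z \<in> L2_L2 T \<Omega>" and p: "p \<in> L2_V T \<Omega>" for z p
    proof (rule seminormed.localized_test[where l="\<lambda>t q. l2_inner \<Omega> (\<lambda>x. k (z t x) *\<^sub>R grad \<Omega> (p t) x) (grad \<Omega> q)" and f=P,
          OF seminormed_H10 _ L2_time_mem[OF P] flux_time_integrable[OF z p P] b])
      show "AE t in time T. (\<lambda>q. l2_inner \<Omega> (\<lambda>x. k (z t x) *\<^sub>R grad \<Omega> (p t) x) (grad \<Omega> q)) \<in> dual_V \<Omega>"
        using L2_time_mem[OF z] L2_time_mem[OF p]
        by eventually_elim (intro grad_dual flux_L2 grad_L2 H10_H1)
    qed
    note on = time_integral(2)[OF zi[OF zt1] order_refl b(2)] time_integral(2)[OF zi[OF zt2] order_refl b(2)]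
      time_integral(2)[OF fi1 order_refl b(2)] time_integral(2)[OF fi2 order_refl b(2)]
    have "integral {0..b} (\<lambda>s. Zt s (P s)) = integral {0..b} (\<lambda>s. zt1 s (P s)) - integral {0..b} (\<lambda>s. zt2 s (P s))"
      unfolding Zt_def by (rule integral_diff[OF on(1,2)])
    moreover have "integral {0..b} A = integral {0..b} (\<lambda>t. l2_inner \<Omega> (\<lambda>x. k (z1 t x) *\<^sub>R grad \<Omega> (p1 t) x) (grad \<Omega> (P t)))
        - integral {0..b} (\<lambda>t. l2_inner \<Omega> (\<lambda>x. k (z2 t x) *\<^sub>R grad \<Omega> (p2 t) x) (grad \<Omega> (P t)))"
      unfolding A_def by (rule integral_diff[OF on(3,4)])
    ultimately show ?thesis
      using fl1[OF Q] fl2[OF Q] unfolding lz[OF zt1] lz[OF zt2] lf[OF z1 p1] lf[OF z2 p2] by linarith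
  qed
  define \<gamma> where "\<gamma> t = w1inf_norm \<Omega> (p1 t)" for t
  have \<gamma>: "\<gamma> \<in> L2 {0<..<T}" unfolding \<gamma>_def[abs_def] by (rule seminormed.L2_time_norm[OF seminormed_W1inf reg])
  define g where "g t = (l2_norm \<Omega> (grad \<Omega> (P t)))\<^sup>2" for t
  have gi: "integrable (time T) g"
    unfolding g_def[abs_def] l2_norm_sq
  proof (rule bilinear_time_integrable[OF seminormed_H10 seminormed_H10 _ _ _ P P, where B="\<lambda>p q. l2_inner \<Omega> (grad \<Omega> p) (grad \<Omega> q)"])
    fix x x' y assume x: "x \<in> H10 \<Omega>" "x' \<in> H10 \<Omega>" and y: "y \<in> H10 \<Omega>"
    note d = seminormed.dual_diff[OF seminormed_H10 grad_dual[OF grad_L2[OF H10_H1[OF y]]] x]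
    show "l2_inner \<Omega> (grad \<Omega> (\<lambda>a. x a - x' a)) (grad \<Omega> y) = l2_inner \<Omega> (grad \<Omega> x) (grad \<Omega> y) - l2_inner \<Omega> (grad \<Omega> x') (grad \<Omega> y)"
      using d by (simp add: l2_inner_commute)
    show "l2_inner \<Omega> (grad \<Omega> y) (grad \<Omega> (\<lambda>a. x a - x' a)) = l2_inner \<Omega> (grad \<Omega> y) (grad \<Omega> x) - l2_inner \<Omega> (grad \<Omega> y) (grad \<Omega> x')"
      using d by simp
  next
    fix x y assume "x \<in> H10 \<Omega>" "y \<in> H10 \<Omega>"
    then have "\<bar>l2_inner \<Omega> (grad \<Omega> x) (grad \<Omega> y)\<bar> \<le> l2_norm \<Omega> (grad \<Omega> x) * l2_norm \<Omega> (grad \<Omega> y)"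
      by (intro l2_cauchy_schwarz grad_L2 H10_H1)
    also have "\<dots> \<le> h1_norm \<Omega> x * h1_norm \<Omega> y" by (intro mult_mono h1_norm_ge l2_norm_nonneg)
    finally show "\<bar>l2_inner \<Omega> (grad \<Omega> x) (grad \<Omega> y)\<bar> \<le> h1_norm \<Omega> x * h1_norm \<Omega> y" .
  qed
  \<comment> \<open>The Gronwall weight: \<open>L\<^sup>2 / k\<^sub>1\<close> is twice the constant of Young's inequality in the flux estimate, and
    \<open>2 (c\<^sub>0 + 1)\<close> bounds the squared norm of the fluid content by the energy.\<close>
  define m where "m t = 2 * (c0 + 1) * L\<^sup>2 / k1 * (\<gamma> t)\<^sup>2" for t
  have mi: "integrable (time T) m" using \<gamma> unfolding m_def[abs_def] L2_def by simp
  have m0: "0 \<le> m t" for t unfolding m_def using c0 k1 by simp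
  have Em: "lin.E \<in> borel_measurable (time T)"
  proof -
    have "integrable (time T) lin.E"
      unfolding lin.E_def[abs_def]
    proof (rule bilinear_time_integrable[OF seminormed_L2 seminormed_H10 _ _ _ Z P, where B="\<lambda>z p. l2_inner \<Omega> z p"])
      fix x y :: "real^3 \<Rightarrow> real" assume "x \<in> L2 \<Omega>" "y \<in> H10 \<Omega>"
      then have "\<bar>l2_inner \<Omega> x y\<bar> \<le> l2_norm \<Omega> x * l2_norm \<Omega> y" by (intro l2_cauchy_schwarz) (auto intro: H1_L2[OF H10_H1])
      also have "\<dots> \<le> l2_norm \<Omega> x * h1_norm \<Omega> y" by (intro mult_left_mono h1_norm_ge l2_norm_nonneg)
      finally show "\<bar>l2_inner \<Omega> x y\<bar> \<le> l2_norm \<Omega> x * h1_norm \<Omega> y" .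
    qed (auto intro!: l2_inner_diff_left l2_inner_diff_right intro: H1_L2[OF H10_H1])
    then show ?thesis by (rule borel_measurable_integrable)
  qed
  obtain B where B: "\<And>t. t \<in> G \<Longrightarrow> l2_norm \<Omega> (Z t) \<le> B \<and> l2_norm \<Omega> (P t) \<le> B" using lin.bounded by blast
  have EB: "lin.E t \<le> B * B" if t: "t \<in> G" for t
  proof -
    have "lin.E t \<le> l2_norm \<Omega> (Z t) * l2_norm \<Omega> (P t)"
      using l2_cauchy_schwarz[OF lin.GD(6)[OF t] lin.GD(5)[OF t]] by (simp add: lin.E_def)
    also have "\<dots> \<le> B * B" using B[OF t] l2_norm_nonneg[of "Z t"] l2_norm_nonneg[of "P t"] by (intro mult_mono) auto
    finally show ?thesis .
  qed
  have mEi: "integrable (time T) (\<lambda>t. m t * lin.E t)"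
  proof (rule Bochner_Integration.integrable_bound)
    show "integrable (time T) (\<lambda>t. m t * (B * B))" using mi by simp
    show "(\<lambda>t. m t * lin.E t) \<in> borel_measurable (time T)"
      by (rule borel_measurable_times[OF borel_measurable_integrable[OF mi] Em])
    show "AE t in time T. norm (m t * lin.E t) \<le> norm (m t * (B * B))"
      using lin.AE_G
    proof eventually_elim
      case (elim t)
      have "\<bar>m t * lin.E t\<bar> = m t * lin.E t" using m0[of t] lin.E_nonneg[OF elim] by simp
      also have "\<dots> \<le> m t * (B * B)" by (rule mult_left_mono[OF EB[OF elim] m0])
      finally show ?case by simp
    qed
  qed
  have lower: "AE t in time T. - 2 * A t \<le> m t * lin.E t - k1 * g t"
    using lin.AE_G L2_time_mem[OF reg] L2_time_mem[OF p1] L2_time_mem[OF p2] L2_time_mem[OF z1] L2_time_mem[OF z2]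
  proof eventually_elim
    case (elim t)
    note gr = grad_L2[OF H10_H1[OF elim(3)]] grad_L2[OF H10_H1[OF elim(4)]]
    have P': "P t = (\<lambda>x. p1 t x - p2 t x)" and Z': "Z t = (\<lambda>x. z1 t x - z2 t x)" by (auto simp: P_def Z_def)
    have gP: "AE x in lebesgue_on \<Omega>. grad \<Omega> (P t) x = grad \<Omega> (p1 t) x - grad \<Omega> (p2 t) x"
      unfolding P' by (rule grad_diff(1)[OF elim(3,4)])
    note gPL = grad_L2[OF H10_H1[OF lin.GD(4)[OF elim(1)]]]
    have nonneg: "0 \<le> linf_norm \<Omega> (grad \<Omega> (p1 t))" by (rule linf_norm_nonneg[OF W1inf_weak_partial(4)[OF elim(2)]])
    have "k1 / 2 * (l2_norm \<Omega> (\<lambda>x. grad \<Omega> (p1 t) x - grad \<Omega> (p2 t) x))\<^sup>2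
        - L\<^sup>2 / (2 * k1) * ((linf_norm \<Omega> (grad \<Omega> (p1 t)))\<^sup>2 * (l2_norm \<Omega> (\<lambda>x. z1 t x - z2 t x))\<^sup>2)
      \<le> l2_inner \<Omega> (\<lambda>x. k (z1 t x) *\<^sub>R grad \<Omega> (p1 t) x) (\<lambda>x. grad \<Omega> (p1 t) x - grad \<Omega> (p2 t) x)
       - l2_inner \<Omega> (\<lambda>x. k (z2 t x) *\<^sub>R grad \<Omega> (p2 t) x) (\<lambda>x. grad \<Omega> (p1 t) x - grad \<Omega> (p2 t) x)"
      by (rule flux_monotone[OF elim(5,6) gr linf_norm_AE[OF W1inf_weak_partial(4)[OF elim(2)]] nonneg])
    also have "\<dots> = A t"
      unfolding A_def using l2_inner_cong[OF flux_L2[OF elim(5) gr(1)] gPL AE_I2[OF refl] gP]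
        l2_inner_cong[OF flux_L2[OF elim(6) gr(2)] gPL AE_I2[OF refl] gP] by simp
    finally have 1: "k1 / 2 * g t - L\<^sup>2 / (2 * k1) * ((linf_norm \<Omega> (grad \<Omega> (p1 t)))\<^sup>2 * (l2_norm \<Omega> (Z t))\<^sup>2) \<le> A t"
      unfolding g_def Z' l2_norm_cong[OF gPL gP] .
    have "(linf_norm \<Omega> (grad \<Omega> (p1 t)))\<^sup>2 * (l2_norm \<Omega> (Z t))\<^sup>2 \<le> (\<gamma> t)\<^sup>2 * (2 * (c0 + 1) * lin.E t)"
      by (intro mult_mono power_mono lin.Z_le_E elim) (auto simp: \<gamma>_def w1inf_norm_def nonneg)
    then have "L\<^sup>2 / (2 * k1) * ((linf_norm \<Omega> (grad \<Omega> (p1 t)))\<^sup>2 * (l2_norm \<Omega> (Z t))\<^sup>2) \<le> L\<^sup>2 / (2 * k1) * ((\<gamma> t)\<^sup>2 * (2 * (c0 + 1) * lin.E t))"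
      using k1 by (intro mult_left_mono) auto
    also have "\<dots> = m t * lin.E t / 2" using k1 by (simp add: m_def field_simps)
    finally show ?case using 1 by linarith
  qed
  have ineq: "lin.E b \<le> integral {0..b} (\<lambda>t. m t * lin.E t) - k1 * integral {0..b} g" if b: "b \<in> G'" for b
  proof -
    have bT: "0 \<le> b" "b \<le> T" using lin.GD(1,2)[of b] b G'(1) by auto
    have "lin.E b = integral {0..b} (\<lambda>t. - 2 * A t)"
      using E[OF b] flow[OF bT] by simp
    also have "\<dots> \<le> integral {0..b} (\<lambda>t. m t * lin.E t - k1 * g t)"
    proof (rule time_integral_le[OF integrable_mult_right[OF Ai] Bochner_Integration.integrable_diff[OF mEi integrable_mult_right[OF gi]] order_refl bT(2)])
      show "AE t in time T. 0 < t \<longrightarrow> t < b \<longrightarrow> - 2 * A t \<le> m t * lin.E t - k1 * g t"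
        using lower by eventually_elim simp
    qed
    also have "\<dots> = integral {0..b} (\<lambda>t. m t * lin.E t) - integral {0..b} (\<lambda>t. k1 * g t)"
      by (rule integral_diff) (rule time_integral(2)[OF mEi order_refl bT(2)], rule time_integral(2)[OF integrable_mult_right[OF gi] order_refl bT(2)])
    finally show ?thesis by simp
  qed
  have gint: "0 \<le> integral {0..b} g" if "b \<in> G'" for b
    by (rule time_integral_nonneg[OF gi order_refl]) (use lin.GD(2)[of b] that G'(1) in \<open>auto simp: g_def\<close>)
  have E0: "lin.E b = 0" if "b \<in> G'" for b
  proof (rule gronwall_zero[OF mi _ mEi G'(2) _ _ _ _ that])
    show "AE t in time T. 0 \<le> m t" by (simp add: m0)
    show "G' \<subseteq> {0<..<T}" using lin.GD(1,2) G'(1) by auto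
    show "0 \<le> lin.E t" "lin.E t \<le> B * B" if "t \<in> G'" for t
      using lin.E_nonneg[of t] EB[of t] that G'(1) by auto
    show "lin.E t \<le> integral {0..t} (\<lambda>s. m s * lin.E s)" if "t \<in> G'" for t
      using ineq[OF that] mult_nonneg_nonneg[OF less_imp_le[OF k1] gint[OF that]] by linarith
  qed
  \<comment> \<open>With the energy gone, the inequality still bounds the dissipation.\<close>
  have "AE b in time T. integral {0..b} g = 0"
    using G'(2)
  proof eventually_elim
    case (elim b)
    have bT: "0 \<le> b" "b \<le> T" using lin.GD(1,2)[of b] elim G'(1) by auto
    have "AE t in time T. 0 < t \<longrightarrow> t < b \<longrightarrow> m t * lin.E t = 0" using G'(2) by eventually_elim (simp add: E0)
    then have "integral {0..b} (\<lambda>t. m t * lin.E t) = integral {0..b} (\<lambda>t. 0)"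
      by (rule time_integral_cong[OF mEi integrable_zero order_refl bT(2)])
    then have "k1 * integral {0..b} g \<le> 0" using ineq[OF elim] E0[OF elim] by simp
    then show ?case using k1 gint[OF elim] by (simp add: mult_le_0_iff)
  qed
  from primitive_zero_imp_zero[OF gi this] G'(2)
  show ?thesis
  proof eventually_elim
    case (elim t)
    have tG: "t \<in> G" using elim G'(1) by auto
    note GD = lin.GD[OF tG]
    have "AE x in lebesgue_on \<Omega>. grad \<Omega> (P t) x = 0"
      by (rule l2_norm_eq_0[OF grad_L2[OF H10_H1[OF GD(4)]]]) (use elim(1) in \<open>simp add: g_def\<close>)
    then have "AE x in lebesgue_on \<Omega>. weak_partial \<Omega> 1 (P t) x = 0"
      by eventually_elim (simp add: grad_def vec_eq_iff)
    then have Pz: "AE x in lebesgue_on \<Omega>. P t x = 0" by (rule H10_partial_zero[OF bounded_domain GD(4)])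
    have "0 \<le> e_form \<Omega> (U t) (U t)" using e_form_ge[OF GD(3)] zero_le_power2 order_trans by blast
    moreover have "0 \<le> c0 * (l2_norm \<Omega> (P t))\<^sup>2" using c0 by simp
    ultimately have "e_form \<Omega> (U t) (U t) = 0" using lin.E_eq[OF tG] E0[OF elim(2)] by linarith
    from e_form_zero[OF GD(3) this] Pz
    show ?case by eventually_elim (simp add: U_def P_def)
  qed
qed

end

theorem theorem2p3:
  fixes \<Omega> :: "(real^3) set" and T c0 k1 k2 :: real and k :: "real \<Rightarrow> real"
    and F u :: "real \<Rightarrow> real^3 \<Rightarrow> real^3" and p :: "real \<Rightarrow> real^3 \<Rightarrow> real"
    and S :: "real \<Rightarrow> (real^3 \<Rightarrow> real) \<Rightarrow> real" and d0 :: "real^3 \<Rightarrow> real"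
  assumes "open \<Omega>" and "bounded \<Omega>" and "C2_domain \<Omega>" and "T > 0"
    and "c0 \<ge> 0"
    and "0 < k1" and "\<forall>x. k1 \<le> k x \<and> k x \<le> k2" and "\<exists>L. L-lipschitz_on UNIV k"
    and "S \<in> L2_time T (dual_V \<Omega>) (dual_V_norm \<Omega>)"
    and "F \<in> L2_L2 T \<Omega>" and "embed_dual \<Omega> F \<in> H1_time T (dual_vV \<Omega>) (dual_vV_norm \<Omega>)"
    and "d0 \<in> L2 \<Omega>"
    and "(u, p) \<in> W_class \<Omega> T c0 F S d0 k"
  shows "((\<exists>u0\<in>vH10 \<Omega>. \<exists>p0\<in>L2 \<Omega>. AE x in lebesgue_on \<Omega>. d0 x = divg \<Omega> u0 x + c0 * p0 x) \<longrightarrow>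
          (p \<in> L2_W1inf T \<Omega> \<longrightarrow> (\<forall>z\<in>W_class \<Omega> T c0 F S d0 k. sol_eq \<Omega> T z (u, p))) \<and>
          ((\<exists>(v, q)\<in>W_class \<Omega> T c0 F S d0 k. q \<in> L2_W1inf T \<Omega>) \<longrightarrow>
             (\<forall>z\<in>W_class \<Omega> T c0 F S d0 k. \<forall>z'\<in>W_class \<Omega> T c0 F S d0 k. sol_eq \<Omega> T z z')))
       \<and> (c0 > 0 \<longrightarrow>
          (p \<in> L2_W1inf T \<Omega> \<longrightarrow> (\<forall>z\<in>W_class \<Omega> T c0 F S d0 k. sol_eq \<Omega> T z (u, p))) \<and>
          ((\<exists>(v, q)\<in>W_class \<Omega> T c0 F S d0 k. q \<in> L2_W1inf T \<Omega>) \<longrightarrow>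
             (\<forall>z\<in>W_class \<Omega> T c0 F S d0 k. \<forall>z'\<in>W_class \<Omega> T c0 F S d0 k. sol_eq \<Omega> T z z')))"
proof -
  obtain L where L: "L-lipschitz_on UNIV k" using assms(8) by blast
  interpret permeable_poro_domain \<Omega> k k1 k2 L
    by unfold_locales (use assms L in auto)
  let ?W = "W_class \<Omega> T c0 F S d0 k"
  have regular: "sol_eq \<Omega> T z (v, q)" if vq: "(v, q) \<in> ?W" "q \<in> L2_W1inf T \<Omega>" and z: "z \<in> ?W" for v q z
  proof -
    have z': "(fst z, snd z) \<in> ?W" using z by simp
    have "AE t in time T. AE x in lebesgue_on \<Omega>. v t x = fst z t x \<and> q t x = snd z t x"
      by (rule solutions_agree[OF assms(4,5) vq(1) z' vq(2)])
    then show ?thesis unfolding sol_eq_def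
    proof eventually_elim
      case (elim t)
      then show ?case by eventually_elim simp
    qed
  qed
  have all: "sol_eq \<Omega> T z z'" if ex: "\<exists>(v, q)\<in>?W. q \<in> L2_W1inf T \<Omega>" and z: "z \<in> ?W" "z' \<in> ?W" for z z'
  proof -
    obtain v q where vq: "(v, q) \<in> ?W" "q \<in> L2_W1inf T \<Omega>" using ex by blast
    from regular[OF vq z(1)] regular[OF vq z(2)] show ?thesis unfolding sol_eq_def
    proof eventually_elim
      case (elim t)
      then show ?case by eventually_elim simp
    qed
  qed
  show ?thesis using regular[OF assms(13)] all by blast
qed

end
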